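(* The following hold for both choices of sign $\pm$. (i) Suppose that $f(X_1,\dots,X_d)\in L^1$, $\tilde f(X_1,\dots,X_{\tilde d})\in L^1$ and $\mu>0$. Then, as $x\to\infty$, $$\frac{\tilde U_{N_\pm(x)}}{x^{\tilde d/d}}\longrightarrow\frac{\tilde\mu}{\tilde d!}\Bigl(\frac{d!}{\mu}\Bigr)^{\tilde d/d}\quad\text{almost surely.}$$ (ii) Suppose that $f(X_1,\dots,X_d)\in L^2$, $\tilde f(X_1,\dots,X_{\tilde d})\in L^2$ and $\mu>0$. Then, as $x\to\infty$, $$\frac{\tilde U_{N_\pm(x)}-\bigl(\frac{d!}{\mu}\bigr)^{\tilde d/d}\frac{\tilde\mu}{\tilde d!}x^{\tilde d/d}}{x^{\tilde d/d-1/(2d)}}\ \overset{\mathrm d}{\longrightarrow}\ N(0,\gamma^2),$$ where $$\gamma^2:=\Bigl(\frac{d!}{\mu}\Bigr)^{(2\tilde d-1)/d}\operatorname{Var}\Bigl(\tilde Z_1-\frac{(d-1)!\,\tilde\mu}{(\tilde d-1)!\,\mu}Z_1\Bigr).$$ (iii) Assume that $f(X_1,\dots,X_d)\in L^2$, $\tilde f(X_1,\dots,X_{\tilde d})\in L^2$ and $\mu>0$, and let $\gamma^2$ be as in (ii). If $\tilde d\ge d$, then $\gamma^2=0$ if and only if $$\tilde f_i(X)=\frac{\tilde\mu}{\mu}\sum_{j}\frac{\binom{d-1}{j-1}\binom{\tilde d-d}{i-j}}{\binom{\tilde d-1}{i-1}}f_j(X)\quad\text{a.s.},\qquad i=1,\dots,\tilde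 d,$$ where the sum is over $j\in\{1,\dots,d\}$. If $\tilde d<d$ and $\tilde\mu\ne0$, then $\gamma^2=0$ if and only if $$f_i(X)=\frac{\mu}{\tilde\mu}\sum_{j}\frac{\binom{\tilde d-1}{j-1}\binom{d-\tilde d}{i-j}}{\binom{d-1}{i-1}}\tilde f_j(X)\quad\text{a.s.},\qquad i=1,\dots,d,$$ where the sum is over $j\in\{1,\dots,\tilde d\}$; if $\tilde d<d$ and $\tilde\mu=0$, then $\gamma^2=0$ if and only if $\tilde f_j(X)=0$ a.s. for all $j=1,\dots,\tilde d$. In particular, if $\tilde d=d$, then $$\gamma^2=0\iff\mu\tilde f_i(X)=\tilde\mu f_i(X)\ \text{a.s.},\quad i=1,\dots,d,$$ and if $d=1$, then $$\gamma^2=0\iff\mu\tilde f_i(X)=\tilde\mu f_1(X)\ \text{a.s.},\quad i=1,\dots,\tilde d.$$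
   Context: $X,X_1,X_2,\dots$ is an i.i.d. sequence of random variables with values in an arbitrary measurable space $(S,\mathcal S)$; $d,\tilde d\ge1$ are fixed integers (possibly different), and $f:S^d\to\mathbb R$, $\tilde f:S^{\tilde d}\to\mathbb R$ are measurable (no symmetry assumed). For $n\ge0$, $$U_n:=\sum_{1\le i_1<\dots<i_d\le n}f(X_{i_1},\dots,X_{i_d}),\qquad \tilde U_n:=\sum_{1\le i_1<\dots<i_{\tilde d}\le n}\tilde f(X_{i_1},\dots,X_{i_{\tilde d}}),$$ $\mu:=\mathbb Ef(X_1,\dots,X_d)$, $\tilde\mu:=\mathbb E\tilde f(X_1,\dots,X_{\tilde d})$. For $x>0$, $N_-(x):=\sup\{n\ge0:U_n\le x\}$ and $N_+(x):=\inf\{n\ge0:U_n>x\}$ (these are a.s. finite when $f(X_1,\dots,X_d)\in L^1$ and $\mu>0$). Let $f_i(x):=\mathbb Ef(X_1,\dots,X_{i-1},x,X_{i+1},\dots,X_d)-\mu$ for $1\le i\le d$ and $\tilde f_i(x):=\mathbb E\tilde f(X_1,\dots,X_{i-1},x,X_{i+1},\dots,X_{\tilde d})-\tilde\mu$ for $1\le i\le\tilde d$. Let $(W_1,\dots,W_d,\tilde W_1,\dots,\tilde W_{\tilde d})$ be a continuous centered Gaussian process on $[0,\infty)$, starting at $0$, with stationary independent increments and covariances $\operatorname{Cov}(W_i(s),W_j(t))=\operatorname{Cov}(f_i(X),f_j(X))\min(s,t)$, $\operatorname{Cov}(\tilde W_i(s),\tilde W_j(t))=\operatorname{Cov}(\tilde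 f_i(X),\tilde f_j(X))\min(s,t)$, $\operatorname{Cov}(W_i(s),\tilde W_j(t))=\operatorname{Cov}(f_i(X),\tilde f_j(X))\min(s,t)$. With $\psi_{j;d}(s,t):=\frac{1}{(j-1)!\,(d-j)!}s^{j-1}(t-s)^{d-j}$, set $$Z_1:=\sum_{j=1}^d\int_0^1\psi_{j;d}(s,1)\,\mathrm dW_j(s),\qquad\tilde Z_1:=\sum_{j=1}^{\tilde d}\int_0^1\psi_{j;\tilde d}(s,1)\,\mathrm d\tilde W_j(s).$$ Conventions: $\binom{n}{k}=0$ for $k<0$ or $k>n\ge 0$; $N(0,0)$ is the point mass at $0$. *)

theory Defs
  imports "HOL-Probability.Probability"
begin

section \<open>Asymmetric U-statistics\<close>

text \<open>
  A kernel on \<open>S^d\<close> is a function on \<open>Pi\<^sub>M {1..d} (\<lambda>_. S)\<close>. An index tuple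
  \<open>1 \<le> i\<^sub>1 < \<dots> < i\<^sub>d \<le> n\<close> is a strictly increasing function from \<open>{1..d}\<close> to \<open>{1..n}\<close>,
  made unique by extensionality.
\<close>

definition ustat :: "nat \<Rightarrow> ((nat \<Rightarrow> 's) \<Rightarrow> real) \<Rightarrow> (nat \<Rightarrow> 'w \<Rightarrow> 's) \<Rightarrow> nat \<Rightarrow> 'w \<Rightarrow> real" where
  "ustat d f X n \<omega> =
    (\<Sum>i | i \<in> {1..d} \<rightarrow>\<^sub>E {1..n} \<and> strict_mono_on {1..d} i. f (\<lambda>k\<in>{1..d}. X (i k) \<omega>))"

definition kernel_mean ::
    "'w measure \<Rightarrow> nat \<Rightarrow> ((nat \<Rightarrow> 's) \<Rightarrow> real) \<Rightarrow> (nat \<Rightarrow> 'w \<Rightarrow> 's) \<Rightarrow> real" where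
  "kernel_mean M d f X = (\<integral>\<omega>. f (\<lambda>k\<in>{1..d}. X k \<omega>) \<partial>M)"

definition kernel_L1 ::
    "'w measure \<Rightarrow> nat \<Rightarrow> ((nat \<Rightarrow> 's) \<Rightarrow> real) \<Rightarrow> (nat \<Rightarrow> 'w \<Rightarrow> 's) \<Rightarrow> bool" where
  "kernel_L1 M d f X \<longleftrightarrow> integrable M (\<lambda>\<omega>. f (\<lambda>k\<in>{1..d}. X k \<omega>))"

definition kernel_L2 ::
    "'w measure \<Rightarrow> nat \<Rightarrow> ((nat \<Rightarrow> 's) \<Rightarrow> real) \<Rightarrow> (nat \<Rightarrow> 'w \<Rightarrow> 's) \<Rightarrow> bool" where
  "kernel_L2 M d f X \<longleftrightarrow>
    (\<lambda>\<omega>. f (\<lambda>k\<in>{1..d}. X k \<omega>)) \<in> borel_measurable M \<and>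
    integrable M (\<lambda>\<omega>. (f (\<lambda>k\<in>{1..d}. X k \<omega>))\<^sup>2)"

text \<open>
  The function \<open>f\<^sub>i\<close>. It is defined by its integral only for almost every \<open>x\<close>; elsewhere the
  Bochner integral contributes the value \<open>0\<close>.
\<close>

definition kernel_proj ::
    "'w measure \<Rightarrow> nat \<Rightarrow> ((nat \<Rightarrow> 's) \<Rightarrow> real) \<Rightarrow> (nat \<Rightarrow> 'w \<Rightarrow> 's) \<Rightarrow> nat \<Rightarrow> 's \<Rightarrow> real" where
  "kernel_proj M d f X i x =
    (\<integral>\<omega>. f ((\<lambda>k\<in>{1..d}. X k \<omega>)(i := x)) \<partial>M) - kernel_mean M d f X"

text \<open>
  \<open>Sup\<close> and \<open>Inf\<close> are those of type \<open>nat\<close>, so their values are fixed but unspecified when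
  \<open>{n. U\<^sub>n \<le> x}\<close> is infinite, respectively \<open>{n. U\<^sub>n > x}\<close> is empty. In the theorem this
  happens with probability \<open>0\<close>.
\<close>

definition N_minus ::
    "nat \<Rightarrow> ((nat \<Rightarrow> 's) \<Rightarrow> real) \<Rightarrow> (nat \<Rightarrow> 'w \<Rightarrow> 's) \<Rightarrow> real \<Rightarrow> 'w \<Rightarrow> nat" where
  "N_minus d f X x \<omega> = Sup {n. ustat d f X n \<omega> \<le> x}"

definition N_plus ::
    "nat \<Rightarrow> ((nat \<Rightarrow> 's) \<Rightarrow> real) \<Rightarrow> (nat \<Rightarrow> 'w \<Rightarrow> 's) \<Rightarrow> real \<Rightarrow> 'w \<Rightarrow> nat" where
  "N_plus d f X x \<omega> = Inf {n. ustat d f X n \<omega> > x}"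

section \<open>Normal laws and convergence in distribution\<close>

text \<open>\<open>normal_law m v\<close> is \<open>N(m, v)\<close>; the second argument is the variance.\<close>

definition normal_law :: "real \<Rightarrow> real \<Rightarrow> real measure" where
  "normal_law m v = (if v = 0 then return borel m else density lborel (normal_density m (sqrt v)))"

text \<open>The library's \<^const>\<open>weak_conv_m\<close>, along an arbitrary filter instead of along a sequence.\<close>

definition weak_conv_filter :: "('i \<Rightarrow> real measure) \<Rightarrow> real measure \<Rightarrow> 'i filter \<Rightarrow> bool" where
  "weak_conv_filter P L F \<longleftrightarrow>
    (\<forall>y. isCont (cdf L) y \<longrightarrow> ((\<lambda>x. cdf (P x) y) \<longlongrightarrow> cdf L y) F)"

lemma weak_conv_filter_sequentially: "weak_conv_filter P L sequentially \<longleftrightarrow> weak_conv_m P L"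
  by (simp add: weak_conv_filter_def weak_conv_m_def weak_conv_def)

definition cov :: "'w measure \<Rightarrow> ('w \<Rightarrow> real) \<Rightarrow> ('w \<Rightarrow> real) \<Rightarrow> real" where
  "cov M Y Z = (\<integral>\<omega>. (Y \<omega> - (\<integral>\<omega>'. Y \<omega>' \<partial>M)) * (Z \<omega> - (\<integral>\<omega>'. Z \<omega>' \<partial>M)) \<partial>M)"

section \<open>The Gaussian process\<close>

text \<open>A family is centered Gaussian iff every finite linear combination has a law \<open>N(0, v)\<close>.\<close>

definition centered_gaussian :: "'v measure \<Rightarrow> 'i set \<Rightarrow> ('i \<Rightarrow> 'v \<Rightarrow> real) \<Rightarrow> bool" where
  "centered_gaussian P T Y \<longleftrightarrow>
    (\<forall>t\<in>T. Y t \<in> borel_measurable P) \<and>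
    (\<forall>F c. finite F \<and> F \<subseteq> T \<longrightarrow>
      (\<exists>v\<ge>0. distr P borel (\<lambda>\<omega>. \<Sum>t\<in>F. c t * Y t \<omega>) = normal_law 0 v))"

text \<open>
  \<open>(B k)\<close> for \<open>k \<in> J\<close> is a continuous centered Gaussian process on \<open>[0, \<infinity>)\<close> with values in
  \<open>\<real>\<^sup>J\<close>, started at \<open>0\<close>, with stationary independent (vector) increments and covariances
  \<open>Cov (B k s, B l t) = C k l * min s t\<close>.
\<close>

definition gaussian_process_with_cov ::
    "'v measure \<Rightarrow> 'k set \<Rightarrow> ('k \<Rightarrow> 'k \<Rightarrow> real) \<Rightarrow> ('k \<Rightarrow> real \<Rightarrow> 'v \<Rightarrow> real) \<Rightarrow> bool" where
  "gaussian_process_with_cov P J C B \<longleftrightarrow>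
    prob_space P \<and>
    (\<forall>k\<in>J. \<forall>\<omega>\<in>space P. B k 0 \<omega> = 0 \<and> continuous_on {0..} (\<lambda>t. B k t \<omega>)) \<and>
    centered_gaussian P (J \<times> {0..}) (\<lambda>(k, t). B k t) \<and>
    (\<forall>s\<ge>0. \<forall>h\<ge>0.
      distr P (Pi\<^sub>M J (\<lambda>_. borel)) (\<lambda>\<omega>. \<lambda>k\<in>J. B k (s + h) \<omega> - B k s \<omega>) =
      distr P (Pi\<^sub>M J (\<lambda>_. borel)) (\<lambda>\<omega>. \<lambda>k\<in>J. B k h \<omega> - B k 0 \<omega>)) \<and>
    (\<forall>(n::nat) t. 0 \<le> t 0 \<and> mono_on {..n} t \<longrightarrow>
      prob_space.indep_vars P (\<lambda>_. Pi\<^sub>M J (\<lambda>_. borel))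
        (\<lambda>i \<omega>. \<lambda>k\<in>J. B k (t (Suc i)) \<omega> - B k (t i) \<omega>) {..<n}) \<and>
    (\<forall>k\<in>J. \<forall>l\<in>J. \<forall>s\<ge>0. \<forall>t\<ge>0. cov P (B k s) (B l t) = C k l * min s t)"

section \<open>Wiener integrals of deterministic functions\<close>

text \<open>
  The step function \<open>\<Sum>\<^sub>k a\<^sub>k 1_(t\<^sub>k, t\<^sub>k\<^sub>+\<^sub>1]\<close> and its integral against a path \<open>w\<close>.
\<close>

definition step_fun :: "nat \<Rightarrow> (nat \<Rightarrow> real) \<Rightarrow> (nat \<Rightarrow> real) \<Rightarrow> real \<Rightarrow> real" where
  "step_fun m t a s = (\<Sum>k<m. a k * indicator {t k<..t (Suc k)} s)"

definition step_integral :: "nat \<Rightarrow> (nat \<Rightarrow> real) \<Rightarrow> (nat \<Rightarrow> real) \<Rightarrow> (real \<Rightarrow> real) \<Rightarrow> real" where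
  "step_integral m t a w = (\<Sum>k<m. a k * (w (t (Suc k)) - w (t k)))"

text \<open>
  \<open>I\<close> is (a version of) \<open>\<integral>\<^sub>u\<^sup>v g dB\<close>: the limit in \<open>L\<^sup>2(P)\<close> of the integrals of step functions
  converging to \<open>g\<close> in \<open>L\<^sup>2[u, v]\<close>. By the Ito isometry \<open>I\<close> does not depend, up to null sets, on
  the approximating sequence. Both limits use the nonnegative integral, so that convergence to \<open>0\<close>
  includes square integrability of the differences.
\<close>

definition is_wiener_integral ::
    "'v measure \<Rightarrow> (real \<Rightarrow> 'v \<Rightarrow> real) \<Rightarrow> real \<Rightarrow> real \<Rightarrow> (real \<Rightarrow> real) \<Rightarrow> ('v \<Rightarrow> real) \<Rightarrow> bool" where
  "is_wiener_integral P B u v g I \<longleftrightarrow>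
    g \<in> borel_measurable borel \<and> I \<in> borel_measurable P \<and>
    (\<exists>m t a.
      (\<forall>n. mono_on {..m n} (t n) \<and> t n ` {..m n} \<subseteq> {u..v}) \<and>
      (\<lambda>n. \<integral>\<^sup>+s\<in>{u..v}. ennreal ((g s - step_fun (m n) (t n) (a n) s)\<^sup>2) \<partial>lborel)
        \<longlonglongrightarrow> 0 \<and>
      (\<lambda>n. \<integral>\<^sup>+\<omega>. ennreal ((I \<omega> - step_integral (m n) (t n) (a n) (\<lambda>s. B s \<omega>))\<^sup>2) \<partial>P)
        \<longlonglongrightarrow> 0)"

definition psi :: "nat \<Rightarrow> nat \<Rightarrow> real \<Rightarrow> real \<Rightarrow> real" where
  "psi j d s t = 1 / (fact (j - 1) * fact (d - j)) * s ^ (j - 1) * (t - s) ^ (d - j)"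

section \<open>Binomial coefficients\<close>

text \<open>
  The lower index is an integer, since truncated subtraction on \<open>nat\<close> would turn
  \<open>n choose (i - j)\<close> into \<open>1\<close> instead of \<open>0\<close> for \<open>i < j\<close>.
\<close>

definition binom :: "nat \<Rightarrow> int \<Rightarrow> real" where
  "binom n k = (if k < 0 then 0 else real (n choose nat k))"

end

(*
  A law of large numbers for U_n, obtained from a maximal inequality and truncation, determines
  N(x) ~ (d! x / mu)^(1/d), and substitution into the second U-statistic gives (i).

  For (ii), write U_n = (mu / d!) n^d + D_n. An L^2 projection argument replaces D_n, up to
  o(n^(d - 1/2)), by the linear part, the sum over m <= n of n^(d - 1) sum_j psi_j(m / n, 1) f_j(X_m).
  Kolmogorov's inequality bounds the oscillation of D_n over short windows, so D may be evaluated
  at n = floor((d! x / mu)^(1/d)) instead of at N(x). Since U_N(x) differs from x by at most a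
  jump, D_n also controls N(x)^d - n^d, hence the effect of the random index on the leading term
  of the second U-statistic. What is left is a weighted sum of independent vectors, whose
  characteristic function converges to that of the Wiener integral.

  For (iii), the limit variance is the integral over s of the second moment of a polynomial in s
  with random coefficients; it vanishes iff all coefficients in the Bernstein basis vanish almost
  surely, after the lower degree has been raised to the higher one.
*)

theory Submission
  imports Defs "HOL-Real_Asymp.Real_Asymp"
begin

text \<open>Without symmetry of the kernel a sum over increasing tuples is not exchangeable, so its
  averages need not form a reverse martingale. A maximal inequality is therefore proved only for
  nonnegative kernels, where the sum may be enlarged to all injective tuples; it is applied to the
  tail left by truncation, while the bounded part is handled by variances. Conditioning is replaced
  by Fubini: variables to be averaged are evaluated at an independent copy on
  \<open>M \<Otimes>\<^sub>M M\<close>. Every variance bound is then a count of pairs of tuples.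
  Centred kernels at disjoint tuples are uncorrelated, and subtracting the projections at the
  positions in \<open>Q\<close> does the same for pairs meeting only once, at such a position:
  \<open>Q = {}\<close> gives order n^(2d-1), \<open>Q = {1..d}\<close> gives n^(2d-2), and
  \<open>Q = {d}\<close> gives n^(2d-3) for the tuples with top index n. The last choice is what
  makes Kolmogorov's inequality usable in a window, since the projections it removes carry weights
  that depend on their own index only, whereas the weights of the linear part change with n.\<close>

section \<open>Counting increasing index tuples\<close>

definition inc_tuples :: "nat \<Rightarrow> nat \<Rightarrow> (nat \<Rightarrow> nat) set" where
  "inc_tuples d n = {i. i \<in> {1..d} \<rightarrow>\<^sub>E {1..n} \<and> strict_mono_on {1..d} i}"

lemma ustat_eq: "ustat d f X n \<omega> = (\<Sum>i\<in>inc_tuples d n. f (\<lambda>k\<in>{1..d}. X (i k) \<omega>))"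
  by (simp add: ustat_def inc_tuples_def)

lemma inc_tuples_subset: "inc_tuples d n \<subseteq> {1..d} \<rightarrow>\<^sub>E {1..n}"
  by (auto simp: inc_tuples_def)

lemma finite_inc_tuples [simp, intro]: "finite (inc_tuples d n)"
  by (rule finite_subset[OF inc_tuples_subset]) (auto intro: finite_PiE)

lemma inc_tuples_inj: "i \<in> inc_tuples d n \<Longrightarrow> inj_on i {1..d}"
  by (auto simp: inc_tuples_def strict_mono_on_imp_inj_on)

lemma inc_tuples_range: "i \<in> inc_tuples d n \<Longrightarrow> k \<in> {1..d} \<Longrightarrow> i k \<in> {1..n}"
  by (auto simp: inc_tuples_def)

lemma inc_tuples_0_left: "inc_tuples 0 n = {\<lambda>_. undefined}"
  by (auto simp: inc_tuples_def)

lemma inc_tuples_0_right: "inc_tuples (Suc d) 0 = {}"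
  by (auto simp: inc_tuples_def PiE_def Pi_def)

text \<open>Strict monotonicity makes the last entry the maximum, so the tuples that reach
  \<open>Suc n\<close> are the shorter tuples with this entry appended: the bijection behind
  Pascal's rule.\<close>

lemma inc_tuples_extend:
  "(\<lambda>i. i(Suc d := Suc n)) ` inc_tuples d n = {i \<in> inc_tuples (Suc d) (Suc n). i (Suc d) = Suc n}"
  (is "?l = ?r")
proof
  show "?l \<subseteq> ?r"
  proof
    fix j assume "j \<in> ?l"
    then obtain i where i: "i \<in> {1..d} \<rightarrow>\<^sub>E {1..n}" "strict_mono_on {1..d} i" "j = i(Suc d := Suc n)"
      by (auto simp: inc_tuples_def)
    have "j \<in> {1..Suc d} \<rightarrow>\<^sub>E {1..Suc n}"
      using i(1) unfolding i(3) by (auto simp: PiE_iff extensional_def le_Suc_eq)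
    moreover have "strict_mono_on {1..Suc d} j"
      using i unfolding i(3) by (auto simp: strict_mono_on_def PiE_iff le_Suc_eq less_Suc_eq_le)
    ultimately show "j \<in> ?r" by (auto simp: inc_tuples_def i(3))
  qed
  show "?r \<subseteq> ?l"
  proof
    fix j assume "j \<in> ?r"
    then have j: "j \<in> {1..Suc d} \<rightarrow>\<^sub>E {1..Suc n}" "strict_mono_on {1..Suc d} j" "j (Suc d) = Suc n"
      by (auto simp: inc_tuples_def)
    have lt: "j k < Suc n" if "k \<in> {1..d}" for k
      using j(2,3) that unfolding strict_mono_on_def by force
    have "j(Suc d := undefined) \<in> inc_tuples d n"
      using j lt by (auto simp: inc_tuples_def PiE_iff extensional_def strict_mono_on_def
          less_Suc_eq_le le_Suc_eq)
    moreover have "j = (j(Suc d := undefined))(Suc d := Suc n)"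
      using j(3) by auto
    ultimately show "j \<in> ?l" by blast
  qed
qed

text \<open>The value overwritten at \<open>Suc d\<close> was \<open>undefined\<close> by
  extensionality, so nothing is lost.\<close>

lemma inj_on_inc_tuples_extend: "inj_on (\<lambda>i. i(Suc d := c)) (inc_tuples d n)"
proof (rule inj_onI)
  fix i j assume ij: "i \<in> inc_tuples d n" "j \<in> inc_tuples d n" "i(Suc d := c) = j(Suc d := c)"
  have "i k = j k" for k
  proof (cases "k = Suc d")
    case True
    then show ?thesis using ij(1,2) by (auto simp: inc_tuples_def PiE_iff extensional_def)
  next
    case False
    then show ?thesis using ij(3) by (metis fun_upd_apply)
  qed
  then show "i = j" by auto
qed

lemma inc_tuples_Suc_Suc:
  "inc_tuples (Suc d) (Suc n) = inc_tuples (Suc d) n \<union> (\<lambda>i. i(Suc d := Suc n)) ` inc_tuples d n"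
proof -
  have "i \<in> inc_tuples (Suc d) n"
    if i: "i \<in> inc_tuples (Suc d) (Suc n)" "i (Suc d) \<noteq> Suc n" for i
  proof -
    have "i (Suc d) \<le> n" using i by (auto simp: inc_tuples_def PiE_iff le_Suc_eq)
    moreover have "i k \<le> i (Suc d)" if "k \<in> {1..Suc d}" for k
      using i(1) that unfolding inc_tuples_def strict_mono_on_def
      by (cases "k = Suc d") (force intro: less_imp_le)+
    ultimately show ?thesis using i(1) by (fastforce simp: inc_tuples_def PiE_iff)
  qed
  moreover have "inc_tuples (Suc d) n \<subseteq> inc_tuples (Suc d) (Suc n)"
    by (auto simp: inc_tuples_def PiE_iff le_Suc_eq)
  ultimately show ?thesis unfolding inc_tuples_extend by blast
qed

lemma inc_tuples_Suc_Suc_disjoint: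
  "inc_tuples (Suc d) n \<inter> (\<lambda>i. i(Suc d := Suc n)) ` inc_tuples d n = {}"
  unfolding inc_tuples_extend by (force simp: inc_tuples_def PiE_iff)

text \<open>Pascal's rule for arbitrary summands. With constants and with indicators it provides the
  induction steps of \<open>card_inc_tuples\<close> and \<open>card_inc_tuples_at\<close>.\<close>

lemma sum_inc_tuples_Suc_Suc:
  fixes F :: "(nat \<Rightarrow> nat) \<Rightarrow> 'b :: comm_monoid_add"
  shows "(\<Sum>i\<in>inc_tuples (Suc d) (Suc n). F i) =
    (\<Sum>i\<in>inc_tuples (Suc d) n. F i) + (\<Sum>i\<in>inc_tuples d n. F (i(Suc d := Suc n)))"
  unfolding inc_tuples_Suc_Suc
  by (subst sum.union_disjoint)
    (auto simp: inc_tuples_Suc_Suc_disjoint sum.reindex inj_on_inc_tuples_extend)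

lemma card_inc_tuples: "card (inc_tuples d n) = n choose d"
proof (induction n arbitrary: d)
  case 0
  then show ?case by (cases d) (auto simp: inc_tuples_0_left inc_tuples_0_right)
next
  case (Suc n)
  show ?case
  proof (cases d)
    case (Suc e)
    show ?thesis unfolding Suc
      using sum_inc_tuples_Suc_Suc[of "\<lambda>_. 1::nat" e n] Suc.IH by simp
  qed (auto simp: inc_tuples_0_left)
qed

lemma card_inc_tuples_top:
  "card {i \<in> inc_tuples (Suc d) (Suc n). i (Suc d) = Suc n} = n choose d"
  unfolding inc_tuples_extend[symmetric]
  by (simp add: card_image inj_on_inc_tuples_extend card_inc_tuples)

text \<open>Below \<open>k\<close> there are \<open>p - 1\<close> entries to choose and above it
  \<open>d - p\<close>. The recursion of the induction splits off the largest index, so the cases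
  are whether \<open>k\<close> is that index and whether \<open>p\<close> is the last
  position.\<close>

lemma card_inc_tuples_at:
  assumes "p \<in> {1..d}" "k \<in> {1..n}"
  shows "card {i \<in> inc_tuples d n. i p = k} = (k - 1 choose (p - 1)) * (n - k choose (d - p))"
  using assms
proof (induction n arbitrary: d)
  case (Suc n)
  then obtain e where d: "d = Suc e" by (cases d) auto
  have count: "card {i \<in> A. P i} = (\<Sum>i\<in>A. if P i then 1 else 0)"
    if "finite A" for A :: "(nat \<Rightarrow> nat) set" and P
    using that by (simp only: card_eq_sum sum.inter_filter)
  have rec: "card {i \<in> inc_tuples d (Suc n). i p = k} =
    card {i \<in> inc_tuples d n. i p = k} +
    card {i \<in> inc_tuples e n. (i(Suc e := Suc n)) p = k}"
    by (simp only: count finite_inc_tuples d sum_inc_tuples_Suc_Suc)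
  show ?case
  proof (cases "k = Suc n")
    case True
    have 0: "{i \<in> inc_tuples m n. i p = k} = {}" if "p \<le> m" for m
      using Suc.prems(1) that True by (force simp: inc_tuples_def PiE_iff)
    show ?thesis
    proof (cases "p = d")
      case p: True
      then have "{i \<in> inc_tuples e n. (i(Suc e := Suc n)) p = k} = inc_tuples e n"
        using True d by auto
      then show ?thesis using rec p 0[of d] True d by (simp add: card_inc_tuples)
    next
      case False
      then have "{i \<in> inc_tuples e n. (i(Suc e := Suc n)) p = k} = {i \<in> inc_tuples e n. i p = k}"
        using d by auto
      moreover have "Suc n - k choose (d - p) = 0"
        using False True Suc.prems(1) by (simp add: binomial_eq_0)
      moreover have "p \<le> d" "p \<le> e" using False d Suc.prems(1) by auto
      ultimately show ?thesis by (simp only: rec 0 card.empty mult_0_right add_0)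
    qed
  next
    case False
    then have k: "k \<in> {1..n}" using Suc.prems by auto
    have IH: "card {i \<in> inc_tuples d n. i p = k} = (k - 1 choose (p - 1)) * (n - k choose (d - p))"
      using Suc.IH Suc.prems k by auto
    have n: "Suc n - k = Suc (n - k)" using k by auto
    show ?thesis
    proof (cases "p = d")
      case p: True
      then have "{i \<in> inc_tuples e n. (i(Suc e := Suc n)) p = k} = {}"
        using False d by auto
      then show ?thesis using rec IH p by simp
    next
      case p: False
      then have "{i \<in> inc_tuples e n. (i(Suc e := Suc n)) p = k} = {i \<in> inc_tuples e n. i p = k}"
        using d by auto
      moreover have "card {i \<in> inc_tuples e n. i p = k} = (k - 1 choose (p - 1)) * (n - k choose (e - p))"
        using Suc.IH Suc.prems k p d by auto
      moreover have "d - p = Suc (e - p)" using p Suc.prems(1) d by auto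
      ultimately show ?thesis using rec IH n by (simp add: algebra_simps)
    qed
  qed
qed simp

section \<open>Counting pairs of tuples with common indices\<close>

text \<open>A fixed coordinate costs a factor \<open>n\<close>. It is written on the left, so that
  no exponent with truncated subtraction appears and \<open>n = 0\<close> is covered; the bounds
  derived from this one keep the form.\<close>

lemma card_PiE_fix:
  assumes "q \<in> {1..d}"
  shows "card {j \<in> {1..d} \<rightarrow>\<^sub>E {1..n}. j q = a} * n \<le> n ^ d"
proof -
  have "{j \<in> {1..d} \<rightarrow>\<^sub>E {1..n}. j q = a} \<subseteq> PiE {1..d} (\<lambda>k. if k = q then {a} else {1..n})"
    using assms by (auto simp: PiE_iff extensional_def)
  then have "card {j \<in> {1..d} \<rightarrow>\<^sub>E {1..n}. j q = a} \<le> card (PiE {1..d} (\<lambda>k. if k = q then {a} else {1..n}))"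
    by (rule card_mono[rotated]) (auto intro!: finite_PiE)
  also have "\<dots> = (\<Prod>k\<in>{1..d}. if k = q then 1 else n)"
    by (subst card_PiE) (auto intro!: prod.cong)
  also have "\<dots> = n ^ card ({1..d} - {q})"
    using assms by (subst prod.remove[of _ q]) auto
  also have "\<dots> = n ^ (d - 1)" using assms by simp
  finally have "card {j \<in> {1..d} \<rightarrow>\<^sub>E {1..n}. j q = a} * n \<le> n ^ (d - 1) * n"
    by (rule mult_right_mono) simp
  also have "\<dots> = n ^ d" using assms by (cases d) auto
  finally show ?thesis .
qed

lemma card_PiE_fix2:
  assumes "q \<in> {1..d}" "q' \<in> {1..d}" "q \<noteq> q'"
  shows "card {j \<in> {1..d} \<rightarrow>\<^sub>E {1..n}. j q = a \<and> j q' = b} * n ^ 2 \<le> n ^ d"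
proof -
  have "{j \<in> {1..d} \<rightarrow>\<^sub>E {1..n}. j q = a \<and> j q' = b}
      \<subseteq> PiE {1..d} (\<lambda>k. if k = q then {a} else if k = q' then {b} else {1..n})"
    using assms by (auto simp: PiE_iff extensional_def)
  then have "card {j \<in> {1..d} \<rightarrow>\<^sub>E {1..n}. j q = a \<and> j q' = b}
      \<le> card (PiE {1..d} (\<lambda>k. if k = q then {a} else if k = q' then {b} else {1..n}))"
    by (rule card_mono[rotated]) (auto intro!: finite_PiE)
  also have "\<dots> = (\<Prod>k\<in>{1..d}. if k = q then 1 else if k = q' then 1 else n)"
    by (subst card_PiE) (auto intro!: prod.cong)
  also have "\<dots> = n ^ card ({1..d} - {q} - {q'})"
    using assms by (subst prod.remove[of _ q], simp, simp, subst prod.remove[of _ q']) auto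
  also have "\<dots> = n ^ (d - 2)" using assms by (simp add: numeral_2_eq_2)
  finally have "card {j \<in> {1..d} \<rightarrow>\<^sub>E {1..n}. j q = a \<and> j q' = b} * n ^ 2 \<le> n ^ (d - 2) * n ^ 2"
    by (rule mult_right_mono) simp
  also have "\<dots> = n ^ (d - 2 + 2)" by (simp only: power_add)
  also have "d - 2 + 2 = d" using assms by auto
  finally show ?thesis .
qed

lemma card_pairs_Bex_le:
  assumes "finite T" "finite W"
  shows "card {(i, j). i \<in> T \<and> j \<in> T \<and> (\<exists>w\<in>W. R w i j)} \<le> (\<Sum>w\<in>W. \<Sum>i\<in>T. card {j \<in> T. R w i j})"
proof -
  have eq: "{(i, j). i \<in> T \<and> j \<in> T \<and> (\<exists>w\<in>W. R w i j)} = (\<Union>w\<in>W. SIGMA i:T. {j \<in> T. R w i j})"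
    by auto
  have "card (\<Union>w\<in>W. SIGMA i:T. {j \<in> T. R w i j}) \<le> (\<Sum>w\<in>W. card (SIGMA i:T. {j \<in> T. R w i j}))"
    using assms by (intro card_UN_le) auto
  then show ?thesis unfolding eq using assms by simp
qed

text \<open>Once the coinciding positions \<open>(p, q)\<close> and the tuple \<open>i\<close> are
  chosen, one entry of \<open>j\<close> is determined; this costs a factor \<open>n\<close> in each
  of the \<open>d ^ 2\<close> cases.\<close>

lemma card_pairs_share1:
  fixes d n :: nat
  defines "T \<equiv> {1..d} \<rightarrow>\<^sub>E {1..n}" and "D \<equiv> {1..d}"
  shows "card {(i, j). i \<in> T \<and> j \<in> T \<and> (\<exists>(p, q)\<in>D \<times> D. i p = j q)} * n \<le> d ^ 2 * n ^ (2 * d)"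
proof -
  have fin: "finite T" unfolding T_def by (auto intro: finite_PiE)
  have cT: "card T = n ^ d" unfolding T_def by (subst card_PiE) auto
  have "card {(i, j). i \<in> T \<and> j \<in> T \<and> (\<exists>w\<in>D \<times> D. case w of (p, q) \<Rightarrow> i p = j q)} * n
      \<le> (\<Sum>w\<in>D \<times> D. \<Sum>i\<in>T. card {j \<in> T. case w of (p, q) \<Rightarrow> i p = j q}) * n"
    by (intro mult_right_mono card_pairs_Bex_le fin) (auto simp: D_def)
  also have "\<dots> = (\<Sum>w\<in>D \<times> D. \<Sum>i\<in>T. card {j \<in> T. j (snd w) = i (fst w)} * n)"
    by (simp add: sum_distrib_right case_prod_beta eq_commute)
  also have "\<dots> \<le> (\<Sum>w\<in>D \<times> D. \<Sum>i\<in>T. n ^ d)"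
    unfolding T_def D_def by (intro sum_mono card_PiE_fix) auto
  also have "\<dots> = d ^ 2 * n ^ (2 * d)"
    by (simp add: cT D_def power2_eq_square mult_2 power_add)
  finally show ?thesis .
qed

text \<open>A double coincidence is recorded by four positions, whence \<open>d ^ 4\<close>. The
  condition \<open>q \<noteq> q'\<close> ensures that two different entries of \<open>j\<close> are
  determined, which costs \<open>n ^ 2\<close>.\<close>

lemma card_pairs_share2:
  fixes d n :: nat
  defines "T \<equiv> {1..d} \<rightarrow>\<^sub>E {1..n}" and "W \<equiv> {(p, p', q, q'). {p, p', q, q'} \<subseteq> {1..d} \<and> q \<noteq> q'}"
  shows "card {(i, j). i \<in> T \<and> j \<in> T \<and> (\<exists>(p, p', q, q')\<in>W. i p = j q \<and> i p' = j q')} * n ^ 2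
    \<le> d ^ 4 * n ^ (2 * d)"
proof -
  have fin: "finite T" unfolding T_def by (auto intro: finite_PiE)
  have W: "W \<subseteq> {1..d} \<times> {1..d} \<times> {1..d} \<times> {1..d}" unfolding W_def by auto
  have finW: "finite W" by (rule finite_subset[OF W]) auto
  have "card W \<le> card ({1..d} \<times> {1..d} \<times> {1..d} \<times> {1..d})"
    using W by (rule card_mono[rotated]) auto
  then have cW: "card W \<le> d ^ 4" by (simp add: card_cartesian_product numeral_eq_Suc)
  have cT: "card T = n ^ d" unfolding T_def by (subst card_PiE) auto
  have "card {(i, j). i \<in> T \<and> j \<in> T \<and> (\<exists>w\<in>W. case w of (p, p', q, q') \<Rightarrow> i p = j q \<and> i p' = j q')} * n ^ 2
      \<le> (\<Sum>w\<in>W. \<Sum>i\<in>T. card {j \<in> T. case w of (p, p', q, q') \<Rightarrow> i p = j q \<and> i p' = j q'}) * n ^ 2"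
    by (intro mult_right_mono card_pairs_Bex_le fin finW) auto
  also have "\<dots> = (\<Sum>w\<in>W. \<Sum>i\<in>T.
      card {j \<in> T. case w of (p, p', q, q') \<Rightarrow> j q = i p \<and> j q' = i p'} * n ^ 2)"
    by (simp add: sum_distrib_right case_prod_beta eq_commute)
  also have "\<dots> \<le> (\<Sum>w\<in>W. \<Sum>i\<in>T. n ^ d)"
  proof (intro sum_mono, clarify)
    fix p p' q q' i assume "(p, p', q, q') \<in> W"
    then show "card {j \<in> T. j q = i p \<and> j q' = i p'} * n\<^sup>2 \<le> n ^ d"
      unfolding T_def W_def by (intro card_PiE_fix2) auto
  qed
  also have "\<dots> \<le> d ^ 4 * n ^ (2 * d)"
    using cW by (simp add: cT mult_2 power_add mult_right_mono)
  finally show ?thesis .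
qed

text \<open>The top entry costs a factor \<open>n\<close> in each of the two tuples, and the further
  common entry costs another one in \<open>j\<close>; together this is \<open>n ^ 3\<close>.\<close>

lemma card_pairs_top_share1:
  fixes d n :: nat
  assumes "d \<ge> 1"
  defines "T \<equiv> {i \<in> {1..d} \<rightarrow>\<^sub>E {1..n}. i d = n}" and "D \<equiv> {1..<d}"
  shows "card {(i, j). i \<in> T \<and> j \<in> T \<and> (\<exists>(p, q)\<in>D \<times> D. i p = j q)} * n ^ 3 \<le> d ^ 2 * n ^ (2 * d)"
proof -
  have fin: "finite T" unfolding T_def by (rule finite_subset[of _ "{1..d} \<rightarrow>\<^sub>E {1..n}"]) (auto intro: finite_PiE)
  have cT: "card T * n \<le> n ^ d" unfolding T_def by (rule card_PiE_fix) (use assms in auto)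
  have "card {(i, j). i \<in> T \<and> j \<in> T \<and> (\<exists>w\<in>D \<times> D. case w of (p, q) \<Rightarrow> i p = j q)} * n ^ 3
      \<le> (\<Sum>w\<in>D \<times> D. \<Sum>i\<in>T. card {j \<in> T. case w of (p, q) \<Rightarrow> i p = j q}) * n ^ 3"
    by (intro mult_right_mono card_pairs_Bex_le fin) (auto simp: D_def)
  also have "\<dots> = (\<Sum>w\<in>D \<times> D. (\<Sum>i\<in>T. card {j \<in> T. j (snd w) = i (fst w)} * n ^ 2) * n)"
    by (simp only: sum_distrib_right case_prod_beta power3_eq_cube power2_eq_square mult.assoc)
      (simp only: eq_commute)
  also have "\<dots> \<le> (\<Sum>w\<in>D \<times> D. (\<Sum>i\<in>T. n ^ d) * n)"
  proof (intro sum_mono mult_right_mono)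
    fix w i assume w: "w \<in> D \<times> D" and "i \<in> T"
    have "{j \<in> T. j (snd w) = i (fst w)} =
        {j \<in> {1..d} \<rightarrow>\<^sub>E {1..n}. j (snd w) = i (fst w) \<and> j d = n}"
      unfolding T_def by auto
    then show "card {j \<in> T. j (snd w) = i (fst w)} * n\<^sup>2 \<le> n ^ d"
      using card_PiE_fix2[of "snd w" d d] w assms by (auto simp: D_def)
  qed auto
  also have "\<dots> = (d - 1) ^ 2 * (card T * n) * n ^ d"
    by (simp add: D_def power2_eq_square algebra_simps)
  also have "\<dots> \<le> d ^ 2 * n ^ d * n ^ d"
    using cT by (intro mult_mono power_mono) auto
  also have "\<dots> = d ^ 2 * n ^ (2 * d)"
    by (simp add: mult_2 power_add)
  finally show ?thesis .
qed

section \<open>Polynomial approximation of binomial weights\<close>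

text \<open>Induction on \<open>a\<close> through (m choose a+1) = (m choose a)(m - a)/(a + 1),
  where the errors of two bounded factors add up. The shift \<open>c\<close> admits both
  \<open>k\<close> and \<open>k - 1\<close> as upper index, and uniformity in \<open>k\<close> is
  needed because the errors are later summed over it.\<close>

lemma binomial_quotient_approx:
  "\<exists>C\<ge>0. \<forall>k n. c \<le> k \<and> k \<le> n \<and> n \<ge> 1 \<longrightarrow>
    \<bar>real (k - c choose a) / real n ^ a - (real k / real n) ^ a / fact a\<bar> \<le> C / real n"
proof (induction a)
  case 0
  show ?case by (intro exI[of _ 0]) auto
next
  case (Suc a)
  then obtain C where C: "C \<ge> 0" "\<And>k n. c \<le> k \<Longrightarrow> k \<le> n \<Longrightarrow> n \<ge> 1 \<Longrightarrow>
    \<bar>real (k - c choose a) / real n ^ a - (real k / real n) ^ a / fact a\<bar> \<le> C / real n" by blast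
  \<comment> \<open>As an identity of reals it also covers m < a: both binomial coefficients vanish
    there, whatever the sign of m - a.\<close>
  have rec: "real (m choose Suc a) = real (m choose a) * (real m - real a) / (real a + 1)" for m
  proof (cases "a \<le> m")
    case True
    have "Suc a * (m choose Suc a) = (m - a) * (m choose a)"
      by (simp only: binomial_absorption binomial_absorb_comp)
    then have "real (Suc a) * real (m choose Suc a) = real (m choose a) * (real m - real a)"
      using True by (metis mult.commute of_nat_diff of_nat_mult)
    then show ?thesis by (simp add: field_simps)
  qed (auto simp: binomial_eq_0)
  \<comment> \<open>One constant for two purposes: it bounds the factor \<open>s\<close>, and
    divided by \<open>n\<close> it bounds \<open>s - t\<close>.\<close>
  define K where "K = C + 1 + real a + real c"
  have "\<bar>real (k - c choose Suc a) / real n ^ Suc a - (real k / real n) ^ Suc a / fact (Suc a)\<bar>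
      \<le> (C * K + K) / real n" if k: "c \<le> k" "k \<le> n" "n \<ge> 1" for k n
  proof -
    define u where "u = real (k - c choose a) / real n ^ a"
    define v where "v = (real k / real n) ^ a / fact a"
    define s where "s = (real (k - c) - real a) / real n"
    define t where "t = real k / real n"
    have n0: "real n > 0" using k by simp
    have t: "0 \<le> t" "t \<le> 1" using k by (auto simp: t_def)
    have v: "0 \<le> v" "v \<le> 1"
    proof -
      show "0 \<le> v" by (simp add: v_def)
      have "t ^ a \<le> 1" using t by (simp add: power_le_one)
      also have "1 \<le> (fact a :: real)" by simp
      finally show "v \<le> 1" by (simp add: v_def t_def)
    qed
    have uv: "\<bar>u - v\<bar> \<le> C / real n" using C(2)[OF k] by (simp add: u_def v_def)
    have st: "\<bar>s - t\<bar> \<le> K / real n"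
    proof -
      have "s - t = - (real c + real a) / real n" using k by (simp add: s_def t_def field_simps)
      then have "\<bar>s - t\<bar> = (real c + real a) / real n" using n0 by (simp add: abs_divide)
      then show ?thesis using C(1) n0 by (simp add: K_def divide_right_mono)
    qed
    have s: "\<bar>s\<bar> \<le> K"
    proof -
      have "K / real n \<ge> 0" using C(1) n0 by (simp add: K_def)
      have "s \<le> 1" using k by (simp add: s_def)
      moreover have "- s \<le> real a / real n" by (simp add: s_def divide_simps)
      moreover have "real a / real n \<le> real a" using k by (simp add: divide_le_eq mult_le_cancel_left1)
      ultimately show ?thesis using C(1) by (simp add: K_def)
    qed
    have "u * s - v * t = (u - v) * s + v * (s - t)" by (simp add: algebra_simps)
    then have "\<bar>u * s - v * t\<bar> \<le> \<bar>u - v\<bar> * \<bar>s\<bar> + \<bar>v\<bar> * \<bar>s - t\<bar>"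
      by (metis abs_mult abs_triangle_ineq)
    also have "\<dots> \<le> C / real n * K + 1 * (K / real n)"
      using uv s v st C(1) n0 by (intro add_mono mult_mono) auto
    finally have prod_le: "\<bar>u * s - v * t\<bar> \<le> (C * K + K) / real n" by (simp add: add_divide_distrib)
    have "real (k - c choose Suc a) / real n ^ Suc a = u * s / (real a + 1)"
      by (simp add: u_def s_def rec field_simps)
    moreover have "(real k / real n) ^ Suc a / fact (Suc a) = v * t / (real a + 1)"
      by (simp add: v_def t_def field_simps)
    ultimately have "\<bar>real (k - c choose Suc a) / real n ^ Suc a - (real k / real n) ^ Suc a / fact (Suc a)\<bar>
      = \<bar>u * s - v * t\<bar> / (real a + 1)"
      by (simp add: diff_divide_distrib[symmetric] abs_divide)
    also have "\<dots> \<le> \<bar>u * s - v * t\<bar>" by (simp add: divide_le_eq mult_le_cancel_left1)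
    finally show ?thesis using prod_le by simp
  qed
  moreover have "C * K + K \<ge> 0" using C(1) by (simp add: K_def)
  ultimately show ?case by blast
qed

lemma binomial_le_power: "real (n choose k) \<le> real n ^ k"
proof (cases "k \<le> n")
  case True
  then show ?thesis using binomial_le_pow[of k n] by (metis of_nat_le_iff of_nat_power)
qed (auto simp: binomial_eq_0)

text \<open>By \<open>card_inc_tuples_at\<close> the product of binomial coefficients is the
  coefficient of the p-th projection at X_k. The two factors are approximated separately; one factor
  of each product stays in [0, 1], so their errors add.\<close>

lemma weight_approx:
  assumes "p \<in> {1..d}"
  shows "\<exists>C\<ge>0. \<forall>k n. 1 \<le> k \<and> k \<le> n \<longrightarrow>
    \<bar>real ((k - 1 choose (p - 1)) * (n - k choose (d - p))) / real n ^ (d - 1) - psi p d (real k / real n) 1\<bar>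
      \<le> C / real n"
proof -
  obtain C1 where C1: "C1 \<ge> 0" "\<And>k n. 1 \<le> k \<Longrightarrow> k \<le> n \<Longrightarrow> n \<ge> 1 \<Longrightarrow>
    \<bar>real (k - 1 choose (p - 1)) / real n ^ (p - 1) - (real k / real n) ^ (p - 1) / fact (p - 1)\<bar> \<le> C1 / real n"
    using binomial_quotient_approx[of 1 "p - 1"] by blast
  obtain C2 where C2: "C2 \<ge> 0" "\<And>k n. k \<le> n \<Longrightarrow> n \<ge> 1 \<Longrightarrow>
    \<bar>real (k choose (d - p)) / real n ^ (d - p) - (real k / real n) ^ (d - p) / fact (d - p)\<bar> \<le> C2 / real n"
    using binomial_quotient_approx[of 0 "d - p"] by auto
  have "\<bar>real ((k - 1 choose (p - 1)) * (n - k choose (d - p))) / real n ^ (d - 1) - psi p d (real k / real n) 1\<bar>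
      \<le> (C1 + C2) / real n" if k: "1 \<le> k" "k \<le> n" for k n
  proof -
    have n: "n \<ge> 1" using k by simp
    define u where "u = real (k - 1 choose (p - 1)) / real n ^ (p - 1)"
    define v where "v = (real k / real n) ^ (p - 1) / fact (p - 1)"
    define u' where "u' = real (n - k choose (d - p)) / real n ^ (d - p)"
    define v' where "v' = (1 - real k / real n) ^ (d - p) / fact (d - p)"
    have uv: "\<bar>u - v\<bar> \<le> C1 / real n" using C1(2)[OF k n] by (simp add: u_def v_def)
    have "real (n - k) / real n = 1 - real k / real n" using k by (simp add: field_simps of_nat_diff)
    then have uv': "\<bar>u' - v'\<bar> \<le> C2 / real n" using C2(2)[of "n - k" n] n by (simp add: u'_def v'_def)
    have u': "0 \<le> u'" "u' \<le> 1"
    proof -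
      show "0 \<le> u'" by (simp add: u'_def)
      have "real (n - k choose (d - p)) \<le> real (n - k) ^ (d - p)" by (rule binomial_le_power)
      also have "\<dots> \<le> real n ^ (d - p)" by (intro power_mono) auto
      finally show "u' \<le> 1" using n by (simp add: u'_def)
    qed
    have v: "0 \<le> v" "v \<le> 1"
    proof -
      show "0 \<le> v" by (simp add: v_def)
      have "(real k / real n) ^ (p - 1) \<le> 1" using k by (intro power_le_one) auto
      also have "1 \<le> (fact (p - 1) :: real)" by simp
      finally show "v \<le> 1" by (simp add: v_def)
    qed
    have "u * u' - v * v' = (u - v) * u' + v * (u' - v')" by (simp add: algebra_simps)
    then have "\<bar>u * u' - v * v'\<bar> \<le> \<bar>u - v\<bar> * \<bar>u'\<bar> + \<bar>v\<bar> * \<bar>u' - v'\<bar>"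
      by (metis abs_mult abs_triangle_ineq)
    also have "\<dots> \<le> C1 / real n * 1 + 1 * (C2 / real n)"
      using uv uv' u' v C1(1) C2(1) by (intro add_mono mult_mono) auto
    finally have "\<bar>u * u' - v * v'\<bar> \<le> (C1 + C2) / real n" by (simp add: add_divide_distrib)
    moreover have "d - 1 = (p - 1) + (d - p)" using assms by auto
    then have "real ((k - 1 choose (p - 1)) * (n - k choose (d - p))) / real n ^ (d - 1) = u * u'"
      by (simp add: u_def u'_def power_add)
    moreover have "psi p d (real k / real n) 1 = v * v'" by (simp add: psi_def v_def v'_def)
    ultimately show ?thesis by simp
  qed
  then show ?thesis using C1(1) C2(1) by (intro exI[of _ "C1 + C2"]) auto
qed

section \<open>Riemann sums\<close>

text \<open>Comparison with the increments of the primitive \<open>G\<close>: by the mean value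
  theorem each cell contributes g(z)/n for some point z of the cell, and uniform continuity moves z
  to the right endpoint.\<close>

lemma riemann_sum_tendsto:
  fixes g :: "real \<Rightarrow> real"
  assumes g: "continuous_on {0..1} g"
  shows "(\<lambda>n. (\<Sum>k=1..n. g (real k / real n)) / real n) \<longlonglongrightarrow> integral {0..1} g"
proof (rule LIMSEQ_I)
  fix e :: real assume e: "e > 0"
  have "uniformly_continuous_on {0..1} g" using g by (intro compact_uniformly_continuous) auto
  then obtain dl where dl: "dl > 0" "\<And>x y. x \<in> {0..1} \<Longrightarrow> y \<in> {0..1} \<Longrightarrow> dist y x < dl \<Longrightarrow> dist (g y) (g x) < e"
    using e unfolding uniformly_continuous_on_def by metis
  define G where "G x = integral {0..x} g" for x
  have G: "(G has_real_derivative g x) (at x within {0..1})" if "x \<in> {0..1}" for x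
    unfolding G_def using integral_has_real_derivative[OF g that] .
  obtain N :: nat where N: "real N > 1 / dl" using reals_Archimedean2 by blast
  have "\<bar>(\<Sum>k=1..n. g (real k / real n)) / real n - integral {0..1} g\<bar> < e" if n: "n \<ge> max N 1" for n
  proof -
    have n0: "real n > 0" using n by simp
    have "1 / dl < real n" using N n by (meson le_max_iff_disj le_trans less_le_trans max.bounded_iff of_nat_mono)
    then have small: "1 / real n < dl" using dl(1) n0 by (simp add: field_simps)
    have tele: "(\<Sum>k=1..m. G (real k / real n) - G (real (k - 1) / real n)) = G (real m / real n) - G 0" for m
      by (induction m) auto
    have trm: "\<bar>g (real k / real n) / real n - (G (real k / real n) - G (real (k - 1) / real n))\<bar> < e / real n"
      if k: "k \<in> {1..n}" for k
    proof -
      let ?a = "real (k - 1) / real n" and ?b = "real k / real n"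
      have ab: "?a < ?b" "?a \<ge> 0" "?b \<le> 1" "?b - ?a = 1 / real n"
        using k n0 by (auto simp: field_simps of_nat_diff)
      have "\<exists>z\<in>{?a<..<?b}. G ?b - G ?a = (?b - ?a) * g z"
      proof -
        have "\<exists>z\<in>{?a<..<?b}. G ?b - G ?a = g z * (?b - ?a)"
        proof (rule mvt_simple[OF ab(1)])
          fix x assume x: "?a \<le> x" "x \<le> ?b"
          then have "(G has_real_derivative g x) (at x within {0..1})"
            using ab order_trans[OF ab(2)] by (intro G) auto
          then have "(G has_real_derivative g x) (at x within {?a..?b})"
            by (rule DERIV_subset) (use ab in auto)
          then show "(G has_derivative (*) (g x)) (at x within {?a..?b})"
            by (simp add: has_field_derivative_def)
        qed
        then show ?thesis by (simp add: mult.commute)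
      qed
      then obtain z where z: "z \<in> {?a<..<?b}" "G ?b - G ?a = (1 / real n) * g z" using ab(4) by auto
      have "dist (g ?b) (g z) < e"
      proof (rule dl(2))
        show "dist ?b z < dl" using z(1) ab small by (auto simp: dist_real_def)
      qed (use z ab order_trans[OF ab(2)] in auto)
      then have "\<bar>g ?b - g z\<bar> / real n < e / real n"
        using n0 by (simp add: dist_real_def divide_strict_right_mono)
      moreover have "g ?b / real n - (G ?b - G ?a) = (g ?b - g z) / real n"
        unfolding z(2) by (simp add: diff_divide_distrib)
      ultimately show ?thesis using n0 by (simp add: abs_divide)
    qed
    have "(\<Sum>k=1..n. g (real k / real n)) / real n - integral {0..1} g =
        (\<Sum>k=1..n. g (real k / real n) / real n - (G (real k / real n) - G (real (k - 1) / real n)))"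
      unfolding sum_subtractf[of "\<lambda>k. g (real k / real n) / real n"] tele sum_divide_distrib
      using n0 by (simp add: G_def)
    also have "\<bar>\<dots>\<bar> \<le> (\<Sum>k=1..n. \<bar>g (real k / real n) / real n - (G (real k / real n) - G (real (k - 1) / real n))\<bar>)"
      by (rule sum_abs)
    also have "\<dots> < (\<Sum>k=1..n. e / real n)"
      using n trm by (intro sum_strict_mono) auto
    also have "\<dots> = e" using n0 by simp
    finally show ?thesis .
  qed
  then show "\<exists>no. \<forall>n\<ge>no. norm ((\<Sum>k=1..n. g (real k / real n)) / real n - integral {0..1} g) < e"
    unfolding real_norm_def by blast
qed

section \<open>Bernstein polynomials and degree elevation\<close>

text \<open>The right side is the Bernstein polynomial of degree \<open>d - 1\<close> with index
  \<open>j - 1\<close>; up to a factorial, the weights in the limit are the Bernstein basis.\<close>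

lemma fact_psi:
  assumes "j \<in> {1..d}"
  shows "fact (d - 1) * psi j d s 1 = real (d - 1 choose (j - 1)) * s ^ (j - 1) * (1 - s) ^ (d - j)"
proof -
  have "real (d - 1 choose (j - 1)) = fact (d - 1) / (fact (j - 1) * fact (d - 1 - (j - 1)))"
    using assms by (intro binomial_fact) auto
  moreover have "d - 1 - (j - 1) = d - j" using assms by auto
  ultimately show ?thesis by (simp add: psi_def)
qed

text \<open>Degree elevation: multiply by 1 = (s + (1 - s))^(e - d) and expand. The quotient of
  binomial coefficients is the coordinate of the result in the Bernstein basis of degree
  \<open>e - 1\<close>.\<close>

lemma psi_elevation:
  assumes j: "j \<in> {1..d}" and "d \<le> e"
  shows "fact (d - 1) * psi j d s 1 =
    (\<Sum>i=1..e. binom (d - 1) (int j - 1) * binom (e - d) (int i - int j) / binom (e - 1) (int i - 1)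
      * (fact (e - 1) * psi i e s 1))"
proof -
  let ?B = "real (d - 1 choose (j - 1))"
  have bj: "binom (d - 1) (int j - 1) = ?B"
    using j by (simp add: binom_def nat_diff_distrib)
  have trm: "binom (d - 1) (int j - 1) * binom (e - d) (int i - int j) / binom (e - 1) (int i - 1)
      * (fact (e - 1) * psi i e s 1) = ?B * (binom (e - d) (int i - int j) * (s ^ (i - 1) * (1 - s) ^ (e - i)))"
    if i: "i \<in> {1..e}" for i
  proof -
    have "binom (e - 1) (int i - 1) = real (e - 1 choose (i - 1))"
      using i by (simp add: binom_def nat_diff_distrib)
    moreover have "real (e - 1 choose (i - 1)) \<noteq> 0" using i by (simp add: binomial_eq_0_iff) auto
    ultimately show ?thesis unfolding fact_psi[OF i] bj by simp
  qed
  \<comment> \<open>With an integer lower index the terms with i < j vanish, so the range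
    \<open>{1..e}\<close> reduces to the indices that occur in the binomial expansion.\<close>
  have "(\<Sum>i=1..e. binom (e - d) (int i - int j) * (s ^ (i - 1) * (1 - s) ^ (e - i))) =
    (\<Sum>i\<in>(+) j ` {..e - d}. binom (e - d) (int i - int j) * (s ^ (i - 1) * (1 - s) ^ (e - i)))"
  proof (rule sum.mono_neutral_right)
    show "(+) j ` {..e - d} \<subseteq> {1..e}" using assms by auto
    show "\<forall>i\<in>{1..e} - (+) j ` {..e - d}. binom (e - d) (int i - int j) * (s ^ (i - 1) * (1 - s) ^ (e - i)) = 0"
    proof
      fix i assume i: "i \<in> {1..e} - (+) j ` {..e - d}"
      have "i < j \<or> i > j + (e - d)"
      proof (rule ccontr)
        assume "\<not> ?thesis"
        then have "i = j + (i - j)" "i - j \<in> {..e - d}" by auto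
        then show False using i by blast
      qed
      then have "binom (e - d) (int i - int j) = 0"
        by (auto simp: binom_def intro!: binomial_eq_0)
      then show "binom (e - d) (int i - int j) * (s ^ (i - 1) * (1 - s) ^ (e - i)) = 0" by simp
    qed
  qed auto
  also have "\<dots> = (\<Sum>l\<le>e - d. real (e - d choose l) * (s ^ (j + l - 1) * (1 - s) ^ (e - (j + l))))"
    by (subst sum.reindex) (auto simp: binom_def)
  also have "\<dots> = (\<Sum>l\<le>e - d. s ^ (j - 1) * (1 - s) ^ (d - j) * (real (e - d choose l) * s ^ l * (1 - s) ^ (e - d - l)))"
  proof (rule sum.cong)
    fix l assume l: "l \<in> {..e - d}"
    have "j + l - 1 = (j - 1) + l" "e - (j + l) = (d - j) + (e - d - l)" using l assms by auto
    then show "real (e - d choose l) * (s ^ (j + l - 1) * (1 - s) ^ (e - (j + l))) =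
        s ^ (j - 1) * (1 - s) ^ (d - j) * (real (e - d choose l) * s ^ l * (1 - s) ^ (e - d - l))"
      by (simp add: power_add)
  qed simp
  also have "\<dots> = s ^ (j - 1) * (1 - s) ^ (d - j) * (s + (1 - s)) ^ (e - d)"
    unfolding binomial_ring sum_distrib_left by simp
  finally have "(\<Sum>i=1..e. binom (e - d) (int i - int j) * (s ^ (i - 1) * (1 - s) ^ (e - i))) =
    s ^ (j - 1) * (1 - s) ^ (d - j)" by simp
  then have "fact (d - 1) * psi j d s 1 =
      (\<Sum>i=1..e. ?B * (binom (e - d) (int i - int j) * (s ^ (i - 1) * (1 - s) ^ (e - i))))"
    unfolding fact_psi[OF j] sum_distrib_left[symmetric] by simp
  also have "\<dots> = (\<Sum>i=1..e. binom (d - 1) (int j - 1) * binom (e - d) (int i - int j) / binom (e - 1) (int i - 1)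
      * (fact (e - 1) * psi i e s 1))"
    by (rule sum.cong[OF refl trm[symmetric]])
  finally show ?thesis .
qed

text \<open>Division by (1 - s)^(d - 1) turns the combination into a polynomial in s / (1 - s), an
  injective function of s, and this polynomial has infinitely many zeros. An arbitrary infinite
  \<open>A\<close> is allowed, since almost sure identities can be used simultaneously only for
  countably many s.\<close>

lemma psi_linear_independent:
  fixes c :: "nat \<Rightarrow> real"
  assumes A: "infinite A" "A \<subseteq> {0<..<1}"
    and zero: "\<And>s. s \<in> A \<Longrightarrow> (\<Sum>i=1..d. c i * psi i d s 1) = 0"
    and i: "i \<in> {1..d}"
  shows "c i = 0"
proof -
  define b where "b k = c (Suc k) / (fact k * fact (d - Suc k))" for k
  obtain e where d: "d = Suc e" using i by (cases d) auto
  have root: "(\<Sum>k\<le>e. b k * (s / (1 - s)) ^ k) = 0" if s: "s \<in> A" for s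
  proof -
    have s01: "0 < s" "s < 1" using s A(2) by auto
    have "0 = (\<Sum>i=1..d. c i * psi i d s 1)" using zero[OF s] by simp
    also have "\<dots> = (\<Sum>k\<le>e. c (Suc k) * psi (Suc k) d s 1)"
      unfolding d by (simp only: One_nat_def sum.atLeast_Suc_atMost_Suc_shift atMost_atLeast0 comp_def)
    also have "\<dots> = (\<Sum>k\<le>e. (1 - s) ^ e * (b k * (s / (1 - s)) ^ k))"
    proof (rule sum.cong)
      fix k assume "k \<in> {..e}"
      then have "(1 - s) ^ e = (1 - s) ^ (e - k) * (1 - s) ^ k" by (simp add: power_add[symmetric])
      then show "c (Suc k) * psi (Suc k) d s 1 = (1 - s) ^ e * (b k * (s / (1 - s)) ^ k)"
        using s01 by (simp add: psi_def b_def d power_divide)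
    qed simp
    finally show ?thesis using s01 by (simp add: sum_distrib_left[symmetric])
  qed
  have "inj_on (\<lambda>s::real. s / (1 - s)) A"
  proof (rule inj_onI)
    fix x y assume "x \<in> A" "y \<in> A" "x / (1 - x) = y / (1 - y)"
    moreover from this have "1 - x \<noteq> 0" "1 - y \<noteq> 0" using A(2) by auto
    ultimately have "x * (1 - y) = y * (1 - x)" by (simp add: frac_eq_eq)
    then show "x = y" by (simp add: algebra_simps)
  qed
  then have "infinite ((\<lambda>s. s / (1 - s)) ` A)" using A(1) by (simp add: finite_image_iff)
  moreover have "(\<lambda>s. s / (1 - s)) ` A \<subseteq> {z. (\<Sum>k\<le>e. b k * z ^ k) = 0}" using root by auto
  ultimately have "infinite {z. (\<Sum>k\<le>e. b k * z ^ k) = 0}" using finite_subset by blast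
  then have "b k = 0" if "k \<le> e" for k using that by (subst (asm) polyfun_finite_roots) auto
  from this[of "i - 1"] show ?thesis using i by (auto simp: b_def d)
qed

declare One_nat_def [simp del]

section \<open>Square-integrable functions\<close>

lemma integrable_mult_squares:
  fixes f g :: "'a \<Rightarrow> real"
  assumes "f \<in> borel_measurable M" "g \<in> borel_measurable M"
    and "integrable M (\<lambda>x. (f x)\<^sup>2)" "integrable M (\<lambda>x. (g x)\<^sup>2)"
  shows "integrable M (\<lambda>x. f x * g x)"
proof (rule Bochner_Integration.integrable_bound)
  show "integrable M (\<lambda>x. (f x)\<^sup>2 + (g x)\<^sup>2)" using assms by simp
  show "AE x in M. norm (f x * g x) \<le> norm ((f x)\<^sup>2 + (g x)\<^sup>2)"
  proof (rule AE_I2)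
    fix x
    have "2 * (\<bar>f x\<bar> * \<bar>g x\<bar>) \<le> \<bar>f x\<bar>\<^sup>2 + \<bar>g x\<bar>\<^sup>2"
      using sum_squares_bound[of "\<bar>f x\<bar>" "\<bar>g x\<bar>"] by (simp add: mult.assoc)
    moreover have "0 \<le> \<bar>f x\<bar> * \<bar>g x\<bar>" by simp
    ultimately show "norm (f x * g x) \<le> norm ((f x)\<^sup>2 + (g x)\<^sup>2)"
      by (simp add: abs_mult del: mult_nonneg_nonneg)
  qed
qed (use assms in measurable)

lemma integrable_square_add:
  fixes f g :: "'a \<Rightarrow> real"
  assumes "f \<in> borel_measurable M" "g \<in> borel_measurable M"
    and "integrable M (\<lambda>x. (f x)\<^sup>2)" "integrable M (\<lambda>x. (g x)\<^sup>2)"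
  shows "integrable M (\<lambda>x. (f x + g x)\<^sup>2)"
  using assms integrable_mult_squares[OF assms] by (simp add: power2_sum mult.assoc)

lemma integrable_square_sum:
  fixes f :: "'i \<Rightarrow> 'a \<Rightarrow> real"
  assumes "finite I" "\<And>i. i \<in> I \<Longrightarrow> f i \<in> borel_measurable M"
    and "\<And>i. i \<in> I \<Longrightarrow> integrable M (\<lambda>x. (f i x)\<^sup>2)"
  shows "integrable M (\<lambda>x. (\<Sum>i\<in>I. f i x)\<^sup>2)"
  using assms by (induction rule: finite_induct) (auto intro!: integrable_square_add)

lemma (in prob_space) square_expectation_le:
  fixes f :: "'a \<Rightarrow> real"
  assumes "integrable M f" "integrable M (\<lambda>x. (f x)\<^sup>2)"
  shows "(expectation f)\<^sup>2 \<le> expectation (\<lambda>x. (f x)\<^sup>2)"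
  using variance_eq[OF assms] variance_positive[of f] by simp

section \<open>Functions of tuples of independent variables\<close>

text \<open>Indices of U-statistics start at 1, so \<open>X 0\<close> occurs in none of them and
  serves as the generic copy X.\<close>

locale iid_sequence = prob_space M for M :: "'w measure" +
  fixes S :: "'s measure" and X :: "nat \<Rightarrow> 'w \<Rightarrow> 's"
  assumes indep: "indep_vars (\<lambda>_. S) X UNIV"
    and ident: "distr M S (X n) = distr M S (X 0)"
begin

definition tup :: "nat \<Rightarrow> (nat \<Rightarrow> nat) \<Rightarrow> 'w \<Rightarrow> nat \<Rightarrow> 's" where
  "tup d i \<omega> = (\<lambda>k\<in>{1..d}. X (i k) \<omega>)"

lemma X_measurable [measurable]: "X n \<in> measurable M S"
  using indep by (auto simp: indep_vars_def2)

lemma restrict_X_measurable [measurable]: "(\<lambda>\<omega>. \<lambda>k\<in>A. X (i k) \<omega>) \<in> measurable M (Pi\<^sub>M A (\<lambda>_. S))"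
  by (rule measurable_restrict) simp

lemma tup_measurable [measurable]: "tup d i \<in> measurable M (Pi\<^sub>M {1..d} (\<lambda>_. S))"
  unfolding tup_def[abs_def] by (rule restrict_X_measurable)

lemma X_space: "\<omega> \<in> space M \<Longrightarrow> X n \<omega> \<in> space S"
  by (rule measurable_space[OF X_measurable])

lemma distr_all: "distr M (Pi\<^sub>M UNIV (\<lambda>_. S)) (\<lambda>\<omega> k. X k \<omega>) = Pi\<^sub>M UNIV (\<lambda>_. distr M S (X 0))"
proof -
  have "(\<lambda>k. distr M S (X k)) = (\<lambda>_. distr M S (X 0))" by (intro ext ident)
  then show ?thesis
    using indep indep_vars_iff_distr_eq_PiM[where I=UNIV and M'="\<lambda>_. S" and X=X]
    unfolding restrict_UNIV by simp
qed

lemma prob_space_law: "prob_space (distr M S (X 0))"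
  by (rule prob_space_distr) simp

text \<open>The law of the whole sequence is projected, which covers finite tuples as well as an
  infinite \<open>K\<close>; the latter is needed for permutations of the sequence.\<close>

lemma distr_restrict:
  assumes "inj_on i K"
  shows "distr M (Pi\<^sub>M K (\<lambda>_. S)) (\<lambda>\<omega>. \<lambda>k\<in>K. X (i k) \<omega>) = Pi\<^sub>M K (\<lambda>_. distr M S (X 0))"
proof -
  let ?L = "distr M S (X 0)"
  have "Pi\<^sub>M K (\<lambda>_. ?L) = distr (Pi\<^sub>M UNIV (\<lambda>_. ?L)) (Pi\<^sub>M K (\<lambda>_. ?L)) (\<lambda>\<omega>. \<lambda>n\<in>K. \<omega> (i n))"
    using assms by (intro distr_PiM_reindex[symmetric]) (auto intro: prob_space_law)
  also have "\<dots> = distr (distr M (Pi\<^sub>M UNIV (\<lambda>_. S)) (\<lambda>\<omega> k. X k \<omega>)) (Pi\<^sub>M K (\<lambda>_. S)) (\<lambda>\<omega>. \<lambda>n\<in>K. \<omega> (i n))"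
    unfolding distr_all by (intro distr_cong) (auto intro!: sets_PiM_cong)
  also have "\<dots> = distr M (Pi\<^sub>M K (\<lambda>_. S)) ((\<lambda>\<omega>. \<lambda>n\<in>K. \<omega> (i n)) \<circ> (\<lambda>\<omega> k. X k \<omega>))"
  proof (rule distr_distr)
    show "(\<lambda>\<omega>. \<lambda>n\<in>K. \<omega> (i n)) \<in> Pi\<^sub>M UNIV (\<lambda>_. S) \<rightarrow>\<^sub>M Pi\<^sub>M K (\<lambda>_. S)"
      by (intro measurable_restrict measurable_component_singleton) auto
    show "(\<lambda>\<omega> k. X k \<omega>) \<in> M \<rightarrow>\<^sub>M Pi\<^sub>M UNIV (\<lambda>_. S)"
      using restrict_X_measurable[where A=UNIV and i="\<lambda>k. k"] unfolding restrict_UNIV .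
  qed
  finally show ?thesis by (simp add: comp_def)
qed

text \<open>Moments of a kernel at any injective tuple can therefore be computed at the tuple (1,
  ..., d), without symmetry of the kernel.\<close>

lemma distr_tup:
  assumes "inj_on i {1..d}"
  shows "distr M (Pi\<^sub>M {1..d} (\<lambda>_. S)) (tup d i) = distr M (Pi\<^sub>M {1..d} (\<lambda>_. S)) (tup d (\<lambda>k. k))"
  unfolding tup_def[abs_def] using distr_restrict[OF assms] distr_restrict[of "\<lambda>k. k" "{1..d}"] by simp

lemma
  fixes h :: "(nat \<Rightarrow> 's) \<Rightarrow> real"
  assumes [measurable]: "h \<in> borel_measurable (Pi\<^sub>M {1..d} (\<lambda>_. S))" and i: "inj_on i {1..d}"
  shows integral_tup: "(\<integral>\<omega>. h (tup d i \<omega>) \<partial>M) = (\<integral>\<omega>. h (tup d (\<lambda>k. k) \<omega>) \<partial>M)"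
    and integrable_tup: "integrable M (\<lambda>\<omega>. h (tup d i \<omega>)) \<longleftrightarrow> integrable M (\<lambda>\<omega>. h (tup d (\<lambda>k. k) \<omega>))"
proof -
  have "(\<integral>\<omega>. h (tup d j \<omega>) \<partial>M) = (\<integral>y. h y \<partial>distr M (Pi\<^sub>M {1..d} (\<lambda>_. S)) (tup d j))" for j
    by (rule integral_distr[symmetric]) auto
  then show "(\<integral>\<omega>. h (tup d i \<omega>) \<partial>M) = (\<integral>\<omega>. h (tup d (\<lambda>k. k) \<omega>) \<partial>M)"
    by (simp only: distr_tup[OF i])
  have "integrable M (\<lambda>\<omega>. h (tup d j \<omega>)) \<longleftrightarrow> integrable (distr M (Pi\<^sub>M {1..d} (\<lambda>_. S)) (tup d j)) h" for j
    by (rule integrable_distr_eq[symmetric]) auto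
  then show "integrable M (\<lambda>\<omega>. h (tup d i \<omega>)) \<longleftrightarrow> integrable M (\<lambda>\<omega>. h (tup d (\<lambda>k. k) \<omega>))"
    by (simp only: distr_tup[OF i])
qed

lemma
  fixes g :: "'s \<Rightarrow> real"
  assumes [measurable]: "g \<in> borel_measurable S"
  shows integral_X: "(\<integral>\<omega>. g (X n \<omega>) \<partial>M) = (\<integral>\<omega>. g (X 0 \<omega>) \<partial>M)"
    and integrable_X: "integrable M (\<lambda>\<omega>. g (X n \<omega>)) \<longleftrightarrow> integrable M (\<lambda>\<omega>. g (X 0 \<omega>))"
proof -
  have "(\<integral>\<omega>. g (X n \<omega>) \<partial>M) = (\<integral>y. g y \<partial>distr M S (X n))" for n
    by (rule integral_distr[symmetric]) auto
  then show "(\<integral>\<omega>. g (X n \<omega>) \<partial>M) = (\<integral>\<omega>. g (X 0 \<omega>) \<partial>M)"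
    by (metis ident)
  have "integrable M (\<lambda>\<omega>. g (X n \<omega>)) \<longleftrightarrow> integrable (distr M S (X n)) g" for n
    by (rule integrable_distr_eq[symmetric]) auto
  then show "integrable M (\<lambda>\<omega>. g (X n \<omega>)) \<longleftrightarrow> integrable M (\<lambda>\<omega>. g (X 0 \<omega>))"
    by (metis ident)
qed

lemma AE_X:
  assumes [measurable]: "Measurable.pred S Q"
  shows "(AE \<omega> in M. Q (X n \<omega>)) \<longleftrightarrow> (AE \<omega> in M. Q (X 0 \<omega>))"
proof -
  have "(AE \<omega> in M. Q (X n \<omega>)) \<longleftrightarrow> (AE x in distr M S (X n). Q x)" for n
    by (rule AE_distr_iff[symmetric]) auto
  then show ?thesis by (metis ident)
qed

text \<open>Disjoint blocks are independent, so the second one may be evaluated at a separate point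
  \<open>\<omega>'\<close> of an independent copy. Conditioning on the first block then becomes
  integration over \<open>\<omega>'\<close>.\<close>

lemma distr_decouple:
  assumes AB: "A \<inter> B = {}"
  shows "distr M (Pi\<^sub>M A (\<lambda>_. S) \<Otimes>\<^sub>M Pi\<^sub>M B (\<lambda>_. S)) (\<lambda>\<omega>. (\<lambda>k\<in>A. X k \<omega>, \<lambda>k\<in>B. X k \<omega>)) =
    distr (M \<Otimes>\<^sub>M M) (Pi\<^sub>M A (\<lambda>_. S) \<Otimes>\<^sub>M Pi\<^sub>M B (\<lambda>_. S))
      (\<lambda>(\<omega>, \<omega>'). (\<lambda>k\<in>A. X k \<omega>, \<lambda>k\<in>B. X k \<omega>'))"
proof -
  have "indep_var (Pi\<^sub>M A (\<lambda>_. S)) (\<lambda>\<omega>. \<lambda>k\<in>A. X k \<omega>) (Pi\<^sub>M B (\<lambda>_. S)) (\<lambda>\<omega>. \<lambda>k\<in>B. X k \<omega>)"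
    using indep_var_restrict[OF indep AB] by simp
  then have "distr M (Pi\<^sub>M A (\<lambda>_. S)) (\<lambda>\<omega>. \<lambda>k\<in>A. X k \<omega>) \<Otimes>\<^sub>M distr M (Pi\<^sub>M B (\<lambda>_. S)) (\<lambda>\<omega>. \<lambda>k\<in>B. X k \<omega>)
    = distr M (Pi\<^sub>M A (\<lambda>_. S) \<Otimes>\<^sub>M Pi\<^sub>M B (\<lambda>_. S)) (\<lambda>\<omega>. (\<lambda>k\<in>A. X k \<omega>, \<lambda>k\<in>B. X k \<omega>))"
    unfolding indep_var_distribution_eq by blast
  moreover have "sigma_finite_measure (distr M (Pi\<^sub>M B (\<lambda>_. S)) (\<lambda>\<omega>. \<lambda>k\<in>B. X k \<omega>))"
    by (intro prob_space_imp_sigma_finite prob_space_distr restrict_X_measurable)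
  ultimately show ?thesis
    by (subst (asm) pair_measure_distr) (auto intro: restrict_X_measurable)
qed

lemma
  fixes F :: "(nat \<Rightarrow> 's) \<times> (nat \<Rightarrow> 's) \<Rightarrow> real"
  assumes AB: "A \<inter> B = {}" and F: "F \<in> borel_measurable (Pi\<^sub>M A (\<lambda>_. S) \<Otimes>\<^sub>M Pi\<^sub>M B (\<lambda>_. S))"
  shows integral_decouple: "(\<integral>\<omega>. F (\<lambda>k\<in>A. X k \<omega>, \<lambda>k\<in>B. X k \<omega>) \<partial>M) =
      (\<integral>(\<omega>, \<omega>'). F (\<lambda>k\<in>A. X k \<omega>, \<lambda>k\<in>B. X k \<omega>') \<partial>(M \<Otimes>\<^sub>M M))"
    and integrable_decouple: "integrable M (\<lambda>\<omega>. F (\<lambda>k\<in>A. X k \<omega>, \<lambda>k\<in>B. X k \<omega>)) \<longleftrightarrow>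
      integrable (M \<Otimes>\<^sub>M M) (\<lambda>(\<omega>, \<omega>'). F (\<lambda>k\<in>A. X k \<omega>, \<lambda>k\<in>B. X k \<omega>'))"
proof -
  let ?N = "Pi\<^sub>M A (\<lambda>_. S) \<Otimes>\<^sub>M Pi\<^sub>M B (\<lambda>_. S)"
  have m1: "(\<lambda>\<omega>. (\<lambda>k\<in>A. X k \<omega>, \<lambda>k\<in>B. X k \<omega>)) \<in> M \<rightarrow>\<^sub>M ?N" by simp
  have m2: "(\<lambda>(\<omega>, \<omega>'). (\<lambda>k\<in>A. X k \<omega>, \<lambda>k\<in>B. X k \<omega>')) \<in> M \<Otimes>\<^sub>M M \<rightarrow>\<^sub>M ?N"
    by measurable
  show "(\<integral>\<omega>. F (\<lambda>k\<in>A. X k \<omega>, \<lambda>k\<in>B. X k \<omega>) \<partial>M) =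
      (\<integral>(\<omega>, \<omega>'). F (\<lambda>k\<in>A. X k \<omega>, \<lambda>k\<in>B. X k \<omega>') \<partial>(M \<Otimes>\<^sub>M M))"
    using integral_distr[OF m1 F] integral_distr[OF m2 F]
    unfolding distr_decouple[OF AB] case_prod_beta by simp
  show "integrable M (\<lambda>\<omega>. F (\<lambda>k\<in>A. X k \<omega>, \<lambda>k\<in>B. X k \<omega>)) \<longleftrightarrow>
      integrable (M \<Otimes>\<^sub>M M) (\<lambda>(\<omega>, \<omega>'). F (\<lambda>k\<in>A. X k \<omega>, \<lambda>k\<in>B. X k \<omega>'))"
    using integrable_distr_eq[OF m1 F] integrable_distr_eq[OF m2 F]
    unfolding distr_decouple[OF AB] case_prod_beta by simp
qed

lemma pair_prob_space: "pair_prob_space M M"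
  by unfold_locales

text \<open>The positions in \<open>Q\<close> carry indices that occur in \<open>j\<close>, the
  other positions carry indices foreign to \<open>j\<close>. Decoupling the foreign variables and
  integrating them first leaves the conditional mean of \<open>h\<close> given the positions in
  \<open>Q\<close> as a factor, and \<open>zero\<close> says that it vanishes.\<close>

lemma orthogonal:
  fixes h g :: "(nat \<Rightarrow> 's) \<Rightarrow> real"
  assumes h: "h \<in> borel_measurable (Pi\<^sub>M {1..d} (\<lambda>_. S))"
    and g: "g \<in> borel_measurable (Pi\<^sub>M {1..e} (\<lambda>_. S))"
    and Q: "i ` Q \<subseteq> j ` {1..e}" and disj: "i ` ({1..d} - Q) \<inter> j ` {1..e} = {}"
    and int: "integrable M (\<lambda>\<omega>. h (tup d i \<omega>) * g (tup e j \<omega>))"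
    and zero: "AE \<omega> in M. (\<integral>\<omega>'. h (\<lambda>k\<in>{1..d}. if k \<in> Q then X (i k) \<omega> else X (i k) \<omega>') \<partial>M) = 0"
  shows "(\<integral>\<omega>. h (tup d i \<omega>) * g (tup e j \<omega>) \<partial>M) = 0"
proof -
  interpret MM: pair_prob_space M M by (rule pair_prob_space)
  define A where "A = j ` {1..e}"
  define B where "B = i ` ({1..d} - Q)"
  \<comment> \<open>\<open>u\<close> holds all variables indexed by \<open>j\<close>, including
    those shared with \<open>h\<close>; \<open>v\<close> holds the remaining variables of
    \<open>h\<close>.\<close>
  define F where "F = (\<lambda>(u, v). h (\<lambda>k\<in>{1..d}. if k \<in> Q then u (i k) else v (i k)) * g (\<lambda>k\<in>{1..e}. u (j k)))"
  have AB: "A \<inter> B = {}" using disj by (auto simp: A_def B_def)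
  have F: "F \<in> borel_measurable (Pi\<^sub>M A (\<lambda>_. S) \<Otimes>\<^sub>M Pi\<^sub>M B (\<lambda>_. S))"
  proof -
    have "(\<lambda>w. \<lambda>k\<in>{1..d}. if k \<in> Q then fst w (i k) else snd w (i k)) \<in>
        Pi\<^sub>M A (\<lambda>_. S) \<Otimes>\<^sub>M Pi\<^sub>M B (\<lambda>_. S) \<rightarrow>\<^sub>M Pi\<^sub>M {1..d} (\<lambda>_. S)"
    proof (rule measurable_restrict)
      fix k assume k: "k \<in> {1..d}"
      show "(\<lambda>w. if k \<in> Q then fst w (i k) else snd w (i k)) \<in> Pi\<^sub>M A (\<lambda>_. S) \<Otimes>\<^sub>M Pi\<^sub>M B (\<lambda>_. S) \<rightarrow>\<^sub>M S"
      proof (cases "k \<in> Q")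
        case True
        then have "i k \<in> A" using Q by (auto simp: A_def)
        then show ?thesis using True by simp
      next
        case False
        then have "i k \<in> B" using k by (auto simp: B_def)
        then show ?thesis using False by simp
      qed
    qed
    moreover have "(\<lambda>w. \<lambda>k\<in>{1..e}. fst w (j k)) \<in>
        Pi\<^sub>M A (\<lambda>_. S) \<Otimes>\<^sub>M Pi\<^sub>M B (\<lambda>_. S) \<rightarrow>\<^sub>M Pi\<^sub>M {1..e} (\<lambda>_. S)"
      by (rule measurable_restrict) (simp add: A_def)
    ultimately show ?thesis
      unfolding F_def case_prod_beta
      by (intro borel_measurable_times measurable_compose[OF _ h] measurable_compose[OF _ g])
  qed
  have F_eq: "F (\<lambda>k\<in>A. X k \<omega>, \<lambda>k\<in>B. X k \<omega>') =
      h (\<lambda>k\<in>{1..d}. if k \<in> Q then X (i k) \<omega> else X (i k) \<omega>') * g (tup e j \<omega>)" for \<omega> \<omega>'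
  proof -
    have "(\<lambda>k\<in>{1..d}. if k \<in> Q then (\<lambda>k\<in>A. X k \<omega>) (i k) else (\<lambda>k\<in>B. X k \<omega>') (i k)) =
        (\<lambda>k\<in>{1..d}. if k \<in> Q then X (i k) \<omega> else X (i k) \<omega>')"
      using Q by (intro restrict_ext) (auto simp: A_def B_def)
    moreover have "(\<lambda>k\<in>{1..e}. (\<lambda>k\<in>A. X k \<omega>) (j k)) = tup e j \<omega>"
      unfolding tup_def by (intro restrict_ext) (auto simp: A_def)
    ultimately show ?thesis by (simp add: F_def)
  qed
  have F_diag: "F (\<lambda>k\<in>A. X k \<omega>, \<lambda>k\<in>B. X k \<omega>) = h (tup d i \<omega>) * g (tup e j \<omega>)" for \<omega>
    unfolding F_eq tup_def by (simp cong: restrict_cong)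
  have "integrable (M \<Otimes>\<^sub>M M) (\<lambda>(\<omega>, \<omega>'). F (\<lambda>k\<in>A. X k \<omega>, \<lambda>k\<in>B. X k \<omega>'))"
    using int unfolding integrable_decouple[OF AB F, symmetric] F_diag .
  from MM.integral_fst'[OF this]
  have "(\<integral>\<omega>. h (tup d i \<omega>) * g (tup e j \<omega>) \<partial>M) =
      (\<integral>\<omega>. \<integral>\<omega>'. F (\<lambda>k\<in>A. X k \<omega>, \<lambda>k\<in>B. X k \<omega>') \<partial>M \<partial>M)"
    using integral_decouple[OF AB F] unfolding F_diag by simp
  also have "\<dots> = (\<integral>\<omega>. 0 \<partial>M)"
  proof (rule integral_cong_AE)
    show "(\<lambda>\<omega>. \<integral>\<omega>'. F (\<lambda>k\<in>A. X k \<omega>, \<lambda>k\<in>B. X k \<omega>') \<partial>M) \<in> borel_measurable M"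
      using F by measurable
    show "AE \<omega> in M. (\<integral>\<omega>'. F (\<lambda>k\<in>A. X k \<omega>, \<lambda>k\<in>B. X k \<omega>') \<partial>M) = 0"
      using zero unfolding F_eq by eventually_elim simp
  qed simp
  finally show ?thesis by simp
qed

text \<open>The projection before centring. It is also applied to the square of a kernel and to
  residual kernels, where subtracting the mean of \<open>f\<close> would be out of place.\<close>

definition cproj :: "nat \<Rightarrow> ((nat \<Rightarrow> 's) \<Rightarrow> real) \<Rightarrow> nat \<Rightarrow> 's \<Rightarrow> real" where
  "cproj d h p x = (\<integral>\<omega>. h ((tup d (\<lambda>k. k) \<omega>)(p := x)) \<partial>M)"

lemma kernel_mean_eq: "kernel_mean M d h X = (\<integral>\<omega>. h (tup d (\<lambda>k. k) \<omega>) \<partial>M)"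
  by (simp add: kernel_mean_def tup_def)

lemma kernel_proj_eq: "kernel_proj M d h X p x = cproj d h p x - kernel_mean M d h X"
  by (simp add: kernel_proj_def cproj_def tup_def)

lemma upd_measurable:
  assumes "p \<in> {1..d}"
  shows "(\<lambda>(x, y). y(p := x)) \<in> S \<Otimes>\<^sub>M Pi\<^sub>M {1..d} (\<lambda>_. S) \<rightarrow>\<^sub>M Pi\<^sub>M {1..d} (\<lambda>_. S)"
  unfolding case_prod_beta by (rule measurable_fun_upd[where J="{1..d}"]) (use assms in auto)

lemma upd_tup_measurable:
  assumes "p \<in> {1..d}"
  shows "(\<lambda>(x, \<omega>). (tup d i \<omega>)(p := x)) \<in> S \<Otimes>\<^sub>M M \<rightarrow>\<^sub>M Pi\<^sub>M {1..d} (\<lambda>_. S)"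
  unfolding case_prod_beta by (rule measurable_fun_upd[where J="{1..d}"]) (use assms in auto)

lemma cproj_measurable:
  assumes h: "h \<in> borel_measurable (Pi\<^sub>M {1..d} (\<lambda>_. S))" and p: "p \<in> {1..d}"
  shows "cproj d h p \<in> borel_measurable S"
  unfolding cproj_def[abs_def]
  using measurable_compose[OF upd_tup_measurable[OF p] h]
  by (intro borel_measurable_lebesgue_integral) (simp add: case_prod_beta)

lemma
  assumes h: "h \<in> borel_measurable (Pi\<^sub>M {1..d} (\<lambda>_. S))" and p: "p \<in> {1..d}"
    and i: "inj_on i {1..d}" and x: "x \<in> space S"
  shows integral_tup_upd: "(\<integral>\<omega>. h ((tup d i \<omega>)(p := x)) \<partial>M) = cproj d h p x"
proof -
  have "(\<lambda>y. h (y(p := x))) \<in> borel_measurable (Pi\<^sub>M {1..d} (\<lambda>_. S))"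
    using measurable_compose[OF measurable_Pair1'[OF x] measurable_compose[OF upd_measurable[OF p] h]]
    by simp
  from integral_tup[OF this i] show ?thesis by (simp add: cproj_def)
qed

text \<open>Fubini with coordinate \<open>p\<close> in the first factor and the others in the
  second. The argument runs at \<open>X p\<close>, whose index fits the tuple (1, ..., d), and is
  carried over to \<open>X n\<close> by identical distribution.\<close>

lemma
  assumes h: "h \<in> borel_measurable (Pi\<^sub>M {1..d} (\<lambda>_. S))" and p: "p \<in> {1..d}"
    and int: "integrable M (\<lambda>\<omega>. h (tup d (\<lambda>k. k) \<omega>))"
  shows cproj_integrable: "integrable M (\<lambda>\<omega>. cproj d h p (X n \<omega>))"
    and cproj_expectation: "(\<integral>\<omega>. cproj d h p (X n \<omega>) \<partial>M) = (\<integral>\<omega>. h (tup d (\<lambda>k. k) \<omega>) \<partial>M)"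
    and cproj_AE_integrable: "AE \<omega> in M. integrable M (\<lambda>\<omega>'. h ((tup d (\<lambda>k. k) \<omega>')(p := X n \<omega>)))"
proof -
  interpret MM: pair_prob_space M M by (rule pair_prob_space)
  define A where "A = {p}"
  define B where "B = {1..d} - {p}"
  define F where "F = (\<lambda>(u :: nat \<Rightarrow> 's, v :: nat \<Rightarrow> 's). h (\<lambda>k\<in>{1..d}. if k \<in> {p} then u p else v k))"
  have AB: "A \<inter> B = {}" by (auto simp: A_def B_def)
  have F: "F \<in> borel_measurable (Pi\<^sub>M A (\<lambda>_. S) \<Otimes>\<^sub>M Pi\<^sub>M B (\<lambda>_. S))"
  proof -
    have "(\<lambda>w. \<lambda>k\<in>{1..d}. if k \<in> {p} then fst w p else snd w k) \<in>
        Pi\<^sub>M A (\<lambda>_. S) \<Otimes>\<^sub>M Pi\<^sub>M B (\<lambda>_. S) \<rightarrow>\<^sub>M Pi\<^sub>M {1..d} (\<lambda>_. S)"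
    proof (rule measurable_restrict)
      fix k assume k: "k \<in> {1..d}"
      show "(\<lambda>w. if k \<in> {p} then fst w p else snd w k) \<in> Pi\<^sub>M A (\<lambda>_. S) \<Otimes>\<^sub>M Pi\<^sub>M B (\<lambda>_. S) \<rightarrow>\<^sub>M S"
        using k by (cases "k = p") (auto simp: A_def B_def)
    qed
    then show ?thesis
      unfolding F_def case_prod_beta by (rule measurable_compose[OF _ h])
  qed
  have F_eq: "F (\<lambda>k\<in>A. X k \<omega>, \<lambda>k\<in>B. X k \<omega>') = h ((tup d (\<lambda>k. k) \<omega>')(p := X p \<omega>))" for \<omega> \<omega>'
  proof -
    have "(\<lambda>k\<in>{1..d}. if k \<in> {p} then (\<lambda>k\<in>A. X k \<omega>) p else (\<lambda>k\<in>B. X k \<omega>') k) =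
        (tup d (\<lambda>k. k) \<omega>')(p := X p \<omega>)"
      using p by (auto simp: A_def B_def tup_def fun_eq_iff)
    then show ?thesis by (simp add: F_def)
  qed
  have F_diag: "F (\<lambda>k\<in>A. X k \<omega>, \<lambda>k\<in>B. X k \<omega>) = h (tup d (\<lambda>k. k) \<omega>)" for \<omega>
    unfolding F_eq using p by (auto simp: tup_def fun_upd_idem)
  have intMM: "integrable (M \<Otimes>\<^sub>M M) (\<lambda>(\<omega>, \<omega>'). h ((tup d (\<lambda>k. k) \<omega>')(p := X p \<omega>)))"
    using int integrable_decouple[OF AB F] unfolding F_diag F_eq by simp
  have "integrable M (\<lambda>\<omega>. cproj d h p (X p \<omega>))"
    using MM.integrable_fst'[OF intMM] by (simp add: cproj_def)
  then show "integrable M (\<lambda>\<omega>. cproj d h p (X n \<omega>))"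
    using integrable_X[OF cproj_measurable[OF h p]] by blast
  have "(\<integral>\<omega>. cproj d h p (X p \<omega>) \<partial>M) = (\<integral>\<omega>. h (tup d (\<lambda>k. k) \<omega>) \<partial>M)"
    using MM.integral_fst'[OF intMM] integral_decouple[OF AB F] unfolding F_diag F_eq
    by (simp add: cproj_def)
  then show "(\<integral>\<omega>. cproj d h p (X n \<omega>) \<partial>M) = (\<integral>\<omega>. h (tup d (\<lambda>k. k) \<omega>) \<partial>M)"
    using integral_X[OF cproj_measurable[OF h p]] by metis
  have "AE \<omega> in M. integrable M (\<lambda>\<omega>'. h ((tup d (\<lambda>k. k) \<omega>')(p := X p \<omega>)))"
    using MM.AE_integrable_fst'[OF intMM] by simp
  moreover have "Measurable.pred S (\<lambda>x. integrable M (\<lambda>\<omega>'. h ((tup d (\<lambda>k. k) \<omega>')(p := x))))"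
    using measurable_compose[OF upd_tup_measurable[OF p] h]
    by (intro borel_measurable_lebesgue_integrable) (simp add: case_prod_beta)
  ultimately show "AE \<omega> in M. integrable M (\<lambda>\<omega>'. h ((tup d (\<lambda>k. k) \<omega>')(p := X n \<omega>)))"
    using AE_X by blast
qed

text \<open>Jensen's inequality on almost every fibre: the square of the projection is at most the
  projection of the square.\<close>

lemma cproj_square_integrable:
  assumes h: "h \<in> borel_measurable (Pi\<^sub>M {1..d} (\<lambda>_. S))" and p: "p \<in> {1..d}"
    and int: "integrable M (\<lambda>\<omega>. (h (tup d (\<lambda>k. k) \<omega>))\<^sup>2)"
  shows "integrable M (\<lambda>\<omega>. (cproj d h p (X n \<omega>))\<^sup>2)"
proof -
  note [measurable] = h cproj_measurable[OF h p]
  have "integrable M (\<lambda>\<omega>. h (tup d (\<lambda>k. k) \<omega>))"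
    using int by (rule square_integrable_imp_integrable[rotated]) measurable
  note 1 = cproj_AE_integrable[OF h p this, of n]
  have h2: "(\<lambda>y. (h y)\<^sup>2) \<in> borel_measurable (Pi\<^sub>M {1..d} (\<lambda>_. S))" by measurable
  note 2 = cproj_AE_integrable[OF h2 p int, of n]
  show ?thesis
  proof (rule Bochner_Integration.integrable_bound[OF cproj_integrable[OF h2 p int, of n]])
    show "AE \<omega> in M. norm ((cproj d h p (X n \<omega>))\<^sup>2) \<le> norm (cproj d (\<lambda>y. (h y)\<^sup>2) p (X n \<omega>))"
      using 1 2
    proof eventually_elim
      case (elim \<omega>)
      then have "(cproj d h p (X n \<omega>))\<^sup>2 \<le> cproj d (\<lambda>y. (h y)\<^sup>2) p (X n \<omega>)"
        unfolding cproj_def by (rule square_expectation_le)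
      then show ?case by simp
    qed
  qed measurable
qed

end

section \<open>Second moments of sums over tuples\<close>

context iid_sequence
begin

text \<open>Expanding the square leaves one expectation per pair. Pairs outside \<open>R\<close>
  contribute nothing and the others at most the second moment of a single summand, so a variance
  bound becomes a count of the pairs in \<open>R\<close>.\<close>

lemma expectation_sum_tup_square_le:
  fixes h :: "(nat \<Rightarrow> 's) \<Rightarrow> real"
  assumes h [measurable]: "h \<in> borel_measurable (Pi\<^sub>M {1..d} (\<lambda>_. S))"
    and int: "integrable M (\<lambda>\<omega>. (h (tup d (\<lambda>k. k) \<omega>))\<^sup>2)"
    and T: "finite T" "\<And>i. i \<in> T \<Longrightarrow> inj_on i {1..d}"
    and R: "\<And>i j. i \<in> T \<Longrightarrow> j \<in> T \<Longrightarrow> \<not> R i j \<Longrightarrow> (\<integral>\<omega>. h (tup d i \<omega>) * h (tup d j \<omega>) \<partial>M) = 0"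
  shows "integrable M (\<lambda>\<omega>. (\<Sum>i\<in>T. h (tup d i \<omega>))\<^sup>2)"
    and "(\<integral>\<omega>. (\<Sum>i\<in>T. h (tup d i \<omega>))\<^sup>2 \<partial>M) \<le>
      real (card {(i, j). i \<in> T \<and> j \<in> T \<and> R i j}) * (\<integral>\<omega>. (h (tup d (\<lambda>k. k) \<omega>))\<^sup>2 \<partial>M)"
proof -
  define c where "c = (\<integral>\<omega>. (h (tup d (\<lambda>k. k) \<omega>))\<^sup>2 \<partial>M)"
  have h2: "(\<lambda>y. (h y)\<^sup>2) \<in> borel_measurable (Pi\<^sub>M {1..d} (\<lambda>_. S))" by measurable
  have int_i: "integrable M (\<lambda>\<omega>. (h (tup d i \<omega>))\<^sup>2)" if "i \<in> T" for i
    using int integrable_tup[OF h2 T(2)[OF that]] by simp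
  have c: "(\<integral>\<omega>. (h (tup d i \<omega>))\<^sup>2 \<partial>M) = c" if "i \<in> T" for i
    using integral_tup[OF h2 T(2)[OF that]] by (simp add: c_def)
  have int_ij: "integrable M (\<lambda>\<omega>. h (tup d i \<omega>) * h (tup d j \<omega>))" if "i \<in> T" "j \<in> T" for i j
    using that by (intro integrable_mult_squares int_i) auto
  show "integrable M (\<lambda>\<omega>. (\<Sum>i\<in>T. h (tup d i \<omega>))\<^sup>2)"
    using T(1) int_i by (intro integrable_square_sum) auto
  have bound: "(\<integral>\<omega>. h (tup d i \<omega>) * h (tup d j \<omega>) \<partial>M) \<le> (if R i j then c else 0)"
    if ij: "i \<in> T" "j \<in> T" for i j
  proof (cases "R i j")
    case True
    have "2 * (\<integral>\<omega>. h (tup d i \<omega>) * h (tup d j \<omega>) \<partial>M) = (\<integral>\<omega>. 2 * (h (tup d i \<omega>) * h (tup d j \<omega>)) \<partial>M)"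
      by simp
    also have "\<dots> \<le> (\<integral>\<omega>. (h (tup d i \<omega>))\<^sup>2 + (h (tup d j \<omega>))\<^sup>2 \<partial>M)"
    proof (intro integral_mono Bochner_Integration.integrable_add int_i ij)
      show "integrable M (\<lambda>\<omega>. 2 * (h (tup d i \<omega>) * h (tup d j \<omega>)))"
        using int_ij[OF ij] by simp
      show "2 * (h (tup d i \<omega>) * h (tup d j \<omega>)) \<le> (h (tup d i \<omega>))\<^sup>2 + (h (tup d j \<omega>))\<^sup>2" for \<omega>
        using sum_squares_bound[of "h (tup d i \<omega>)" "h (tup d j \<omega>)"] by (simp add: mult.assoc)
    qed
    also have "\<dots> = 2 * c" using int_i[OF ij(1)] int_i[OF ij(2)] c ij by simp
    finally show ?thesis using True by simp
  qed (use R ij in auto)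
  have "(\<integral>\<omega>. (\<Sum>i\<in>T. h (tup d i \<omega>))\<^sup>2 \<partial>M) = (\<Sum>i\<in>T. \<Sum>j\<in>T. \<integral>\<omega>. h (tup d i \<omega>) * h (tup d j \<omega>) \<partial>M)"
    unfolding power2_eq_square sum_product using int_ij
    by (subst Bochner_Integration.integral_sum Bochner_Integration.integrable_sum; auto)+
  also have "\<dots> \<le> (\<Sum>i\<in>T. \<Sum>j\<in>T. if R i j then c else 0)"
    by (intro sum_mono bound)
  also have "\<dots> = (\<Sum>w\<in>T \<times> T. if case w of (i, j) \<Rightarrow> R i j then c else 0)"
    by (simp add: sum.cartesian_product case_prod_beta)
  also have "\<dots> = (\<Sum>w\<in>{w \<in> T \<times> T. case w of (i, j) \<Rightarrow> R i j}. c)"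
    using T(1) by (subst sum.inter_filter) auto
  also have "{w \<in> T \<times> T. case w of (i, j) \<Rightarrow> R i j} = {(i, j). i \<in> T \<and> j \<in> T \<and> R i j}"
    by auto
  finally show "(\<integral>\<omega>. (\<Sum>i\<in>T. h (tup d i \<omega>))\<^sup>2 \<partial>M) \<le>
      real (card {(i, j). i \<in> T \<and> j \<in> T \<and> R i j}) * (\<integral>\<omega>. (h (tup d (\<lambda>k. k) \<omega>))\<^sup>2 \<partial>M)"
    by (simp add: c_def)
qed

lemma orthogonal_disjoint:
  fixes h :: "(nat \<Rightarrow> 's) \<Rightarrow> real"
  assumes h [measurable]: "h \<in> borel_measurable (Pi\<^sub>M {1..d} (\<lambda>_. S))"
    and int: "integrable M (\<lambda>\<omega>. (h (tup d (\<lambda>k. k) \<omega>))\<^sup>2)"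
    and ij: "inj_on i {1..d}" "inj_on j {1..d}" "i ` {1..d} \<inter> j ` {1..d} = {}"
    and zero: "(\<integral>\<omega>. h (tup d (\<lambda>k. k) \<omega>) \<partial>M) = 0"
  shows "(\<integral>\<omega>. h (tup d i \<omega>) * h (tup d j \<omega>) \<partial>M) = 0"
proof (rule orthogonal[where Q="{}"])
  have h2: "(\<lambda>y. (h y)\<^sup>2) \<in> borel_measurable (Pi\<^sub>M {1..d} (\<lambda>_. S))" by measurable
  show "integrable M (\<lambda>\<omega>. h (tup d i \<omega>) * h (tup d j \<omega>))"
    using int integrable_tup[OF h2 ij(1)] integrable_tup[OF h2 ij(2)]
    by (intro integrable_mult_squares) auto
  have "(\<lambda>k\<in>{1..d}. if k \<in> {} then X (i k) \<omega> else X (i k) \<omega>') = tup d i \<omega>'" for \<omega> \<omega>'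
    by (simp add: tup_def)
  then show "AE \<omega> in M. (\<integral>\<omega>'. h (\<lambda>k\<in>{1..d}. if k \<in> {} then X (i k) \<omega> else X (i k) \<omega>') \<partial>M) = 0"
    using zero integral_tup[OF h ij(1)] by simp
qed (use ij h in simp_all)

text \<open>Exactly one position \<open>p\<close> of \<open>i\<close> carries an index of
  \<open>j\<close>, so the conditional mean required by \<open>orthogonal\<close> is the projection
  at \<open>p\<close>.\<close>

lemma orthogonal_single:
  fixes h :: "(nat \<Rightarrow> 's) \<Rightarrow> real"
  assumes h [measurable]: "h \<in> borel_measurable (Pi\<^sub>M {1..d} (\<lambda>_. S))"
    and int: "integrable M (\<lambda>\<omega>. (h (tup d (\<lambda>k. k) \<omega>))\<^sup>2)"
    and ij: "inj_on i {1..d}" "inj_on j {1..d}"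
    and p: "p \<in> {1..d}" "i p \<in> j ` {1..d}" "i ` ({1..d} - {p}) \<inter> j ` {1..d} = {}"
    and zero: "AE \<omega> in M. cproj d h p (X (i p) \<omega>) = 0"
  shows "(\<integral>\<omega>. h (tup d i \<omega>) * h (tup d j \<omega>) \<partial>M) = 0"
proof (rule orthogonal[where Q="{p}"])
  have h2: "(\<lambda>y. (h y)\<^sup>2) \<in> borel_measurable (Pi\<^sub>M {1..d} (\<lambda>_. S))" by measurable
  show "integrable M (\<lambda>\<omega>. h (tup d i \<omega>) * h (tup d j \<omega>))"
    using int integrable_tup[OF h2 ij(1)] integrable_tup[OF h2 ij(2)]
    by (intro integrable_mult_squares) auto
  have "(\<lambda>k\<in>{1..d}. if k \<in> {p} then X (i k) \<omega> else X (i k) \<omega>') = (tup d i \<omega>')(p := X (i p) \<omega>)" for \<omega> \<omega>'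
    using p(1) by (auto simp: tup_def fun_eq_iff)
  moreover have "AE \<omega> in M. (\<integral>\<omega>'. h ((tup d i \<omega>')(p := X (i p) \<omega>)) \<partial>M) = 0"
    using zero AE_space
    by eventually_elim (simp add: integral_tup_upd[OF h p(1) ij(1) X_space])
  ultimately show "AE \<omega> in M. (\<integral>\<omega>'. h (\<lambda>k\<in>{1..d}. if k \<in> {p} then X (i k) \<omega> else X (i k) \<omega>') \<partial>M) = 0"
    by simp
qed (use p h in simp_all)

text \<open>A partial Hoeffding decomposition: \<open>Q\<close> lists the positions whose
  first-order terms are removed. It occurs with \<open>{}\<close> for the law of large numbers, with
  \<open>{1..d}\<close> for the remainder of the linearization, and with \<open>{d}\<close> for
  increments over a window.\<close>

definition resid :: "nat \<Rightarrow> ((nat \<Rightarrow> 's) \<Rightarrow> real) \<Rightarrow> nat set \<Rightarrow> (nat \<Rightarrow> 's) \<Rightarrow> real" where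
  "resid d f Q y = f y - kernel_mean M d f X - (\<Sum>p\<in>Q. kernel_proj M d f X p (y p))"

end

section \<open>Square-integrable kernels and their residuals\<close>

locale L2_kernel = iid_sequence M S X
  for M :: "'w measure" and S :: "'s measure" and X :: "nat \<Rightarrow> 'w \<Rightarrow> 's" +
  fixes d :: nat and f :: "(nat \<Rightarrow> 's) \<Rightarrow> real"
  assumes d_pos: "d \<ge> 1"
    and f_measurable: "f \<in> borel_measurable (Pi\<^sub>M {1..d} (\<lambda>_. S))"
    and f_L2: "kernel_L2 M d f X"
begin

abbreviation "\<mu> \<equiv> kernel_mean M d f X"
abbreviation "\<phi> \<equiv> kernel_proj M d f X"

lemma f_square_integrable: "integrable M (\<lambda>\<omega>. (f (tup d (\<lambda>k. k) \<omega>))\<^sup>2)"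
  using f_L2 by (simp add: kernel_L2_def tup_def)

lemma f_integrable: "integrable M (\<lambda>\<omega>. f (tup d (\<lambda>k. k) \<omega>))"
  by (rule square_integrable_imp_integrable[OF _ f_square_integrable])
    (rule measurable_compose[OF tup_measurable f_measurable])

lemma f_L1: "kernel_L1 M d f X"
  using f_integrable by (simp add: kernel_L1_def tup_def)

lemma proj_measurable: "p \<in> {1..d} \<Longrightarrow> \<phi> p \<in> borel_measurable S"
  using cproj_measurable[OF f_measurable] by (simp add: kernel_proj_eq[abs_def])

lemma proj_square_integrable: "p \<in> {1..d} \<Longrightarrow> integrable M (\<lambda>\<omega>. (\<phi> p (X n \<omega>))\<^sup>2)"
  using integrable_square_add[of "\<lambda>\<omega>. cproj d f p (X n \<omega>)" M "\<lambda>_. - \<mu>"]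
    cproj_square_integrable[OF f_measurable _ f_square_integrable]
    measurable_compose[OF X_measurable cproj_measurable[OF f_measurable]]
  by (simp add: kernel_proj_eq)

lemma proj_integrable: "p \<in> {1..d} \<Longrightarrow> integrable M (\<lambda>\<omega>. \<phi> p (X n \<omega>))"
  using cproj_integrable[OF f_measurable _ f_integrable] by (simp add: kernel_proj_eq)

lemma proj_expectation: "p \<in> {1..d} \<Longrightarrow> (\<integral>\<omega>. \<phi> p (X n \<omega>) \<partial>M) = 0"
  using cproj_integrable[OF f_measurable _ f_integrable] cproj_expectation[OF f_measurable _ f_integrable]
  by (simp add: kernel_proj_eq kernel_mean_eq prob_space)

context
  fixes Q :: "nat set"
  assumes Q: "Q \<subseteq> {1..d}"
begin

lemma finite_Q: "finite Q"
  by (rule finite_subset[OF Q]) simp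

lemma resid_tup: "resid d f Q (tup d i \<omega>) = f (tup d i \<omega>) - \<mu> - (\<Sum>p\<in>Q. \<phi> p (X (i p) \<omega>))"
proof -
  have "(\<Sum>p\<in>Q. \<phi> p (tup d i \<omega> p)) = (\<Sum>p\<in>Q. \<phi> p (X (i p) \<omega>))"
    using Q by (intro sum.cong) (auto simp: tup_def)
  then show ?thesis by (simp add: resid_def)
qed

lemma resid_measurable: "resid d f Q \<in> borel_measurable (Pi\<^sub>M {1..d} (\<lambda>_. S))"
  unfolding resid_def[abs_def]
proof (intro borel_measurable_diff borel_measurable_sum f_measurable borel_measurable_const)
  fix p assume "p \<in> Q"
  then have "p \<in> {1..d}" using Q by auto
  then show "(\<lambda>y. \<phi> p (y p)) \<in> borel_measurable (Pi\<^sub>M {1..d} (\<lambda>_. S))"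
    by (intro measurable_compose[OF _ proj_measurable] measurable_component_singleton)
qed

lemma resid_square_integrable: "integrable M (\<lambda>\<omega>. (resid d f Q (tup d (\<lambda>k. k) \<omega>))\<^sup>2)"
proof -
  have m: "(\<lambda>\<omega>. f (tup d (\<lambda>k. k) \<omega>)) \<in> borel_measurable M"
    by (rule measurable_compose[OF tup_measurable f_measurable])
  have m': "(\<lambda>\<omega>. \<phi> p (X p \<omega>)) \<in> borel_measurable M" if "p \<in> Q" for p
    using that Q by (intro measurable_compose[OF X_measurable proj_measurable]) auto
  have "integrable M (\<lambda>\<omega>. (\<Sum>p\<in>Q. - \<phi> p (X p \<omega>))\<^sup>2)"
    using Q proj_square_integrable by (intro integrable_square_sum finite_Q) (auto intro!: m')
  moreover have "integrable M (\<lambda>\<omega>. (f (tup d (\<lambda>k. k) \<omega>) + (- \<mu>))\<^sup>2)"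
    by (rule integrable_square_add[OF m _ f_square_integrable]) auto
  ultimately have "integrable M (\<lambda>\<omega>. ((f (tup d (\<lambda>k. k) \<omega>) + (- \<mu>)) + (\<Sum>p\<in>Q. - \<phi> p (X p \<omega>)))\<^sup>2)"
    by (intro integrable_square_add[where f="\<lambda>\<omega>. f (tup d (\<lambda>k. k) \<omega>) + (- \<mu>)"
          and g="\<lambda>\<omega>. \<Sum>p\<in>Q. - \<phi> p (X p \<omega>)"])
      (use m m' in auto)
  then show ?thesis by (simp only: resid_tup sum_negf diff_conv_add_uminus)
qed

lemma resid_expectation: "(\<integral>\<omega>. resid d f Q (tup d (\<lambda>k. k) \<omega>) \<partial>M) = 0"
proof -
  have p: "p \<in> {1..d}" if "p \<in> Q" for p using that Q by auto
  have "(\<integral>\<omega>. (\<Sum>p\<in>Q. \<phi> p (X p \<omega>)) \<partial>M) = 0"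
    using proj_integrable[OF p] proj_expectation[OF p] by simp
  then show ?thesis
    using f_integrable proj_integrable[OF p]
    by (simp add: resid_tup prob_space kernel_mean_eq)
qed

text \<open>With coordinate \<open>q\<close> fixed, the projections at the other positions integrate
  to zero and the one at \<open>q\<close> cancels the projection of \<open>f\<close>. The identity
  is only almost sure, because the fibre of \<open>f\<close> has to be integrable.\<close>

lemma cproj_resid:
  assumes q: "q \<in> Q"
  shows "AE \<omega> in M. cproj d (resid d f Q) q (X n \<omega>) = 0"
proof -
  have qd: "q \<in> {1..d}" using q Q by auto
  have p: "p \<in> {1..d}" if "p \<in> Q" for p using that Q by auto
  show ?thesis
    using cproj_AE_integrable[OF f_measurable qd f_integrable, of n]
  proof eventually_elim
    case (elim \<omega>)
    let ?x = "X n \<omega>"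
    have int: "integrable M (\<lambda>\<omega>'. \<phi> p (X p \<omega>'))" if "p \<in> Q - {q}" for p
      using that by (intro proj_integrable p) auto
    have "resid d f Q ((tup d (\<lambda>k. k) \<omega>')(q := ?x)) =
        f ((tup d (\<lambda>k. k) \<omega>')(q := ?x)) - \<mu> - (\<phi> q ?x + (\<Sum>p\<in>Q - {q}. \<phi> p (X p \<omega>')))" for \<omega>'
    proof -
      have "(\<Sum>p\<in>Q. \<phi> p (((tup d (\<lambda>k. k) \<omega>')(q := ?x)) p)) =
          \<phi> q ?x + (\<Sum>p\<in>Q - {q}. \<phi> p (((tup d (\<lambda>k. k) \<omega>')(q := ?x)) p))"
        using q finite_Q by (subst sum.remove[of _ q]) auto
      also have "(\<Sum>p\<in>Q - {q}. \<phi> p (((tup d (\<lambda>k. k) \<omega>')(q := ?x)) p)) = (\<Sum>p\<in>Q - {q}. \<phi> p (X p \<omega>'))"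
        using p by (intro sum.cong) (auto simp: tup_def)
      finally show ?thesis by (simp add: resid_def)
    qed
    then have "cproj d (resid d f Q) q ?x =
        (\<integral>\<omega>'. f ((tup d (\<lambda>k. k) \<omega>')(q := ?x)) - \<mu> - (\<phi> q ?x + (\<Sum>p\<in>Q - {q}. \<phi> p (X p \<omega>'))) \<partial>M)"
      by (simp add: cproj_def)
    also have "\<dots> = cproj d f q ?x - \<mu> - (\<phi> q ?x + (\<Sum>p\<in>Q - {q}. \<integral>\<omega>'. \<phi> p (X p \<omega>') \<partial>M))"
    proof -
      define g where "g = (\<lambda>\<omega>'. f ((tup d (\<lambda>k. k) \<omega>')(q := ?x)))"
      have "integrable M g" unfolding g_def by (rule elim)
      then have "(\<integral>\<omega>'. g \<omega>' - \<mu> - (\<phi> q ?x + (\<Sum>p\<in>Q - {q}. \<phi> p (X p \<omega>'))) \<partial>M) =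
          (\<integral>\<omega>'. g \<omega>' \<partial>M) - \<mu> - (\<phi> q ?x + (\<Sum>p\<in>Q - {q}. \<integral>\<omega>'. \<phi> p (X p \<omega>') \<partial>M))"
      proof -
        define s where "s = (\<lambda>\<omega>'. \<Sum>p\<in>Q - {q}. \<phi> p (X p \<omega>'))"
        have "integrable M s" unfolding s_def using int by (rule Bochner_Integration.integrable_sum)
        moreover have "(\<integral>\<omega>'. s \<omega>' \<partial>M) = (\<Sum>p\<in>Q - {q}. \<integral>\<omega>'. \<phi> p (X p \<omega>') \<partial>M)"
          unfolding s_def using int by (rule Bochner_Integration.integral_sum)
        ultimately have "(\<integral>\<omega>'. g \<omega>' - \<mu> - (\<phi> q ?x + s \<omega>') \<partial>M) =
          (\<integral>\<omega>'. g \<omega>' \<partial>M) - \<mu> - (\<phi> q ?x + (\<Sum>p\<in>Q - {q}. \<integral>\<omega>'. \<phi> p (X p \<omega>') \<partial>M))"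
          using \<open>integrable M g\<close> by (simp add: prob_space)
        then show ?thesis by (simp only: s_def)
      qed
      then show ?thesis by (simp add: g_def cproj_def)
    qed
    also have "(\<Sum>p\<in>Q - {q}. \<integral>\<omega>'. \<phi> p (X p \<omega>') \<partial>M) = 0"
      using p by (intro sum.neutral) (auto simp: proj_expectation)
    finally show ?case by (simp add: kernel_proj_eq)
  qed
qed

end

text \<open>Centred kernels at disjoint tuples are uncorrelated, so only pairs with a common index
  count.\<close>

lemma expectation_square_ustat_le:
  "\<exists>C\<ge>0. \<forall>n. (\<integral>\<omega>. (\<Sum>i\<in>inc_tuples d n. resid d f {} (tup d i \<omega>))\<^sup>2 \<partial>M) * real n \<le> C * real n ^ (2 * d)"
proof -
  define c where "c = (\<integral>\<omega>. (resid d f {} (tup d (\<lambda>k. k) \<omega>))\<^sup>2 \<partial>M)"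
  have c: "c \<ge> 0" by (simp add: c_def)
  have "(\<integral>\<omega>. (\<Sum>i\<in>inc_tuples d n. resid d f {} (tup d i \<omega>))\<^sup>2 \<partial>M) * real n \<le> real d ^ 2 * c * real n ^ (2 * d)" for n
  proof -
    let ?R = "\<lambda>i j. \<exists>(p, q)\<in>{1..d} \<times> {1..d}. i p = j q"
    let ?T = "{1..d} \<rightarrow>\<^sub>E {1..n}"
    have "(\<integral>\<omega>. (\<Sum>i\<in>inc_tuples d n. resid d f {} (tup d i \<omega>))\<^sup>2 \<partial>M) \<le>
        real (card {(i, j). i \<in> inc_tuples d n \<and> j \<in> inc_tuples d n \<and> ?R i j}) * c"
      unfolding c_def
    proof (rule expectation_sum_tup_square_le)
      fix i j assume ij: "i \<in> inc_tuples d n" "j \<in> inc_tuples d n" "\<not> ?R i j"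
      show "(\<integral>\<omega>. resid d f {} (tup d i \<omega>) * resid d f {} (tup d j \<omega>) \<partial>M) = 0"
        using ij by (intro orthogonal_disjoint resid_measurable resid_square_integrable
            resid_expectation inc_tuples_inj) auto
    qed (simp_all add: resid_measurable resid_square_integrable inc_tuples_inj)
    also have "\<dots> \<le> real (card {(i, j). i \<in> ?T \<and> j \<in> ?T \<and> ?R i j}) * c"
    proof (intro mult_right_mono of_nat_mono card_mono)
      show "finite {(i, j). i \<in> ?T \<and> j \<in> ?T \<and> ?R i j}"
        by (rule finite_subset[of _ "?T \<times> ?T"]) (auto intro: finite_PiE)
    qed (use inc_tuples_subset[of d n] c in auto)
    finally have "(\<integral>\<omega>. (\<Sum>i\<in>inc_tuples d n. resid d f {} (tup d i \<omega>))\<^sup>2 \<partial>M) * real n \<le>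
      real (card {(i, j). i \<in> ?T \<and> j \<in> ?T \<and> ?R i j}) * c * real n"
      by (rule mult_right_mono) simp
    also have "\<dots> = real (card {(i, j). i \<in> ?T \<and> j \<in> ?T \<and> ?R i j} * n) * c" by simp
    also have "\<dots> \<le> real (d ^ 2 * n ^ (2 * d)) * c"
      using card_pairs_share1[of d n] c by (intro mult_right_mono of_nat_mono) auto
    finally show ?thesis by (simp add: mult_ac)
  qed
  then show ?thesis using c by (intro exI[of _ "real d ^ 2 * c"]) auto
qed

text \<open>With all first-order terms removed, pairs with a single common index drop out as well;
  this gains a further power of \<open>n\<close>.\<close>

lemma expectation_square_remainder_le:
  "\<exists>C\<ge>0. \<forall>n. (\<integral>\<omega>. (\<Sum>i\<in>inc_tuples d n. resid d f {1..d} (tup d i \<omega>))\<^sup>2 \<partial>M) * real n ^ 2 \<le> C * real n ^ (2 * d)"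
proof -
  define c where "c = (\<integral>\<omega>. (resid d f {1..d} (tup d (\<lambda>k. k) \<omega>))\<^sup>2 \<partial>M)"
  have c: "c \<ge> 0" by (simp add: c_def)
  let ?W = "{(p, p', q, q'). {p, p', q, q'} \<subseteq> {1..d} \<and> q \<noteq> q'}"
  have "(\<integral>\<omega>. (\<Sum>i\<in>inc_tuples d n. resid d f {1..d} (tup d i \<omega>))\<^sup>2 \<partial>M) * real n ^ 2
      \<le> real d ^ 4 * c * real n ^ (2 * d)" for n
  proof -
    let ?R = "\<lambda>i j :: nat \<Rightarrow> nat. \<exists>(p, p', q, q')\<in>?W. i p = j q \<and> i p' = j q'"
    let ?T = "{1..d} \<rightarrow>\<^sub>E {1..n}"
    have "(\<integral>\<omega>. (\<Sum>i\<in>inc_tuples d n. resid d f {1..d} (tup d i \<omega>))\<^sup>2 \<partial>M) \<le>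
        real (card {(i, j). i \<in> inc_tuples d n \<and> j \<in> inc_tuples d n \<and> ?R i j}) * c"
      unfolding c_def
    proof (rule expectation_sum_tup_square_le)
      fix i j assume ij: "i \<in> inc_tuples d n" "j \<in> inc_tuples d n" "\<not> ?R i j"
      have inj: "inj_on i {1..d}" "inj_on j {1..d}" using ij inc_tuples_inj by auto
      show "(\<integral>\<omega>. resid d f {1..d} (tup d i \<omega>) * resid d f {1..d} (tup d j \<omega>) \<partial>M) = 0"
      proof (cases "i ` {1..d} \<inter> j ` {1..d} = {}")
        case True
        then show ?thesis using inj by (intro orthogonal_disjoint resid_measurable
            resid_square_integrable resid_expectation) auto
      next
        case False
        then obtain p q where pq: "p \<in> {1..d}" "q \<in> {1..d}" "i p = j q" by blast
        \<comment> \<open>As \<open>i\<close> is injective, a second coincidence would use another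
          position of \<open>j\<close> and would put the pair into \<open>?R\<close>.\<close>
        have "i p' \<noteq> j q'" if "p' \<in> {1..d} - {p}" "q' \<in> {1..d}" for p' q'
        proof
          assume eq: "i p' = j q'"
          have "q \<noteq> q'"
          proof
            assume "q = q'"
            then have "i p' = i p" using eq pq(3) by simp
            then show False using inj(1) that(1) pq(1) by (auto dest: inj_onD)
          qed
          then have "(p, p', q, q') \<in> ?W" using pq that by auto
          then show False using ij(3) eq pq(3) by blast
        qed
        then have "i ` ({1..d} - {p}) \<inter> j ` {1..d} = {}" by blast
        then show ?thesis using inj pq by (intro orthogonal_single[where p=p] resid_measurable
            resid_square_integrable cproj_resid) auto
      qed
    qed (simp_all add: resid_measurable resid_square_integrable inc_tuples_inj)
    also have "\<dots> \<le> real (card {(i, j). i \<in> ?T \<and> j \<in> ?T \<and> ?R i j}) * c"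
    proof (intro mult_right_mono of_nat_mono card_mono)
      show "finite {(i, j). i \<in> ?T \<and> j \<in> ?T \<and> ?R i j}"
        by (rule finite_subset[of _ "?T \<times> ?T"]) (auto intro: finite_PiE)
    qed (use inc_tuples_subset[of d n] c in auto)
    finally have "(\<integral>\<omega>. (\<Sum>i\<in>inc_tuples d n. resid d f {1..d} (tup d i \<omega>))\<^sup>2 \<partial>M) * real n ^ 2 \<le>
      real (card {(i, j). i \<in> ?T \<and> j \<in> ?T \<and> ?R i j}) * c * real n ^ 2"
      by (rule mult_right_mono) simp
    also have "\<dots> = real (card {(i, j). i \<in> ?T \<and> j \<in> ?T \<and> ?R i j} * n ^ 2) * c" by simp
    also have "\<dots> \<le> real (d ^ 4 * n ^ (2 * d)) * c"
      using c by (intro mult_right_mono of_nat_mono card_pairs_share2)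
    finally show ?thesis by (simp add: mult_ac)
  qed
  then show ?thesis using c by (intro exI[of _ "real d ^ 4 * c"]) auto
qed

end

context L2_kernel
begin

text \<open>All tuples here end in \<open>n\<close>. With the projection at position
  \<open>d\<close> removed, pairs having no other index in common are uncorrelated, and those
  counted by \<open>card_pairs_top_share1\<close> remain.\<close>

lemma expectation_square_increment_le:
  "\<exists>C\<ge>0. \<forall>n. (\<integral>\<omega>. (\<Sum>i\<in>{i \<in> inc_tuples d n. i d = n}. resid d f {d} (tup d i \<omega>))\<^sup>2 \<partial>M) * real n ^ 3
    \<le> C * real n ^ (2 * d)"
proof -
  define c where "c = (\<integral>\<omega>. (resid d f {d} (tup d (\<lambda>k. k) \<omega>))\<^sup>2 \<partial>M)"
  have c: "c \<ge> 0" by (simp add: c_def)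
  have d: "{d} \<subseteq> {1..d}" "d \<in> {1..d}" using d_pos by auto
  have "(\<integral>\<omega>. (\<Sum>i\<in>{i \<in> inc_tuples d n. i d = n}. resid d f {d} (tup d i \<omega>))\<^sup>2 \<partial>M) * real n ^ 3
      \<le> real d ^ 2 * c * real n ^ (2 * d)" for n
  proof -
    let ?R = "\<lambda>i j :: nat \<Rightarrow> nat. \<exists>(p, q)\<in>{1..<d} \<times> {1..<d}. i p = j q"
    let ?T = "{i \<in> {1..d} \<rightarrow>\<^sub>E {1..n}. i d = n}"
    let ?I = "{i \<in> inc_tuples d n. i d = n}"
    have "(\<integral>\<omega>. (\<Sum>i\<in>?I. resid d f {d} (tup d i \<omega>))\<^sup>2 \<partial>M) \<le>
        real (card {(i, j). i \<in> ?I \<and> j \<in> ?I \<and> ?R i j}) * c"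
      unfolding c_def
    proof (rule expectation_sum_tup_square_le)
      show "inj_on i {1..d}" if "i \<in> ?I" for i using that inc_tuples_inj by blast
      fix i j assume ij: "i \<in> ?I" "j \<in> ?I" "\<not> ?R i j"
      have inj: "inj_on i {1..d}" "inj_on j {1..d}" using ij inc_tuples_inj by auto
      have "i p \<noteq> j q" if pq: "p \<in> {1..d} - {d}" "q \<in> {1..d}" for p q
      proof
        assume eq: "i p = j q"
        show False
        proof (cases "q = d")
          case True
          then have "i p = i d" using eq ij by simp
          then show False using inj(1) pq d(2) by (auto dest: inj_onD)
        next
          case False
          then have "(p, q) \<in> {1..<d} \<times> {1..<d}" using pq by auto
          then show False using ij(3) eq by blast
        qed
      qed
      then have "i ` ({1..d} - {d}) \<inter> j ` {1..d} = {}" by blast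
      moreover have "i d \<in> j ` {1..d}" using ij d(2) by (metis (mono_tags, lifting) image_eqI mem_Collect_eq)
      ultimately show "(\<integral>\<omega>. resid d f {d} (tup d i \<omega>) * resid d f {d} (tup d j \<omega>) \<partial>M) = 0"
        using inj d by (intro orthogonal_single[where p=d] resid_measurable
            resid_square_integrable cproj_resid) auto
    qed (use d in \<open>simp_all add: resid_measurable resid_square_integrable\<close>)
    also have "\<dots> \<le> real (card {(i, j). i \<in> ?T \<and> j \<in> ?T \<and> ?R i j}) * c"
    proof (intro mult_right_mono of_nat_mono card_mono)
      show "finite {(i, j). i \<in> ?T \<and> j \<in> ?T \<and> ?R i j}"
        by (rule finite_subset[of _ "({1..d} \<rightarrow>\<^sub>E {1..n}) \<times> ({1..d} \<rightarrow>\<^sub>E {1..n})"]) (auto intro: finite_PiE)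
    qed (use inc_tuples_subset[of d n] c in auto)
    finally have "(\<integral>\<omega>. (\<Sum>i\<in>?I. resid d f {d} (tup d i \<omega>))\<^sup>2 \<partial>M) * real n ^ 3 \<le>
      real (card {(i, j). i \<in> ?T \<and> j \<in> ?T \<and> ?R i j}) * c * real n ^ 3"
      by (rule mult_right_mono) simp
    also have "\<dots> = real (card {(i, j). i \<in> ?T \<and> j \<in> ?T \<and> ?R i j} * n ^ 3) * c" by simp
    also have "\<dots> \<le> real (d ^ 2 * n ^ (2 * d)) * c"
      using c d_pos by (intro mult_right_mono of_nat_mono card_pairs_top_share1)
    finally show ?thesis by (simp add: mult_ac)
  qed
  then show ?thesis using c by (intro exI[of _ "real d ^ 2 * c"]) auto
qed

end

section \<open>The strong law of large numbers\<close>

text \<open>Unlike the set of increasing tuples, this set is stable under permutations of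
  \<open>{1..n}\<close>, so sums over it are exchangeable whatever the kernel.\<close>

definition inj_tuples :: "nat \<Rightarrow> nat \<Rightarrow> (nat \<Rightarrow> nat) set" where
  "inj_tuples d n = {i. i \<in> {1..d} \<rightarrow>\<^sub>E {1..n} \<and> inj_on i {1..d}}"

lemma inj_tuples_subset: "inj_tuples d n \<subseteq> {1..d} \<rightarrow>\<^sub>E {1..n}"
  by (auto simp: inj_tuples_def)

lemma finite_inj_tuples [simp, intro]: "finite (inj_tuples d n)"
  by (rule finite_subset[OF inj_tuples_subset]) (auto intro: finite_PiE)

lemma inc_tuples_subset_inj_tuples: "inc_tuples d n \<subseteq> inj_tuples d n"
  using inc_tuples_inj by (auto simp: inj_tuples_def inc_tuples_def)

lemma card_inj_tuples_le: "card (inj_tuples d n) \<le> n ^ d"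
proof -
  have "card (inj_tuples d n) \<le> card ({1..d} \<rightarrow>\<^sub>E {1..n})"
    by (intro card_mono inj_tuples_subset) (auto intro: finite_PiE)
  then show ?thesis by (simp add: card_PiE)
qed

lemma card_inj_tuples_pos:
  assumes "d \<le> n"
  shows "card (inj_tuples d n) > 0"
proof -
  have "(\<lambda>k\<in>{1..d}. k) \<in> inj_tuples d n"
    using assms by (auto simp: inj_tuples_def inj_on_def)
  then show ?thesis by (auto simp: card_gt_0_iff)
qed

text \<open>The complements of \<open>{1..d}\<close> and of the range of \<open>i\<close> in
  \<open>{1..k}\<close> have the same size; any bijection between them completes
  \<open>i\<close>.\<close>

lemma permutation_extending:
  assumes i: "i \<in> inj_tuples d k" and "d \<le> k"
  obtains \<pi> where "\<pi> permutes {1..k}" "\<And>j. j \<in> {1..d} \<Longrightarrow> \<pi> j = i j"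
proof -
  have inj: "inj_on i {1..d}" and im: "i ` {1..d} \<subseteq> {1..k}"
    using i by (auto simp: inj_tuples_def)
  have "card ({1..k} - i ` {1..d}) = card ({1..k} - {1..d})"
    using im assms(2) inj by (simp add: card_Diff_subset card_image)
  then obtain b where b: "bij_betw b ({1..k} - {1..d}) ({1..k} - i ` {1..d})"
    by (metis finite_Diff finite_atLeastAtMost finite_same_card_bij)
  define \<pi> where "\<pi> j = (if j \<in> {1..d} then i j else if j \<in> {1..k} then b j else j)" for j
  have "bij_betw \<pi> ({1..d} \<union> ({1..k} - {1..d})) (i ` {1..d} \<union> ({1..k} - i ` {1..d}))"
  proof (rule bij_betw_combine)
    have "bij_betw i {1..d} (i ` {1..d})" using inj by (simp add: bij_betw_def)
    then show "bij_betw \<pi> {1..d} (i ` {1..d})"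
      by (rule bij_betw_cong[THEN iffD1, rotated]) (simp add: \<pi>_def)
    show "bij_betw \<pi> ({1..k} - {1..d}) ({1..k} - i ` {1..d})"
      using b by (rule bij_betw_cong[THEN iffD1, rotated]) (simp add: \<pi>_def)
  qed auto
  moreover have "{1..d} \<union> ({1..k} - {1..d}) = {1..k}" using assms(2) by auto
  moreover have "i ` {1..d} \<union> ({1..k} - i ` {1..d}) = {1..k}" using im by auto
  ultimately have "bij_betw \<pi> {1..k} {1..k}" by simp
  then have "\<pi> permutes {1..k}"
    by (rule bij_imp_permutes) (use assms(2) in \<open>auto simp: \<pi>_def\<close>)
  then show ?thesis using that by (simp add: \<pi>_def)
qed

lemma sum_inj_tuples_permute:
  assumes \<pi>: "\<pi> permutes {1..n}"
  shows "(\<Sum>i\<in>inj_tuples d n. g (\<lambda>k\<in>{1..d}. x (\<pi> (i k)))) = (\<Sum>i\<in>inj_tuples d n. g (\<lambda>k\<in>{1..d}. x (i k)))"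
proof (rule sum.reindex_bij_witness[where i="\<lambda>i. \<lambda>k\<in>{1..d}. inv \<pi> (i k)" and j="\<lambda>i. \<lambda>k\<in>{1..d}. \<pi> (i k)"])
  have comp: "(\<lambda>k\<in>{1..d}. \<rho> (i k)) \<in> inj_tuples d n" if "i \<in> inj_tuples d n" "\<rho> permutes {1..n}" for i \<rho>
  proof -
    have "inj_on (\<lambda>k. \<rho> (i k)) {1..d}"
      using that comp_inj_on[of i "{1..d}" \<rho>] permutes_inj_on[OF that(2)]
      by (simp add: inj_tuples_def comp_def)
    moreover have "\<rho> (i k) \<in> {1..n}" if "k \<in> {1..d}" for k
      using \<open>i \<in> inj_tuples d n\<close> that permutes_in_image[OF \<open>\<rho> permutes {1..n}\<close>]
      unfolding inj_tuples_def by blast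
    ultimately show ?thesis by (simp add: inj_tuples_def inj_on_restrict_eq)
  qed
  fix i assume i: "i \<in> inj_tuples d n"
  show "(\<lambda>k\<in>{1..d}. \<pi> (i k)) \<in> inj_tuples d n" "(\<lambda>k\<in>{1..d}. inv \<pi> (i k)) \<in> inj_tuples d n"
    using comp[OF i] \<pi> permutes_inv by auto
  have ext: "i k = undefined" if "k \<notin> {1..d}" for k
    using i that by (auto simp: inj_tuples_def PiE_iff extensional_def)
  show "(\<lambda>k\<in>{1..d}. inv \<pi> ((\<lambda>k\<in>{1..d}. \<pi> (i k)) k)) = i"
    using ext permutes_inverses(2)[OF \<pi>] by (auto simp: fun_eq_iff)
  show "(\<lambda>k\<in>{1..d}. \<pi> ((\<lambda>k\<in>{1..d}. inv \<pi> (i k)) k)) = i"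
    using ext permutes_inverses(1)[OF \<pi>] by (auto simp: fun_eq_iff)
  show "g (\<lambda>k\<in>{1..d}. x ((\<lambda>k\<in>{1..d}. \<pi> (i k)) k)) = g (\<lambda>k\<in>{1..d}. x (\<pi> (i k)))"
    by (simp cong: restrict_cong)
qed

context iid_sequence
begin

text \<open>Formulated for functionals of the whole sequence, because the event in the maximal
  inequality involves indices beyond the permuted ones.\<close>

lemma integral_permute:
  fixes F :: "(nat \<Rightarrow> 's) \<Rightarrow> real"
  assumes F: "F \<in> borel_measurable (Pi\<^sub>M UNIV (\<lambda>_. S))" and \<pi>: "inj \<pi>"
  shows "(\<integral>\<omega>. F (\<lambda>n. X (\<pi> n) \<omega>) \<partial>M) = (\<integral>\<omega>. F (\<lambda>n. X n \<omega>) \<partial>M)"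
proof -
  have 1: "(\<lambda>\<omega> n. X (\<rho> n) \<omega>) \<in> M \<rightarrow>\<^sub>M Pi\<^sub>M UNIV (\<lambda>_. S)" for \<rho>
    using restrict_X_measurable[where A=UNIV and i=\<rho>] unfolding restrict_UNIV .
  have "(\<integral>\<omega>. F (\<lambda>n. X (\<rho> n) \<omega>) \<partial>M) = (\<integral>x. F x \<partial>Pi\<^sub>M UNIV (\<lambda>_. distr M S (X 0)))" if "inj \<rho>" for \<rho>
    using integral_distr[OF 1 F, of \<rho>] distr_restrict[OF that] unfolding restrict_UNIV by simp
  from this[OF \<pi>] this[of "\<lambda>n. n"] show ?thesis by simp
qed

text \<open>
  The averages over all injective tuples form a reverse martingale; the proof is Doob's maximal
  inequality for it, with conditional expectations replaced by exchangeability: on the event that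
  \<open>k\<close> is the last index at which the average is large, an event invariant under permutations of
  \<open>{1..k}\<close>, the average may be replaced by \<open>g (X\<^sub>1, \<dots>, X\<^sub>d)\<close>.
\<close>

lemma maximal_inequality_finite:
  fixes g :: "(nat \<Rightarrow> 's) \<Rightarrow> real"
  assumes g [measurable]: "g \<in> borel_measurable (Pi\<^sub>M {1..d} (\<lambda>_. S))" and nonneg: "\<And>y. g y \<ge> 0"
    and int: "integrable M (\<lambda>\<omega>. g (tup d (\<lambda>k. k) \<omega>))" and l: "l > 0"
  shows "prob {\<omega> \<in> space M. \<exists>n\<in>{d..N}. l * real (card (inj_tuples d n)) \<le> (\<Sum>i\<in>inj_tuples d n. g (tup d i \<omega>))}
    \<le> (\<integral>\<omega>. g (tup d (\<lambda>k. k) \<omega>) \<partial>M) / l"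
proof -
  define c where "c n = real (card (inj_tuples d n))" for n
  have c: "c n > 0" if "n \<ge> d" for n using card_inj_tuples_pos[OF that] by (simp add: c_def)
  define G :: "nat \<Rightarrow> (nat \<Rightarrow> 's) \<Rightarrow> real" where "G n x = (\<Sum>i\<in>inj_tuples d n. g (\<lambda>k\<in>{1..d}. x (i k)))" for n x
  have [measurable]: "(\<lambda>x. g (\<lambda>k\<in>{1..d}. x (i k))) \<in> borel_measurable (Pi\<^sub>M UNIV (\<lambda>_. S))" for i
    by (rule measurable_compose[OF _ g], rule measurable_restrict) simp
  have [measurable]: "G n \<in> borel_measurable (Pi\<^sub>M UNIV (\<lambda>_. S))" for n
    unfolding G_def[abs_def] by measurable
  \<comment> \<open>The last index is taken rather than the first: sums \<open>G n\<close> with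
    \<open>n \<ge> k\<close> are invariant under permutations of \<open>{1..k}\<close>, while
    earlier ones need not be.\<close>
  define E where "E k x \<longleftrightarrow> l * c k \<le> G k x \<and> (\<forall>m\<in>{Suc k..N}. G m x < l * c m)" for k x
  have E [measurable]: "Measurable.pred (Pi\<^sub>M UNIV (\<lambda>_. S)) (E k)" for k
    unfolding E_def[abs_def] by measurable
  have Xm [measurable]: "(\<lambda>\<omega> n. X n \<omega>) \<in> M \<rightarrow>\<^sub>M Pi\<^sub>M UNIV (\<lambda>_. S)"
    using restrict_X_measurable[where A=UNIV and i="\<lambda>n. n"] unfolding restrict_UNIV .
  let ?X = "\<lambda>\<omega> n. X n \<omega>"
  let ?g = "\<lambda>i \<omega>. g (tup d i \<omega>)"
  define A where "A k = {\<omega> \<in> space M. E k (?X \<omega>)}" for k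
  have A [measurable]: "A k \<in> sets M" for k
    unfolding A_def by (rule predE[OF measurable_compose[OF Xm E]])
  have int_i: "integrable M (\<lambda>\<omega>. ?g i \<omega> * indicator (A k) \<omega>)" if "i \<in> inj_tuples d n" for i k n
  proof -
    have "integrable M (?g i)"
      using that int integrable_tup[OF g, of i] unfolding inj_tuples_def by blast
    then show ?thesis by (intro integrable_real_mult_indicator) auto
  qed
  have exch: "(\<integral>\<omega>. ?g i \<omega> * indicator (A k) \<omega> \<partial>M) = (\<integral>\<omega>. ?g (\<lambda>k. k) \<omega> * indicator (A k) \<omega> \<partial>M)"
    if i: "i \<in> inj_tuples d k" and dk: "d \<le> k" for i k
  proof -
    obtain \<pi> where \<pi>: "\<pi> permutes {1..k}" "\<And>j. j \<in> {1..d} \<Longrightarrow> \<pi> j = i j"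
      using permutation_extending[OF i dk] by blast
    define F where "F x = g (\<lambda>k\<in>{1..d}. x k) * (if E k x then 1 else 0)" for x
    have F: "F \<in> borel_measurable (Pi\<^sub>M UNIV (\<lambda>_. S))" unfolding F_def[abs_def] by measurable
    have inv: "G n (\<lambda>n. x (\<pi> n)) = G n x" if "n \<ge> k" for n x
    proof -
      have "\<pi> permutes {1..n}" using \<pi>(1) by (rule permutes_subset) (use that in auto)
      then show ?thesis unfolding G_def by (rule sum_inj_tuples_permute)
    qed
    have "E k (\<lambda>n. x (\<pi> n)) = E k x" for x unfolding E_def using inv by auto
    then have "E k (\<lambda>n. X (\<pi> n) \<omega>) = E k (?X \<omega>)" for \<omega> .
    moreover have "(\<lambda>j\<in>{1..d}. X (\<pi> j) \<omega>) = tup d i \<omega>" for \<omega>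
      using \<pi>(2) by (auto simp: tup_def)
    ultimately have "F (\<lambda>n. X (\<pi> n) \<omega>) = ?g i \<omega> * (if E k (?X \<omega>) then 1 else 0)" for \<omega>
      by (simp add: F_def)
    moreover have "F (?X \<omega>) = ?g (\<lambda>k. k) \<omega> * (if E k (?X \<omega>) then 1 else 0)" for \<omega>
      by (simp add: F_def tup_def)
    ultimately have "(\<integral>\<omega>. ?g i \<omega> * (if E k (?X \<omega>) then 1 else 0) \<partial>M) =
        (\<integral>\<omega>. ?g (\<lambda>k. k) \<omega> * (if E k (?X \<omega>) then 1 else 0) \<partial>M)"
      using integral_permute[OF F permutes_inj[OF \<pi>(1)]] by simp
    moreover have "(\<integral>\<omega>. h \<omega> * (if E k (?X \<omega>) then 1 else 0) \<partial>M) = (\<integral>\<omega>. h \<omega> * indicator (A k) \<omega> \<partial>M)" for h :: "'w \<Rightarrow> real"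
      by (intro Bochner_Integration.integral_cong) (auto simp: A_def indicator_def)
    ultimately show ?thesis by simp
  qed
  have bound: "l * prob (A k) \<le> (\<integral>\<omega>. ?g (\<lambda>k. k) \<omega> * indicator (A k) \<omega> \<partial>M)" if dk: "d \<le> k" for k
  proof -
    \<comment> \<open>Multiplied by the number of tuples, so that each of the \<open>c k\<close>
      summands can be replaced by the one at (1, ..., d).\<close>
    have "c k * (l * prob (A k)) = (\<integral>\<omega>. l * c k * indicator (A k) \<omega> \<partial>M)"
      using A[of k] sets.sets_into_space[OF A[of k]] by (simp add: Int_absorb2 mult_ac)
    also have "\<dots> \<le> (\<integral>\<omega>. (\<Sum>i\<in>inj_tuples d k. ?g i \<omega> * indicator (A k) \<omega>) \<partial>M)"
    proof (rule integral_mono)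
      show "integrable M (\<lambda>\<omega>. \<Sum>i\<in>inj_tuples d k. ?g i \<omega> * indicator (A k) \<omega>)"
        by (intro Bochner_Integration.integrable_sum int_i)
      show "l * c k * indicator (A k) \<omega> \<le> (\<Sum>i\<in>inj_tuples d k. ?g i \<omega> * indicator (A k) \<omega>)" for \<omega>
        by (auto simp: indicator_def A_def E_def G_def tup_def)
    qed (simp add: integrable_real_mult_indicator less_top[symmetric])
    also have "\<dots> = (\<Sum>i\<in>inj_tuples d k. \<integral>\<omega>. ?g i \<omega> * indicator (A k) \<omega> \<partial>M)"
      by (intro Bochner_Integration.integral_sum int_i)
    also have "\<dots> = c k * (\<integral>\<omega>. ?g (\<lambda>k. k) \<omega> * indicator (A k) \<omega> \<partial>M)"
      using exch[OF _ dk] by (simp add: c_def)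
    finally show ?thesis using c[OF dk] by simp
  qed
  have disj: "disjoint_family_on A {d..N}"
  unfolding disjoint_family_on_def
  proof (intro ballI impI)
    fix m n assume mn: "m \<in> {d..N}" "n \<in> {d..N}" "m \<noteq> n"
    show "A m \<inter> A n = {}"
      using mn unfolding A_def E_def by (cases "m < n") (force simp: not_le[symmetric])+
  qed
  have eq: "{\<omega> \<in> space M. \<exists>n\<in>{d..N}. l * c n \<le> (\<Sum>i\<in>inj_tuples d n. ?g i \<omega>)} = (\<Union>k\<in>{d..N}. A k)"
  proof (intro equalityI subsetI)
    fix \<omega> assume "\<omega> \<in> {\<omega> \<in> space M. \<exists>n\<in>{d..N}. l * c n \<le> (\<Sum>i\<in>inj_tuples d n. ?g i \<omega>)}"
    then have \<omega>: "\<omega> \<in> space M" "\<exists>n\<in>{d..N}. l * c n \<le> G n (?X \<omega>)" by (auto simp: G_def tup_def)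
    define K where "K = {n \<in> {d..N}. l * c n \<le> G n (?X \<omega>)}"
    have K: "finite K" "K \<noteq> {}" using \<omega> by (auto simp: K_def)
    have "Max K \<in> K" using K by (rule Max_in)
    moreover have "G m (?X \<omega>) < l * c m" if "m \<in> {Suc (Max K)..N}" for m
    proof (rule ccontr)
      assume "\<not> ?thesis"
      then have "m \<in> K" using that \<open>Max K \<in> K\<close> by (auto simp: K_def)
      then show False using Max_ge[OF K(1)] that by fastforce
    qed
    ultimately show "\<omega> \<in> (\<Union>k\<in>{d..N}. A k)" using \<omega>(1) by (auto simp: A_def E_def K_def)
  qed (auto simp: A_def E_def G_def tup_def)
  have "l * prob (\<Union>k\<in>{d..N}. A k) = (\<Sum>k\<in>{d..N}. l * prob (A k))"
    using disj by (subst finite_measure_finite_Union) (auto simp: sum_distrib_left)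
  also have "\<dots> \<le> (\<Sum>k\<in>{d..N}. \<integral>\<omega>. ?g (\<lambda>k. k) \<omega> * indicator (A k) \<omega> \<partial>M)"
    by (intro sum_mono bound) auto
  also have "\<dots> = (\<integral>\<omega>. (\<Sum>k\<in>{d..N}. ?g (\<lambda>k. k) \<omega> * indicator (A k) \<omega>) \<partial>M)"
    using int by (intro Bochner_Integration.integral_sum[symmetric] integrable_real_mult_indicator) auto
  also have "\<dots> \<le> (\<integral>\<omega>. ?g (\<lambda>k. k) \<omega> \<partial>M)"
  proof (rule integral_mono)
    show "integrable M (\<lambda>\<omega>. \<Sum>k\<in>{d..N}. ?g (\<lambda>k. k) \<omega> * indicator (A k) \<omega>)"
      using int by (intro Bochner_Integration.integrable_sum integrable_real_mult_indicator) auto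
    show "(\<Sum>k\<in>{d..N}. ?g (\<lambda>k. k) \<omega> * indicator (A k) \<omega>) \<le> ?g (\<lambda>k. k) \<omega>" for \<omega>
    proof -
      have "(\<Sum>k\<in>{d..N}. indicator (A k) \<omega>) = (indicator (\<Union>k\<in>{d..N}. A k) \<omega> :: real)"
        using disj by (intro indicator_UN_disjoint[symmetric]) auto
      then have "(\<Sum>k\<in>{d..N}. ?g (\<lambda>k. k) \<omega> * indicator (A k) \<omega>) = ?g (\<lambda>k. k) \<omega> * indicator (\<Union>k\<in>{d..N}. A k) \<omega>"
        by (simp add: sum_distrib_left[symmetric])
      also have "\<dots> \<le> ?g (\<lambda>k. k) \<omega>" using nonneg by (simp add: indicator_def)
      finally show ?thesis .
    qed
  qed (rule int)
  finally show ?thesis using l unfolding c_def[symmetric] eq by (simp add: field_simps)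
qed

text \<open>The index bound \<open>N\<close> is removed by continuity from below. As
  \<open>g\<close> is nonnegative, the sum over increasing tuples is at most the one over injective
  tuples, and there are at most n^d of the latter.\<close>

lemma maximal_inequality:
  fixes g :: "(nat \<Rightarrow> 's) \<Rightarrow> real"
  assumes g [measurable]: "g \<in> borel_measurable (Pi\<^sub>M {1..d} (\<lambda>_. S))" and nonneg: "\<And>y. g y \<ge> 0"
    and int: "integrable M (\<lambda>\<omega>. g (tup d (\<lambda>k. k) \<omega>))" and l: "l > 0"
  shows "prob {\<omega> \<in> space M. \<exists>n\<ge>d. l * real n ^ d \<le> (\<Sum>i\<in>inc_tuples d n. g (tup d i \<omega>))}
    \<le> (\<integral>\<omega>. g (tup d (\<lambda>k. k) \<omega>) \<partial>M) / l"
proof -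
  define A where "A N = {\<omega> \<in> space M. \<exists>n\<in>{d..N}. l * real (card (inj_tuples d n)) \<le> (\<Sum>i\<in>inj_tuples d n. g (tup d i \<omega>))}" for N
  have [measurable]: "A N \<in> sets M" for N unfolding A_def by measurable
  have "incseq A" by (rule incseq_SucI) (auto simp: A_def)
  then have "(\<lambda>N. prob (A N)) \<longlonglongrightarrow> prob (\<Union>N. A N)"
    by (intro finite_Lim_measure_incseq) auto
  moreover have "prob (A N) \<le> (\<integral>\<omega>. g (tup d (\<lambda>k. k) \<omega>) \<partial>M) / l" for N
    unfolding A_def by (rule maximal_inequality_finite[OF g nonneg int l])
  ultimately have "prob (\<Union>N. A N) \<le> (\<integral>\<omega>. g (tup d (\<lambda>k. k) \<omega>) \<partial>M) / l"
    by (intro LIMSEQ_le_const2) auto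
  moreover have "prob {\<omega> \<in> space M. \<exists>n\<ge>d. l * real n ^ d \<le> (\<Sum>i\<in>inc_tuples d n. g (tup d i \<omega>))} \<le> prob (\<Union>N. A N)"
  proof (rule finite_measure_mono)
    show "{\<omega> \<in> space M. \<exists>n\<ge>d. l * real n ^ d \<le> (\<Sum>i\<in>inc_tuples d n. g (tup d i \<omega>))} \<subseteq> (\<Union>N. A N)"
    proof
      fix \<omega> assume "\<omega> \<in> {\<omega> \<in> space M. \<exists>n\<ge>d. l * real n ^ d \<le> (\<Sum>i\<in>inc_tuples d n. g (tup d i \<omega>))}"
      then obtain n where n: "\<omega> \<in> space M" "n \<ge> d" "l * real n ^ d \<le> (\<Sum>i\<in>inc_tuples d n. g (tup d i \<omega>))" by blast
      have "l * real (card (inj_tuples d n)) \<le> l * real n ^ d"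
        using l card_inj_tuples_le[of d n] by (intro mult_left_mono) (auto simp flip: of_nat_power)
      also note n(3)
      also have "(\<Sum>i\<in>inc_tuples d n. g (tup d i \<omega>)) \<le> (\<Sum>i\<in>inj_tuples d n. g (tup d i \<omega>))"
        using nonneg by (intro sum_mono2 inc_tuples_subset_inj_tuples) auto
      finally have "\<omega> \<in> A n" using n by (auto simp: A_def)
      then show "\<omega> \<in> (\<Union>N. A N)" by blast
    qed
  qed measurable
  ultimately show ?thesis by simp
qed

end

section \<open>Bounded kernels and truncation\<close>

lemma inc_tuples_mono: "m \<le> n \<Longrightarrow> inc_tuples d m \<subseteq> inc_tuples d n"
  by (fastforce simp: inc_tuples_def PiE_iff)

lemma binomial_diff_le:
  assumes "m \<le> n" "d \<ge> 1"
  shows "real (n choose d) - real (m choose d) \<le> real (n - m) * real n ^ (d - 1)"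
  using assms(1)
proof (induction n rule: dec_induct)
  case (step n)
  obtain e where d: "d = Suc e" using assms(2) by (cases d) auto
  have "real (Suc n choose d) - real (m choose d) = real (n choose e) + (real (n choose d) - real (m choose d))"
    by (simp add: d)
  also have "\<dots> \<le> real (Suc n) ^ (d - 1) + real (n - m) * real (Suc n) ^ (d - 1)"
  proof (rule add_mono)
    have "real (n choose e) \<le> real n ^ e" by (rule binomial_le_power)
    also have "\<dots> \<le> real (Suc n) ^ e" by (rule power_mono) auto
    finally show "real (n choose e) \<le> real (Suc n) ^ (d - 1)" by (simp add: d)
    have "real (n - m) * real n ^ (d - 1) \<le> real (n - m) * real (Suc n) ^ (d - 1)"
      by (intro mult_left_mono power_mono) auto
    then show "real (n choose d) - real (m choose d) \<le> real (n - m) * real (Suc n) ^ (d - 1)"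
      using step.IH by linarith
  qed
  also have "\<dots> = real (Suc n - m) * real (Suc n) ^ (d - 1)"
    using step.hyps by (simp add: Suc_diff_le algebra_simps)
  finally show ?case .
qed simp

lemma binomial_asymptotic: "(\<lambda>n. real (n choose d) / real n ^ d) \<longlonglongrightarrow> 1 / fact d"
proof -
  obtain C where C: "\<And>n. n \<ge> 1 \<Longrightarrow> \<bar>real (n choose d) / real n ^ d - (real n / real n) ^ d / fact d\<bar> \<le> C / real n"
    using binomial_quotient_approx[of 0 d] by (metis diff_zero le_refl zero_le)
  have "(\<lambda>n. C / real n) \<longlonglongrightarrow> 0" by real_asymp
  then have "(\<lambda>n. real (n choose d) / real n ^ d - 1 / fact d) \<longlonglongrightarrow> 0"
    by (rule Lim_null_comparison[rotated])
      (use C in \<open>auto intro!: eventually_mono[OF eventually_ge_at_top[of 1]]\<close>)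
  then show ?thesis by (simp add: LIM_zero_iff)
qed

text \<open>Monotone convergence makes the sum of the \<open>Y n x\<close> finite almost surely,
  hence its terms tend to 0.\<close>

lemma AE_tendsto_0_if_summable_integral:
  fixes Y :: "nat \<Rightarrow> 'a \<Rightarrow> real"
  assumes int: "\<And>n. integrable M (Y n)" and nonneg: "\<And>n x. Y n x \<ge> 0"
    and summable: "summable (\<lambda>n. \<integral>x. Y n x \<partial>M)"
  shows "AE x in M. (\<lambda>n. Y n x) \<longlonglongrightarrow> 0"
proof -
  have [measurable]: "Y n \<in> borel_measurable M" for n using int by auto
  have "(\<integral>\<^sup>+x. (\<Sum>n. ennreal (Y n x)) \<partial>M) = (\<Sum>n. \<integral>\<^sup>+x. ennreal (Y n x) \<partial>M)"
    by (rule nn_integral_suminf) measurable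
  also have "\<dots> = (\<Sum>n. ennreal (\<integral>x. Y n x \<partial>M))"
    using int nonneg by (simp add: nn_integral_eq_integral)
  also have "\<dots> = ennreal (\<Sum>n. \<integral>x. Y n x \<partial>M)"
    using summable nonneg by (intro suminf_ennreal2) auto
  finally have "(\<integral>\<^sup>+x. (\<Sum>n. ennreal (Y n x)) \<partial>M) \<noteq> \<infinity>" by simp
  then have "AE x in M. (\<Sum>n. ennreal (Y n x)) \<noteq> \<infinity>"
    by (rule nn_integral_PInf_AE[rotated]) measurable
  then show ?thesis
  proof eventually_elim
    case (elim x)
    then have "summable (\<lambda>n. Y n x)" 
      by (intro summable_suminf_not_top) (use nonneg in simp_all)
    then show ?case by (rule summable_LIMSEQ_zero)
  qed
qed

lemma (in L2_kernel) ustat_eq_mean_plus: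
  "ustat d f X n \<omega> = \<mu> * real (n choose d) + (\<Sum>i\<in>inc_tuples d n. resid d f {} (tup d i \<omega>))"
  by (simp add: ustat_eq resid_def tup_def sum_subtractf card_inc_tuples)

text \<open>The variance bound gives normalized second moments of order 1/n, summable only along the
  squares. From the last square up to \<open>n\<close> at most 2 sqrt(n) n^(d-1) tuples are added,
  and as the kernel is bounded their contribution is negligible against n^d.\<close>

lemma (in L2_kernel) bounded_strong_law:
  assumes bounded: "\<And>y. \<bar>f y\<bar> \<le> K"
  shows "AE \<omega> in M. (\<lambda>n. (ustat d f X n \<omega> - \<mu> * real (n choose d)) / real n ^ d) \<longlonglongrightarrow> 0"
proof -
  define V where "V n \<omega> = (\<Sum>i\<in>inc_tuples d n. resid d f {} (tup d i \<omega>))" for n \<omega>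
  define Y where "Y m \<omega> = (V (m\<^sup>2) \<omega> / real (m\<^sup>2) ^ d)\<^sup>2" for m \<omega>
  obtain C where C: "C \<ge> 0" "\<And>n. (\<integral>\<omega>. (V n \<omega>)\<^sup>2 \<partial>M) * real n \<le> C * real n ^ (2 * d)"
    using expectation_square_ustat_le unfolding V_def by blast
  have intV: "integrable M (\<lambda>\<omega>. (V n \<omega>)\<^sup>2)" for n
    unfolding V_def
  proof (rule integrable_square_sum)
    fix i assume i: "i \<in> inc_tuples d n"
    have m: "(\<lambda>y. (resid d f {} y)\<^sup>2) \<in> borel_measurable (Pi\<^sub>M {1..d} (\<lambda>_. S))"
      using resid_measurable[of "{}"] by auto
    show "integrable M (\<lambda>\<omega>. (resid d f {} (tup d i \<omega>))\<^sup>2)"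
      using integrable_tup[OF m inc_tuples_inj[OF i]] resid_square_integrable[of "{}"] by blast
    show "(\<lambda>\<omega>. resid d f {} (tup d i \<omega>)) \<in> borel_measurable M"
      by (rule measurable_compose[OF tup_measurable resid_measurable]) simp
  qed simp
  have intY: "integrable M (Y m)" for m
    unfolding Y_def[abs_def] power_divide using intV by simp
  have "AE \<omega> in M. (\<lambda>m. Y m \<omega>) \<longlonglongrightarrow> 0"
  proof (rule AE_tendsto_0_if_summable_integral[OF intY])
    show "Y m \<omega> \<ge> 0" for m \<omega> by (simp add: Y_def)
    show "summable (\<lambda>m. \<integral>\<omega>. Y m \<omega> \<partial>M)"
    proof (rule summable_comparison_test_ev)
      show "summable (\<lambda>m. C * (1 / real m ^ 2))"
        using inverse_power_summable[of 2, where 'a=real] by (intro summable_mult) (simp add: inverse_eq_divide)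
      show "\<forall>\<^sub>F m in sequentially. norm (\<integral>\<omega>. Y m \<omega> \<partial>M) \<le> C * (1 / real m ^ 2)"
        using eventually_gt_at_top[of 0]
      proof eventually_elim
        case (elim m)
        then have m: "real m > 0" by simp
        have "(\<integral>\<omega>. Y m \<omega> \<partial>M) = (\<integral>\<omega>. (V (m\<^sup>2) \<omega>)\<^sup>2 \<partial>M) / real (m\<^sup>2) ^ (2 * d)"
          unfolding Y_def power_divide by (simp add: power_mult[symmetric] mult.commute)
        also have "\<dots> \<le> (C * real (m\<^sup>2) ^ (2 * d) / real (m\<^sup>2)) / real (m\<^sup>2) ^ (2 * d)"
          using C(2)[of "m\<^sup>2"] m by (intro divide_right_mono) (auto simp: pos_le_divide_eq)
        also have "\<dots> = C * (1 / real m ^ 2)" using m by simp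
        finally have "(\<integral>\<omega>. Y m \<omega> \<partial>M) \<le> C * (1 / real m ^ 2)" .
        moreover have "(\<integral>\<omega>. Y m \<omega> \<partial>M) \<ge> 0" by (simp add: Y_def)
        ultimately show ?case by simp
      qed
    qed
  qed
  then show ?thesis
  proof eventually_elim
    case (elim \<omega>)
    \<comment> \<open>\<open>(r n)\<^sup>2\<close> is the largest square not exceeding
      \<open>n\<close>.\<close>
    define r where "r n = nat \<lfloor>sqrt (real n)\<rfloor>" for n :: nat
    have r: "(r n)\<^sup>2 \<le> n" "real (n - (r n)\<^sup>2) \<le> 2 * sqrt (real n)" for n
    proof -
      have "real (r n) = real_of_int \<lfloor>sqrt (real n)\<rfloor>" by (simp add: r_def)
      then have 1: "real (r n) \<le> sqrt (real n)" "sqrt (real n) < real (r n) + 1" by linarith+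
      have "(real (r n))\<^sup>2 \<le> (sqrt (real n))\<^sup>2" using 1 by (intro power_mono) auto
      then have "real ((r n)\<^sup>2) \<le> real n" by simp
      then show 2: "(r n)\<^sup>2 \<le> n" by (simp only: of_nat_le_iff)
      have "real n = (sqrt (real n))\<^sup>2" by simp
      have "real n - (real (r n))\<^sup>2 = (sqrt (real n) - real (r n)) * (sqrt (real n) + real (r n))"
        by (simp add: algebra_simps power2_eq_square)
      also have "\<dots> \<le> 1 * (sqrt (real n) + sqrt (real n))" using 1 by (intro mult_mono) auto
      finally show "real (n - (r n)\<^sup>2) \<le> 2 * sqrt (real n)" using 2 by (simp add: of_nat_diff)
    qed
    have r_top: "filterlim r at_top sequentially"
      unfolding r_def by real_asymp
    have K: "K \<ge> 0" using bounded[of undefined] by linarith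
    define L where "L = K + \<bar>\<mu>\<bar>"
    have res: "\<bar>resid d f {} y\<bar> \<le> L" for y
      unfolding resid_def L_def using bounded[of y] by simp
    have "(\<lambda>m. sqrt (Y m \<omega>)) \<longlonglongrightarrow> sqrt 0" by (intro tendsto_real_sqrt elim)
    then have "(\<lambda>m. \<bar>V (m\<^sup>2) \<omega> / real (m\<^sup>2) ^ d\<bar>) \<longlonglongrightarrow> 0" by (simp add: Y_def)
    then have sq: "(\<lambda>n. \<bar>V ((r n)\<^sup>2) \<omega> / real ((r n)\<^sup>2) ^ d\<bar>) \<longlonglongrightarrow> 0"
      using r_top by (rule filterlim_compose)
    have "(\<lambda>n. V n \<omega> / real n ^ d) \<longlonglongrightarrow> 0"
    proof (rule Lim_null_comparison)
      have "(\<lambda>n. L * (2 * sqrt (real n)) / real n) \<longlonglongrightarrow> 0" by real_asymp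
      from tendsto_add[OF sq this]
      show "(\<lambda>n. \<bar>V ((r n)\<^sup>2) \<omega> / real ((r n)\<^sup>2) ^ d\<bar> + L * (2 * sqrt (real n)) / real n) \<longlonglongrightarrow> 0" by simp
      have "\<forall>\<^sub>F n in sequentially. r n > 0"
        using r_top[unfolded filterlim_at_top, rule_format, of 1] by (rule eventually_mono) simp
      then show "\<forall>\<^sub>F n in sequentially. norm (V n \<omega> / real n ^ d) \<le>
          \<bar>V ((r n)\<^sup>2) \<omega> / real ((r n)\<^sup>2) ^ d\<bar> + L * (2 * sqrt (real n)) / real n"
      proof eventually_elim
        case (elim n)
        let ?m = "(r n)\<^sup>2"
        have m: "?m > 0" "?m \<le> n" using elim r(1)[of n] by simp_all
        have "V n \<omega> = V ?m \<omega> + (\<Sum>i\<in>inc_tuples d n - inc_tuples d ?m. resid d f {} (tup d i \<omega>))"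
          unfolding V_def using sum.subset_diff[OF inc_tuples_mono[OF m(2)] finite_inc_tuples]
          by (simp add: add.commute)
        then have "\<bar>V n \<omega>\<bar> \<le> \<bar>V ?m \<omega>\<bar> + \<bar>\<Sum>i\<in>inc_tuples d n - inc_tuples d ?m. resid d f {} (tup d i \<omega>)\<bar>"
          by simp
        also have "\<bar>\<Sum>i\<in>inc_tuples d n - inc_tuples d ?m. resid d f {} (tup d i \<omega>)\<bar> \<le>
            real (card (inc_tuples d n - inc_tuples d ?m)) * L"
          by (rule order_trans[OF sum_abs]) (intro sum_bounded_above res)
        also have "real (card (inc_tuples d n - inc_tuples d ?m)) * L \<le> 2 * sqrt (real n) * real n ^ (d - 1) * L"
        proof (rule mult_right_mono)
          show "L \<ge> 0" using K by (simp add: L_def)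
          have "real (card (inc_tuples d n - inc_tuples d ?m)) = real (n choose d) - real (?m choose d)"
            using inc_tuples_mono[OF m(2), of d] card_mono[OF finite_inc_tuples inc_tuples_mono[OF m(2), of d]]
            by (simp add: card_Diff_subset of_nat_diff flip: card_inc_tuples)
          also have "\<dots> \<le> real (n - ?m) * real n ^ (d - 1)"
            by (rule binomial_diff_le[OF m(2) d_pos])
          also have "\<dots> \<le> 2 * sqrt (real n) * real n ^ (d - 1)"
            by (intro mult_right_mono r) auto
          finally show "real (card (inc_tuples d n - inc_tuples d ?m)) \<le> 2 * sqrt (real n) * real n ^ (d - 1)" .
        qed
        finally have "\<bar>V n \<omega>\<bar> \<le> \<bar>V ?m \<omega>\<bar> + 2 * sqrt (real n) * real n ^ (d - 1) * L"
          by simp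
        then have "\<bar>V n \<omega>\<bar> / real n ^ d \<le> (\<bar>V ?m \<omega>\<bar> + 2 * sqrt (real n) * real n ^ (d - 1) * L) / real n ^ d"
          by (rule divide_right_mono) simp
        also have "\<dots> = \<bar>V ?m \<omega>\<bar> / real n ^ d + L * (2 * sqrt (real n)) / real n"
          using d_pos m by (cases d) (auto simp: add_divide_distrib)
        also have "\<bar>V ?m \<omega>\<bar> / real n ^ d \<le> \<bar>V ?m \<omega>\<bar> / real ?m ^ d"
        proof -
          have "real ?m \<le> real n" "0 < real ?m" using m by (simp_all only: of_nat_le_iff of_nat_0_less_iff)
          then have "real ?m ^ d \<le> real n ^ d" "0 < real n ^ d * real ?m ^ d"
            by (simp_all only: power_mono of_nat_0_le_iff zero_less_power mult_pos_pos less_le_trans)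
          then show ?thesis by (intro divide_left_mono) simp_all
        qed
        finally show ?case by (simp add: abs_divide)
      qed
    qed
    then show ?case by (simp add: ustat_eq_mean_plus V_def)
  qed
qed

context iid_sequence
begin

lemma ustat_measurable:
  assumes f: "f \<in> borel_measurable (Pi\<^sub>M {1..d} (\<lambda>_. S))"
  shows "ustat d f X n \<in> borel_measurable M"
proof -
  have "(\<lambda>\<omega>. f (tup d i \<omega>)) \<in> borel_measurable M" for i
    by (rule measurable_compose[OF tup_measurable f])
  then show ?thesis unfolding ustat_eq[abs_def] tup_def[symmetric] by simp
qed

lemma L2_kernel_truncated:
  fixes f :: "(nat \<Rightarrow> 's) \<Rightarrow> real"
  assumes "d \<ge> 1" and f [measurable]: "f \<in> borel_measurable (Pi\<^sub>M {1..d} (\<lambda>_. S))"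
  shows "L2_kernel M S X d (\<lambda>y. if \<bar>f y\<bar> \<le> K then f y else 0)"
proof -
  have m: "(\<lambda>y. if \<bar>f y\<bar> \<le> K then f y else 0) \<in> borel_measurable (Pi\<^sub>M {1..d} (\<lambda>_. S))"
    by measurable
  have "(\<lambda>\<omega>. if \<bar>f (tup d (\<lambda>k. k) \<omega>)\<bar> \<le> K then f (tup d (\<lambda>k. k) \<omega>) else 0) \<in> borel_measurable M"
    by (rule measurable_compose[OF tup_measurable m])
  moreover have "norm ((if \<bar>z\<bar> \<le> K then z else 0)\<^sup>2) \<le> K\<^sup>2" for z :: real
    using power_mono[of "\<bar>z\<bar>" K 2] by simp
  ultimately have "integrable M (\<lambda>\<omega>. (if \<bar>f (tup d (\<lambda>k. k) \<omega>)\<bar> \<le> K then f (tup d (\<lambda>k. k) \<omega>) else 0)\<^sup>2)"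
    by (intro integrable_const_bound[where B="K\<^sup>2"] AE_I2) auto
  then have "kernel_L2 M d (\<lambda>y. if \<bar>f y\<bar> \<le> K then f y else 0) X"
    using measurable_compose[OF tup_measurable m, of "\<lambda>k. k"]
    unfolding kernel_L2_def tup_def by (intro conjI)
  then show ?thesis using assms m by unfold_locales
qed

text \<open>The bounded part at truncation level K obeys the law already. The maximal inequality
  bounds the probability that the tail sum ever reaches e n^d by \<open>\<epsilon>K K / e\<close>,
  and this tends to 0 as K grows.\<close>

theorem strong_law_ustat:
  fixes f :: "(nat \<Rightarrow> 's) \<Rightarrow> real"
  assumes d: "d \<ge> 1" and f [measurable]: "f \<in> borel_measurable (Pi\<^sub>M {1..d} (\<lambda>_. S))"
    and L1: "kernel_L1 M d f X"
  shows "AE \<omega> in M. (\<lambda>n. ustat d f X n \<omega> / real n ^ d) \<longlonglongrightarrow> kernel_mean M d f X / fact d"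
proof -
  let ?\<mu> = "kernel_mean M d f X"
  have int: "integrable M (\<lambda>\<omega>. f (tup d (\<lambda>k. k) \<omega>))"
    using L1 by (simp add: kernel_L1_def tup_def)
  define fK where "fK K y = (if \<bar>f y\<bar> \<le> real K then f y else 0)" for K :: nat and y
  define gK where "gK K y = (if \<bar>f y\<bar> \<le> real K then 0 else \<bar>f y\<bar>)" for K :: nat and y
  have fK_m [measurable]: "fK K \<in> borel_measurable (Pi\<^sub>M {1..d} (\<lambda>_. S))" for K
    unfolding fK_def[abs_def] by measurable
  have gK_m [measurable]: "gK K \<in> borel_measurable (Pi\<^sub>M {1..d} (\<lambda>_. S))" for K
    unfolding gK_def[abs_def] by measurable
  have ftup_m: "(\<lambda>\<omega>. f (tup d (\<lambda>k. k) \<omega>)) \<in> borel_measurable M"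
    and gKtup_m: "(\<lambda>\<omega>. gK K (tup d (\<lambda>k. k) \<omega>)) \<in> borel_measurable M"
    and fKtup_m: "(\<lambda>\<omega>. fK K (tup d (\<lambda>k. k) \<omega>)) \<in> borel_measurable M" for K
    by (rule measurable_compose[OF tup_measurable]; measurable)+
  have gK_int: "integrable M (\<lambda>\<omega>. gK K (tup d (\<lambda>k. k) \<omega>))" for K
    by (rule Bochner_Integration.integrable_bound[OF int gKtup_m]) (simp add: gK_def)
  have fK_int: "integrable M (\<lambda>\<omega>. fK K (tup d (\<lambda>k. k) \<omega>))" for K
    by (rule Bochner_Integration.integrable_bound[OF int fKtup_m]) (simp add: fK_def)
  define \<epsilon>K where "\<epsilon>K K = (\<integral>\<omega>. gK K (tup d (\<lambda>k. k) \<omega>) \<partial>M)" for K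
  have \<epsilon>K0: "\<epsilon>K \<longlonglongrightarrow> 0"
  proof -
    have "(\<lambda>K. \<integral>\<omega>. gK K (tup d (\<lambda>k. k) \<omega>) \<partial>M) \<longlonglongrightarrow> (\<integral>\<omega>. 0 \<partial>M)"
    proof (rule integral_dominated_convergence[where w="\<lambda>\<omega>. \<bar>f (tup d (\<lambda>k. k) \<omega>)\<bar>"])
      show "AE \<omega> in M. (\<lambda>K. gK K (tup d (\<lambda>k. k) \<omega>)) \<longlonglongrightarrow> 0"
      proof (rule AE_I2)
        fix \<omega>
        have "\<forall>\<^sub>F K in sequentially. \<bar>f (tup d (\<lambda>k. k) \<omega>)\<bar> \<le> real K"
          by (metis eventually_ge_at_top eventually_mono nat_le_real_less real_nat_ceiling_ge order.trans of_nat_mono eventually_sequentially nat_ceiling_le_eq)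
        then have "\<forall>\<^sub>F K in sequentially. gK K (tup d (\<lambda>k. k) \<omega>) = 0"
          by eventually_elim (simp add: gK_def)
        then show "(\<lambda>K. gK K (tup d (\<lambda>k. k) \<omega>)) \<longlonglongrightarrow> 0"
          by (rule tendsto_eventually)
      qed
      show "integrable M (\<lambda>\<omega>. \<bar>f (tup d (\<lambda>k. k) \<omega>)\<bar>)" using int by (rule integrable_abs)
    qed (use gKtup_m in \<open>auto simp: gK_def\<close>)
    then show ?thesis by (simp add: \<epsilon>K_def[abs_def])
  qed
  define T where "T n \<omega> = (ustat d f X n \<omega> - ?\<mu> * real (n choose d)) / real n ^ d" for n \<omega>
  have T_m [measurable]: "T n \<in> borel_measurable M" for n
    unfolding T_def[abs_def] using ustat_measurable[OF f] by measurable
  \<comment> \<open>The factor 3 collects the fluctuation of the truncated statistic, the tail sum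
    and the change of the mean, each at most \<open>e\<close> relative to n^d.\<close>
  have null: "AE \<omega> in M. \<forall>\<^sub>F n in sequentially. \<bar>T n \<omega>\<bar> < 3 * e" if e: "e > 0" for e
  proof -
    define A where "A = {\<omega> \<in> space M. \<not> (\<forall>\<^sub>F n in sequentially. \<bar>T n \<omega>\<bar> < 3 * e)}"
    have A [measurable]: "A \<in> sets M" unfolding A_def by measurable
    define B where "B K = {\<omega> \<in> space M. \<exists>n\<ge>d. e * real n ^ d \<le> (\<Sum>i\<in>inc_tuples d n. gK K (tup d i \<omega>))}" for K
    have B [measurable]: "B K \<in> sets M" for K unfolding B_def by measurable
    have PB: "prob (B K) \<le> \<epsilon>K K / e" for K
      unfolding B_def \<epsilon>K_def by (rule maximal_inequality[OF gK_m _ gK_int e]) (simp add: gK_def)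
    \<comment> \<open>\<open>A\<close> does not depend on \<open>K\<close>, while the bound for
      \<open>B K\<close> tends to 0; hence \<open>A\<close> will be null.\<close>
    have AB: "prob A \<le> prob (B K)" if K: "\<epsilon>K K < e" for K
    proof (rule finite_measure_mono_AE)
      interpret K: L2_kernel M S X d "fK K"
        unfolding fK_def[abs_def] by (rule L2_kernel_truncated[OF d f])
      have "AE \<omega> in M. (\<lambda>n. (ustat d (fK K) X n \<omega> - K.\<mu> * real (n choose d)) / real n ^ d) \<longlonglongrightarrow> 0"
        by (rule K.bounded_strong_law[where K="real K"]) (simp add: fK_def)
      then show "AE \<omega> in M. \<omega> \<in> A \<longrightarrow> \<omega> \<in> B K"
        using AE_space
      proof eventually_elim
        case (elim \<omega>)
        show ?case
        proof (rule impI, rule ccontr)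
          assume \<omega>A: "\<omega> \<in> A" and \<omega>B: "\<omega> \<notin> B K"
          have "\<forall>\<^sub>F n in sequentially. \<bar>(ustat d (fK K) X n \<omega> - K.\<mu> * real (n choose d)) / real n ^ d\<bar> < e"
            using tendstoD[OF elim(1) e] by (simp add: dist_real_def)
          then have "\<forall>\<^sub>F n in sequentially. \<bar>T n \<omega>\<bar> < 3 * e"
            using eventually_ge_at_top[of "max d 1"]
          proof eventually_elim
            case (elim n)
            have n: "n \<ge> d" "real n ^ d > 0" using elim by auto
            have \<mu>diff: "\<bar>K.\<mu> - ?\<mu>\<bar> \<le> \<epsilon>K K"
            proof -
              have "K.\<mu> - ?\<mu> = (\<integral>\<omega>. fK K (tup d (\<lambda>k. k) \<omega>) - f (tup d (\<lambda>k. k) \<omega>) \<partial>M)"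
                using fK_int int by (simp add: kernel_mean_eq)
              also have "\<bar>\<dots>\<bar> \<le> (\<integral>\<omega>. \<bar>fK K (tup d (\<lambda>k. k) \<omega>) - f (tup d (\<lambda>k. k) \<omega>)\<bar> \<partial>M)"
                by (rule integral_abs_bound)
              also have "\<dots> = \<epsilon>K K" unfolding \<epsilon>K_def
                by (intro Bochner_Integration.integral_cong) (auto simp: fK_def gK_def)
              finally show ?thesis .
            qed
            have "\<bar>ustat d f X n \<omega> - ustat d (fK K) X n \<omega>\<bar> \<le> (\<Sum>i\<in>inc_tuples d n. gK K (tup d i \<omega>))"
            proof -
              have "ustat d f X n \<omega> - ustat d (fK K) X n \<omega> = (\<Sum>i\<in>inc_tuples d n. f (tup d i \<omega>) - fK K (tup d i \<omega>))"
                by (simp add: ustat_eq tup_def sum_subtractf)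
              also have "\<bar>\<dots>\<bar> \<le> (\<Sum>i\<in>inc_tuples d n. \<bar>f (tup d i \<omega>) - fK K (tup d i \<omega>)\<bar>)"
                by (rule sum_abs)
              also have "\<dots> = (\<Sum>i\<in>inc_tuples d n. gK K (tup d i \<omega>))"
                by (intro sum.cong) (auto simp: fK_def gK_def)
              finally show ?thesis .
            qed
            also have "\<dots> < e * real n ^ d" 
            proof -
              have "\<not> e * real n ^ d \<le> (\<Sum>i\<in>inc_tuples d n. gK K (tup d i \<omega>))"
                using \<omega>B \<open>\<omega> \<in> space M\<close> n(1) unfolding B_def by blast
              then show ?thesis by simp
            qed
            finally have 1: "\<bar>ustat d f X n \<omega> - ustat d (fK K) X n \<omega>\<bar> < e * real n ^ d" .
            have 2: "\<bar>ustat d (fK K) X n \<omega> - K.\<mu> * real (n choose d)\<bar> < e * real n ^ d"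
              using elim(1) n(2) by (simp add: abs_divide divide_less_eq)
            have "\<bar>K.\<mu> - ?\<mu>\<bar> * real (n choose d) \<le> e * real n ^ d"
              using \<mu>diff K e binomial_le_power[of n d] by (intro mult_mono) auto
            then have 3: "\<bar>K.\<mu> * real (n choose d) - ?\<mu> * real (n choose d)\<bar> \<le> e * real n ^ d"
              by (simp add: left_diff_distrib[symmetric] abs_mult)
            have "\<bar>ustat d f X n \<omega> - ?\<mu> * real (n choose d)\<bar> < 3 * e * real n ^ d"
              using 1 2 3 by linarith
            then show ?case using n(2) by (simp add: T_def abs_divide divide_less_eq)
          qed
          then show False using \<omega>A by (simp add: A_def)
        qed
      qed
    qed measurable
    have "prob A \<le> 0"
    proof (rule LIMSEQ_le_const)
      show "(\<lambda>K. \<epsilon>K K / e) \<longlonglongrightarrow> 0" using tendsto_divide[OF \<epsilon>K0 tendsto_const, of e] e by simp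
      have "\<forall>\<^sub>F K in sequentially. \<epsilon>K K < e" using order_tendstoD(2)[OF \<epsilon>K0 e] .
      then obtain N where "\<And>K. K \<ge> N \<Longrightarrow> \<epsilon>K K < e" unfolding eventually_sequentially by blast
      then show "\<exists>N. \<forall>K\<ge>N. prob A \<le> \<epsilon>K K / e" using AB PB order_trans by blast
    qed
    then have "prob A = 0" using measure_nonneg[of M A] by linarith
    then have "A \<in> null_sets M" by (simp add: null_sets_def emeasure_eq_measure)
    from AE_not_in[OF this] AE_space show ?thesis
      by eventually_elim (simp add: A_def)
  qed
  have "AE \<omega> in M. \<forall>j. \<forall>\<^sub>F n in sequentially. \<bar>T n \<omega>\<bar> < 3 * (1 / real (Suc j))"
    unfolding AE_all_countable by (intro allI null) simp
  then show ?thesis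
  proof eventually_elim
    case (elim \<omega>)
    have "(\<lambda>n. T n \<omega>) \<longlonglongrightarrow> 0"
    proof (rule tendstoI)
      fix e :: real assume "e > 0"
      then obtain j where j: "inverse (real (Suc j)) < e / 3" using reals_Archimedean[of "e / 3"] by auto
      show "\<forall>\<^sub>F n in sequentially. dist (T n \<omega>) 0 < e"
        using elim[rule_format, of j]
      proof eventually_elim
        case (elim n)
        then show ?case using j unfolding inverse_eq_divide dist_real_def by linarith
      qed
    qed
    from tendsto_add[OF this tendsto_mult[OF tendsto_const binomial_asymptotic, of ?\<mu> d]]
    show ?case by (simp add: T_def diff_divide_distrib)
  qed
qed

end

section \<open>First passage times\<close>

text \<open>The sequence need not be monotone, so last and first passage may lie far apart. Each is
  nevertheless an end of an upcrossing: the last index with value at most \<open>x\<close> is its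
  lower end, the first index with larger value its upper end. This treats both signs at
  once.\<close>

lemma first_passage:
  fixes u :: "nat \<Rightarrow> real"
  assumes lim: "filterlim u at_top sequentially" and u0: "u 0 \<le> x"
    and N: "N = Sup {n. u n \<le> x} \<or> N = Inf {n. u n > x}"
  shows "\<exists>a. u a \<le> x \<and> x < u (Suc a) \<and> (N = a \<or> N = Suc a)"
proof -
  have fin: "finite {n. u n \<le> x}"
  proof -
    obtain m where "\<And>n. n \<ge> m \<Longrightarrow> u n > x"
      using lim unfolding filterlim_at_top_dense eventually_sequentially by blast
    then have "{n. u n \<le> x} \<subseteq> {..m}" by (metis (mono_tags, lifting) atMost_iff linorder_not_less mem_Collect_eq nat_le_linear subsetI)
    then show ?thesis by (rule finite_subset) simp
  qed
  from N show ?thesis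
  proof
    assume N: "N = Sup {n. u n \<le> x}"
    then have N': "N = Max {n. u n \<le> x}" using u0 by (auto simp: Sup_nat_def)
    have "N \<in> {n. u n \<le> x}" unfolding N' using fin u0 by (intro Max_in) auto
    moreover have "Suc N \<notin> {n. u n \<le> x}"
      using Max_ge[OF fin, of "Suc N"] N' by auto
    ultimately show ?thesis by auto
  next
    assume N: "N = Inf {n. u n > x}"
    have ne: "{n. u n > x} \<noteq> {}" using fin by (metis (mono_tags, lifting) Collect_cong finite_Collect_not infinite_UNIV_nat not_le empty_iff finite.emptyI)
    have 1: "u N > x" using Inf_nat_def1[OF ne] N by auto
    then obtain a where a: "N = Suc a" using u0 by (cases N) auto
    have "\<not> u a > x" using cInf_lower[of a "{n. u n > x}"] N a by fastforce
    then show ?thesis using 1 a by (intro exI[of _ a]) (auto simp: not_less)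
  qed
qed

text \<open>An upcrossing at \<open>m\<close> encloses \<open>x\<close> between two consecutive
  values of \<open>u\<close>, both asymptotic to a m^d; taking roots gives \<open>m\<close> and with
  it \<open>N\<close>.\<close>

lemma first_passage_asymptotics:
  fixes u :: "nat \<Rightarrow> real" and N :: "real \<Rightarrow> nat"
  assumes d: "d \<ge> 1" and a: "a > 0" and u0: "u 0 = 0"
    and lim: "(\<lambda>n. u n / real n ^ d) \<longlonglongrightarrow> a"
    and N: "\<And>x. N x = Sup {n. u n \<le> x} \<or> N x = Inf {n. u n > x}"
  shows "filterlim u at_top sequentially"
    and "filterlim N at_top at_top"
    and "((\<lambda>x. real (N x) / (x / a) powr (1 / real d)) \<longlongrightarrow> 1) at_top"
proof -
  show u_top: "filterlim u at_top sequentially"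
  proof -
    have "filterlim (\<lambda>n. real n ^ d) at_top sequentially"
      using d by (intro filterlim_pow_at_top filterlim_real_sequentially) auto
    from filterlim_tendsto_pos_mult_at_top[OF lim a this]
    show ?thesis
    proof (rule filterlim_at_top_mono)
      show "\<forall>\<^sub>F n in sequentially. u n / real n ^ d * real n ^ d \<le> u n"
        using eventually_gt_at_top[of 0] by eventually_elim simp
    qed
  qed
  have "\<forall>x\<ge>0. \<exists>m. u m \<le> x \<and> x < u (Suc m) \<and> (N x = m \<or> N x = Suc m)"
    using first_passage[OF u_top _ N] u0 by auto
  then obtain m where m: "\<And>x. x \<ge> 0 \<Longrightarrow> u (m x) \<le> x" "\<And>x. x \<ge> 0 \<Longrightarrow> x < u (Suc (m x))"
    "\<And>x. x \<ge> 0 \<Longrightarrow> N x = m x \<or> N x = Suc (m x)" by metis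
  \<comment> \<open>\<open>u (Suc (m x))\<close> exceeds \<open>x\<close>, hence also every value of
    \<open>u\<close> on a given initial segment once \<open>x\<close> is large.\<close>
  have m_top: "filterlim m at_top at_top"
    unfolding filterlim_at_top
  proof
    fix B :: nat
    have "\<forall>\<^sub>F x :: real in at_top. x \<ge> max 0 (Max (u ` {..B}))" by (rule eventually_ge_at_top)
    then show "\<forall>\<^sub>F x in at_top. B \<le> m x"
    proof eventually_elim
      case (elim x)
      show ?case
      proof (rule ccontr)
        assume "\<not> B \<le> m x"
        then have "Suc (m x) \<in> {..B}" by auto
        then have "u (Suc (m x)) \<le> Max (u ` {..B})" by (intro Max_ge) auto
        moreover have "0 \<le> x" "Max (u ` {..B}) \<le> x" using elim by (simp_all only: max.bounded_iff)
        ultimately show False using m(2)[of x] by linarith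
      qed
    qed
  qed
  show N_top: "filterlim N at_top at_top"
  proof (rule filterlim_at_top_mono[OF m_top])
    show "\<forall>\<^sub>F x in at_top. m x \<le> N x"
      using eventually_ge_at_top[of 0] by eventually_elim (use m(3) in fastforce)
  qed
  have m1: "((\<lambda>x. u (m x) / real (m x) ^ d) \<longlongrightarrow> a) at_top"
    using lim m_top by (rule filterlim_compose)
  have m2: "((\<lambda>x. u (Suc (m x)) / real (Suc (m x)) ^ d * (real (Suc (m x)) / real (m x)) ^ d) \<longlongrightarrow> a * 1 ^ d) at_top"
  proof (intro tendsto_mult tendsto_power)
    have "filterlim (\<lambda>x. Suc (m x)) at_top at_top"
      using filterlim_compose[OF filterlim_Suc m_top] .
    with lim show "((\<lambda>x. u (Suc (m x)) / real (Suc (m x)) ^ d) \<longlongrightarrow> a) at_top"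
      by (rule filterlim_compose)
    have "(\<lambda>n. real (Suc n) / real n) \<longlonglongrightarrow> 1" by real_asymp
    then show "((\<lambda>x. real (Suc (m x)) / real (m x)) \<longlongrightarrow> 1) at_top"
      using m_top by (rule filterlim_compose)
  qed
  have m_pos: "\<forall>\<^sub>F x in at_top. m x \<ge> 1" using m_top unfolding filterlim_at_top by blast
  have xm: "((\<lambda>x. x / real (m x) ^ d) \<longlongrightarrow> a) at_top"
  proof (rule tendsto_sandwich[OF _ _ m1])
    show "((\<lambda>x. u (Suc (m x)) / real (m x) ^ d) \<longlongrightarrow> a) at_top"
      using m2 by (simp add: power_divide)
    show "\<forall>\<^sub>F x in at_top. u (m x) / real (m x) ^ d \<le> x / real (m x) ^ d"
      using eventually_ge_at_top[of 0] by eventually_elim (use m(1) in \<open>simp add: divide_right_mono\<close>)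
    show "\<forall>\<^sub>F x in at_top. x / real (m x) ^ d \<le> u (Suc (m x)) / real (m x) ^ d"
      using eventually_ge_at_top[of 0]
      by eventually_elim (use m(2) in \<open>simp add: divide_right_mono less_imp_le\<close>)
  qed
  have Nm: "((\<lambda>x. real (N x) / real (m x)) \<longlongrightarrow> 1) at_top"
  proof (rule tendsto_sandwich)
    show "((\<lambda>_. 1) \<longlongrightarrow> (1 :: real)) at_top" by simp
    have "(\<lambda>n. real (Suc n) / real n) \<longlonglongrightarrow> 1" by real_asymp
    then show "((\<lambda>x. real (Suc (m x)) / real (m x)) \<longlongrightarrow> 1) at_top"
      using m_top by (rule filterlim_compose)
    show "\<forall>\<^sub>F x in at_top. 1 \<le> real (N x) / real (m x)"
      using eventually_ge_at_top[of 0] m_pos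
      by eventually_elim (use m(3) in \<open>fastforce simp: le_divide_eq\<close>)
    show "\<forall>\<^sub>F x in at_top. real (N x) / real (m x) \<le> real (Suc (m x)) / real (m x)"
      using eventually_ge_at_top[of 0] m_pos
      by eventually_elim (use m(3) in \<open>fastforce intro: divide_right_mono\<close>)
  qed
  have "((\<lambda>x. ((real (N x) / real (m x)) ^ d / (x / real (m x) ^ d) * a) powr (1 / real d)) \<longlongrightarrow>
      (1 ^ d / a * a) powr (1 / real d)) at_top"
    using a by (intro tendsto_intros Nm xm) auto
  then have "((\<lambda>x. ((real (N x) / real (m x)) ^ d / (x / real (m x) ^ d) * a) powr (1 / real d)) \<longlongrightarrow> 1) at_top"
    using a by simp
  then show "((\<lambda>x. real (N x) / (x / a) powr (1 / real d)) \<longlongrightarrow> 1) at_top"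
  proof (rule Lim_transform_eventually)
    show "\<forall>\<^sub>F x in at_top. ((real (N x) / real (m x)) ^ d / (x / real (m x) ^ d) * a) powr (1 / real d) =
        real (N x) / (x / a) powr (1 / real d)"
      using eventually_gt_at_top[of 0] m_pos
    proof eventually_elim
      case (elim x)
      have "(real (N x) / real (m x)) ^ d / (x / real (m x) ^ d) * a = real (N x) ^ d / (x / a)"
        using elim a by (simp add: power_divide)
      also have "\<dots> powr (1 / real d) = (real (N x) ^ d) powr (1 / real d) / (x / a) powr (1 / real d)"
        by (rule powr_divide)
      also have "(real (N x) ^ d) powr (1 / real d) = real (N x)"
        using d by (cases "N x = 0") (auto simp: powr_realpow[symmetric] powr_powr)
      finally show ?case .
    qed
  qed
qed

lemma first_passage_ratio:
  fixes u u' :: "nat \<Rightarrow> real" and N :: "real \<Rightarrow> nat"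
  assumes d: "d \<ge> 1" and a: "a > 0" and u0: "u 0 = 0"
    and lim: "(\<lambda>n. u n / real n ^ d) \<longlonglongrightarrow> a"
    and lim': "(\<lambda>n. u' n / real n ^ e) \<longlonglongrightarrow> b"
    and N: "\<And>x. N x = Sup {n. u n \<le> x} \<or> N x = Inf {n. u n > x}"
  shows "((\<lambda>x. u' (N x) / x powr (real e / real d)) \<longlongrightarrow> b * (1 / a) powr (real e / real d)) at_top"
proof -
  note asym = first_passage_asymptotics[OF d a u0 lim N]
  have "((\<lambda>x. u' (N x) / real (N x) ^ e * (real (N x) / (x / a) powr (1 / real d)) ^ e * (1 / a) powr (real e / real d)) \<longlongrightarrow>
      b * 1 ^ e * (1 / a) powr (real e / real d)) at_top"
    by (intro tendsto_mult tendsto_power tendsto_const asym(3) filterlim_compose[OF lim' asym(2)])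
  then have "((\<lambda>x. u' (N x) / real (N x) ^ e * (real (N x) / (x / a) powr (1 / real d)) ^ e * (1 / a) powr (real e / real d)) \<longlongrightarrow>
      b * (1 / a) powr (real e / real d)) at_top" by simp
  then show ?thesis
  proof (rule Lim_transform_eventually)
    have "\<forall>\<^sub>F x in at_top. N x \<ge> 1" using asym(2) unfolding filterlim_at_top by blast
    then show "\<forall>\<^sub>F x in at_top. u' (N x) / real (N x) ^ e * (real (N x) / (x / a) powr (1 / real d)) ^ e *
        (1 / a) powr (real e / real d) = u' (N x) / x powr (real e / real d)"
      using eventually_gt_at_top[of 0]
    proof eventually_elim
      case (elim x)
      have "((x / a) powr (1 / real d)) ^ e = (x / a) powr (real e / real d)"
        using elim a by (simp add: powr_realpow[symmetric] powr_powr)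
      also have "\<dots> = x powr (real e / real d) * (1 / a) powr (real e / real d)"
        using elim a by (simp add: powr_mult[symmetric])
      finally have *: "((x / a) powr (1 / real d)) ^ e = x powr (real e / real d) * (1 / a) powr (real e / real d)" .
      show ?case using elim a unfolding power_divide * by simp
    qed
  qed
qed

lemma ustat_0: "d \<ge> 1 \<Longrightarrow> ustat d f X 0 \<omega> = 0"
  by (cases d) (auto simp: ustat_eq inc_tuples_0_right)

text \<open>The argument is pathwise: \<open>first_passage_ratio\<close> applies wherever the laws
  of large numbers of both statistics hold.\<close>

theorem (in iid_sequence) ustat_first_passage_strong_law:
  assumes "d \<ge> 1" "e \<ge> 1"
    and "f \<in> borel_measurable (Pi\<^sub>M {1..d} (\<lambda>_. S))" "g \<in> borel_measurable (Pi\<^sub>M {1..e} (\<lambda>_. S))"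
    and "kernel_L1 M d f X" "kernel_L1 M e g X" and pos: "kernel_mean M d f X > 0"
    and N: "N \<in> {N_minus d f X, N_plus d f X}"
  shows "AE \<omega> in M. ((\<lambda>x. ustat e g X (N x \<omega>) \<omega> / x powr (real e / real d)) \<longlongrightarrow>
    kernel_mean M e g X / fact e * (fact d / kernel_mean M d f X) powr (real e / real d)) at_top"
  using strong_law_ustat[OF assms(1,3,5)] strong_law_ustat[OF assms(2,4,6)]
proof eventually_elim
  case (elim \<omega>)
  have "((\<lambda>x. ustat e g X (N x \<omega>) \<omega> / x powr (real e / real d)) \<longlongrightarrow>
      kernel_mean M e g X / fact e * (1 / (kernel_mean M d f X / fact d)) powr (real e / real d)) at_top"
  proof (rule first_passage_ratio[OF assms(1) _ _ elim])
    show "N x \<omega> = Sup {n. ustat d f X n \<omega> \<le> x} \<or> N x \<omega> = Inf {n. ustat d f X n \<omega> > x}" for x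
      using N by (auto simp: N_minus_def N_plus_def)
  qed (use pos assms(1) in \<open>auto simp: ustat_0\<close>)
  then show ?case by simp
qed

section \<open>Kolmogorov's maximal inequality and fluctuations in a window\<close>

context iid_sequence
begin

lemma expectation_mult_X:
  fixes y z :: "'s \<Rightarrow> real"
  assumes y: "y \<in> borel_measurable S" and z: "z \<in> borel_measurable S"
    and int: "integrable M (\<lambda>\<omega>. y (X i \<omega>))" "integrable M (\<lambda>\<omega>. z (X j \<omega>))" and ij: "i \<noteq> j"
  shows "(\<integral>\<omega>. y (X i \<omega>) * z (X j \<omega>) \<partial>M) = (\<integral>\<omega>. y (X i \<omega>) \<partial>M) * (\<integral>\<omega>. z (X j \<omega>) \<partial>M)"
proof -
  have "indep_var (Pi\<^sub>M {i} (\<lambda>_. S)) (\<lambda>\<omega>. \<lambda>k\<in>{i}. X k \<omega>) (Pi\<^sub>M {j} (\<lambda>_. S)) (\<lambda>\<omega>. \<lambda>k\<in>{j}. X k \<omega>)"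
    using indep_var_restrict[OF indep, of "{i}" "{j}"] ij by simp
  then have "indep_var borel ((\<lambda>u. y (u i)) \<circ> (\<lambda>\<omega>. \<lambda>k\<in>{i}. X k \<omega>)) borel ((\<lambda>u. z (u j)) \<circ> (\<lambda>\<omega>. \<lambda>k\<in>{j}. X k \<omega>))"
    by (rule indep_var_compose)
      (auto intro!: measurable_compose[OF _ y] measurable_compose[OF _ z] measurable_component_singleton)
  then have "indep_var borel (\<lambda>\<omega>. y (X i \<omega>)) borel (\<lambda>\<omega>. z (X j \<omega>))" by (simp add: comp_def)
  then show ?thesis using int by (rule indep_var_lebesgue_integral)
qed

lemma expectation_square_sum_X:
  fixes y :: "nat \<Rightarrow> 's \<Rightarrow> real"
  assumes J: "finite J" and y: "\<And>j. j \<in> J \<Longrightarrow> y j \<in> borel_measurable S"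
    and int: "\<And>j. j \<in> J \<Longrightarrow> integrable M (\<lambda>\<omega>. (y j (X j \<omega>))\<^sup>2)"
    and mean: "\<And>j. j \<in> J \<Longrightarrow> (\<integral>\<omega>. y j (X j \<omega>) \<partial>M) = 0"
  shows "(\<integral>\<omega>. (\<Sum>j\<in>J. y j (X j \<omega>))\<^sup>2 \<partial>M) = (\<Sum>j\<in>J. \<integral>\<omega>. (y j (X j \<omega>))\<^sup>2 \<partial>M)"
proof -
  have m: "(\<lambda>\<omega>. y j (X j \<omega>)) \<in> borel_measurable M" if "j \<in> J" for j
    by (rule measurable_compose[OF X_measurable y[OF that]])
  have int1: "integrable M (\<lambda>\<omega>. y j (X j \<omega>))" if "j \<in> J" for j
    by (rule square_integrable_imp_integrable[OF m int]) (use that in auto)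
  have int2: "integrable M (\<lambda>\<omega>. y i (X i \<omega>) * y j (X j \<omega>))" if "i \<in> J" "j \<in> J" for i j
    using that by (intro integrable_mult_squares m int)
  have off: "(\<integral>\<omega>. y i (X i \<omega>) * y j (X j \<omega>) \<partial>M) = (if i = j then \<integral>\<omega>. (y j (X j \<omega>))\<^sup>2 \<partial>M else 0)"
    if "i \<in> J" "j \<in> J" for i j
    using that expectation_mult_X[OF y[OF that(1)] y[OF that(2)] int1[OF that(1)] int1[OF that(2)]] mean
    by (cases "i = j") (auto simp: power2_eq_square)
  have "(\<integral>\<omega>. (\<Sum>j\<in>J. y j (X j \<omega>))\<^sup>2 \<partial>M) = (\<Sum>i\<in>J. \<Sum>j\<in>J. \<integral>\<omega>. y i (X i \<omega>) * y j (X j \<omega>) \<partial>M)"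
    unfolding power2_eq_square sum_product using int2
    by (subst Bochner_Integration.integral_sum Bochner_Integration.integrable_sum; simp)+
  also have "\<dots> = (\<Sum>i\<in>J. \<Sum>j\<in>J. if i = j then \<integral>\<omega>. (y j (X j \<omega>))\<^sup>2 \<partial>M else 0)"
    by (intro sum.cong off) auto
  also have "\<dots> = (\<Sum>j\<in>J. \<integral>\<omega>. (y j (X j \<omega>))\<^sup>2 \<partial>M)"
    using J by (simp add: sum.delta)
  finally show ?thesis .
qed

text \<open>Split according to the first index \<open>m\<close> at which the partial sum reaches
  \<open>l\<close>. Later increments are centred and independent of the variables up to
  \<open>m\<close>, so on this event the second moment at \<open>b\<close> is at least the one at
  \<open>m\<close>.\<close>

lemma kolmogorov_inequality:
  fixes y :: "nat \<Rightarrow> 's \<Rightarrow> real"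
  assumes y: "\<And>j. y j \<in> borel_measurable S"
    and int: "\<And>j. integrable M (\<lambda>\<omega>. (y j (X j \<omega>))\<^sup>2)"
    and mean: "\<And>j. (\<integral>\<omega>. y j (X j \<omega>) \<partial>M) = 0"
    and l: "l > 0"
  shows "prob {\<omega> \<in> space M. \<exists>m\<in>{a..b}. l \<le> \<bar>\<Sum>j\<in>{a<..m}. y j (X j \<omega>)\<bar>}
    \<le> (\<Sum>j\<in>{a<..b}. \<integral>\<omega>. (y j (X j \<omega>))\<^sup>2 \<partial>M) / l\<^sup>2"
proof -
  have Ym [measurable]: "(\<lambda>\<omega>. y j (X j \<omega>)) \<in> borel_measurable M" for j
    by (rule measurable_compose[OF X_measurable y])
  have int1: "integrable M (\<lambda>\<omega>. y j (X j \<omega>))" for j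
    by (rule square_integrable_imp_integrable[OF Ym int])
  define T where "T m \<omega> = (\<Sum>j\<in>{a<..m}. y j (X j \<omega>))" for m \<omega>
  have Tm [measurable]: "T m \<in> borel_measurable M" for m unfolding T_def[abs_def] by measurable
  have Tint: "integrable M (\<lambda>\<omega>. (T m \<omega>)\<^sup>2)" for m
    unfolding T_def using int by (intro integrable_square_sum) auto
  define E where "E m \<omega> \<longleftrightarrow> l \<le> \<bar>T m \<omega>\<bar> \<and> (\<forall>k\<in>{a..<m}. \<bar>T k \<omega>\<bar> < l)" for m \<omega>
  define A where "A m = {\<omega> \<in> space M. E m \<omega>}" for m
  have A [measurable]: "A m \<in> sets M" for m unfolding A_def E_def by measurable
  have AT: "integrable M (\<lambda>\<omega>. indicator (A m) \<omega> * (T k \<omega>)\<^sup>2)" for m k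
    using integrable_real_mult_indicator[OF A[of m] Tint[of k]] by (simp add: mult.commute)
  have ATint: "integrable M (\<lambda>\<omega>. indicator (A m) \<omega> * T m \<omega>)" for m
  proof -
    have "integrable M (T m)" by (rule square_integrable_imp_integrable[OF Tm Tint])
    from integrable_real_mult_indicator[OF A this, of m] show ?thesis by (simp add: mult.commute)
  qed
  have ATY: "integrable M (\<lambda>\<omega>. indicator (A m) \<omega> * T m \<omega> * y j (X j \<omega>))" for m j
    using integrable_real_mult_indicator[OF A[of m] integrable_mult_squares[OF Tm[of m] Ym[of j] Tint[of m] int[of j]]]
    by (simp add: mult_ac)
  have cross: "(\<integral>\<omega>. indicator (A m) \<omega> * T m \<omega> * y j (X j \<omega>) \<partial>M) = 0" if "m < j" for m j
  proof -
    let ?I = "{a<..m}"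
    define TT where "TT k u = (\<Sum>j\<in>{a<..k}. y j (u j))" for k and u :: "nat \<Rightarrow> 's"
    \<comment> \<open>Indicator of the event times the partial sum, written as a function of the
      variables up to \<open>m\<close>, so that independence of blocks applies.\<close>
    define \<psi> where "\<psi> u = (if l \<le> \<bar>TT m u\<bar> \<and> (\<forall>k\<in>{a..<m}. \<bar>TT k u\<bar> < l) then TT m u else 0)" for u
    have TT [measurable]: "TT k \<in> borel_measurable (Pi\<^sub>M ?I (\<lambda>_. S))" if "k \<le> m" for k
      unfolding TT_def[abs_def]
    proof (rule borel_measurable_sum)
      fix j assume "j \<in> {a<..k}"
      then show "(\<lambda>u. y j (u j)) \<in> borel_measurable (Pi\<^sub>M ?I (\<lambda>_. S))"
        using that by (intro measurable_compose[OF _ y] measurable_component_singleton) auto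
    qed
    have "Measurable.pred (Pi\<^sub>M ?I (\<lambda>_. S)) (\<lambda>u. l \<le> \<bar>TT m u\<bar> \<and> (\<forall>k\<in>{a..<m}. \<bar>TT k u\<bar> < l))"
    proof (intro pred_intros_logic pred_intros_finite)
      show "Measurable.pred (Pi\<^sub>M ?I (\<lambda>_. S)) (\<lambda>u. l \<le> \<bar>TT m u\<bar>)"
        using TT[of m] by measurable
      show "Measurable.pred (Pi\<^sub>M ?I (\<lambda>_. S)) (\<lambda>u. \<bar>TT k u\<bar> < l)" if "k \<in> {a..<m}" for k
        using TT[of k] that by simp
    qed simp
    then have \<psi>: "\<psi> \<in> borel_measurable (Pi\<^sub>M ?I (\<lambda>_. S))"
      unfolding \<psi>_def[abs_def] using TT[of m] by (intro measurable_If) auto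
    have \<psi>X: "\<psi> (\<lambda>k\<in>?I. X k \<omega>) = indicator (A m) \<omega> * T m \<omega>" if "\<omega> \<in> space M" for \<omega>
    proof -
      have "TT k (\<lambda>k\<in>?I. X k \<omega>) = T k \<omega>" if "k \<le> m" for k
        unfolding TT_def T_def using that by (intro sum.cong) auto
      then show ?thesis using that by (auto simp: \<psi>_def A_def E_def indicator_def)
    qed
    have "indep_var (Pi\<^sub>M ?I (\<lambda>_. S)) (\<lambda>\<omega>. \<lambda>k\<in>?I. X k \<omega>) (Pi\<^sub>M {j} (\<lambda>_. S)) (\<lambda>\<omega>. \<lambda>k\<in>{j}. X k \<omega>)"
      using indep_var_restrict[OF indep, of ?I "{j}"] that by simp
    then have "indep_var borel (\<psi> \<circ> (\<lambda>\<omega>. \<lambda>k\<in>?I. X k \<omega>)) borel ((\<lambda>u. y j (u j)) \<circ> (\<lambda>\<omega>. \<lambda>k\<in>{j}. X k \<omega>))"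
      by (rule indep_var_compose[OF _ \<psi>])
        (auto intro!: measurable_compose[OF _ y] measurable_component_singleton)
    then have iv: "indep_var borel (\<lambda>\<omega>. \<psi> (\<lambda>k\<in>?I. X k \<omega>)) borel (\<lambda>\<omega>. y j (X j \<omega>))" by (simp add: comp_def)
    have "integrable M (\<lambda>\<omega>. \<psi> (\<lambda>k\<in>?I. X k \<omega>)) \<longleftrightarrow> integrable M (\<lambda>\<omega>. indicator (A m) \<omega> * T m \<omega>)"
      by (intro Bochner_Integration.integrable_cong) (auto simp: \<psi>X)
    then have "integrable M (\<lambda>\<omega>. \<psi> (\<lambda>k\<in>?I. X k \<omega>))" using ATint[of m] by blast
    from indep_var_lebesgue_integral[OF iv this int1] mean
    have "(\<integral>\<omega>. \<psi> (\<lambda>k\<in>?I. X k \<omega>) * y j (X j \<omega>) \<partial>M) = 0" by simp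
    moreover have "(\<integral>\<omega>. \<psi> (\<lambda>k\<in>?I. X k \<omega>) * y j (X j \<omega>) \<partial>M) = (\<integral>\<omega>. indicator (A m) \<omega> * T m \<omega> * y j (X j \<omega>) \<partial>M)"
      by (intro Bochner_Integration.integral_cong) (auto simp: \<psi>X)
    ultimately show ?thesis by simp
  qed
  have bound: "l\<^sup>2 * prob (A m) \<le> (\<integral>\<omega>. indicator (A m) \<omega> * (T b \<omega>)\<^sup>2 \<partial>M)" if mb: "m \<in> {a..b}" for m
  proof -
    have "l\<^sup>2 * prob (A m) = (\<integral>\<omega>. l\<^sup>2 * indicator (A m) \<omega> \<partial>M)"
      using sets.sets_into_space[OF A[of m]] by (simp add: Int_absorb2)
    also have "\<dots> \<le> (\<integral>\<omega>. indicator (A m) \<omega> * (T m \<omega>)\<^sup>2 \<partial>M)"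
    proof (rule integral_mono[OF _ AT])
      show "l\<^sup>2 * indicator (A m) \<omega> \<le> indicator (A m) \<omega> * (T m \<omega>)\<^sup>2" for \<omega>
      proof (cases "\<omega> \<in> A m")
        case True
        then have "l \<le> \<bar>T m \<omega>\<bar>" by (simp add: A_def E_def)
        then have "l\<^sup>2 \<le> \<bar>T m \<omega>\<bar>\<^sup>2" using l by (intro power_mono) auto
        then show ?thesis using True by simp
      qed simp
    qed (simp add: less_top[symmetric])
    \<comment> \<open>The added terms are zero. With them the integrand becomes the expansion of
      \<open>(T b \<omega>)\<^sup>2\<close> without the square of the later increment.\<close>
    also have "\<dots> = (\<integral>\<omega>. indicator (A m) \<omega> * (T m \<omega>)\<^sup>2 \<partial>M) + 2 * (\<Sum>j\<in>{m<..b}. \<integral>\<omega>. indicator (A m) \<omega> * T m \<omega> * y j (X j \<omega>) \<partial>M)"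
      using cross by simp
    also have "\<dots> = (\<integral>\<omega>. indicator (A m) \<omega> * (T m \<omega>)\<^sup>2 + 2 * (\<Sum>j\<in>{m<..b}. indicator (A m) \<omega> * T m \<omega> * y j (X j \<omega>)) \<partial>M)"
    proof -
      have "integrable M (\<lambda>\<omega>. 2 * (\<Sum>j\<in>{m<..b}. indicator (A m) \<omega> * T m \<omega> * y j (X j \<omega>)))"
        by (intro integrable_mult_right Bochner_Integration.integrable_sum ATY)
      from Bochner_Integration.integral_add[OF AT[of m m] this]
      have "(\<integral>\<omega>. indicator (A m) \<omega> * (T m \<omega>)\<^sup>2 + 2 * (\<Sum>j\<in>{m<..b}. indicator (A m) \<omega> * T m \<omega> * y j (X j \<omega>)) \<partial>M) =
        (\<integral>\<omega>. indicator (A m) \<omega> * (T m \<omega>)\<^sup>2 \<partial>M) +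
        2 * (\<integral>\<omega>. (\<Sum>j\<in>{m<..b}. indicator (A m) \<omega> * T m \<omega> * y j (X j \<omega>)) \<partial>M)" by simp
      moreover have "(\<integral>\<omega>. (\<Sum>j\<in>{m<..b}. indicator (A m) \<omega> * T m \<omega> * y j (X j \<omega>)) \<partial>M) =
          (\<Sum>j\<in>{m<..b}. \<integral>\<omega>. indicator (A m) \<omega> * T m \<omega> * y j (X j \<omega>) \<partial>M)"
        by (intro Bochner_Integration.integral_sum ATY)
      ultimately show ?thesis by simp
    qed
    also have "\<dots> \<le> (\<integral>\<omega>. indicator (A m) \<omega> * (T b \<omega>)\<^sup>2 \<partial>M)"
    proof (rule integral_mono[OF _ AT])
      show "integrable M (\<lambda>\<omega>. indicator (A m) \<omega> * (T m \<omega>)\<^sup>2 + 2 * (\<Sum>j\<in>{m<..b}. indicator (A m) \<omega> * T m \<omega> * y j (X j \<omega>)))"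
        using AT ATY by (intro Bochner_Integration.integrable_add integrable_mult_right Bochner_Integration.integrable_sum)
      fix \<omega>
      define R where "R = (\<Sum>j\<in>{m<..b}. y j (X j \<omega>))"
      have "{a<..b} = {a<..m} \<union> {m<..b}" using mb by auto
      then have "T b \<omega> = T m \<omega> + R"
        unfolding T_def R_def by (simp add: sum.union_disjoint)
      then have "(T b \<omega>)\<^sup>2 = (T m \<omega>)\<^sup>2 + 2 * (T m \<omega> * R) + R\<^sup>2" by (simp add: power2_sum)
      then have "(T m \<omega>)\<^sup>2 + 2 * (T m \<omega> * R) \<le> (T b \<omega>)\<^sup>2" by simp
      then show "indicator (A m) \<omega> * (T m \<omega>)\<^sup>2 + 2 * (\<Sum>j\<in>{m<..b}. indicator (A m) \<omega> * T m \<omega> * y j (X j \<omega>)) \<le> indicator (A m) \<omega> * (T b \<omega>)\<^sup>2"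
        by (cases "\<omega> \<in> A m") (simp_all add: R_def sum_distrib_left)
    qed
    finally show ?thesis .
  qed
  have disj: "disjoint_family_on A {a..b}"
    unfolding disjoint_family_on_def
  proof (intro ballI impI)
    fix m n assume "m \<in> {a..b}" "n \<in> {a..b}" "m \<noteq> n"
    then show "A m \<inter> A n = {}"
      unfolding A_def E_def by (cases "m < n") (force simp: not_le[symmetric])+
  qed
  have eq: "{\<omega> \<in> space M. \<exists>m\<in>{a..b}. l \<le> \<bar>T m \<omega>\<bar>} = (\<Union>m\<in>{a..b}. A m)"
  proof (intro equalityI subsetI)
    fix \<omega> assume "\<omega> \<in> {\<omega> \<in> space M. \<exists>m\<in>{a..b}. l \<le> \<bar>T m \<omega>\<bar>}"
    then have \<omega>: "\<omega> \<in> space M" "\<exists>m. m \<in> {a..b} \<and> l \<le> \<bar>T m \<omega>\<bar>" by auto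
    define m where "m = (LEAST m. m \<in> {a..b} \<and> l \<le> \<bar>T m \<omega>\<bar>)"
    have m: "m \<in> {a..b} \<and> l \<le> \<bar>T m \<omega>\<bar>" unfolding m_def by (rule LeastI_ex[OF \<omega>(2)])
    moreover have "\<bar>T k \<omega>\<bar> < l" if "k \<in> {a..<m}" for k
    proof (rule ccontr)
      assume "\<not> ?thesis"
      then have "m \<le> k" unfolding m_def using that m by (intro Least_le) auto
      then show False using that by simp
    qed
    ultimately show "\<omega> \<in> (\<Union>m\<in>{a..b}. A m)" using \<omega>(1) by (auto simp: A_def E_def)
  qed (auto simp: A_def E_def)
  have "l\<^sup>2 * prob (\<Union>m\<in>{a..b}. A m) = (\<Sum>m\<in>{a..b}. l\<^sup>2 * prob (A m))"
    using disj by (subst finite_measure_finite_Union) (auto simp: sum_distrib_left)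
  also have "\<dots> \<le> (\<Sum>m\<in>{a..b}. \<integral>\<omega>. indicator (A m) \<omega> * (T b \<omega>)\<^sup>2 \<partial>M)"
    by (intro sum_mono bound)
  also have "\<dots> = (\<integral>\<omega>. (\<Sum>m\<in>{a..b}. indicator (A m) \<omega> * (T b \<omega>)\<^sup>2) \<partial>M)"
    by (intro Bochner_Integration.integral_sum[symmetric] AT)
  also have "\<dots> \<le> (\<integral>\<omega>. (T b \<omega>)\<^sup>2 \<partial>M)"
  proof (rule integral_mono[OF _ Tint])
    show "integrable M (\<lambda>\<omega>. \<Sum>m\<in>{a..b}. indicator (A m) \<omega> * (T b \<omega>)\<^sup>2)"
      by (intro Bochner_Integration.integrable_sum AT)
    fix \<omega>
    have "(\<Sum>m\<in>{a..b}. indicator (A m) \<omega>) = (indicator (\<Union>m\<in>{a..b}. A m) \<omega> :: real)"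
      using disj by (intro indicator_UN_disjoint[symmetric]) auto
    then have "(\<Sum>m\<in>{a..b}. indicator (A m) \<omega> * (T b \<omega>)\<^sup>2) = indicator (\<Union>m\<in>{a..b}. A m) \<omega> * (T b \<omega>)\<^sup>2"
      by (simp add: sum_distrib_right[symmetric])
    also have "\<dots> \<le> (T b \<omega>)\<^sup>2" by (simp add: indicator_def)
    finally show "(\<Sum>m\<in>{a..b}. indicator (A m) \<omega> * (T b \<omega>)\<^sup>2) \<le> (T b \<omega>)\<^sup>2" .
  qed
  also have "\<dots> = (\<Sum>j\<in>{a<..b}. \<integral>\<omega>. (y j (X j \<omega>))\<^sup>2 \<partial>M)"
    unfolding T_def using y int mean by (intro expectation_square_sum_X) auto
  finally show ?thesis
    using l unfolding T_def[symmetric] eq by (simp add: field_simps)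
qed

end

section \<open>Oscillation of a U-statistic in a window\<close>

context L2_kernel
begin

text \<open>The change of the statistic from \<open>n - 1\<close> to \<open>n\<close>, with its mean
  and the projection on the new variable taken out.\<close>

definition increment :: "nat \<Rightarrow> 'w \<Rightarrow> real" where
  "increment n \<omega> = (\<Sum>i\<in>{i \<in> inc_tuples d n. i d = n}. resid d f {d} (tup d i \<omega>))"

lemma ustat_Suc:
  "ustat d f X (Suc n) \<omega> - \<mu> * real (Suc n choose d) = ustat d f X n \<omega> - \<mu> * real (n choose d)
    + increment (Suc n) \<omega> + real (n choose (d - 1)) * \<phi> d (X (Suc n) \<omega>)"
proof -
  obtain e where d: "d = Suc e" using d_pos by (cases d) auto
  let ?I = "{i \<in> inc_tuples d (Suc n). i d = Suc n}"
  have Q: "{d} \<subseteq> {1..d}" using d_pos by auto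
  have split: "inc_tuples d (Suc n) = inc_tuples d n \<union> ?I" "inc_tuples d n \<inter> ?I = {}"
    unfolding d using inc_tuples_Suc_Suc[of e n] inc_tuples_Suc_Suc_disjoint[of e n]
    by (simp_all only: inc_tuples_extend)
  have "ustat d f X (Suc n) \<omega> = ustat d f X n \<omega> + (\<Sum>i\<in>?I. f (tup d i \<omega>))"
  proof -
    have "sum g (inc_tuples d (Suc n)) = sum g (inc_tuples d n) + sum g ?I" for g :: "(nat \<Rightarrow> nat) \<Rightarrow> real"
      by (subst split(1), rule sum.union_disjoint[OF _ _ split(2)]) simp_all
    then show ?thesis by (simp only: ustat_eq tup_def[symmetric])
  qed
  moreover have "(\<Sum>i\<in>?I. f (tup d i \<omega>)) = (\<Sum>i\<in>?I. resid d f {d} (tup d i \<omega>) + \<mu> + \<phi> d (X (Suc n) \<omega>))"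
    by (intro sum.cong) (auto simp: resid_tup[OF Q])
  moreover have "\<dots> = increment (Suc n) \<omega> + real (card ?I) * (\<mu> + \<phi> d (X (Suc n) \<omega>))"
    by (simp add: increment_def sum.distrib algebra_simps)
  moreover have "card ?I = n choose (d - 1)" using card_inc_tuples_top[of e n] by (simp add: d)
  moreover have "real (Suc n choose d) = real (n choose (d - 1)) + real (n choose d)" by (simp add: d)
  ultimately show ?thesis by (simp add: algebra_simps)
qed

text \<open>In contrast to the weights of the linear part, those in the last sum depend on
  \<open>k\<close> alone, so for varying \<open>m\<close> it is a process of partial sums and falls
  under Kolmogorov's inequality.\<close>

lemma ustat_window:
  assumes "a \<le> m"
  shows "ustat d f X m \<omega> - \<mu> * real (m choose d) = ustat d f X a \<omega> - \<mu> * real (a choose d)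
    + (\<Sum>k\<in>{a<..m}. increment k \<omega>) + (\<Sum>k\<in>{a<..m}. real (k - 1 choose (d - 1)) * \<phi> d (X k \<omega>))"
  using assms
proof (induction m rule: dec_induct)
  case (step m)
  then have "{a<..Suc m} = insert (Suc m) {a<..m}" by auto
  then show ?case using step.IH by (simp add: ustat_Suc)
qed simp

lemma increment_measurable [measurable]: "increment n \<in> borel_measurable M"
  unfolding increment_def[abs_def]
  by (intro borel_measurable_sum measurable_compose[OF tup_measurable resid_measurable]) (use d_pos in auto)

lemma increment_square_integrable: "integrable M (\<lambda>\<omega>. (increment n \<omega>)\<^sup>2)"
  unfolding increment_def
proof (rule integrable_square_sum)
  have Q: "{d} \<subseteq> {1..d}" using d_pos by auto
  note m = resid_measurable[OF Q]
  have m2: "(\<lambda>y. (resid d f {d} y)\<^sup>2) \<in> borel_measurable (Pi\<^sub>M {1..d} (\<lambda>_. S))"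
    using m by measurable
  fix i assume i: "i \<in> {i \<in> inc_tuples d n. i d = n}"
  then have "inj_on i {1..d}" using inc_tuples_inj by blast
  from integrable_tup[OF m2 this] resid_square_integrable[OF Q]
  show "integrable M (\<lambda>\<omega>. (resid d f {d} (tup d i \<omega>))\<^sup>2)" by blast
  show "(\<lambda>\<omega>. resid d f {d} (tup d i \<omega>)) \<in> borel_measurable M"
    by (rule measurable_compose[OF tup_measurable m])
qed simp

text \<open>The two sums in \<open>ustat_window\<close> share the threshold equally. The condition
  \<open>b \<le> 2 * a\<close> keeps all indices of the window comparable with \<open>b\<close>. The
  bound is linear in the relative length of the window, so it is small for short windows.\<close>

lemma window_probability:
  "\<exists>C\<ge>0. \<forall>a b \<epsilon>. 1 \<le> a \<and> a \<le> b \<and> b \<le> 2 * a \<and> \<epsilon> > 0 \<longrightarrow>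
    prob {\<omega> \<in> space M. \<exists>m\<in>{a..b}. 2 * \<epsilon> * (real b ^ d / sqrt (real b)) \<le>
      \<bar>(ustat d f X m \<omega> - \<mu> * real (m choose d)) - (ustat d f X a \<omega> - \<mu> * real (a choose d))\<bar>}
    \<le> C * (real (b - a) / real b) / \<epsilon>\<^sup>2"
proof -
  obtain C where C: "C \<ge> 0" "\<And>n. (\<integral>\<omega>. (increment n \<omega>)\<^sup>2 \<partial>M) * real n ^ 3 \<le> C * real n ^ (2 * d)"
    using expectation_square_increment_le unfolding increment_def by blast
  define s where "s = (\<integral>\<omega>. (\<phi> d (X 0 \<omega>))\<^sup>2 \<partial>M)"
  have s: "s \<ge> 0" by (simp add: s_def)
  have dd: "d \<in> {1..d}" using d_pos by auto
  have \<phi>m [measurable]: "\<phi> d \<in> borel_measurable S" by (rule proj_measurable[OF dd])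
  have main: "prob {\<omega> \<in> space M. \<exists>m\<in>{a..b}. 2 * \<epsilon> * (real b ^ d / sqrt (real b)) \<le>
      \<bar>(ustat d f X m \<omega> - \<mu> * real (m choose d)) - (ustat d f X a \<omega> - \<mu> * real (a choose d))\<bar>}
    \<le> (8 * C + s) * (real (b - a) / real b) / \<epsilon>\<^sup>2"
    if ab: "1 \<le> a" "a \<le> b" "b \<le> 2 * a" and \<epsilon>: "\<epsilon> > 0" for a b \<epsilon>
  proof -
    have b0: "real b > 0" using ab by simp
    define c where "c = real b ^ d / sqrt (real b)"
    have c0: "c > 0" using b0 by (simp add: c_def)
    have c2: "c\<^sup>2 = real b ^ (2 * d) / real b"
      using b0 by (simp add: c_def power_divide power_mult[symmetric] mult.commute)
    define r where "r = real (b - a) / real b"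
    have r: "0 \<le> r" "r \<le> 1" using ab by (simp_all add: r_def)
    \<comment> \<open>Absolute values give one variable that dominates the sum for all
      \<open>m\<close>. Cauchy-Schwarz costs a factor \<open>b - a\<close>, which second moments of
      order b^(2d-3) can afford.\<close>
    define E1 where "E1 \<omega> = (\<Sum>k\<in>{a<..b}. \<bar>increment k \<omega>\<bar>)" for \<omega>
    have E1m [measurable]: "E1 \<in> borel_measurable M" unfolding E1_def[abs_def] by measurable
    have E1int: "integrable M (\<lambda>\<omega>. (E1 \<omega>)\<^sup>2)"
      unfolding E1_def using increment_square_integrable by (intro integrable_square_sum) auto
    have "(\<integral>\<omega>. (E1 \<omega>)\<^sup>2 \<partial>M) \<le> (\<integral>\<omega>. (\<Sum>k\<in>{a<..b}. (increment k \<omega>)\<^sup>2) * real (b - a) \<partial>M)"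
    proof (rule integral_mono[OF E1int])
      show "integrable M (\<lambda>\<omega>. (\<Sum>k\<in>{a<..b}. (increment k \<omega>)\<^sup>2) * real (b - a))"
        by (intro integrable_mult_left Bochner_Integration.integrable_sum increment_square_integrable)
      show "(E1 \<omega>)\<^sup>2 \<le> (\<Sum>k\<in>{a<..b}. (increment k \<omega>)\<^sup>2) * real (b - a)" for \<omega>
        using sum_squared_le_sum_of_squares[of "\<lambda>k. \<bar>increment k \<omega>\<bar>" "{a<..b}"] by (simp add: E1_def)
    qed
    also have "\<dots> = (\<Sum>k\<in>{a<..b}. \<integral>\<omega>. (increment k \<omega>)\<^sup>2 \<partial>M) * real (b - a)"
      using increment_square_integrable by simp
    \<comment> \<open>The 8 is 2^3, from \<open>real b \<le> 2 * real k\<close> in the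
      denominator.\<close>
    also have "\<dots> \<le> (\<Sum>k\<in>{a<..b}. 8 * C * real b ^ (2 * d) / real b ^ 3) * real (b - a)"
    proof (intro mult_right_mono sum_mono)
      fix k assume k: "k \<in> {a<..b}"
      then have k0: "real k > 0" "real b \<le> 2 * real k" using ab by auto
      have "(\<integral>\<omega>. (increment k \<omega>)\<^sup>2 \<partial>M) \<le> C * real k ^ (2 * d) / real k ^ 3"
        using C(2)[of k] k0 by (simp add: pos_le_divide_eq)
      also have "\<dots> \<le> C * real b ^ (2 * d) / (real b / 2) ^ 3"
        using C(1) k0 k b0 by (intro frac_le mult_left_mono power_mono mult_nonneg_nonneg) auto
      also have "\<dots> = 8 * C * real b ^ (2 * d) / real b ^ 3" by (simp add: power_divide)
      finally show "(\<integral>\<omega>. (increment k \<omega>)\<^sup>2 \<partial>M) \<le> 8 * C * real b ^ (2 * d) / real b ^ 3" .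
    qed simp
    also have "\<dots> = 8 * C * r\<^sup>2 * c\<^sup>2"
      unfolding c2 r_def power_divide using b0 by (simp add: power2_eq_square power3_eq_cube)
    finally have E1sq: "(\<integral>\<omega>. (E1 \<omega>)\<^sup>2 \<partial>M) \<le> 8 * C * r\<^sup>2 * c\<^sup>2" .
    have "prob {\<omega> \<in> space M. \<epsilon> * c \<le> \<bar>E1 \<omega>\<bar>} \<le> (\<integral>\<omega>. (E1 \<omega>)\<^sup>2 \<partial>M) / (\<epsilon> * c)\<^sup>2"
      using \<epsilon> c0 by (intro second_moment_method E1int) auto
    also have "\<dots> \<le> 8 * C * r\<^sup>2 * c\<^sup>2 / (\<epsilon> * c)\<^sup>2" by (intro divide_right_mono E1sq) simp
    also have "\<dots> = 8 * C * r\<^sup>2 / \<epsilon>\<^sup>2" using c0 by (simp add: power_mult_distrib)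
    also have "\<dots> \<le> 8 * C * r / \<epsilon>\<^sup>2"
      using r C(1) by (intro divide_right_mono mult_left_mono) (auto simp: power2_eq_square mult_left_le)
    finally have P1: "prob {\<omega> \<in> space M. \<epsilon> * c \<le> \<bar>E1 \<omega>\<bar>} \<le> 8 * C * r / \<epsilon>\<^sup>2" .
    define y where "y k x = real (k - 1 choose (d - 1)) * \<phi> d x" for k x
    have ym [measurable]: "y k \<in> borel_measurable S" for k unfolding y_def[abs_def] by measurable
    have yint: "integrable M (\<lambda>\<omega>. (y k (X k \<omega>))\<^sup>2)" for k
      unfolding y_def power_mult_distrib by (intro integrable_mult_right proj_square_integrable dd)
    have "prob {\<omega> \<in> space M. \<exists>m\<in>{a..b}. \<epsilon> * c \<le> \<bar>\<Sum>j\<in>{a<..m}. y j (X j \<omega>)\<bar>}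
        \<le> (\<Sum>j\<in>{a<..b}. \<integral>\<omega>. (y j (X j \<omega>))\<^sup>2 \<partial>M) / (\<epsilon> * c)\<^sup>2"
      using \<epsilon> c0 proj_expectation[OF dd] by (intro kolmogorov_inequality ym yint) (auto simp: y_def)
    also have "\<dots> \<le> (\<Sum>j\<in>{a<..b}. real b ^ (2 * d) / real b ^ 2 * s) / (\<epsilon> * c)\<^sup>2"
    proof (intro divide_right_mono sum_mono)
      fix j assume j: "j \<in> {a<..b}"
      have "(\<lambda>x. (\<phi> d x)\<^sup>2) \<in> borel_measurable S" by measurable
      then have "(\<integral>\<omega>. (\<phi> d (X j \<omega>))\<^sup>2 \<partial>M) = s" unfolding s_def by (rule integral_X)
      then have "(\<integral>\<omega>. (y j (X j \<omega>))\<^sup>2 \<partial>M) = (real (j - 1 choose (d - 1)))\<^sup>2 * s"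
        by (simp add: y_def power_mult_distrib)
      also have "\<dots> \<le> (real b ^ (d - 1))\<^sup>2 * s"
      proof (intro mult_right_mono power_mono s)
        have "real (j - 1 choose (d - 1)) \<le> real (j - 1) ^ (d - 1)" by (rule binomial_le_power)
        also have "\<dots> \<le> real b ^ (d - 1)" using j by (intro power_mono) auto
        finally show "real (j - 1 choose (d - 1)) \<le> real b ^ (d - 1)" .
      qed simp
      also have "(real b ^ (d - 1))\<^sup>2 = real b ^ (2 * d) / real b ^ 2"
        using d_pos b0 by (simp add: power_diff power_mult[symmetric] mult.commute power_divide)
      finally show "(\<integral>\<omega>. (y j (X j \<omega>))\<^sup>2 \<partial>M) \<le> real b ^ (2 * d) / real b ^ 2 * s" .
    qed simp
    also have "(\<Sum>j\<in>{a<..b}. real b ^ (2 * d) / real b ^ 2 * s) = r * s * c\<^sup>2"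
      unfolding c2 r_def using b0 by (simp add: power2_eq_square)
    also have "r * s * c\<^sup>2 / (\<epsilon> * c)\<^sup>2 = s * r / \<epsilon>\<^sup>2" using c0 by (simp add: power_mult_distrib)
    finally have P2: "prob {\<omega> \<in> space M. \<exists>m\<in>{a..b}. \<epsilon> * c \<le> \<bar>\<Sum>j\<in>{a<..m}. y j (X j \<omega>)\<bar>} \<le> s * r / \<epsilon>\<^sup>2" .
    let ?V = "\<lambda>m \<omega>. ustat d f X m \<omega> - \<mu> * real (m choose d)"
    have "prob {\<omega> \<in> space M. \<exists>m\<in>{a..b}. 2 * \<epsilon> * c \<le> \<bar>?V m \<omega> - ?V a \<omega>\<bar>} \<le>
        prob ({\<omega> \<in> space M. \<epsilon> * c \<le> \<bar>E1 \<omega>\<bar>} \<union> {\<omega> \<in> space M. \<exists>m\<in>{a..b}. \<epsilon> * c \<le> \<bar>\<Sum>j\<in>{a<..m}. y j (X j \<omega>)\<bar>})"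
    proof (rule finite_measure_mono)
      show "{\<omega> \<in> space M. \<exists>m\<in>{a..b}. 2 * \<epsilon> * c \<le> \<bar>?V m \<omega> - ?V a \<omega>\<bar>} \<subseteq>
        {\<omega> \<in> space M. \<epsilon> * c \<le> \<bar>E1 \<omega>\<bar>} \<union> {\<omega> \<in> space M. \<exists>m\<in>{a..b}. \<epsilon> * c \<le> \<bar>\<Sum>j\<in>{a<..m}. y j (X j \<omega>)\<bar>}"
      proof
        fix \<omega> assume "\<omega> \<in> {\<omega> \<in> space M. \<exists>m\<in>{a..b}. 2 * \<epsilon> * c \<le> \<bar>?V m \<omega> - ?V a \<omega>\<bar>}"
        then obtain m where m: "\<omega> \<in> space M" "m \<in> {a..b}" "2 * \<epsilon> * c \<le> \<bar>?V m \<omega> - ?V a \<omega>\<bar>" by blast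
        have "?V m \<omega> - ?V a \<omega> = (\<Sum>k\<in>{a<..m}. increment k \<omega>) + (\<Sum>j\<in>{a<..m}. y j (X j \<omega>))"
          using m(2) ustat_window[of a m \<omega>] by (simp add: y_def)
        moreover have "\<bar>\<Sum>k\<in>{a<..m}. increment k \<omega>\<bar> \<le> E1 \<omega>"
        proof -
          have "\<bar>\<Sum>k\<in>{a<..m}. increment k \<omega>\<bar> \<le> (\<Sum>k\<in>{a<..m}. \<bar>increment k \<omega>\<bar>)" by (rule sum_abs)
          also have "\<dots> \<le> E1 \<omega>" unfolding E1_def using m(2) by (intro sum_mono2) auto
          finally show ?thesis .
        qed
        ultimately have "2 * \<epsilon> * c \<le> \<bar>E1 \<omega>\<bar> + \<bar>\<Sum>j\<in>{a<..m}. y j (X j \<omega>)\<bar>" using m(3) by linarith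
        then have "\<epsilon> * c \<le> \<bar>E1 \<omega>\<bar> \<or> \<epsilon> * c \<le> \<bar>\<Sum>j\<in>{a<..m}. y j (X j \<omega>)\<bar>" by linarith
        then show "\<omega> \<in> {\<omega> \<in> space M. \<epsilon> * c \<le> \<bar>E1 \<omega>\<bar>} \<union> {\<omega> \<in> space M. \<exists>m\<in>{a..b}. \<epsilon> * c \<le> \<bar>\<Sum>j\<in>{a<..m}. y j (X j \<omega>)\<bar>}"
          using m by blast
      qed
    qed measurable
    also have "\<dots> \<le> prob {\<omega> \<in> space M. \<epsilon> * c \<le> \<bar>E1 \<omega>\<bar>} + prob {\<omega> \<in> space M. \<exists>m\<in>{a..b}. \<epsilon> * c \<le> \<bar>\<Sum>j\<in>{a<..m}. y j (X j \<omega>)\<bar>}"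
      by (rule measure_Un_le) measurable
    also have "\<dots> \<le> 8 * C * r / \<epsilon>\<^sup>2 + s * r / \<epsilon>\<^sup>2" by (intro add_mono P1 P2)
    also have "\<dots> = (8 * C + s) * r / \<epsilon>\<^sup>2" by (simp add: algebra_simps add_divide_distrib)
    finally show ?thesis by (simp add: c_def r_def)
  qed
  show ?thesis using main C(1) s by (intro exI[of _ "8 * C + s"]) auto
qed

end

section \<open>Convergence to zero in probability\<close>

context prob_space
begin

text \<open>Measurability is included because \<open>prob\<close> assigns 0 to non-measurable sets,
  which would make the limit statement vacuous.\<close>

definition null_in_prob :: "(nat \<Rightarrow> 'a \<Rightarrow> real) \<Rightarrow> bool" where
  "null_in_prob Y \<longleftrightarrow> (\<forall>k. Y k \<in> borel_measurable M) \<and>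
    (\<forall>\<epsilon>>0. (\<lambda>k. prob {\<omega> \<in> space M. \<epsilon> \<le> \<bar>Y k \<omega>\<bar>}) \<longlonglongrightarrow> 0)"

text \<open>Tightness, demanded only for large \<open>k\<close>, as suits products with null
  sequences.\<close>

definition bounded_in_prob :: "(nat \<Rightarrow> 'a \<Rightarrow> real) \<Rightarrow> bool" where
  "bounded_in_prob Y \<longleftrightarrow> (\<forall>k. Y k \<in> borel_measurable M) \<and>
    (\<forall>\<epsilon>>0. \<exists>K>0. \<forall>\<^sub>F k in sequentially. prob {\<omega> \<in> space M. K \<le> \<bar>Y k \<omega>\<bar>} < \<epsilon>)"

lemma null_in_prob_measurable: "null_in_prob Y \<Longrightarrow> Y k \<in> borel_measurable M"
  by (simp add: null_in_prob_def)

lemma bounded_in_prob_measurable: "bounded_in_prob Y \<Longrightarrow> Y k \<in> borel_measurable M"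
  by (simp add: bounded_in_prob_def)

lemma null_in_probD:
  "null_in_prob Y \<Longrightarrow> \<epsilon> > 0 \<Longrightarrow> \<eta> > 0 \<Longrightarrow> \<forall>\<^sub>F k in sequentially. prob {\<omega> \<in> space M. \<epsilon> \<le> \<bar>Y k \<omega>\<bar>} < \<eta>"
  unfolding null_in_prob_def by (auto intro: order_tendstoD(2))

lemma null_in_probI:
  assumes "\<And>k. Y k \<in> borel_measurable M"
    and "\<And>\<epsilon> \<eta>. \<epsilon> > 0 \<Longrightarrow> \<eta> > 0 \<Longrightarrow> \<forall>\<^sub>F k in sequentially. prob {\<omega> \<in> space M. \<epsilon> \<le> \<bar>Y k \<omega>\<bar>} < \<eta>"
  shows "null_in_prob Y"
  unfolding null_in_prob_def using assms
  by (auto intro!: tendstoI simp: dist_real_def)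

text \<open>Domination is asked for only eventually and off a null set: later comparisons divide by
  indices that are positive for large \<open>k\<close>, and some hold only where the strong law
  does.\<close>

lemma null_in_prob_dominated:
  assumes Y: "null_in_prob Y" and Z: "\<And>k. Z k \<in> borel_measurable M"
    and le: "\<forall>\<^sub>F k in sequentially. AE \<omega> in M. \<bar>Z k \<omega>\<bar> \<le> \<bar>Y k \<omega>\<bar>"
  shows "null_in_prob Z"
proof (rule null_in_probI[OF Z])
  fix \<epsilon> \<eta> :: real assume "\<epsilon> > 0" "\<eta> > 0"
  from null_in_probD[OF Y this] le
  show "\<forall>\<^sub>F k in sequentially. prob {\<omega> \<in> space M. \<epsilon> \<le> \<bar>Z k \<omega>\<bar>} < \<eta>"
  proof eventually_elim
    case (elim k)
    note [measurable] = Z null_in_prob_measurable[OF Y]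
    have "prob {\<omega> \<in> space M. \<epsilon> \<le> \<bar>Z k \<omega>\<bar>} \<le> prob {\<omega> \<in> space M. \<epsilon> \<le> \<bar>Y k \<omega>\<bar>}"
    proof (rule finite_measure_mono_AE)
      show "AE \<omega> in M. \<omega> \<in> {\<omega> \<in> space M. \<epsilon> \<le> \<bar>Z k \<omega>\<bar>} \<longrightarrow> \<omega> \<in> {\<omega> \<in> space M. \<epsilon> \<le> \<bar>Y k \<omega>\<bar>}"
        using elim(2) by eventually_elim auto
    qed measurable
    then show ?case using elim(1) by linarith
  qed
qed

lemma null_in_prob_cong:
  assumes "null_in_prob Y" "\<And>k. Z k \<in> borel_measurable M"
    and "\<forall>\<^sub>F k in sequentially. AE \<omega> in M. Z k \<omega> = Y k \<omega>"
  shows "null_in_prob Z"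
  using assms(3) by (intro null_in_prob_dominated[OF assms(1,2)]) (auto elim!: eventually_mono)

lemma null_in_prob_add:
  assumes Y: "null_in_prob Y" and Z: "null_in_prob Z"
  shows "null_in_prob (\<lambda>k \<omega>. Y k \<omega> + Z k \<omega>)"
proof (rule null_in_probI)
  note [measurable] = null_in_prob_measurable[OF Y] null_in_prob_measurable[OF Z]
  show "(\<lambda>\<omega>. Y k \<omega> + Z k \<omega>) \<in> borel_measurable M" for k by measurable
  fix \<epsilon> \<eta> :: real assume e: "\<epsilon> > 0" "\<eta> > 0"
  then have e2: "\<epsilon> / 2 > 0" "\<eta> / 2 > 0" by auto
  from null_in_probD[OF Y e2] null_in_probD[OF Z e2]
  show "\<forall>\<^sub>F k in sequentially. prob {\<omega> \<in> space M. \<epsilon> \<le> \<bar>Y k \<omega> + Z k \<omega>\<bar>} < \<eta>"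
  proof eventually_elim
    case (elim k)
    have "prob {\<omega> \<in> space M. \<epsilon> \<le> \<bar>Y k \<omega> + Z k \<omega>\<bar>} \<le>
        prob ({\<omega> \<in> space M. \<epsilon> / 2 \<le> \<bar>Y k \<omega>\<bar>} \<union> {\<omega> \<in> space M. \<epsilon> / 2 \<le> \<bar>Z k \<omega>\<bar>})"
      by (rule finite_measure_mono) (auto simp: abs_if split: if_splits)
    also have "\<dots> \<le> prob {\<omega> \<in> space M. \<epsilon> / 2 \<le> \<bar>Y k \<omega>\<bar>} + prob {\<omega> \<in> space M. \<epsilon> / 2 \<le> \<bar>Z k \<omega>\<bar>}"
      by (rule measure_Un_le) measurable
    finally show ?case using elim by linarith
  qed
qed

lemma null_in_prob_AE:
  assumes Y: "\<And>k. Y k \<in> borel_measurable M" and lim: "AE \<omega> in M. (\<lambda>k. Y k \<omega>) \<longlonglongrightarrow> 0"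
  shows "null_in_prob Y"
  unfolding null_in_prob_def
proof (intro conjI allI impI Y)
  fix \<epsilon> :: real assume e: "\<epsilon> > 0"
  note [measurable] = Y
  have "(\<lambda>k. \<integral>\<omega>. indicator {\<omega> \<in> space M. \<epsilon> \<le> \<bar>Y k \<omega>\<bar>} \<omega> \<partial>M) \<longlonglongrightarrow> (\<integral>\<omega>. (0 :: real) \<partial>M)"
  proof (rule integral_dominated_convergence[where w="\<lambda>_. 1"])
    show "AE \<omega> in M. (\<lambda>k. indicator {\<omega> \<in> space M. \<epsilon> \<le> \<bar>Y k \<omega>\<bar>} \<omega>) \<longlonglongrightarrow> (0 :: real)"
      using lim
    proof eventually_elim
      case (elim \<omega>)
      have "\<forall>\<^sub>F k in sequentially. indicator {\<omega> \<in> space M. \<epsilon> \<le> \<bar>Y k \<omega>\<bar>} \<omega> = (0 :: real)"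
        using tendstoD[OF elim e] by eventually_elim (simp add: dist_real_def)
      then show ?case by (rule tendsto_eventually)
    qed
  qed (auto simp: indicator_def)
  then show "(\<lambda>k. prob {\<omega> \<in> space M. \<epsilon> \<le> \<bar>Y k \<omega>\<bar>}) \<longlonglongrightarrow> 0"
    by (simp add: Int_def conj_ac cong: conj_cong)
qed

lemma null_in_prob_const: "c \<longlonglongrightarrow> 0 \<Longrightarrow> null_in_prob (\<lambda>k _. c k)"
  by (rule null_in_prob_AE) auto

lemma null_in_prob_sum:
  "finite I \<Longrightarrow> (\<And>i. i \<in> I \<Longrightarrow> null_in_prob (Y i)) \<Longrightarrow> null_in_prob (\<lambda>k \<omega>. \<Sum>i\<in>I. Y i k \<omega>)"
proof (induction rule: finite_induct)
  case empty
  then show ?case using null_in_prob_const[of "\<lambda>_. 0"] by simp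
next
  case (insert i I)
  then have "null_in_prob (\<lambda>k \<omega>. Y i k \<omega> + (\<Sum>i\<in>I. Y i k \<omega>))" by (intro null_in_prob_add) auto
  then show ?case using insert by simp
qed

lemma null_in_prob_L2:
  assumes Y: "\<And>k. Y k \<in> borel_measurable M" "\<And>k. integrable M (\<lambda>\<omega>. (Y k \<omega>)\<^sup>2)"
    and lim: "(\<lambda>k. \<integral>\<omega>. (Y k \<omega>)\<^sup>2 \<partial>M) \<longlonglongrightarrow> 0"
  shows "null_in_prob Y"
  unfolding null_in_prob_def
proof (intro conjI allI impI Y)
  fix \<epsilon> :: real assume e: "\<epsilon> > 0"
  show "(\<lambda>k. prob {\<omega> \<in> space M. \<epsilon> \<le> \<bar>Y k \<omega>\<bar>}) \<longlonglongrightarrow> 0"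
  proof (rule tendsto_sandwich[OF _ _ tendsto_const])
    show "(\<lambda>k. (\<integral>\<omega>. (Y k \<omega>)\<^sup>2 \<partial>M) / \<epsilon>\<^sup>2) \<longlonglongrightarrow> 0"
      using tendsto_divide[OF lim tendsto_const, of "\<epsilon>\<^sup>2"] e by simp
    show "\<forall>\<^sub>F k in sequentially. prob {\<omega> \<in> space M. \<epsilon> \<le> \<bar>Y k \<omega>\<bar>} \<le> (\<integral>\<omega>. (Y k \<omega>)\<^sup>2 \<partial>M) / \<epsilon>\<^sup>2"
      by (intro always_eventually allI second_moment_method Y e)
  qed simp
qed

lemma bounded_in_prob_L2:
  assumes Y: "\<And>k. Y k \<in> borel_measurable M" "\<And>k. integrable M (\<lambda>\<omega>. (Y k \<omega>)\<^sup>2)"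
    and bound: "\<And>k. (\<integral>\<omega>. (Y k \<omega>)\<^sup>2 \<partial>M) \<le> C"
  shows "bounded_in_prob Y"
  unfolding bounded_in_prob_def
proof (intro conjI allI impI Y)
  fix \<epsilon> :: real assume e: "\<epsilon> > 0"
  have "C \<ge> 0" using bound[of 0] by (rule order_trans[rotated]) simp
  \<comment> \<open>Chebyshev's bound C / K^2 then equals \<epsilon> C / (C + 1), which is strictly
    below \<epsilon> even for C = 0.\<close>
  define K where "K = sqrt ((C + 1) / \<epsilon>)"
  have K: "K > 0" "K\<^sup>2 = (C + 1) / \<epsilon>" using e \<open>C \<ge> 0\<close> by (simp_all add: K_def)
  have "prob {\<omega> \<in> space M. K \<le> \<bar>Y k \<omega>\<bar>} < \<epsilon>" for k
  proof -
    have "prob {\<omega> \<in> space M. K \<le> \<bar>Y k \<omega>\<bar>} \<le> (\<integral>\<omega>. (Y k \<omega>)\<^sup>2 \<partial>M) / K\<^sup>2"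
      by (intro second_moment_method Y K)
    also have "\<dots> \<le> C / K\<^sup>2" by (intro divide_right_mono bound) simp
    also have "\<dots> = \<epsilon> * (C / (C + 1))" unfolding K(2) using e \<open>C \<ge> 0\<close> by simp
    also have "\<dots> < \<epsilon> * 1" using e \<open>C \<ge> 0\<close> by (intro mult_strict_left_mono) auto
    finally show ?thesis by simp
  qed
  then show "\<exists>K>0. \<forall>\<^sub>F k in sequentially. prob {\<omega> \<in> space M. K \<le> \<bar>Y k \<omega>\<bar>} < \<epsilon>"
    using K(1) by (intro exI[of _ K]) simp
qed

lemma null_in_prob_mult_bounded:
  assumes Y: "null_in_prob Y" and Z: "bounded_in_prob Z"
  shows "null_in_prob (\<lambda>k \<omega>. Y k \<omega> * Z k \<omega>)"
proof (rule null_in_probI)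
  note [measurable] = null_in_prob_measurable[OF Y] bounded_in_prob_measurable[OF Z]
  show "(\<lambda>\<omega>. Y k \<omega> * Z k \<omega>) \<in> borel_measurable M" for k by measurable
  fix \<epsilon> \<eta> :: real assume e: "\<epsilon> > 0" "\<eta> > 0"
  then have e2: "\<eta> / 2 > 0" by auto
  then obtain K where K: "K > 0" "\<forall>\<^sub>F k in sequentially. prob {\<omega> \<in> space M. K \<le> \<bar>Z k \<omega>\<bar>} < \<eta> / 2"
    using Z unfolding bounded_in_prob_def by blast
  have "\<epsilon> / K > 0" using e K by simp
  from null_in_probD[OF Y this e2] K(2)
  show "\<forall>\<^sub>F k in sequentially. prob {\<omega> \<in> space M. \<epsilon> \<le> \<bar>Y k \<omega> * Z k \<omega>\<bar>} < \<eta>"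
  proof eventually_elim
    case (elim k)
    have "prob {\<omega> \<in> space M. \<epsilon> \<le> \<bar>Y k \<omega> * Z k \<omega>\<bar>} \<le>
        prob ({\<omega> \<in> space M. \<epsilon> / K \<le> \<bar>Y k \<omega>\<bar>} \<union> {\<omega> \<in> space M. K \<le> \<bar>Z k \<omega>\<bar>})"
    proof (rule finite_measure_mono)
      show "{\<omega> \<in> space M. \<epsilon> \<le> \<bar>Y k \<omega> * Z k \<omega>\<bar>} \<subseteq>
          {\<omega> \<in> space M. \<epsilon> / K \<le> \<bar>Y k \<omega>\<bar>} \<union> {\<omega> \<in> space M. K \<le> \<bar>Z k \<omega>\<bar>}"
      proof (rule subsetI, rule ccontr)
        fix \<omega> assume \<omega>: "\<omega> \<in> {\<omega> \<in> space M. \<epsilon> \<le> \<bar>Y k \<omega> * Z k \<omega>\<bar>}"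
          "\<omega> \<notin> {\<omega> \<in> space M. \<epsilon> / K \<le> \<bar>Y k \<omega>\<bar>} \<union> {\<omega> \<in> space M. K \<le> \<bar>Z k \<omega>\<bar>}"
        then have "\<bar>Y k \<omega>\<bar> < \<epsilon> / K" "\<bar>Z k \<omega>\<bar> < K" by auto
        then have "\<bar>Y k \<omega>\<bar> * \<bar>Z k \<omega>\<bar> < \<epsilon> / K * K" by (intro mult_strict_mono') auto
        then show False using \<omega>(1) K(1) by (simp add: abs_mult)
      qed
    qed measurable
    also have "\<dots> \<le> prob {\<omega> \<in> space M. \<epsilon> / K \<le> \<bar>Y k \<omega>\<bar>} + prob {\<omega> \<in> space M. K \<le> \<bar>Z k \<omega>\<bar>}"
      by (rule measure_Un_le) measurable
    finally show ?case using elim by linarith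
  qed
qed

lemma bounded_in_prob_const: "bounded_in_prob (\<lambda>_ _. c)"
  by (rule bounded_in_prob_L2[where C="c\<^sup>2"]) (auto simp: prob_space)

lemma null_in_prob_cmult: "null_in_prob Y \<Longrightarrow> null_in_prob (\<lambda>k \<omega>. c * Y k \<omega>)"
  using null_in_prob_mult_bounded[OF _ bounded_in_prob_const[of c]] by (simp add: mult.commute)

lemma null_in_prob_diff:
  assumes "null_in_prob Y" "null_in_prob Z"
  shows "null_in_prob (\<lambda>k \<omega>. Y k \<omega> - Z k \<omega>)"
  using null_in_prob_add[OF assms(1) null_in_prob_cmult[OF assms(2), of "-1"]] by simp

lemma bounded_in_prob_add_null:
  assumes Y: "bounded_in_prob Y" and Z: "null_in_prob Z"
  shows "bounded_in_prob (\<lambda>k \<omega>. Y k \<omega> + Z k \<omega>)"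
  unfolding bounded_in_prob_def
proof (intro conjI allI impI)
  note [measurable] = bounded_in_prob_measurable[OF Y] null_in_prob_measurable[OF Z]
  show "(\<lambda>\<omega>. Y k \<omega> + Z k \<omega>) \<in> borel_measurable M" for k by measurable
  fix \<epsilon> :: real assume "\<epsilon> > 0"
  then have e2: "\<epsilon> / 2 > 0" by auto
  then obtain K where K: "K > 0" "\<forall>\<^sub>F k in sequentially. prob {\<omega> \<in> space M. K \<le> \<bar>Y k \<omega>\<bar>} < \<epsilon> / 2"
    using Y unfolding bounded_in_prob_def by blast
  from null_in_probD[OF Z zero_less_one e2] K(2)
  have "\<forall>\<^sub>F k in sequentially. prob {\<omega> \<in> space M. K + 1 \<le> \<bar>Y k \<omega> + Z k \<omega>\<bar>} < \<epsilon>"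
  proof eventually_elim
    case (elim k)
    have "prob {\<omega> \<in> space M. K + 1 \<le> \<bar>Y k \<omega> + Z k \<omega>\<bar>} \<le>
        prob ({\<omega> \<in> space M. 1 \<le> \<bar>Z k \<omega>\<bar>} \<union> {\<omega> \<in> space M. K \<le> \<bar>Y k \<omega>\<bar>})"
      by (rule finite_measure_mono) (auto simp: abs_if split: if_splits)
    also have "\<dots> \<le> prob {\<omega> \<in> space M. 1 \<le> \<bar>Z k \<omega>\<bar>} + prob {\<omega> \<in> space M. K \<le> \<bar>Y k \<omega>\<bar>}"
      by (rule measure_Un_le) measurable
    finally show ?case using elim by linarith
  qed
  then show "\<exists>K>0. \<forall>\<^sub>F k in sequentially. prob {\<omega> \<in> space M. K \<le> \<bar>Y k \<omega> + Z k \<omega>\<bar>} < \<epsilon>"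
    using K(1) by (intro exI[of _ "K + 1"]) simp
qed

lemma null_in_prob_compose:
  "null_in_prob Y \<Longrightarrow> filterlim g sequentially sequentially \<Longrightarrow> null_in_prob (\<lambda>k. Y (g k))"
  unfolding null_in_prob_def by (auto intro: filterlim_compose)

lemma bounded_in_prob_compose:
  "bounded_in_prob Y \<Longrightarrow> filterlim g sequentially sequentially \<Longrightarrow> bounded_in_prob (\<lambda>k. Y (g k))"
  unfolding bounded_in_prob_def
proof (elim conjE, intro conjI allI impI)
  fix \<epsilon> :: real
  assume "filterlim g sequentially sequentially" "\<epsilon> > 0"
    "\<forall>\<epsilon>>0. \<exists>K>0. \<forall>\<^sub>F k in sequentially. prob {\<omega> \<in> space M. K \<le> \<bar>Y k \<omega>\<bar>} < \<epsilon>"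
  then show "\<exists>K>0. \<forall>\<^sub>F k in sequentially. prob {\<omega> \<in> space M. K \<le> \<bar>Y (g k) \<omega>\<bar>} < \<epsilon>"
    using eventually_compose_filterlim[of "\<lambda>k. prob {\<omega> \<in> space M. _ \<le> \<bar>Y k \<omega>\<bar>} < \<epsilon>" sequentially g sequentially]
    by blast
qed auto

text \<open>Where the variables differ by less than \<epsilon>, the exponentials differ by at most
  \<bar>t\<bar> \<epsilon>, because the complex exponential is 1-Lipschitz on the imaginary axis;
  elsewhere they differ by at most 2.\<close>

lemma char_diff_le:
  assumes Y [measurable]: "Y \<in> borel_measurable M" and Z [measurable]: "Z \<in> borel_measurable M" and "\<epsilon> > 0"
  shows "cmod (char (distr M borel Y) t - char (distr M borel Z) t) \<le>
    \<bar>t\<bar> * \<epsilon> + 2 * prob {\<omega> \<in> space M. \<epsilon> \<le> \<bar>Y \<omega> - Z \<omega>\<bar>}"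
proof -
  let ?A = "{\<omega> \<in> space M. \<epsilon> \<le> \<bar>Y \<omega> - Z \<omega>\<bar>}"
  have int: "integrable M (\<lambda>\<omega>. iexp (t * V \<omega>))" if "V \<in> borel_measurable M" for V
    using that by (intro integrable_const_bound[where B=1]) auto
  have "char (distr M borel Y) t - char (distr M borel Z) t = (\<integral>\<omega>. iexp (t * Y \<omega>) - iexp (t * Z \<omega>) \<partial>M)"
    unfolding char_def using int[OF Y] int[OF Z] by (simp add: integral_distr)
  also have "cmod \<dots> \<le> (\<integral>\<omega>. cmod (iexp (t * Y \<omega>) - iexp (t * Z \<omega>)) \<partial>M)"
    by (rule integral_norm_bound)
  also have "\<dots> \<le> (\<integral>\<omega>. \<bar>t\<bar> * \<epsilon> + 2 * indicator ?A \<omega> \<partial>M)"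
  proof (rule integral_mono_AE)
    show "integrable M (\<lambda>\<omega>. cmod (iexp (t * Y \<omega>) - iexp (t * Z \<omega>)))"
      using int[OF Y] int[OF Z] by (intro integrable_norm Bochner_Integration.integrable_diff)
    show "integrable M (\<lambda>\<omega>. \<bar>t\<bar> * \<epsilon> + 2 * indicator ?A \<omega>)"
      by (intro Bochner_Integration.integrable_add integrable_mult_right integrable_const integrable_real_indicator)
        (auto simp: less_top[symmetric])
    show "AE \<omega> in M. cmod (iexp (t * Y \<omega>) - iexp (t * Z \<omega>)) \<le> \<bar>t\<bar> * \<epsilon> + 2 * indicator ?A \<omega>"
      using AE_space
    proof eventually_elim
      case (elim \<omega>)
      show ?case
      proof (cases "\<omega> \<in> ?A")
        case True
        have "cmod (iexp (t * Y \<omega>) - iexp (t * Z \<omega>)) \<le> cmod (iexp (t * Y \<omega>)) + cmod (iexp (t * Z \<omega>))"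
          by (rule norm_triangle_ineq4)
        then show ?thesis using True \<open>\<epsilon> > 0\<close> by (simp add: add_increasing)
      next
        case False
        have "iexp (t * Y \<omega>) = iexp (t * Z \<omega>) * iexp (t * (Y \<omega> - Z \<omega>))"
          by (simp add: exp_add[symmetric] algebra_simps)
        then have "iexp (t * Y \<omega>) - iexp (t * Z \<omega>) = iexp (t * Z \<omega>) * (iexp (t * (Y \<omega> - Z \<omega>)) - 1)"
          by (simp add: algebra_simps)
        then have "cmod (iexp (t * Y \<omega>) - iexp (t * Z \<omega>)) = cmod (iexp (t * (Y \<omega> - Z \<omega>)) - 1)"
          by (simp add: norm_mult)
        also have "\<dots> \<le> \<bar>t * (Y \<omega> - Z \<omega>)\<bar>"
          using iexp_approx1[of "t * (Y \<omega> - Z \<omega>)" 0] by simp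
        also have "\<dots> \<le> \<bar>t\<bar> * \<epsilon>"
          using False elim by (simp add: abs_mult mult_left_mono)
        finally show ?thesis using False by simp
      qed
    qed
  qed
  also have "\<dots> = \<bar>t\<bar> * \<epsilon> + 2 * prob ?A"
    by (simp add: prob_space Int_absorb2 less_top[symmetric])
  finally show ?thesis .
qed

text \<open>Slutsky's theorem for characteristic functions, the form in which Levy's continuity
  theorem later identifies the limit law.\<close>

lemma char_tendsto_cong:
  assumes Y: "\<And>k. Y k \<in> borel_measurable M" and Z: "\<And>k. Z k \<in> borel_measurable M"
    and null: "null_in_prob (\<lambda>k \<omega>. Y k \<omega> - Z k \<omega>)"
    and lim: "(\<lambda>k. char (distr M borel (Z k)) t) \<longlonglongrightarrow> c"
  shows "(\<lambda>k. char (distr M borel (Y k)) t) \<longlonglongrightarrow> c"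
proof -
  have "(\<lambda>k. char (distr M borel (Y k)) t - char (distr M borel (Z k)) t) \<longlonglongrightarrow> 0"
  proof (rule tendstoI)
    fix e :: real assume e: "e > 0"
    define \<epsilon> where "\<epsilon> = e / (2 * (\<bar>t\<bar> + 1))"
    have \<epsilon>: "\<epsilon> > 0" "\<bar>t\<bar> * \<epsilon> \<le> e / 2"
    proof -
      show "\<epsilon> > 0" using e by (simp add: \<epsilon>_def)
      have "\<bar>t\<bar> * \<epsilon> \<le> (\<bar>t\<bar> + 1) * \<epsilon>" using \<open>\<epsilon> > 0\<close> by (intro mult_right_mono) auto
      also have "\<dots> = e / 2"
      proof -
        have "s * (e / (2 * s)) = e / 2" if "s > 0" for s :: real using that by simp
        from this[of "\<bar>t\<bar> + 1"] show ?thesis by (simp add: \<epsilon>_def)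
      qed
      finally show "\<bar>t\<bar> * \<epsilon> \<le> e / 2" .
    qed
    have "e / 4 > 0" using e by simp
    from null_in_probD[OF null \<epsilon>(1) this]
    show "\<forall>\<^sub>F k in sequentially. dist (char (distr M borel (Y k)) t - char (distr M borel (Z k)) t) 0 < e"
    proof eventually_elim
      case (elim k)
      then show ?case using char_diff_le[OF Y[of k] Z[of k] \<epsilon>(1), of t] \<epsilon>(2) by (simp add: dist_norm)
    qed
  qed
  from tendsto_add[OF this lim] show ?thesis by simp
qed

end

section \<open>Normal laws\<close>

text \<open>Scaling the standard normal law includes v = 0, so the facts derived from it need not
  separate the degenerate limit.\<close>

lemma normal_law_eq_distr:
  assumes "v \<ge> 0"
  shows "normal_law 0 v = distr std_normal_distribution borel (\<lambda>x. sqrt v * x)"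
proof (cases "v = 0")
  case True
  interpret prob_space std_normal_distribution by (rule prob_space_normal_density) simp
  have "distr std_normal_distribution borel (\<lambda>x. 0 :: real) = return borel 0"
    by (rule distr_const) simp
  then show ?thesis using True by (simp add: normal_law_def)
next
  case False
  interpret prob_space std_normal_distribution by (rule prob_space_normal_density) simp
  have "distributed std_normal_distribution lborel (\<lambda>x. x) (normal_density 0 1)"
    by (auto simp: distributed_def distr_id2)
  from normal_density_affine[OF this, of "sqrt v" 0] False assms
  have "distributed std_normal_distribution lborel (\<lambda>x. sqrt v * x) (normal_density 0 (sqrt v))"
    by simp
  then have "distr std_normal_distribution lborel (\<lambda>x. sqrt v * x) = density lborel (normal_density 0 (sqrt v))"
    by (simp add: distributed_def)
  moreover have "distr std_normal_distribution lborel (\<lambda>x. sqrt v * x) = distr std_normal_distribution borel (\<lambda>x. sqrt v * x)"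
    by (intro distr_cong) auto
  ultimately show ?thesis using False by (simp add: normal_law_def)
qed

lemma real_distribution_normal_law: "v \<ge> 0 \<Longrightarrow> real_distribution (normal_law 0 v)"
  unfolding normal_law_eq_distr
  by (intro prob_space.real_distribution_distr prob_space_normal_density) auto

lemma char_normal_law:
  assumes "v \<ge> 0"
  shows "char (normal_law 0 v) t = exp (- (t\<^sup>2) * v / 2)"
proof -
  have "char (normal_law 0 v) t = char std_normal_distribution (t * sqrt v)"
    unfolding normal_law_eq_distr[OF assms] char_def by (simp add: integral_distr mult_ac)
  then show ?thesis using assms
    by (simp add: char_std_normal_distribution power_mult_distrib)
qed

lemma normal_law_moments:
  assumes "v \<ge> 0"
  shows "integrable (normal_law 0 v) (\<lambda>x. x\<^sup>2)" "(\<integral>x. x \<partial>normal_law 0 v) = 0"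
  unfolding normal_law_eq_distr[OF assms]
  using integrable_std_normal_distribution_moment[of 2] integral_std_normal_distribution_moment_odd[of 1]
  by (auto simp: integrable_distr_eq integral_distr power_mult_distrib)

section \<open>Deviations at a random index and their linear part\<close>

context L2_kernel
begin

text \<open>Centred at a pure power of \<open>n\<close> and not at the expectation
  \<open>\<mu> * (n choose d)\<close>, because the passage time is found by solving for a power of
  \<open>n\<close>.\<close>

definition deviation :: "nat \<Rightarrow> 'w \<Rightarrow> real" where
  "deviation n \<omega> = ustat d f X n \<omega> - \<mu> / fact d * real n ^ d"

lemma deviation_measurable [measurable]: "deviation n \<in> borel_measurable M"
  unfolding deviation_def[abs_def] using ustat_measurable[OF f_measurable, of n] by measurable

text \<open>The two centrings differ by O(n^(d-1)), which is negligible at the scale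
  n^(d-1/2).\<close>

lemma deviation_binomial:
  "\<exists>C\<ge>0. \<forall>n\<ge>1. \<forall>\<omega>. \<bar>deviation n \<omega> - (ustat d f X n \<omega> - \<mu> * real (n choose d))\<bar> \<le> C * (real n ^ d / real n)"
proof -
  obtain C where C: "C \<ge> 0" "\<And>n. n \<ge> 1 \<Longrightarrow> \<bar>real (n choose d) / real n ^ d - (real n / real n) ^ d / fact d\<bar> \<le> C / real n"
    using binomial_quotient_approx[of 0 d] by (metis diff_zero le_refl zero_le)
  have "\<bar>deviation n \<omega> - (ustat d f X n \<omega> - \<mu> * real (n choose d))\<bar> \<le> \<bar>\<mu>\<bar> * C * (real n ^ d / real n)"
    if n: "n \<ge> 1" for n \<omega>
  proof -
    have n0: "real n ^ d > 0" using n by simp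
    have "deviation n \<omega> - (ustat d f X n \<omega> - \<mu> * real (n choose d)) =
        \<mu> * (real n ^ d * (real (n choose d) / real n ^ d - (real n / real n) ^ d / fact d))"
      using n n0 by (simp add: deviation_def right_diff_distrib)
    then have "\<bar>deviation n \<omega> - (ustat d f X n \<omega> - \<mu> * real (n choose d))\<bar> =
        \<bar>\<mu>\<bar> * (real n ^ d * \<bar>real (n choose d) / real n ^ d - (real n / real n) ^ d / fact d\<bar>)"
      by (simp add: abs_mult)
    also have "\<dots> \<le> \<bar>\<mu>\<bar> * (real n ^ d * (C / real n))"
      using C(2)[OF n] by (intro mult_left_mono) auto
    finally show ?thesis by (simp add: mult_ac)
  qed
  then show ?thesis using C(1) by (intro exI[of _ "\<bar>\<mu>\<bar> * C"]) auto
qed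

text \<open>
  Anscombe's condition. With high probability \<open>N k\<close> lies in a window around \<open>n k\<close> of length
  \<open>\<delta> n k\<close>, and by Kolmogorov's inequality the oscillation of the deviation there is small.
\<close>

lemma deviation_random_index:
  fixes N :: "nat \<Rightarrow> 'w \<Rightarrow> nat" and n :: "nat \<Rightarrow> nat"
  assumes n: "filterlim n sequentially sequentially"
    and N [measurable]: "\<And>k. N k \<in> M \<rightarrow>\<^sub>M count_space UNIV"
    and ratio: "null_in_prob (\<lambda>k \<omega>. real (N k \<omega>) / real (n k) - 1)"
  shows "null_in_prob (\<lambda>k \<omega>. (deviation (N k \<omega>) \<omega> - deviation (n k) \<omega>) / (real (n k) ^ d / sqrt (real (n k))))"
proof (rule null_in_probI)
  have DN: "(\<lambda>\<omega>. deviation (N k \<omega>) \<omega>) \<in> borel_measurable M" for k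
    by (rule measurable_compose_countable[OF deviation_measurable N])
  note [measurable] = DN
  show "(\<lambda>\<omega>. (deviation (N k \<omega>) \<omega> - deviation (n k) \<omega>) / (real (n k) ^ d / sqrt (real (n k)))) \<in> borel_measurable M" for k
    by measurable
  obtain C where C: "C \<ge> 0" "\<And>a b \<epsilon>. 1 \<le> a \<Longrightarrow> a \<le> b \<Longrightarrow> b \<le> 2 * a \<Longrightarrow> \<epsilon> > 0 \<Longrightarrow>
    prob {\<omega> \<in> space M. \<exists>m\<in>{a..b}. 2 * \<epsilon> * (real b ^ d / sqrt (real b)) \<le>
      \<bar>(ustat d f X m \<omega> - \<mu> * real (m choose d)) - (ustat d f X a \<omega> - \<mu> * real (a choose d))\<bar>}
    \<le> C * (real (b - a) / real b) / \<epsilon>\<^sup>2"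
    using window_probability by blast
  obtain C' where C': "C' \<ge> 0" "\<And>m \<omega>. m \<ge> 1 \<Longrightarrow>
      \<bar>deviation m \<omega> - (ustat d f X m \<omega> - \<mu> * real (m choose d))\<bar> \<le> C' * (real m ^ d / real m)"
    using deviation_binomial by blast
  fix \<epsilon> \<eta> :: real assume e: "\<epsilon> > 0" "\<eta> > 0"
  \<comment> \<open>\<open>N k \<omega>\<close> and \<open>n k\<close> are both compared with the
    left end \<open>a\<close>, each at the cost of 2 \<epsilon>' times the scale at
    \<open>b\<close>, which is at most 2^d times the scale at \<open>n k\<close>. This spends
    \<epsilon> / 2; the two changes of centring get the rest.\<close>
  define \<epsilon>' where "\<epsilon>' = \<epsilon> / (8 * 2 ^ d)"
  have \<epsilon>': "\<epsilon>' > 0" using e by (simp add: \<epsilon>'_def)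
  \<comment> \<open>The bound 1/4 yields \<open>b \<le> 2 * a\<close>. The other bound keeps the
    window probability below \<eta> / 2, the window being at most 2 \<delta> n long; its summand 4
    keeps the denominator positive when \<open>C = 0\<close>.\<close>
  define \<delta> where "\<delta> = min (1 / 4) (\<eta> * \<epsilon>'\<^sup>2 / (4 * C + 4))"
  have \<delta>: "\<delta> > 0" "\<delta> \<le> 1 / 4" "C * (2 * \<delta>) / \<epsilon>'\<^sup>2 \<le> \<eta> / 2"
  proof -
    show d0: "\<delta> > 0" using e \<epsilon>' C(1) by (simp add: \<delta>_def add_nonneg_pos)
    show "\<delta> \<le> 1 / 4" unfolding \<delta>_def by (rule min.cobounded1)
    have "\<delta> \<le> \<eta> * \<epsilon>'\<^sup>2 / (4 * C + 4)" by (simp add: \<delta>_def)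
    then have "\<delta> * (4 * C + 4) \<le> \<eta> * \<epsilon>'\<^sup>2" using C(1) by (simp add: pos_le_divide_eq)
    moreover have "4 * (C * \<delta>) \<le> \<delta> * (4 * C + 4)" using d0 by (simp add: algebra_simps)
    ultimately have "C * (2 * \<delta>) \<le> \<eta> / 2 * \<epsilon>'\<^sup>2" by simp
    then show "C * (2 * \<delta>) / \<epsilon>'\<^sup>2 \<le> \<eta> / 2" using \<epsilon>' by (simp add: pos_divide_le_eq)
  qed
  have ev1: "\<forall>\<^sub>F k in sequentially. prob {\<omega> \<in> space M. \<delta> \<le> \<bar>real (N k \<omega>) / real (n k) - 1\<bar>} < \<eta> / 2"
    using e by (intro null_in_probD[OF ratio \<delta>(1)]) auto
  have ev2: "\<forall>\<^sub>F k in sequentially. n k \<ge> 2"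
    using n unfolding filterlim_at_top by blast
  have ev3: "\<forall>\<^sub>F k in sequentially. 4 * C' * 2 ^ d / sqrt (real (n k)) < \<epsilon> / 2"
  proof -
    have "(\<lambda>n. 4 * C' * 2 ^ d / sqrt (real n)) \<longlonglongrightarrow> 0" by real_asymp
    then have "(\<lambda>k. 4 * C' * 2 ^ d / sqrt (real (n k))) \<longlonglongrightarrow> 0" using n by (rule filterlim_compose)
    then show ?thesis using e by (intro order_tendstoD(2)) auto
  qed
  from ev1 ev2 ev3
  show "\<forall>\<^sub>F k in sequentially. prob {\<omega> \<in> space M.
      \<epsilon> \<le> \<bar>(deviation (N k \<omega>) \<omega> - deviation (n k) \<omega>) / (real (n k) ^ d / sqrt (real (n k)))\<bar>} < \<eta>"
  proof eventually_elim
    case (elim k)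
    let ?n = "n k"
    define h where "h = nat \<lfloor>\<delta> * real ?n\<rfloor>"
    define a where "a = ?n - h"
    define b where "b = ?n + h"
    have n0: "real ?n \<ge> 2" using elim(2) by simp
    have h: "real h \<le> \<delta> * real ?n" "\<And>m. real m < \<delta> * real ?n \<Longrightarrow> m \<le> h"
    proof -
      have "0 \<le> \<delta> * real ?n" using \<delta>(1) by simp
      then show "real h \<le> \<delta> * real ?n" by (simp add: h_def)
      show "m \<le> h" if "real m < \<delta> * real ?n" for m
        using that unfolding h_def by (intro le_nat_floor) simp
    qed
    have hn: "real h \<le> real ?n / 4" using h(1) mult_right_mono[OF \<delta>(2), of "real ?n"] by linarith
    have ab: "1 \<le> a" "a \<le> b" "b \<le> 2 * a" "b \<le> 2 * ?n" "b - a = 2 * h" "?n \<in> {a..b}" "b \<ge> ?n"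
    proof -
      have "4 * h \<le> ?n" using hn by linarith
      then show "1 \<le> a" "a \<le> b" "b \<le> 2 * a" "b \<le> 2 * ?n" "b - a = 2 * h" "?n \<in> {a..b}" "b \<ge> ?n"
        using elim(2) by (auto simp: a_def b_def)
    qed
    let ?V = "\<lambda>m \<omega>. ustat d f X m \<omega> - \<mu> * real (m choose d)"
    let ?c = "\<lambda>n. real n ^ d / sqrt (real n)"
    define B where "B = {\<omega> \<in> space M. \<exists>m\<in>{a..b}. 2 * \<epsilon>' * ?c b \<le> \<bar>?V m \<omega> - ?V a \<omega>\<bar>}"
    have Bm [measurable]: "B \<in> sets M"
      unfolding B_def using ustat_measurable[OF f_measurable] by measurable
    have "prob B \<le> C * (real (b - a) / real b) / \<epsilon>'\<^sup>2"
      unfolding B_def using ab \<epsilon>' by (intro C(2))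
    also have "\<dots> \<le> C * (2 * \<delta>) / \<epsilon>'\<^sup>2"
    proof (intro divide_right_mono mult_left_mono C(1))
      have "real (b - a) \<le> 2 * \<delta> * real ?n" using h(1) ab(5) by simp
      also have "\<dots> \<le> 2 * \<delta> * real b" using ab(7) \<delta>(1) by (intro mult_left_mono) auto
      finally show "real (b - a) / real b \<le> 2 * \<delta>" using ab n0 by (simp add: pos_divide_le_eq)
    qed simp
    also note \<delta>(3)
    finally have PB: "prob B \<le> \<eta> / 2" .
    have cb: "?c b \<le> 2 ^ d * ?c ?n"
    proof -
      have "?c b \<le> real b ^ d / sqrt (real ?n)"
        using ab(7) n0 by (intro divide_left_mono) auto
      also have "\<dots> \<le> (2 * real ?n) ^ d / sqrt (real ?n)"
        using ab(4) by (intro divide_right_mono power_mono) auto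
      finally show ?thesis by (simp add: power_mult_distrib)
    qed
    have "prob {\<omega> \<in> space M. \<epsilon> \<le> \<bar>(deviation (N k \<omega>) \<omega> - deviation ?n \<omega>) / ?c ?n\<bar>} \<le>
        prob (B \<union> {\<omega> \<in> space M. \<delta> \<le> \<bar>real (N k \<omega>) / real ?n - 1\<bar>})"
    proof (rule finite_measure_mono)
      show "{\<omega> \<in> space M. \<epsilon> \<le> \<bar>(deviation (N k \<omega>) \<omega> - deviation ?n \<omega>) / ?c ?n\<bar>} \<subseteq>
          B \<union> {\<omega> \<in> space M. \<delta> \<le> \<bar>real (N k \<omega>) / real ?n - 1\<bar>}"
      proof (rule subsetI, rule ccontr)
        fix \<omega> assume \<omega>: "\<omega> \<in> {\<omega> \<in> space M. \<epsilon> \<le> \<bar>(deviation (N k \<omega>) \<omega> - deviation ?n \<omega>) / ?c ?n\<bar>}"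
          "\<omega> \<notin> B \<union> {\<omega> \<in> space M. \<delta> \<le> \<bar>real (N k \<omega>) / real ?n - 1\<bar>}"
        let ?N = "N k \<omega>"
        have "\<bar>real ?N / real ?n - 1\<bar> < \<delta>" using \<omega> by auto
        then have "\<bar>real ?N / real ?n - 1\<bar> * real ?n < \<delta> * real ?n" using n0 by (intro mult_strict_right_mono) auto
        moreover have "\<bar>real ?N / real ?n - 1\<bar> * real ?n = \<bar>real ?N - real ?n\<bar>"
        proof -
          have "\<bar>real ?N / real ?n - 1\<bar> * \<bar>real ?n\<bar> = \<bar>real ?N - real ?n\<bar>"
            unfolding abs_mult[symmetric] using n0 by (simp add: left_diff_distrib)
          then show ?thesis by simp
        qed
        ultimately have "\<bar>real ?N - real ?n\<bar> < \<delta> * real ?n" by simp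
        then have "real (?N - ?n) < \<delta> * real ?n" "real (?n - ?N) < \<delta> * real ?n" by linarith+
        then have "?N - ?n \<le> h" "?n - ?N \<le> h" using h(2) by auto
        then have N: "?N \<in> {a..b}" by (auto simp: a_def b_def)
        have near: "\<bar>?V m \<omega> - ?V a \<omega>\<bar> < 2 * \<epsilon>' * ?c b" if "m \<in> {a..b}" for m
          using \<omega> that unfolding B_def by (auto simp: not_le)
        have dev: "\<bar>deviation m \<omega> - ?V m \<omega>\<bar> \<le> 2 * C' * 2 ^ d / sqrt (real ?n) * ?c ?n" if m: "m \<in> {a..b}" for m
        proof -
          have m1: "m \<ge> 1" "real m \<ge> real ?n / 2" "real m \<le> 2 * real ?n"
          proof -
            show "m \<ge> 1" "real m \<le> 2 * real ?n" using m ab by auto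
            have "real a \<ge> real ?n - real h" by (simp add: a_def)
            moreover have "real m \<ge> real a" using m by simp
            ultimately show "real m \<ge> real ?n / 2" using hn n0 by linarith
          qed
          have "\<bar>deviation m \<omega> - ?V m \<omega>\<bar> \<le> C' * (real m ^ d / real m)" by (rule C'(2)[OF m1(1)])
          also have "\<dots> \<le> C' * ((2 * real ?n) ^ d / (real ?n / 2))"
            using m1 n0 C'(1) by (intro mult_left_mono frac_le power_mono) auto
          also have "\<dots> = 2 * C' * 2 ^ d * (real ?n ^ d / real ?n)" by (simp add: power_mult_distrib)
          also have "real ?n ^ d / real ?n = ?c ?n / sqrt (real ?n)"
            by simp
          finally show ?thesis by simp
        qed
        have "\<bar>deviation ?N \<omega> - deviation ?n \<omega>\<bar> \<le> \<bar>deviation ?N \<omega> - ?V ?N \<omega>\<bar> + \<bar>?V ?N \<omega> - ?V a \<omega>\<bar>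
            + \<bar>?V ?n \<omega> - ?V a \<omega>\<bar> + \<bar>deviation ?n \<omega> - ?V ?n \<omega>\<bar>"
          by linarith
        also have "\<dots> < 2 * C' * 2 ^ d / sqrt (real ?n) * ?c ?n + 2 * \<epsilon>' * ?c b + 2 * \<epsilon>' * ?c b + 2 * C' * 2 ^ d / sqrt (real ?n) * ?c ?n"
          using dev[OF N] dev[OF ab(6)] near[OF N] near[OF ab(6)] by linarith
        also have "\<dots> = 4 * C' * 2 ^ d / sqrt (real ?n) * ?c ?n + 4 * \<epsilon>' * ?c b" by (simp add: mult_ac)
        also have "\<dots> \<le> \<epsilon> / 2 * ?c ?n + 4 * \<epsilon>' * (2 ^ d * ?c ?n)"
          using elim(3) \<epsilon>' cb by (intro add_mono mult_right_mono mult_left_mono) auto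
        also have "\<dots> = \<epsilon> * ?c ?n" by (simp add: \<epsilon>'_def)
        finally have "\<bar>deviation ?N \<omega> - deviation ?n \<omega>\<bar> < \<epsilon> * ?c ?n" .
        moreover have "?c ?n > 0" using n0 by simp
        moreover have "\<bar>u / c\<bar> < \<epsilon>" if "\<bar>u\<bar> < \<epsilon> * c" "c > 0" for u c :: real
          using that by (simp add: pos_divide_less_eq)
        ultimately have "\<bar>(deviation ?N \<omega> - deviation ?n \<omega>) / ?c ?n\<bar> < \<epsilon>" by blast
        then show False using \<omega>(1) by simp
      qed
    qed measurable
    also have "\<dots> \<le> prob B + prob {\<omega> \<in> space M. \<delta> \<le> \<bar>real (N k \<omega>) / real ?n - 1\<bar>}"
      by (rule measure_Un_le) measurable
    finally show ?case using PB elim(1) by linarith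
  qed
qed

text \<open>The first-order part of the deviation at \<open>n\<close>, already divided by n^(d-1/2)
  and with the combinatorial weights replaced by their limits.\<close>

definition linear_part :: "nat \<Rightarrow> 'w \<Rightarrow> real" where
  "linear_part n \<omega> = (\<Sum>m\<in>{1..n}. \<Sum>p\<in>{1..d}. psi p d (real m / real n) 1 * \<phi> p (X m \<omega>)) / sqrt (real n)"

lemma proj_X_measurable: "p \<in> {1..d} \<Longrightarrow> (\<lambda>\<omega>. \<phi> p (X m \<omega>)) \<in> borel_measurable M"
  by (rule measurable_compose[OF X_measurable proj_measurable])

lemma expectation_square_weighted:
  assumes p: "p \<in> {1..d}"
  shows "integrable M (\<lambda>\<omega>. (\<Sum>m\<in>{1..n}. c m * \<phi> p (X m \<omega>))\<^sup>2)"
    and "(\<integral>\<omega>. (\<Sum>m\<in>{1..n}. c m * \<phi> p (X m \<omega>))\<^sup>2 \<partial>M) = (\<Sum>m\<in>{1..n}. (c m)\<^sup>2) * (\<integral>\<omega>. (\<phi> p (X 0 \<omega>))\<^sup>2 \<partial>M)"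
proof -
  have sq: "integrable M (\<lambda>\<omega>. (c m * \<phi> p (X m \<omega>))\<^sup>2)" for m
    unfolding power_mult_distrib by (intro integrable_mult_right proj_square_integrable p)
  show "integrable M (\<lambda>\<omega>. (\<Sum>m\<in>{1..n}. c m * \<phi> p (X m \<omega>))\<^sup>2)"
    using proj_X_measurable[OF p] by (intro integrable_square_sum sq) auto
  have m2: "(\<lambda>x. (\<phi> p x)\<^sup>2) \<in> borel_measurable S" using proj_measurable[OF p] by measurable
  have "(\<integral>\<omega>. (\<Sum>m\<in>{1..n}. c m * \<phi> p (X m \<omega>))\<^sup>2 \<partial>M) = (\<Sum>m\<in>{1..n}. \<integral>\<omega>. (c m * \<phi> p (X m \<omega>))\<^sup>2 \<partial>M)"
    using proj_measurable[OF p] proj_expectation[OF p] sq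
    by (intro expectation_square_sum_X[where y="\<lambda>m x. c m * \<phi> p x"]) auto
  also have "\<dots> = (\<Sum>m\<in>{1..n}. (c m)\<^sup>2 * (\<integral>\<omega>. (\<phi> p (X 0 \<omega>))\<^sup>2 \<partial>M))"
  proof (intro sum.cong refl)
    fix m
    show "(\<integral>\<omega>. (c m * \<phi> p (X m \<omega>))\<^sup>2 \<partial>M) = (c m)\<^sup>2 * (\<integral>\<omega>. (\<phi> p (X 0 \<omega>))\<^sup>2 \<partial>M)"
      using integral_X[OF m2, of m] by (simp add: power_mult_distrib)
  qed
  finally show "(\<integral>\<omega>. (\<Sum>m\<in>{1..n}. c m * \<phi> p (X m \<omega>))\<^sup>2 \<partial>M) = (\<Sum>m\<in>{1..n}. (c m)\<^sup>2) * (\<integral>\<omega>. (\<phi> p (X 0 \<omega>))\<^sup>2 \<partial>M)"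
    by (simp add: sum_distrib_right)
qed

lemma sum_inc_tuples_proj:
  assumes p: "p \<in> {1..d}"
  shows "(\<Sum>i\<in>inc_tuples d n. \<phi> p (X (i p) \<omega>)) =
    (\<Sum>m\<in>{1..n}. real ((m - 1 choose (p - 1)) * (n - m choose (d - p))) * \<phi> p (X m \<omega>))"
proof -
  have "(\<Sum>i\<in>inc_tuples d n. \<phi> p (X (i p) \<omega>)) = (\<Sum>m\<in>{1..n}. \<Sum>i\<in>{i \<in> inc_tuples d n. i p = m}. \<phi> p (X (i p) \<omega>))"
    using inc_tuples_range[OF _ p] by (intro sum.group[symmetric]) auto
  also have "\<dots> = (\<Sum>m\<in>{1..n}. real (card {i \<in> inc_tuples d n. i p = m}) * \<phi> p (X m \<omega>))"
    by (intro sum.cong refl) simp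
  also have "\<dots> = (\<Sum>m\<in>{1..n}. real ((m - 1 choose (p - 1)) * (n - m choose (d - p))) * \<phi> p (X m \<omega>))"
    by (intro sum.cong refl) (simp only: card_inc_tuples_at[OF p])
  finally show ?thesis .
qed

lemma linear_part_measurable [measurable]: "linear_part n \<in> borel_measurable M"
  unfolding linear_part_def[abs_def]
  by (intro borel_measurable_divide borel_measurable_sum borel_measurable_times borel_measurable_const proj_X_measurable)

text \<open>Three errors are separated, each null at the scale n^(d-1/2): exact weights against
  limiting ones, the kernel remainder without first-order terms, and the change of centring.\<close>

lemma deviation_linear_part:
  "null_in_prob (\<lambda>n \<omega>. deviation n \<omega> / (real n ^ d / sqrt (real n)) - linear_part n \<omega>)"
proof -
  define w where "w n p m = real ((m - 1 choose (p - 1)) * (n - m choose (d - p)))" for n p m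
  define c where "c n p m = w n p m / real n ^ (d - 1) - psi p d (real m / real n) 1" for n p m
  define R where "R n \<omega> = (\<Sum>i\<in>inc_tuples d n. resid d f {1..d} (tup d i \<omega>))" for n \<omega>
  have "\<exists>C\<ge>0. \<forall>m n. 1 \<le> m \<and> m \<le> n \<longrightarrow> \<bar>c n p m\<bar> \<le> C / real n" if "p \<in> {1..d}" for p
    using weight_approx[OF that] unfolding c_def w_def .
  then obtain C where C: "\<And>p. p \<in> {1..d} \<Longrightarrow> C p \<ge> 0"
    "\<And>p m n. p \<in> {1..d} \<Longrightarrow> 1 \<le> m \<Longrightarrow> m \<le> n \<Longrightarrow> \<bar>c n p m\<bar> \<le> C p / real n" by metis
  \<comment> \<open>Orthogonal summands: \<open>n\<close> squared coefficients of size at most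
    (C/n)^2, divided by \<open>n\<close>, give a second moment of order n^(-2).\<close>
  have part1: "null_in_prob (\<lambda>n \<omega>. \<Sum>p\<in>{1..d}. (\<Sum>m\<in>{1..n}. c n p m * \<phi> p (X m \<omega>)) / sqrt (real n))"
  proof (rule null_in_prob_sum)
    fix p assume p: "p \<in> {1..d}"
    let ?s = "\<integral>\<omega>. (\<phi> p (X 0 \<omega>))\<^sup>2 \<partial>M"
    show "null_in_prob (\<lambda>n \<omega>. (\<Sum>m\<in>{1..n}. c n p m * \<phi> p (X m \<omega>)) / sqrt (real n))"
    proof (rule null_in_prob_L2)
      show "(\<lambda>\<omega>. (\<Sum>m\<in>{1..n}. c n p m * \<phi> p (X m \<omega>)) / sqrt (real n)) \<in> borel_measurable M" for n
        using proj_X_measurable[OF p] by measurable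
      show "integrable M (\<lambda>\<omega>. ((\<Sum>m\<in>{1..n}. c n p m * \<phi> p (X m \<omega>)) / sqrt (real n))\<^sup>2)" for n
        unfolding power_divide by (intro integrable_divide expectation_square_weighted p)
      show "(\<lambda>n. \<integral>\<omega>. ((\<Sum>m\<in>{1..n}. c n p m * \<phi> p (X m \<omega>)) / sqrt (real n))\<^sup>2 \<partial>M) \<longlonglongrightarrow> 0"
      proof (rule tendsto_sandwich[OF _ _ tendsto_const])
        have "(\<lambda>n. (C p)\<^sup>2 / (real n * real n)) \<longlonglongrightarrow> 0" by real_asymp
        from tendsto_mult[OF this tendsto_const[of ?s]]
        show "(\<lambda>n. (C p)\<^sup>2 / (real n * real n) * ?s) \<longlonglongrightarrow> 0" by simp
        show "\<forall>\<^sub>F n in sequentially. (\<integral>\<omega>. ((\<Sum>m\<in>{1..n}. c n p m * \<phi> p (X m \<omega>)) / sqrt (real n))\<^sup>2 \<partial>M)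
            \<le> (C p)\<^sup>2 / (real n * real n) * ?s"
          using eventually_ge_at_top[of 1]
        proof eventually_elim
          case (elim n)
          have "(\<integral>\<omega>. ((\<Sum>m\<in>{1..n}. c n p m * \<phi> p (X m \<omega>)) / sqrt (real n))\<^sup>2 \<partial>M) =
              (\<Sum>m\<in>{1..n}. (c n p m)\<^sup>2) * ?s / real n"
            unfolding power_divide by (simp add: expectation_square_weighted[OF p])
          also have "\<dots> \<le> (\<Sum>m\<in>{1..n}. (C p / real n)\<^sup>2) * ?s / real n"
          proof (intro divide_right_mono mult_right_mono sum_mono)
            fix m assume "m \<in> {1..n}"
            then have "\<bar>c n p m\<bar>\<^sup>2 \<le> (C p / real n)\<^sup>2" using C(2)[OF p] by (intro power_mono) auto
            then show "(c n p m)\<^sup>2 \<le> (C p / real n)\<^sup>2" by simp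
          qed auto
          also have "\<dots> = (C p)\<^sup>2 / (real n * real n) * ?s"
            using elim by (simp add: power_divide power2_eq_square)
          finally show ?case .
        qed
      qed simp
    qed
  qed simp
  have Q: "{1..d} \<subseteq> {1..d}" by simp
  have R_meas: "R n \<in> borel_measurable M" for n
    unfolding R_def[abs_def]
    by (intro borel_measurable_sum measurable_compose[OF tup_measurable resid_measurable[OF Q]])
  have R_sq: "integrable M (\<lambda>\<omega>. (R n \<omega>)\<^sup>2)" for n
    unfolding R_def
  proof (rule integrable_square_sum)
    have m2: "(\<lambda>y. (resid d f {1..d} y)\<^sup>2) \<in> borel_measurable (Pi\<^sub>M {1..d} (\<lambda>_. S))"
      using resid_measurable[OF Q] by measurable
    fix i assume i: "i \<in> inc_tuples d n"
    from integrable_tup[OF m2 inc_tuples_inj[OF i]] resid_square_integrable[OF Q]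
    show "integrable M (\<lambda>\<omega>. (resid d f {1..d} (tup d i \<omega>))\<^sup>2)" by blast
    show "(\<lambda>\<omega>. resid d f {1..d} (tup d i \<omega>)) \<in> borel_measurable M"
      by (rule measurable_compose[OF tup_measurable resid_measurable[OF Q]])
  qed simp
  obtain CR where CR: "CR \<ge> 0" "\<And>n. (\<integral>\<omega>. (R n \<omega>)\<^sup>2 \<partial>M) * real n ^ 2 \<le> CR * real n ^ (2 * d)"
    using expectation_square_remainder_le unfolding R_def by blast
  have part2: "null_in_prob (\<lambda>n \<omega>. R n \<omega> / (real n ^ d / sqrt (real n)))"
  proof (rule null_in_prob_L2)
    show "(\<lambda>\<omega>. R n \<omega> / (real n ^ d / sqrt (real n))) \<in> borel_measurable M" for n
      using R_meas by measurable
    show "integrable M (\<lambda>\<omega>. (R n \<omega> / (real n ^ d / sqrt (real n)))\<^sup>2)" for n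
      unfolding power_divide by (intro integrable_divide R_sq)
    show "(\<lambda>n. \<integral>\<omega>. (R n \<omega> / (real n ^ d / sqrt (real n)))\<^sup>2 \<partial>M) \<longlonglongrightarrow> 0"
    proof (rule tendsto_sandwich[OF _ _ tendsto_const])
      show "(\<lambda>n. CR / real n) \<longlonglongrightarrow> 0" by real_asymp
      show "\<forall>\<^sub>F n in sequentially. (\<integral>\<omega>. (R n \<omega> / (real n ^ d / sqrt (real n)))\<^sup>2 \<partial>M) \<le> CR / real n"
        using eventually_ge_at_top[of 1]
      proof eventually_elim
        case (elim n)
        then have n0: "real n > 0" by simp
        have c2: "(real n ^ d / sqrt (real n))\<^sup>2 = real n ^ (2 * d) / real n"
          using n0 by (simp add: power_divide power_mult[symmetric] mult.commute)
        have "(\<integral>\<omega>. (R n \<omega> / (real n ^ d / sqrt (real n)))\<^sup>2 \<partial>M) = (\<integral>\<omega>. (R n \<omega>)\<^sup>2 \<partial>M) / (real n ^ (2 * d) / real n)"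
          unfolding power_divide[of "R n _"] c2 by simp
        also have "\<dots> \<le> (CR * real n ^ (2 * d) / real n ^ 2) / (real n ^ (2 * d) / real n)"
          using CR(2)[of n] n0 by (intro divide_right_mono) (auto simp: pos_le_divide_eq)
        also have "\<dots> = CR / real n" using n0 by (simp add: power2_eq_square)
        finally show ?case .
      qed
    qed simp
  qed
  obtain C' where C': "C' \<ge> 0" "\<And>m \<omega>. m \<ge> 1 \<Longrightarrow>
      \<bar>deviation m \<omega> - (ustat d f X m \<omega> - \<mu> * real (m choose d))\<bar> \<le> C' * (real m ^ d / real m)"
    using deviation_binomial by blast
  have part3: "null_in_prob (\<lambda>n \<omega>. (deviation n \<omega> - (ustat d f X n \<omega> - \<mu> * real (n choose d))) / (real n ^ d / sqrt (real n)))"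
  proof (rule null_in_prob_dominated)
    have "(\<lambda>n. C' / sqrt (real n)) \<longlonglongrightarrow> 0" by real_asymp
    then show "null_in_prob (\<lambda>n _. C' / sqrt (real n))" by (rule null_in_prob_const)
    show "(\<lambda>\<omega>. (deviation n \<omega> - (ustat d f X n \<omega> - \<mu> * real (n choose d))) / (real n ^ d / sqrt (real n))) \<in> borel_measurable M" for n
      using ustat_measurable[OF f_measurable, of n] by measurable
    show "\<forall>\<^sub>F n in sequentially. AE \<omega> in M.
        \<bar>(deviation n \<omega> - (ustat d f X n \<omega> - \<mu> * real (n choose d))) / (real n ^ d / sqrt (real n))\<bar> \<le> \<bar>C' / sqrt (real n)\<bar>"
      using eventually_ge_at_top[of 1]
    proof eventually_elim
      case (elim n)
      then have n0: "real n > 0" by simp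
      show ?case
      proof (rule AE_I2)
        fix \<omega>
        have "\<bar>(deviation n \<omega> - (ustat d f X n \<omega> - \<mu> * real (n choose d))) / (real n ^ d / sqrt (real n))\<bar> \<le>
            C' * (real n ^ d / real n) / (real n ^ d / sqrt (real n))"
          using C'(2)[OF elim, of \<omega>] n0 unfolding abs_divide by (intro frac_le) auto
        also have "\<dots> = C' * (sqrt (real n) / real n)" using n0 by simp
        also have "sqrt (real n) / real n = 1 / sqrt (real n)" by (rule sqrt_divide_self_eq[THEN trans]) (auto simp: inverse_eq_divide)
        finally show "\<bar>(deviation n \<omega> - (ustat d f X n \<omega> - \<mu> * real (n choose d))) / (real n ^ d / sqrt (real n))\<bar> \<le> \<bar>C' / sqrt (real n)\<bar>"
          using C'(1) by simp
      qed
    qed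
  qed
  have "null_in_prob (\<lambda>n \<omega>. (\<Sum>p\<in>{1..d}. (\<Sum>m\<in>{1..n}. c n p m * \<phi> p (X m \<omega>)) / sqrt (real n)) +
      R n \<omega> / (real n ^ d / sqrt (real n)) +
      (deviation n \<omega> - (ustat d f X n \<omega> - \<mu> * real (n choose d))) / (real n ^ d / sqrt (real n)))"
    by (intro null_in_prob_add part1 part2 part3)
  then show ?thesis
  proof (rule null_in_prob_cong)
    show "(\<lambda>\<omega>. deviation n \<omega> / (real n ^ d / sqrt (real n)) - linear_part n \<omega>) \<in> borel_measurable M" for n
      by measurable
    show "\<forall>\<^sub>F n in sequentially. AE \<omega> in M. deviation n \<omega> / (real n ^ d / sqrt (real n)) - linear_part n \<omega> =
      (\<Sum>p\<in>{1..d}. (\<Sum>m\<in>{1..n}. c n p m * \<phi> p (X m \<omega>)) / sqrt (real n)) +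
      R n \<omega> / (real n ^ d / sqrt (real n)) +
      (deviation n \<omega> - (ustat d f X n \<omega> - \<mu> * real (n choose d))) / (real n ^ d / sqrt (real n))"
      using eventually_ge_at_top[of 1]
    proof eventually_elim
      case (elim n)
      then have n0: "real n > 0" by simp
      let ?L = "\<lambda>\<omega>. \<Sum>p\<in>{1..d}. \<Sum>m\<in>{1..n}. w n p m * \<phi> p (X m \<omega>)"
      have U: "ustat d f X n \<omega> - \<mu> * real (n choose d) = R n \<omega> + ?L \<omega>" for \<omega>
      proof -
        have "R n \<omega> = (\<Sum>i\<in>inc_tuples d n. f (tup d i \<omega>)) - \<mu> * real (n choose d) - (\<Sum>i\<in>inc_tuples d n. \<Sum>p\<in>{1..d}. \<phi> p (X (i p) \<omega>))"
          by (simp add: R_def resid_tup[OF Q] sum_subtractf card_inc_tuples)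
        also have "(\<Sum>i\<in>inc_tuples d n. \<Sum>p\<in>{1..d}. \<phi> p (X (i p) \<omega>)) = (\<Sum>p\<in>{1..d}. \<Sum>i\<in>inc_tuples d n. \<phi> p (X (i p) \<omega>))"
          by (rule sum.swap)
        also have "\<dots> = ?L \<omega>" by (intro sum.cong refl) (simp only: sum_inc_tuples_proj w_def)
        finally show ?thesis unfolding ustat_eq tup_def[symmetric] by simp
      qed
      have "?L \<omega> / (real n ^ d / sqrt (real n)) - linear_part n \<omega> = (\<Sum>p\<in>{1..d}. (\<Sum>m\<in>{1..n}. c n p m * \<phi> p (X m \<omega>)) / sqrt (real n))" for \<omega>
      proof -
        have "?L \<omega> / (real n ^ d / sqrt (real n)) = (\<Sum>p\<in>{1..d}. \<Sum>m\<in>{1..n}. w n p m / real n ^ (d - 1) * \<phi> p (X m \<omega>)) / sqrt (real n)"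
        proof -
          have "real n ^ d = real n ^ (d - 1) * (sqrt (real n) * sqrt (real n))"
            using d_pos by (cases d) auto
          then have "real n ^ d / sqrt (real n) = real n ^ (d - 1) * (sqrt (real n) * sqrt (real n)) / sqrt (real n)" by (simp only:)
          also have "\<dots> = real n ^ (d - 1) * sqrt (real n)"
            using n0 by (simp del: real_sqrt_mult_self)
          finally have "real n ^ d / sqrt (real n) = real n ^ (d - 1) * sqrt (real n)" .
          then show ?thesis by (simp add: sum_divide_distrib)
        qed
        moreover have "linear_part n \<omega> = (\<Sum>p\<in>{1..d}. \<Sum>m\<in>{1..n}. psi p d (real m / real n) 1 * \<phi> p (X m \<omega>)) / sqrt (real n)"
          unfolding linear_part_def by (subst sum.swap) simp
        ultimately show ?thesis
          by (simp add: c_def left_diff_distrib sum_subtractf sum_divide_distrib diff_divide_distrib)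
      qed
      note L = this
      show ?case
      proof (rule AE_I2)
        fix \<omega>
        show "deviation n \<omega> / (real n ^ d / sqrt (real n)) - linear_part n \<omega> =
          (\<Sum>p\<in>{1..d}. (\<Sum>m\<in>{1..n}. c n p m * \<phi> p (X m \<omega>)) / sqrt (real n)) +
          R n \<omega> / (real n ^ d / sqrt (real n)) +
          (deviation n \<omega> - (ustat d f X n \<omega> - \<mu> * real (n choose d))) / (real n ^ d / sqrt (real n))"
        proof -
          have "u / c - l = L / c - l + R / c + (u - (R + L)) / c" for u c l L R :: real
            by (simp add: diff_divide_distrib add_divide_distrib)
          then show ?thesis unfolding L[symmetric] U .
        qed
      qed
    qed
  qed
qed

end

section \<open>Central limit theorem for weighted sums\<close>

text \<open>For the upper bound, exp(-x) is at most 1 / (1 + x), and (1 - x + x^2)(1 + x) = 1 +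
  x^3.\<close>

lemma exp_minus_taylor:
  fixes x :: real
  assumes "x \<ge> 0"
  shows "\<bar>(1 - x) - exp (- x)\<bar> \<le> x\<^sup>2"
proof -
  have "1 - x \<le> exp (- x)" using exp_ge_add_one_self[of "- x"] by simp
  moreover have "exp (- x) \<le> 1 - x + x\<^sup>2"
  proof -
    have "exp (- x) = inverse (exp x)" by (rule exp_minus)
    also have "\<dots> \<le> inverse (1 + x)"
      using assms exp_ge_add_one_self[of x] by (intro le_imp_inverse_le) auto
    also have "\<dots> \<le> 1 - x + x\<^sup>2"
    proof -
      have "1 \<le> (1 - x + x\<^sup>2) * (1 + x)"
        using assms by (simp add: algebra_simps power2_eq_square power3_eq_cube[symmetric])
      then show ?thesis using assms by (simp add: inverse_eq_divide pos_divide_le_eq)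
    qed
    finally show ?thesis .
  qed
  ultimately show ?thesis by simp
qed

text \<open>Lindeberg's condition in terms of characteristic functions: factors are compared one by
  one with exponentials of their variances, and Riemann sums turn the averaged variances into
  integrals. All components share the variable X_m, so the product runs over \<open>m\<close> only
  and their correlations enter \<open>v\<close>.\<close>

lemma (in iid_sequence) weighted_clt_char:
  fixes Y :: "'k \<Rightarrow> 's \<Rightarrow> real" and \<psi> :: "'k \<Rightarrow> real \<Rightarrow> real"
  assumes J: "finite J"
    and Y: "\<And>k. k \<in> J \<Longrightarrow> Y k \<in> borel_measurable S"
    and sq: "\<And>k. k \<in> J \<Longrightarrow> integrable M (\<lambda>\<omega>. (Y k (X 0 \<omega>))\<^sup>2)"
    and mean: "\<And>k. k \<in> J \<Longrightarrow> (\<integral>\<omega>. Y k (X 0 \<omega>) \<partial>M) = 0"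
    and \<psi>: "\<And>k. k \<in> J \<Longrightarrow> continuous_on {0..1} (\<psi> k)"
  defines "v \<equiv> \<Sum>k\<in>J. \<Sum>l\<in>J. (\<integral>\<omega>. Y k (X 0 \<omega>) * Y l (X 0 \<omega>) \<partial>M) * integral {0..1} (\<lambda>s. \<psi> k s * \<psi> l s)"
  shows "(\<lambda>n. char (distr M borel (\<lambda>\<omega>. (\<Sum>m\<in>{1..n}. \<Sum>k\<in>J. \<psi> k (real m / real n) * Y k (X m \<omega>)) / sqrt (real n))) t)
    \<longlonglongrightarrow> complex_of_real (exp (- (t\<^sup>2) * v / 2))"
proof -
  have YX: "(\<lambda>\<omega>. Y k (X m \<omega>)) \<in> borel_measurable M" if "k \<in> J" for k m
    by (rule measurable_compose[OF X_measurable Y[OF that]])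
  have int1: "integrable M (\<lambda>\<omega>. Y k (X 0 \<omega>))" if "k \<in> J" for k
    by (rule square_integrable_imp_integrable[OF YX sq]) (use that in auto)
  have "\<exists>K. \<forall>k\<in>J. \<forall>s\<in>{0..1}. \<bar>\<psi> k s\<bar> \<le> K"
    using J \<psi>
  proof (induction rule: finite_induct)
    case (insert k J)
    then obtain K where K: "\<forall>k\<in>J. \<forall>s\<in>{0..1}. \<bar>\<psi> k s\<bar> \<le> K" by auto
    have "bounded (\<psi> k ` {0..1})" using insert.prems by (intro compact_imp_bounded compact_continuous_image) auto
    then obtain K' where "\<forall>s\<in>{0..1}. \<bar>\<psi> k s\<bar> \<le> K'" by (auto simp: bounded_iff)
    then show ?case using K by (intro exI[of _ "max K K'"]) (auto simp: le_max_iff_disj)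
  qed auto
  then obtain K where K: "\<And>k s. k \<in> J \<Longrightarrow> s \<in> {0..1} \<Longrightarrow> \<bar>\<psi> k s\<bar> \<le> K" by blast
  \<comment> \<open>A square-integrable envelope of all summands, uniform in \<open>n\<close> and
    \<open>m\<close>; with it one function controls the whole triangular array.\<close>
  define H where "H x = (\<Sum>k\<in>J. K * \<bar>Y k x\<bar>)" for x
  have Hm [measurable]: "H \<in> borel_measurable S" unfolding H_def[abs_def] using Y by measurable
  have Hsq: "integrable M (\<lambda>\<omega>. (H (X 0 \<omega>))\<^sup>2)"
    unfolding H_def using YX sq J by (intro integrable_square_sum) (auto simp: power_mult_distrib)
  define B where "B = (\<integral>\<omega>. (H (X 0 \<omega>))\<^sup>2 \<partial>M)"
  have B: "B \<ge> 0" by (simp add: B_def)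
  define h where "h n m x = (\<Sum>k\<in>J. \<psi> k (real m / real n) * Y k x)" for n m x
  have hm [measurable]: "h n m \<in> borel_measurable S" for n m unfolding h_def[abs_def] using Y by measurable
  have hX [measurable]: "(\<lambda>\<omega>. h n m (X j \<omega>)) \<in> borel_measurable M" for n m j
    by (rule measurable_compose[OF X_measurable hm])
  have hsq: "integrable M (\<lambda>\<omega>. (h n m (X 0 \<omega>))\<^sup>2)" for n m
    unfolding h_def using YX sq J by (intro integrable_square_sum) (auto simp: power_mult_distrib)
  have hmean: "(\<integral>\<omega>. h n m (X 0 \<omega>) \<partial>M) = 0" for n m
    unfolding h_def using int1 mean by simp
  have hH: "\<bar>h n m x\<bar> \<le> H x" if "m \<in> {1..n}" for n m x
  proof -
    have "\<bar>h n m x\<bar> \<le> (\<Sum>k\<in>J. \<bar>\<psi> k (real m / real n) * Y k x\<bar>)" unfolding h_def by (rule sum_abs)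
    also have "\<dots> \<le> H x"
      unfolding H_def abs_mult using that by (intro sum_mono mult_right_mono K) auto
    finally show ?thesis .
  qed
  have H0: "H x \<ge> 0" for x
    using hH[of 1 1 x] by (simp add: order_trans[OF abs_ge_zero])
  define s where "s n m = (\<integral>\<omega>. (h n m (X 0 \<omega>))\<^sup>2 \<partial>M)" for n m
  have s: "0 \<le> s n m" "m \<in> {1..n} \<Longrightarrow> s n m \<le> B" for n m
  proof -
    show "0 \<le> s n m" by (simp add: s_def)
    assume "m \<in> {1..n}"
    then have le: "(h n m x)\<^sup>2 \<le> (H x)\<^sup>2" for x
      using hH[of m n x] by (metis abs_ge_zero power2_abs power_mono)
    show "s n m \<le> B" unfolding s_def B_def by (rule integral_mono[OF hsq Hsq]) (rule le)
  qed
  \<comment> \<open>The rescaled third-order error of one factor. Third moments may be infinite; the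
    minimum with the square is what gives an integrable dominating function.\<close>
  define \<epsilon> where "\<epsilon> n = (\<integral>\<omega>. min (6 * (H (X 0 \<omega>))\<^sup>2) (\<bar>t\<bar> * (H (X 0 \<omega>))^3 / sqrt (real n)) \<partial>M)" for n :: nat
  have \<epsilon>: "\<epsilon> \<longlonglongrightarrow> 0"
  proof -
    have "(\<lambda>n. \<integral>\<omega>. min (6 * (H (X 0 \<omega>))\<^sup>2) (\<bar>t\<bar> * (H (X 0 \<omega>))^3 / sqrt (real n)) \<partial>M) \<longlonglongrightarrow> (\<integral>\<omega>. 0 \<partial>M)"
    proof (rule integral_dominated_convergence[where w="\<lambda>\<omega>. 6 * (H (X 0 \<omega>))\<^sup>2"])
      show "integrable M (\<lambda>\<omega>. 6 * (H (X 0 \<omega>))\<^sup>2)" using Hsq by simp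
      show "AE \<omega> in M. (\<lambda>n. min (6 * (H (X 0 \<omega>))\<^sup>2) (\<bar>t\<bar> * (H (X 0 \<omega>))^3 / sqrt (real n))) \<longlonglongrightarrow> 0"
      proof (rule AE_I2)
        fix \<omega>
        have "(\<lambda>n. \<bar>t\<bar> * (H (X 0 \<omega>))^3 / sqrt (real n)) \<longlonglongrightarrow> 0"
          by (rule real_tendsto_divide_at_top[OF tendsto_const]) (rule filterlim_compose[OF sqrt_at_top filterlim_real_sequentially])
        then have "(\<lambda>n. min (6 * (H (X 0 \<omega>))\<^sup>2) (\<bar>t\<bar> * (H (X 0 \<omega>))^3 / sqrt (real n))) \<longlonglongrightarrow> min (6 * (H (X 0 \<omega>))\<^sup>2) 0"
          by (intro tendsto_min tendsto_const)
        then show "(\<lambda>n. min (6 * (H (X 0 \<omega>))\<^sup>2) (\<bar>t\<bar> * (H (X 0 \<omega>))^3 / sqrt (real n))) \<longlonglongrightarrow> 0"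
          by (simp add: min_absorb2)
      qed
      show "AE \<omega> in M. norm (min (6 * (H (X 0 \<omega>))\<^sup>2) (\<bar>t\<bar> * (H (X 0 \<omega>))^3 / sqrt (real n))) \<le> 6 * (H (X 0 \<omega>))\<^sup>2" for n
        using H0 by (intro AE_I2) (auto simp: min_def)
    qed measurable
    then show ?thesis by (simp add: \<epsilon>_def[abs_def])
  qed
  define V where "V n m \<omega> = h n m (X m \<omega>) / sqrt (real n)" for n m \<omega>
  have Vm [measurable]: "V n m \<in> borel_measurable M" for n m unfolding V_def[abs_def] by measurable
  have char_prod: "char (distr M borel (\<lambda>\<omega>. (\<Sum>m\<in>{1..n}. \<Sum>k\<in>J. \<psi> k (real m / real n) * Y k (X m \<omega>)) / sqrt (real n))) t =
      (\<Prod>m\<in>{1..n}. char (distr M borel (V n m)) t)" for n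
  proof -
    have "indep_vars (\<lambda>_. borel) (V n) {1..n}"
      unfolding V_def[abs_def] by (rule indep_vars_compose2[OF indep_vars_subset[OF indep]]) measurable
    from char_distr_sum[OF this, of t] show ?thesis
      by (simp add: V_def h_def sum_divide_distrib)
  qed
  have Vsq: "integrable M (\<lambda>\<omega>. (V n m \<omega>)\<^sup>2)" "(\<integral>\<omega>. (V n m \<omega>)\<^sup>2 \<partial>M) = s n m / real n"
    and Vint: "integrable M (V n m)" and Vmean: "(\<integral>\<omega>. V n m \<omega> \<partial>M) = 0" for n m
  proof -
    have m2: "(\<lambda>x. (h n m x)\<^sup>2) \<in> borel_measurable S" by measurable
    show 1: "integrable M (\<lambda>\<omega>. (V n m \<omega>)\<^sup>2)"
      unfolding V_def power_divide using integrable_X[OF m2, of m] hsq by simp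
    show "(\<integral>\<omega>. (V n m \<omega>)\<^sup>2 \<partial>M) = s n m / real n"
      unfolding V_def power_divide s_def using integral_X[OF m2, of m] by simp
    show "integrable M (V n m)" by (rule square_integrable_imp_integrable[OF Vm 1])
    show "(\<integral>\<omega>. V n m \<omega> \<partial>M) = 0"
      unfolding V_def using integral_X[OF hm, of n m m] hmean by simp
  qed
  \<comment> \<open>Two comparisons: the characteristic function with its second-order Taylor
    polynomial, and that polynomial with the exponential.\<close>
  have approx: "cmod (char (distr M borel (V n m)) t - complex_of_real (exp (- (t\<^sup>2 * (s n m / real n) / 2))))
      \<le> t\<^sup>2 / 6 * (\<epsilon> n / real n) + (t\<^sup>2 * B / (2 * real n))\<^sup>2" if m: "m \<in> {1..n}" for n m
  proof -
    have n0: "real n > 0" using m by simp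
    let ?v = "s n m / real n"
    have "cmod (char (distr M borel (V n m)) t - (1 - t\<^sup>2 * ?v / 2)) \<le>
        t\<^sup>2 / 6 * (\<integral>\<omega>. min (6 * (V n m \<omega>)\<^sup>2) (\<bar>t\<bar> * \<bar>V n m \<omega>\<bar>^3) \<partial>M)"
      using char_approx3'[OF Vm Vint Vsq(1) Vmean _ refl, of n m ?v t] Vmean Vsq(2) by simp
    also have "\<dots> \<le> t\<^sup>2 / 6 * (\<epsilon> n / real n)"
    proof (rule mult_left_mono)
      let ?g = "\<lambda>x. min (6 * (H x)\<^sup>2) (\<bar>t\<bar> * (H x)^3 / sqrt (real n))"
      have gm: "?g \<in> borel_measurable S" by measurable
      have "integrable M (\<lambda>\<omega>. ?g (X 0 \<omega>))"
        by (rule Bochner_Integration.integrable_bound[OF integrable_mult_right[OF Hsq, of 6]])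
          (use H0 in \<open>auto simp: min_def intro!: AE_I2\<close>)
      then have gint: "integrable M (\<lambda>\<omega>. ?g (X m \<omega>))" using integrable_X[OF gm, of m] by blast
      have "(\<integral>\<omega>. min (6 * (V n m \<omega>)\<^sup>2) (\<bar>t\<bar> * \<bar>V n m \<omega>\<bar>^3) \<partial>M) \<le> (\<integral>\<omega>. ?g (X m \<omega>) / real n \<partial>M)"
      proof (rule integral_mono)
        show "integrable M (\<lambda>\<omega>. min (6 * (V n m \<omega>)\<^sup>2) (\<bar>t\<bar> * \<bar>V n m \<omega>\<bar>^3))"
          by (rule Bochner_Integration.integrable_bound[OF integrable_mult_right[OF Vsq(1), of 6]])
            (auto simp: min_def intro!: AE_I2)
        show "integrable M (\<lambda>\<omega>. ?g (X m \<omega>) / real n)" using gint by (rule integrable_divide)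
        fix \<omega>
        let ?x = "X m \<omega>"
        have le: "\<bar>h n m ?x\<bar> \<le> H ?x" by (rule hH[OF m])
        have "6 * (V n m \<omega>)\<^sup>2 = 6 * \<bar>h n m ?x\<bar>\<^sup>2 / real n" using n0 by (simp add: V_def power_divide)
        also have "\<dots> \<le> 6 * (H ?x)\<^sup>2 / real n"
          using le n0 by (intro divide_right_mono mult_left_mono power_mono) auto
        finally have 1: "6 * (V n m \<omega>)\<^sup>2 \<le> 6 * (H ?x)\<^sup>2 / real n" .
        have "\<bar>t\<bar> * \<bar>V n m \<omega>\<bar>^3 = \<bar>t\<bar> * \<bar>h n m ?x\<bar>^3 / (sqrt (real n) ^ 3)"
          using n0 by (simp add: V_def abs_divide power_divide)
        also have "\<dots> \<le> \<bar>t\<bar> * (H ?x)^3 / (sqrt (real n) ^ 3)"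
          using le n0 by (intro divide_right_mono mult_left_mono power_mono) auto
        also have "sqrt (real n) ^ 3 = sqrt (real n) * real n" using n0 by (simp add: power3_eq_cube)
        finally have 2: "\<bar>t\<bar> * \<bar>V n m \<omega>\<bar>^3 \<le> \<bar>t\<bar> * (H ?x)^3 / sqrt (real n) / real n" by simp
        have "?g ?x / real n = min (6 * (H ?x)\<^sup>2 / real n) (\<bar>t\<bar> * (H ?x)^3 / sqrt (real n) / real n)"
          using n0 by (simp add: min_divide_distrib_right)
        then show "min (6 * (V n m \<omega>)\<^sup>2) (\<bar>t\<bar> * \<bar>V n m \<omega>\<bar>^3) \<le> ?g ?x / real n"
          using 1 2 by (simp only: min.mono)
      qed
      also have "\<dots> = \<epsilon> n / real n" using integral_X[OF gm, of m] by (simp add: \<epsilon>_def)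
      finally show "(\<integral>\<omega>. min (6 * (V n m \<omega>)\<^sup>2) (\<bar>t\<bar> * \<bar>V n m \<omega>\<bar>^3) \<partial>M) \<le> \<epsilon> n / real n" .
    qed simp
    finally have 1: "cmod (char (distr M borel (V n m)) t - (1 - t\<^sup>2 * ?v / 2)) \<le> t\<^sup>2 / 6 * (\<epsilon> n / real n)" .
    have x0: "0 \<le> t\<^sup>2 * ?v / 2" using s(1) by simp
    have "\<bar>(1 - t\<^sup>2 * ?v / 2) - exp (- (t\<^sup>2 * ?v / 2))\<bar> \<le> (t\<^sup>2 * ?v / 2)\<^sup>2" by (rule exp_minus_taylor[OF x0])
    also have "\<dots> \<le> (t\<^sup>2 * B / (2 * real n))\<^sup>2"
    proof (rule power_mono[OF _ x0])
      have "t\<^sup>2 * s n m \<le> t\<^sup>2 * B" using s(2)[OF m] by (intro mult_left_mono) auto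
      then have "t\<^sup>2 * s n m / (2 * real n) \<le> t\<^sup>2 * B / (2 * real n)" by (rule divide_right_mono) simp
      then show "t\<^sup>2 * ?v / 2 \<le> t\<^sup>2 * B / (2 * real n)" by (simp add: mult.commute)
    qed
    finally have "cmod (complex_of_real ((1 - t\<^sup>2 * ?v / 2) - exp (- (t\<^sup>2 * ?v / 2)))) \<le> (t\<^sup>2 * B / (2 * real n))\<^sup>2"
      by (simp only: norm_of_real)
    then have 2: "cmod ((1 - t\<^sup>2 * ?v / 2) - complex_of_real (exp (- (t\<^sup>2 * ?v / 2)))) \<le> (t\<^sup>2 * B / (2 * real n))\<^sup>2"
      by simp
    show ?thesis using norm_diff_triangle_le[OF 1 2] by simp
  qed
  \<comment> \<open>All factors have modulus at most 1, so the products differ by at most the sum of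
    the differences of the factors, that is, \<open>n\<close> errors of size o(1/n).\<close>
  have diff: "cmod ((\<Prod>m\<in>{1..n}. char (distr M borel (V n m)) t) -
      complex_of_real (exp (- (t\<^sup>2) * ((\<Sum>m\<in>{1..n}. s n m) / real n) / 2)))
    \<le> t\<^sup>2 / 6 * \<epsilon> n + t^4 * B\<^sup>2 / 4 / real n" if n: "n \<ge> 1" for n
  proof -
    have n0: "real n > 0" using n by simp
    have prod_eq: "complex_of_real (exp (- (t\<^sup>2) * ((\<Sum>m\<in>{1..n}. s n m) / real n) / 2)) =
        (\<Prod>m\<in>{1..n}. complex_of_real (exp (- (t\<^sup>2 * (s n m / real n) / 2))))"
      unfolding of_real_prod[symmetric] exp_sum[OF finite_atLeastAtMost, symmetric]
      by (simp add: sum_negf sum_divide_distrib sum_distrib_left)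
    have "cmod ((\<Prod>m\<in>{1..n}. char (distr M borel (V n m)) t) - (\<Prod>m\<in>{1..n}. complex_of_real (exp (- (t\<^sup>2 * (s n m / real n) / 2))))) \<le>
      (\<Sum>m\<in>{1..n}. cmod (char (distr M borel (V n m)) t - complex_of_real (exp (- (t\<^sup>2 * (s n m / real n) / 2)))))"
    proof (rule norm_prod_diff)
      show "cmod (char (distr M borel (V n m)) t) \<le> 1" for m
        by (intro real_distribution.cmod_char_le_1 real_distribution_distr Vm)
      show "cmod (complex_of_real (exp (- (t\<^sup>2 * (s n m / real n) / 2)))) \<le> 1" for m
        using s(1) by simp
    qed
    also have "\<dots> \<le> (\<Sum>m\<in>{1..n}. t\<^sup>2 / 6 * (\<epsilon> n / real n) + (t\<^sup>2 * B / (2 * real n))\<^sup>2)"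
      by (intro sum_mono approx)
    also have "\<dots> = t\<^sup>2 / 6 * \<epsilon> n + t^4 * B\<^sup>2 / 4 / real n"
    proof -
      have "real n * (t\<^sup>2 / 6 * (\<epsilon> n / real n)) = t\<^sup>2 / 6 * \<epsilon> n" using n0 by simp
      moreover have "real n * (t\<^sup>2 * B / (2 * real n))\<^sup>2 = t^4 * B\<^sup>2 / 4 / real n"
        using n0 by (simp add: power_divide power_mult_distrib power2_eq_square power4_eq_xxxx)
      ultimately show ?thesis by (simp add: distrib_left)
    qed
    finally show ?thesis unfolding prod_eq .
  qed
  have slim: "(\<lambda>n. (\<Sum>m\<in>{1..n}. s n m) / real n) \<longlonglongrightarrow> v"
  proof -
    have YY: "integrable M (\<lambda>\<omega>. Y k (X 0 \<omega>) * Y l (X 0 \<omega>))" if "k \<in> J" "l \<in> J" for k l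
      using that by (intro integrable_mult_squares YX sq)
    have s_eq: "s n m = (\<Sum>k\<in>J. \<Sum>l\<in>J. (\<integral>\<omega>. Y k (X 0 \<omega>) * Y l (X 0 \<omega>) \<partial>M) * (\<psi> k (real m / real n) * \<psi> l (real m / real n)))" for n m
    proof -
      have "(h n m x)\<^sup>2 = (\<Sum>k\<in>J. \<Sum>l\<in>J. \<psi> k (real m / real n) * \<psi> l (real m / real n) * (Y k x * Y l x))" for x
        unfolding h_def power2_eq_square sum_product by (simp add: mult_ac)
      then have "s n m = (\<integral>\<omega>. (\<Sum>k\<in>J. \<Sum>l\<in>J. \<psi> k (real m / real n) * \<psi> l (real m / real n) * (Y k (X 0 \<omega>) * Y l (X 0 \<omega>))) \<partial>M)"
        by (simp add: s_def)
      also have "\<dots> = (\<Sum>k\<in>J. \<integral>\<omega>. (\<Sum>l\<in>J. \<psi> k (real m / real n) * \<psi> l (real m / real n) * (Y k (X 0 \<omega>) * Y l (X 0 \<omega>))) \<partial>M)"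
        by (intro Bochner_Integration.integral_sum Bochner_Integration.integrable_sum integrable_mult_right YY)
      also have "\<dots> = (\<Sum>k\<in>J. \<Sum>l\<in>J. \<integral>\<omega>. \<psi> k (real m / real n) * \<psi> l (real m / real n) * (Y k (X 0 \<omega>) * Y l (X 0 \<omega>)) \<partial>M)"
        by (intro sum.cong refl Bochner_Integration.integral_sum integrable_mult_right YY)
      also have "\<dots> = (\<Sum>k\<in>J. \<Sum>l\<in>J. (\<integral>\<omega>. Y k (X 0 \<omega>) * Y l (X 0 \<omega>) \<partial>M) * (\<psi> k (real m / real n) * \<psi> l (real m / real n)))"
        by (intro sum.cong refl) (simp only: integral_mult_right_zero, rule mult.commute)
      finally show ?thesis .
    qed
    have eq: "(\<Sum>m\<in>{1..n}. s n m) / real n = (\<Sum>k\<in>J. \<Sum>l\<in>J. (\<integral>\<omega>. Y k (X 0 \<omega>) * Y l (X 0 \<omega>) \<partial>M) *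
        ((\<Sum>m=1..n. \<psi> k (real m / real n) * \<psi> l (real m / real n)) / real n))" for n
    proof -
      have "(\<Sum>m\<in>{1..n}. s n m) = (\<Sum>k\<in>J. \<Sum>l\<in>J. \<Sum>m=1..n. (\<integral>\<omega>. Y k (X 0 \<omega>) * Y l (X 0 \<omega>) \<partial>M) * (\<psi> k (real m / real n) * \<psi> l (real m / real n)))"
        unfolding s_eq by (subst sum.swap, intro sum.cong refl, rule sum.swap)
      then show ?thesis by (simp add: sum_divide_distrib sum_distrib_left)
    qed
    show ?thesis
      unfolding eq v_def
      by (intro tendsto_sum tendsto_mult tendsto_const riemann_sum_tendsto continuous_on_mult \<psi>)
  qed
  have lim2: "(\<lambda>n. complex_of_real (exp (- (t\<^sup>2) * ((\<Sum>m\<in>{1..n}. s n m) / real n) / 2))) \<longlonglongrightarrow> complex_of_real (exp (- (t\<^sup>2) * v / 2))"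
    by (intro tendsto_of_real tendsto_exp tendsto_divide tendsto_mult tendsto_const slim) auto
  have lim1: "(\<lambda>n. (\<Prod>m\<in>{1..n}. char (distr M borel (V n m)) t) -
      complex_of_real (exp (- (t\<^sup>2) * ((\<Sum>m\<in>{1..n}. s n m) / real n) / 2))) \<longlonglongrightarrow> 0"
  proof (rule Lim_null_comparison)
    show "\<forall>\<^sub>F n in sequentially. cmod ((\<Prod>m\<in>{1..n}. char (distr M borel (V n m)) t) -
      complex_of_real (exp (- (t\<^sup>2) * ((\<Sum>m\<in>{1..n}. s n m) / real n) / 2))) \<le> t\<^sup>2 / 6 * \<epsilon> n + t^4 * B\<^sup>2 / 4 / real n"
      using eventually_ge_at_top[of 1] by eventually_elim (rule diff)
    have "(\<lambda>n. t^4 * B\<^sup>2 / 4 / real n) \<longlonglongrightarrow> 0" by (rule lim_const_over_n)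
    from tendsto_add[OF tendsto_mult[OF tendsto_const[of "t\<^sup>2 / 6"] \<epsilon>] this]
    show "(\<lambda>n. t\<^sup>2 / 6 * \<epsilon> n + t^4 * B\<^sup>2 / 4 / real n) \<longlonglongrightarrow> 0" by simp
  qed
  from tendsto_add[OF lim1 lim2] show ?thesis unfolding char_prod by simp
qed

section \<open>Wiener integrals\<close>

text \<open>From nonnegativity of the quadratic form in \<open>u\<close> and \<open>w\<close> given
  by the integral of \<open>(u * f x + w * g x)\<^sup>2\<close>.\<close>

lemma cauchy_schwarz_integral:
  fixes f g :: "'a \<Rightarrow> real"
  assumes f: "f \<in> borel_measurable M" and g: "g \<in> borel_measurable M"
    and f2: "integrable M (\<lambda>x. (f x)\<^sup>2)" and g2: "integrable M (\<lambda>x. (g x)\<^sup>2)"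
  shows "\<bar>\<integral>x. f x * g x \<partial>M\<bar> \<le> sqrt (\<integral>x. (f x)\<^sup>2 \<partial>M) * sqrt (\<integral>x. (g x)\<^sup>2 \<partial>M)"
proof -
  define A where "A = (\<integral>x. (f x)\<^sup>2 \<partial>M)"
  define B where "B = (\<integral>x. (g x)\<^sup>2 \<partial>M)"
  define c where "c = (\<integral>x. f x * g x \<partial>M)"
  have A: "A \<ge> 0" and B: "B \<ge> 0" by (simp_all add: A_def B_def)
  note fg = integrable_mult_squares[OF f g f2 g2]
  have quad: "0 \<le> u\<^sup>2 * A + 2 * (u * w) * c + w\<^sup>2 * B" for u w
  proof -
    have "(\<integral>x. (u * f x + w * g x)\<^sup>2 \<partial>M) = (\<integral>x. u\<^sup>2 * (f x)\<^sup>2 + 2 * (u * w) * (f x * g x) + w\<^sup>2 * (g x)\<^sup>2 \<partial>M)"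
      by (simp add: power2_sum power_mult_distrib algebra_simps)
    also have "\<dots> = u\<^sup>2 * A + 2 * (u * w) * c + w\<^sup>2 * B"
      using f2 g2 fg by (simp add: A_def B_def c_def)
    finally have "u\<^sup>2 * A + 2 * (u * w) * c + w\<^sup>2 * B = (\<integral>x. (u * f x + w * g x)\<^sup>2 \<partial>M)" by simp
    then show ?thesis by simp
  qed
  have "c\<^sup>2 \<le> A * B"
  proof (cases "B = 0")
    case True
    have "c = 0"
    proof (rule ccontr)
      assume "c \<noteq> 0"
      \<comment> \<open>For B = 0 the form is linear in \<open>w\<close>; this \<open>w\<close> is
        chosen to give it the value -1.\<close>
      have "0 \<le> A + 2 * (1 * (- (A + 1) / (2 * c))) * c" using quad[of 1 "- (A + 1) / (2 * c)"] True by simp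
      also have "\<dots> = - 1" using \<open>c \<noteq> 0\<close> by (simp add: field_simps)
      finally show False by simp
    qed
    then show ?thesis using A B by simp
  next
    case False
    have "0 \<le> B * (A * B - c\<^sup>2)"
      using quad[of B "- c"] by (simp add: algebra_simps power2_eq_square)
    then show ?thesis using False B by (simp add: zero_le_mult_iff)
  qed
  then have "sqrt (c\<^sup>2) \<le> sqrt (A * B)" by (rule real_sqrt_le_mono)
  then show ?thesis by (simp add: real_sqrt_mult A_def B_def c_def)
qed

text \<open>The nonnegative integrals are eventually finite, and \<open>f\<close> is the sum of such
  a difference and of \<open>fn n\<close>. Thus square integrability of the limit is obtained and
  not presupposed.\<close>

lemma L2_limit:
  fixes f :: "'a \<Rightarrow> real" and fn :: "nat \<Rightarrow> 'a \<Rightarrow> real"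
  assumes f: "f \<in> borel_measurable M" and fn: "\<And>n. fn n \<in> borel_measurable M"
    and fn2: "\<And>n. integrable M (\<lambda>x. (fn n x)\<^sup>2)"
    and lim: "(\<lambda>n. \<integral>\<^sup>+x. ennreal ((f x - fn n x)\<^sup>2) \<partial>M) \<longlonglongrightarrow> 0"
  shows "integrable M (\<lambda>x. (f x)\<^sup>2)" and "\<And>n. integrable M (\<lambda>x. (f x - fn n x)\<^sup>2)"
    and "(\<lambda>n. \<integral>x. (f x - fn n x)\<^sup>2 \<partial>M) \<longlonglongrightarrow> 0"
proof -
  note [measurable] = f fn
  have "\<forall>\<^sub>F n in sequentially. (\<integral>\<^sup>+x. ennreal ((f x - fn n x)\<^sup>2) \<partial>M) < 1"
    using lim by (rule order_tendstoD(2)) simp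
  then obtain n0 where "(\<integral>\<^sup>+x. ennreal ((f x - fn n0 x)\<^sup>2) \<partial>M) < 1"
    by (auto simp: eventually_sequentially)
  then have "(\<integral>\<^sup>+x. ennreal ((f x - fn n0 x)\<^sup>2) \<partial>M) < \<infinity>" using less_trans by fastforce
  then have "integrable M (\<lambda>x. (f x - fn n0 x)\<^sup>2)"
    by (intro integrableI_nonneg) auto
  from integrable_square_add[OF _ _ this fn2[of n0]]
  show f2: "integrable M (\<lambda>x. (f x)\<^sup>2)" by simp
  show diff2: "integrable M (\<lambda>x. (f x - fn n x)\<^sup>2)" for n
    using integrable_square_add[of f M "\<lambda>x. - fn n x"] f2 fn2 by simp
  have eq: "(\<integral>\<^sup>+x. ennreal ((f x - fn n x)\<^sup>2) \<partial>M) = ennreal (\<integral>x. (f x - fn n x)\<^sup>2 \<partial>M)" for n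
    using diff2 by (intro nn_integral_eq_integral) auto
  show "(\<lambda>n. \<integral>x. (f x - fn n x)\<^sup>2 \<partial>M) \<longlonglongrightarrow> 0"
    using lim unfolding eq by (simp add: tendsto_ennreal_iff flip: ennreal_0)
qed

text \<open>Continuity of the L^2 inner product. It carries the isometry from step functions to
  limits although the two integrands may come with different partitions.\<close>

lemma tendsto_integral_mult_L2:
  fixes f g :: "'a \<Rightarrow> real" and fn gn :: "nat \<Rightarrow> 'a \<Rightarrow> real"
  assumes f: "f \<in> borel_measurable M" and fn: "\<And>n. fn n \<in> borel_measurable M"
    and g: "g \<in> borel_measurable M" and gn: "\<And>n. gn n \<in> borel_measurable M"
    and fn2: "\<And>n. integrable M (\<lambda>x. (fn n x)\<^sup>2)" and gn2: "\<And>n. integrable M (\<lambda>x. (gn n x)\<^sup>2)"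
    and limf: "(\<lambda>n. \<integral>\<^sup>+x. ennreal ((f x - fn n x)\<^sup>2) \<partial>M) \<longlonglongrightarrow> 0"
    and limg: "(\<lambda>n. \<integral>\<^sup>+x. ennreal ((g x - gn n x)\<^sup>2) \<partial>M) \<longlonglongrightarrow> 0"
  shows "(\<lambda>n. \<integral>x. fn n x * gn n x \<partial>M) \<longlonglongrightarrow> (\<integral>x. f x * g x \<partial>M)"
proof -
  note F = L2_limit[OF f fn fn2 limf] and G = L2_limit[OF g gn gn2 limg]
  define a where "a n = sqrt (\<integral>x. (f x - fn n x)\<^sup>2 \<partial>M)" for n
  define b where "b n = sqrt (\<integral>x. (g x - gn n x)\<^sup>2 \<partial>M)" for n
  define A where "A = sqrt (\<integral>x. (f x)\<^sup>2 \<partial>M)"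
  define B where "B = sqrt (\<integral>x. (g x)\<^sup>2 \<partial>M)"
  have a: "a \<longlonglongrightarrow> 0" and b: "b \<longlonglongrightarrow> 0"
    unfolding a_def b_def using tendsto_real_sqrt[OF F(3)] tendsto_real_sqrt[OF G(3)] by simp_all
  have fnm: "(\<lambda>x. f x - fn n x) \<in> borel_measurable M" and gnm: "(\<lambda>x. g x - gn n x) \<in> borel_measurable M" for n
    using f fn g gn by measurable
  have "(\<lambda>n. (\<integral>x. fn n x * gn n x \<partial>M) - (\<integral>x. f x * g x \<partial>M)) \<longlonglongrightarrow> 0"
  proof (rule Lim_null_comparison)
    have "(\<lambda>n. a n * b n + a n * B + A * b n) \<longlonglongrightarrow> 0 * 0 + 0 * B + A * 0"
      by (intro tendsto_add tendsto_mult tendsto_const a b)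
    then show "(\<lambda>n. a n * b n + a n * B + A * b n) \<longlonglongrightarrow> 0" by simp
    show "\<forall>\<^sub>F n in sequentially. norm ((\<integral>x. fn n x * gn n x \<partial>M) - (\<integral>x. f x * g x \<partial>M)) \<le> a n * b n + a n * B + A * b n"
    proof (intro always_eventually allI)
      fix n
      have i1: "integrable M (\<lambda>x. (f x - fn n x) * (g x - gn n x))"
        by (rule integrable_mult_squares[OF fnm gnm F(2) G(2)])
      have i2: "integrable M (\<lambda>x. (f x - fn n x) * g x)"
        by (rule integrable_mult_squares[OF fnm g F(2) G(1)])
      have i3: "integrable M (\<lambda>x. f x * (g x - gn n x))"
        by (rule integrable_mult_squares[OF f gnm F(1) G(2)])
      have i4: "integrable M (\<lambda>x. f x * g x)"
        by (rule integrable_mult_squares[OF f g F(1) G(1)])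
      have "(\<integral>x. fn n x * gn n x \<partial>M) = (\<integral>x. f x * g x + (f x - fn n x) * (g x - gn n x) - (f x - fn n x) * g x - f x * (g x - gn n x) \<partial>M)"
        by (intro Bochner_Integration.integral_cong) (auto simp: algebra_simps)
      also have "\<dots> = (\<integral>x. f x * g x \<partial>M) + (\<integral>x. (f x - fn n x) * (g x - gn n x) \<partial>M)
          - (\<integral>x. (f x - fn n x) * g x \<partial>M) - (\<integral>x. f x * (g x - gn n x) \<partial>M)"
        by (simp only: Bochner_Integration.integral_diff Bochner_Integration.integral_add
            Bochner_Integration.integrable_diff Bochner_Integration.integrable_add i1 i2 i3 i4)
      finally have "(\<integral>x. fn n x * gn n x \<partial>M) - (\<integral>x. f x * g x \<partial>M) = (\<integral>x. (f x - fn n x) * (g x - gn n x) \<partial>M)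
          - (\<integral>x. (f x - fn n x) * g x \<partial>M) - (\<integral>x. f x * (g x - gn n x) \<partial>M)" by simp
      moreover have "\<bar>\<integral>x. (f x - fn n x) * (g x - gn n x) \<partial>M\<bar> \<le> a n * b n"
        unfolding a_def b_def by (rule cauchy_schwarz_integral[OF fnm gnm F(2) G(2)])
      moreover have "\<bar>\<integral>x. (f x - fn n x) * g x \<partial>M\<bar> \<le> a n * B"
        unfolding a_def B_def by (rule cauchy_schwarz_integral[OF fnm g F(2) G(1)])
      moreover have "\<bar>\<integral>x. f x * (g x - gn n x) \<partial>M\<bar> \<le> A * b n"
        unfolding A_def b_def by (rule cauchy_schwarz_integral[OF f gnm F(1) G(2)])
      ultimately show "norm ((\<integral>x. fn n x * gn n x \<partial>M) - (\<integral>x. f x * g x \<partial>M)) \<le> a n * b n + a n * B + A * b n"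
        by simp
    qed
  qed
  then show ?thesis by (simp add: LIM_zero_iff)
qed

lemma step_fun_measurable [measurable]: "step_fun m t a \<in> borel_measurable borel"
  unfolding step_fun_def[abs_def] by measurable

text \<open>The four-term expression is the covariance of the increments of a standard Brownian
  motion over the two intervals, which reduces the isometry to a comparison of terms.\<close>

lemma integral_indicator_Ioc_mult:
  fixes s s' u u' :: real
  assumes "s \<le> s'" "u \<le> u'"
  shows "integrable lborel (\<lambda>x. indicator {s<..s'} x * indicator {u<..u'} x :: real)"
    and "(\<integral>x. indicator {s<..s'} x * indicator {u<..u'} x \<partial>lborel) = min s' u' - min s' u - min s u' + min s u"
proof -
  have eq: "indicator {s<..s'} x * indicator {u<..u'} x = (indicator {max s u<..min s' u'} x :: real)" for x
    by (auto simp: indicator_def)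
  show "integrable lborel (\<lambda>x. indicator {s<..s'} x * indicator {u<..u'} x :: real)"
    unfolding eq by (cases "max s u \<le> min s' u'") (auto simp: integrable_real_indicator)
  show "(\<integral>x. indicator {s<..s'} x * indicator {u<..u'} x \<partial>lborel) = min s' u' - min s' u - min s u' + min s u"
    unfolding eq using assms by (auto simp: min_def max_def)
qed

lemma step_fun_square_integrable:
  assumes "mono_on {..m} t"
  shows "integrable lborel (\<lambda>x. (step_fun m t a x)\<^sup>2)"
  unfolding step_fun_def
proof (rule integrable_square_sum)
  fix k assume "k \<in> {..<m}"
  then have "t k \<le> t (Suc k)" using assms by (auto simp: mono_on_def)
  from integral_indicator_Ioc_mult(1)[OF this this]
  have "integrable lborel (\<lambda>x. (a k)\<^sup>2 * (indicator {t k<..t (Suc k)} x * indicator {t k<..t (Suc k)} x))"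
    by (rule integrable_mult_right)
  then show "integrable lborel (\<lambda>x. (a k * indicator {t k<..t (Suc k)} x)\<^sup>2)"
    by (simp add: power2_eq_square mult_ac)
qed auto

lemma integral_step_fun_mult:
  assumes t: "mono_on {..m} t" and t': "mono_on {..m'} t'"
  shows "(\<integral>x. step_fun m t a x * step_fun m' t' a' x \<partial>lborel) = (\<Sum>k<m. \<Sum>l<m'. a k * a' l *
    (min (t (Suc k)) (t' (Suc l)) - min (t (Suc k)) (t' l) - min (t k) (t' (Suc l)) + min (t k) (t' l)))"
proof -
  have le: "t k \<le> t (Suc k)" if "k < m" for k using t that by (auto simp: mono_on_def)
  have le': "t' k \<le> t' (Suc k)" if "k < m'" for k using t' that by (auto simp: mono_on_def)
  have int: "integrable lborel (\<lambda>x. a k * a' l * (indicator {t k<..t (Suc k)} x * indicator {t' l<..t' (Suc l)} x))"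
    if "k < m" "l < m'" for k l
    by (intro integrable_mult_right integral_indicator_Ioc_mult le le' that)
  have "(\<integral>x. step_fun m t a x * step_fun m' t' a' x \<partial>lborel) =
      (\<integral>x. (\<Sum>k<m. \<Sum>l<m'. a k * a' l * (indicator {t k<..t (Suc k)} x * indicator {t' l<..t' (Suc l)} x)) \<partial>lborel)"
    unfolding step_fun_def sum_product by (simp add: mult_ac)
  also have "\<dots> = (\<Sum>k<m. \<integral>x. (\<Sum>l<m'. a k * a' l * (indicator {t k<..t (Suc k)} x * indicator {t' l<..t' (Suc l)} x)) \<partial>lborel)"
    by (intro Bochner_Integration.integral_sum Bochner_Integration.integrable_sum int) auto
  also have "\<dots> = (\<Sum>k<m. \<Sum>l<m'. \<integral>x. a k * a' l * (indicator {t k<..t (Suc k)} x * indicator {t' l<..t' (Suc l)} x) \<partial>lborel)"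
    by (intro sum.cong refl Bochner_Integration.integral_sum int) auto
  also have "\<dots> = (\<Sum>k<m. \<Sum>l<m'. a k * a' l *
    (min (t (Suc k)) (t' (Suc l)) - min (t (Suc k)) (t' l) - min (t k) (t' (Suc l)) + min (t k) (t' l)))"
    by (intro sum.cong refl) (simp add: integral_indicator_Ioc_mult(2)[OF le le'])
  finally show ?thesis .
qed

section \<open>Second moments of Wiener integrals\<close>

locale gaussian_process_cov = prob_space P for P :: "'v measure" +
  fixes J :: "'k set" and C :: "'k \<Rightarrow> 'k \<Rightarrow> real" and B :: "'k \<Rightarrow> real \<Rightarrow> 'v \<Rightarrow> real"
  assumes process: "gaussian_process_with_cov P J C B"
begin

lemma process_measurable: "k \<in> J \<Longrightarrow> s \<ge> 0 \<Longrightarrow> B k s \<in> borel_measurable P"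
  using process unfolding gaussian_process_with_cov_def centered_gaussian_def by auto

lemma process_moments:
  assumes "k \<in> J" "s \<ge> 0"
  shows "integrable P (\<lambda>\<omega>. (B k s \<omega>)\<^sup>2)" "(\<integral>\<omega>. B k s \<omega> \<partial>P) = 0"
proof -
  note m = process_measurable[OF assms]
  have "centered_gaussian P (J \<times> {0..}) (\<lambda>(k, t). B k t)"
    using process unfolding gaussian_process_with_cov_def by blast
  then have "\<exists>v\<ge>0. distr P borel (\<lambda>\<omega>. \<Sum>t\<in>{(k, s)}. 1 * (case t of (k, t) \<Rightarrow> B k t) \<omega>) = normal_law 0 v"
    unfolding centered_gaussian_def using assms by (elim conjE allE[where x="{(k, s)}"] allE[where x="\<lambda>_. 1"]) auto
  then obtain v where v: "v \<ge> 0" "distr P borel (B k s) = normal_law 0 v" by auto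
  have "integrable (distr P borel (B k s)) (\<lambda>x. x\<^sup>2)" "(\<integral>x. x \<partial>distr P borel (B k s)) = 0"
    unfolding v(2) by (rule normal_law_moments[OF v(1)])+
  then show "integrable P (\<lambda>\<omega>. (B k s \<omega>)\<^sup>2)" "(\<integral>\<omega>. B k s \<omega> \<partial>P) = 0"
    using m by (simp_all add: integrable_distr_eq integral_distr)
qed

lemma process_product:
  assumes "k \<in> J" "l \<in> J" "s \<ge> 0" "t \<ge> 0"
  shows "(\<integral>\<omega>. B k s \<omega> * B l t \<omega> \<partial>P) = C k l * min s t"
proof -
  have "cov P (B k s) (B l t) = C k l * min s t"
    using process assms unfolding gaussian_process_with_cov_def by blast
  then show ?thesis using process_moments(2) assms by (simp add: cov_def)
qed

lemma process_product_integrable: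
  assumes "k \<in> J" "l \<in> J" "s \<ge> 0" "t \<ge> 0"
  shows "integrable P (\<lambda>\<omega>. B k s \<omega> * B l t \<omega>)"
  using assms by (intro integrable_mult_squares process_measurable process_moments)

lemma step_integral_measurable:
  assumes "k \<in> J" "\<And>i. i \<le> m \<Longrightarrow> t i \<ge> 0"
  shows "(\<lambda>\<omega>. step_integral m t a (\<lambda>s. B k s \<omega>)) \<in> borel_measurable P"
  unfolding step_integral_def using assms
  by (intro borel_measurable_sum borel_measurable_times borel_measurable_diff process_measurable borel_measurable_const) auto

lemma step_integral_moments:
  assumes k: "k \<in> J" and t: "\<And>i. i \<le> m \<Longrightarrow> t i \<ge> 0"
  shows "integrable P (\<lambda>\<omega>. (step_integral m t a (\<lambda>s. B k s \<omega>))\<^sup>2)"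
    and "(\<integral>\<omega>. step_integral m t a (\<lambda>s. B k s \<omega>) \<partial>P) = 0"
proof -
  have m: "B k (t i) \<in> borel_measurable P" if "i \<le> m" for i using k t that by (intro process_measurable) auto
  have sq: "integrable P (\<lambda>\<omega>. (B k (t i) \<omega>)\<^sup>2)" if "i \<le> m" for i using k t that by (intro process_moments) auto
  have int: "integrable P (B k (t i))" if "i \<le> m" for i
    by (rule square_integrable_imp_integrable[OF m sq]) (use that in auto)
  show "integrable P (\<lambda>\<omega>. (step_integral m t a (\<lambda>s. B k s \<omega>))\<^sup>2)"
    unfolding step_integral_def
  proof (rule integrable_square_sum)
    fix i assume i: "i \<in> {..<m}"
    have "integrable P (\<lambda>\<omega>. (B k (t (Suc i)) \<omega> + (- B k (t i) \<omega>))\<^sup>2)"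
      using i m sq by (intro integrable_square_add) auto
    then show "integrable P (\<lambda>\<omega>. (a i * (B k (t (Suc i)) \<omega> - B k (t i) \<omega>))\<^sup>2)"
      by (simp add: power_mult_distrib)
    show "(\<lambda>\<omega>. a i * (B k (t (Suc i)) \<omega> - B k (t i) \<omega>)) \<in> borel_measurable P"
      using i m by (intro borel_measurable_times borel_measurable_diff borel_measurable_const) auto
  qed simp
  show "(\<integral>\<omega>. step_integral m t a (\<lambda>s. B k s \<omega>) \<partial>P) = 0"
    unfolding step_integral_def using int process_moments(2)[OF k t]
    by (subst Bochner_Integration.integral_sum) auto
qed

text \<open>Both sides are expanded bilinearly. A product of increments has the same four-term
  expectation, up to the factor \<open>C k l\<close>, as the corresponding product of indicators has
  integral.\<close>

lemma step_integral_product: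
  assumes k: "k \<in> J" and l: "l \<in> J" and t: "\<And>i. i \<le> m \<Longrightarrow> t i \<ge> 0" and t': "\<And>i. i \<le> m' \<Longrightarrow> t' i \<ge> 0"
    and mono: "mono_on {..m} t" "mono_on {..m'} t'"
  shows "(\<integral>\<omega>. step_integral m t a (\<lambda>s. B k s \<omega>) * step_integral m' t' a' (\<lambda>s. B l s \<omega>) \<partial>P) =
    C k l * (\<integral>x. step_fun m t a x * step_fun m' t' a' x \<partial>lborel)"
proof -
  define G where "G i j \<omega> = a i * a' j * (B k (t (Suc i)) \<omega> * B l (t' (Suc j)) \<omega> - B k (t (Suc i)) \<omega> * B l (t' j) \<omega>
    - B k (t i) \<omega> * B l (t' (Suc j)) \<omega> + B k (t i) \<omega> * B l (t' j) \<omega>)" for i j \<omega>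
  have int: "integrable P (\<lambda>\<omega>. B k (t i) \<omega> * B l (t' j) \<omega>)" if "i \<le> m" "j \<le> m'" for i j
    using that t t' k l by (intro process_product_integrable) auto
  have Gint: "integrable P (G i j)" if "i < m" "j < m'" for i j
    unfolding G_def[abs_def] using that
    by (intro integrable_mult_right Bochner_Integration.integrable_add Bochner_Integration.integrable_diff int) auto
  have G: "(\<integral>\<omega>. G i j \<omega> \<partial>P) = C k l * (a i * a' j * (min (t (Suc i)) (t' (Suc j)) - min (t (Suc i)) (t' j)
      - min (t i) (t' (Suc j)) + min (t i) (t' j)))" if "i < m" "j < m'" for i j
  proof -
    have "(\<integral>\<omega>. G i j \<omega> \<partial>P) = a i * a' j * ((\<integral>\<omega>. B k (t (Suc i)) \<omega> * B l (t' (Suc j)) \<omega> \<partial>P) - (\<integral>\<omega>. B k (t (Suc i)) \<omega> * B l (t' j) \<omega> \<partial>P)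
      - (\<integral>\<omega>. B k (t i) \<omega> * B l (t' (Suc j)) \<omega> \<partial>P) + (\<integral>\<omega>. B k (t i) \<omega> * B l (t' j) \<omega> \<partial>P))"
      unfolding G_def using that by (simp add: int)
    also have "\<dots> = a i * a' j * (C k l * min (t (Suc i)) (t' (Suc j)) - C k l * min (t (Suc i)) (t' j)
      - C k l * min (t i) (t' (Suc j)) + C k l * min (t i) (t' j))"
    proof -
      have "(\<integral>\<omega>. B k (t i) \<omega> * B l (t' j) \<omega> \<partial>P) = C k l * min (t i) (t' j)" if "i \<le> m" "j \<le> m'" for i j
        using that by (intro process_product k l t t')
      then show ?thesis using that by simp
    qed
    also have "\<dots> = C k l * (a i * a' j * (min (t (Suc i)) (t' (Suc j)) - min (t (Suc i)) (t' j)
      - min (t i) (t' (Suc j)) + min (t i) (t' j)))"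
      by (simp add: algebra_simps)
    finally show ?thesis .
  qed
  have "(\<integral>\<omega>. step_integral m t a (\<lambda>s. B k s \<omega>) * step_integral m' t' a' (\<lambda>s. B l s \<omega>) \<partial>P) =
      (\<integral>\<omega>. (\<Sum>i<m. \<Sum>j<m'. G i j \<omega>) \<partial>P)"
    unfolding step_integral_def sum_product G_def by (simp add: algebra_simps)
  also have "\<dots> = (\<Sum>i<m. \<integral>\<omega>. (\<Sum>j<m'. G i j \<omega>) \<partial>P)"
    by (intro Bochner_Integration.integral_sum Bochner_Integration.integrable_sum Gint) auto
  also have "\<dots> = (\<Sum>i<m. \<Sum>j<m'. \<integral>\<omega>. G i j \<omega> \<partial>P)"
    by (intro sum.cong refl Bochner_Integration.integral_sum Gint) auto
  also have "\<dots> = C k l * (\<integral>x. step_fun m t a x * step_fun m' t' a' x \<partial>lborel)"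
    unfolding integral_step_fun_mult[OF mono] sum_distrib_left by (intro sum.cong refl G) auto
  finally show ?thesis .
qed

text \<open>The Ito isometry for two integrands and two components, as the limit of
  \<open>step_integral_product\<close>. The mean is obtained as the inner product with the constant
  1.\<close>

lemma wiener_integral_moments:
  assumes k: "k \<in> J" and l: "l \<in> J"
    and I: "is_wiener_integral P (B k) 0 1 g I" and I': "is_wiener_integral P (B l) 0 1 g' I'"
  shows "(\<integral>\<omega>. I \<omega> * I' \<omega> \<partial>P) = C k l * (\<integral>s. indicator {0..1} s * (g s * g' s) \<partial>lborel)"
    and "integrable P (\<lambda>\<omega>. (I \<omega>)\<^sup>2)" and "(\<integral>\<omega>. I \<omega> \<partial>P) = 0"
proof -
  obtain m t a where t: "\<And>n. mono_on {..m n} (t n)" "\<And>n. t n ` {..m n} \<subseteq> {0..1}"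
    and gm: "g \<in> borel_measurable borel" and Im: "I \<in> borel_measurable P"
    and limg: "(\<lambda>n. \<integral>\<^sup>+s\<in>{0..1}. ennreal ((g s - step_fun (m n) (t n) (a n) s)\<^sup>2) \<partial>lborel) \<longlonglongrightarrow> 0"
    and limI: "(\<lambda>n. \<integral>\<^sup>+\<omega>. ennreal ((I \<omega> - step_integral (m n) (t n) (a n) (\<lambda>s. B k s \<omega>))\<^sup>2) \<partial>P) \<longlonglongrightarrow> 0"
    using I unfolding is_wiener_integral_def by blast
  obtain m' t' a' where t': "\<And>n. mono_on {..m' n} (t' n)" "\<And>n. t' n ` {..m' n} \<subseteq> {0..1}"
    and gm': "g' \<in> borel_measurable borel" and Im': "I' \<in> borel_measurable P"
    and limg': "(\<lambda>n. \<integral>\<^sup>+s\<in>{0..1}. ennreal ((g' s - step_fun (m' n) (t' n) (a' n) s)\<^sup>2) \<partial>lborel) \<longlonglongrightarrow> 0"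
    and limI': "(\<lambda>n. \<integral>\<^sup>+\<omega>. ennreal ((I' \<omega> - step_integral (m' n) (t' n) (a' n) (\<lambda>s. B l s \<omega>))\<^sup>2) \<partial>P) \<longlonglongrightarrow> 0"
    using I' unfolding is_wiener_integral_def by blast
  have pos: "t n i \<ge> 0" if "i \<le> m n" for n i using t(2)[of n] that by auto
  have pos': "t' n i \<ge> 0" if "i \<le> m' n" for n i using t'(2)[of n] that by auto
  \<comment> \<open>Partitions lie in \<open>{0..1}\<close>, so step functions vanish elsewhere and
    the restricted integrals become integrals over the line of \<open>g\<close> cut off outside
    \<open>{0..1}\<close>.\<close>
  have outside: "step_fun m t a s = 0" if "mono_on {..m} t" "t ` {..m} \<subseteq> {0..1}" "s \<notin> {0..1}" for m t a and s :: real
    unfolding step_fun_def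
  proof (rule sum.neutral, rule ballI)
    fix i assume "i \<in> {..<m}"
    then have "t i \<in> {0..1}" "t (Suc i) \<in> {0..1}" using that(2) by (simp_all add: image_subset_iff)
    then show "a i * indicator {t i<..t (Suc i)} s = 0" using that(3) by (auto simp: indicator_def)
  qed
  have ind: "(\<integral>\<^sup>+s\<in>{0..1}. ennreal ((g s - step_fun m t a s)\<^sup>2) \<partial>lborel) =
      (\<integral>\<^sup>+s. ennreal ((indicator {0..1} s * g s - step_fun m t a s)\<^sup>2) \<partial>lborel)"
    if "mono_on {..m} t" "t ` {..m} \<subseteq> {0..1}" for m t a and g :: "real \<Rightarrow> real"
  proof (rule nn_integral_cong)
    fix s show "ennreal ((g s - step_fun m t a s)\<^sup>2) * indicator {0..1} s =
        ennreal ((indicator {0..1} s * g s - step_fun m t a s)\<^sup>2)"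
      using outside[OF that, of s a] by (cases "s \<in> {0..1::real}") auto
  qed
  have gm1: "(\<lambda>s. indicator {0..1} s * g s) \<in> borel_measurable lborel" using gm by measurable
  have gm1': "(\<lambda>s. indicator {0..1} s * g' s) \<in> borel_measurable lborel" using gm' by measurable
  have sm: "step_fun m t a \<in> borel_measurable lborel" for m t a by simp
  note L2I = L2_limit[OF Im step_integral_measurable[OF k pos] step_integral_moments(1)[OF k pos] limI]
  show "integrable P (\<lambda>\<omega>. (I \<omega>)\<^sup>2)" by (rule L2I(1))
  have "(\<lambda>n. \<integral>\<omega>. step_integral (m n) (t n) (a n) (\<lambda>s. B k s \<omega>) * 1 \<partial>P) \<longlonglongrightarrow> (\<integral>\<omega>. I \<omega> * 1 \<partial>P)"
    by (rule tendsto_integral_mult_L2[OF Im step_integral_measurable[OF k pos] _ _ step_integral_moments(1)[OF k pos] _ limI]) simp_all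
  then have "(\<lambda>n. 0) \<longlonglongrightarrow> (\<integral>\<omega>. I \<omega> \<partial>P)"
    using step_integral_moments(2)[OF k pos] by simp
  then show "(\<integral>\<omega>. I \<omega> \<partial>P) = 0" by (simp add: LIMSEQ_const_iff)
  have "(\<lambda>n. \<integral>\<omega>. step_integral (m n) (t n) (a n) (\<lambda>s. B k s \<omega>) * step_integral (m' n) (t' n) (a' n) (\<lambda>s. B l s \<omega>) \<partial>P)
      \<longlonglongrightarrow> (\<integral>\<omega>. I \<omega> * I' \<omega> \<partial>P)"
    by (rule tendsto_integral_mult_L2[OF Im step_integral_measurable[OF k pos] Im' step_integral_measurable[OF l pos']
          step_integral_moments(1)[OF k pos] step_integral_moments(1)[OF l pos'] limI limI'])
  moreover have "(\<integral>\<omega>. step_integral (m n) (t n) (a n) (\<lambda>s. B k s \<omega>) * step_integral (m' n) (t' n) (a' n) (\<lambda>s. B l s \<omega>) \<partial>P) =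
      C k l * (\<integral>x. step_fun (m n) (t n) (a n) x * step_fun (m' n) (t' n) (a' n) x \<partial>lborel)" for n
    by (rule step_integral_product[OF k l pos pos' t(1) t'(1)])
  ultimately have 1: "(\<lambda>n. C k l * (\<integral>x. step_fun (m n) (t n) (a n) x * step_fun (m' n) (t' n) (a' n) x \<partial>lborel)) \<longlonglongrightarrow> (\<integral>\<omega>. I \<omega> * I' \<omega> \<partial>P)"
    by (simp only:)
  have "(\<lambda>n. \<integral>x. step_fun (m n) (t n) (a n) x * step_fun (m' n) (t' n) (a' n) x \<partial>lborel) \<longlonglongrightarrow>
      (\<integral>s. (indicator {0..1} s * g s) * (indicator {0..1} s * g' s) \<partial>lborel)"
    by (rule tendsto_integral_mult_L2[OF gm1 sm gm1' sm step_fun_square_integrable[OF t(1)] step_fun_square_integrable[OF t'(1)]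
          limg[unfolded ind[OF t]] limg'[unfolded ind[OF t']]])
  then have "(\<lambda>n. C k l * (\<integral>x. step_fun (m n) (t n) (a n) x * step_fun (m' n) (t' n) (a' n) x \<partial>lborel)) \<longlonglongrightarrow>
      C k l * (\<integral>s. (indicator {0..1} s * g s) * (indicator {0..1} s * g' s) \<partial>lborel)"
    by (intro tendsto_mult tendsto_const)
  from LIMSEQ_unique[OF 1 this]
  have "(\<integral>\<omega>. I \<omega> * I' \<omega> \<partial>P) = C k l * (\<integral>s. (indicator {0..1} s * g s) * (indicator {0..1} s * g' s) \<partial>lborel)" .
  also have "(\<integral>s. (indicator {0..1} s * g s) * (indicator {0..1} s * g' s) \<partial>lborel) = (\<integral>s. indicator {0..1} s * (g s * g' s) \<partial>lborel)"
    by (intro Bochner_Integration.integral_cong) (auto simp: indicator_def)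
  finally show "(\<integral>\<omega>. I \<omega> * I' \<omega> \<partial>P) = C k l * (\<integral>s. indicator {0..1} s * (g s * g' s) \<partial>lborel)" .
qed

text \<open>Continuity identifies the Lebesgue integral in the isometry with the gauge integral that
  arises as a limit of Riemann sums, so both sides of the limit theorem speak of the same
  number.\<close>

lemma variance_wiener_integrals:
  fixes c :: "'k \<Rightarrow> real" and \<psi> :: "'k \<Rightarrow> real \<Rightarrow> real" and I :: "'k \<Rightarrow> 'v \<Rightarrow> real"
  assumes J: "finite J" and I: "\<And>k. k \<in> J \<Longrightarrow> is_wiener_integral P (B k) 0 1 (\<psi> k) (I k)"
    and \<psi>: "\<And>k. k \<in> J \<Longrightarrow> continuous_on {0..1} (\<psi> k)"
  shows "variance (\<lambda>\<omega>. \<Sum>k\<in>J. c k * I k \<omega>) =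
    (\<Sum>k\<in>J. \<Sum>l\<in>J. C k l * integral {0..1} (\<lambda>s. (c k * \<psi> k s) * (c l * \<psi> l s)))"
proof -
  have Im: "I k \<in> borel_measurable P" if "k \<in> J" for k using I[OF that] by (simp add: is_wiener_integral_def)
  note mom = wiener_integral_moments[OF _ _ I I]
  have sq: "integrable P (\<lambda>\<omega>. (I k \<omega>)\<^sup>2)" if "k \<in> J" for k by (rule mom(2)[OF that that that that])
  have zero: "(\<integral>\<omega>. I k \<omega> \<partial>P) = 0" if "k \<in> J" for k by (rule mom(3)[OF that that that that])
  have int: "integrable P (I k)" if "k \<in> J" for k by (rule square_integrable_imp_integrable[OF Im sq]) (use that in auto)
  have prod_int: "integrable P (\<lambda>\<omega>. I k \<omega> * I l \<omega>)" if "k \<in> J" "l \<in> J" for k l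
    using that by (intro integrable_mult_squares Im sq)
  have prod: "(\<integral>\<omega>. I k \<omega> * I l \<omega> \<partial>P) = C k l * integral {0..1} (\<lambda>s. \<psi> k s * \<psi> l s)" if kl: "k \<in> J" "l \<in> J" for k l
  proof -
    have "set_integrable lborel {0..1} (\<lambda>s. \<psi> k s * \<psi> l s)"
      by (intro borel_integrable_atLeastAtMost' continuous_on_mult \<psi> kl)
    from set_borel_integral_eq_integral(2)[OF this]
    have "(\<integral>s. indicator {0..1} s * (\<psi> k s * \<psi> l s) \<partial>lborel) = integral {0..1} (\<lambda>s. \<psi> k s * \<psi> l s)"
      by (simp add: set_lebesgue_integral_def)
    then show ?thesis using mom(1)[OF kl kl] by simp
  qed
  have "(\<integral>\<omega>. (\<Sum>k\<in>J. c k * I k \<omega>) \<partial>P) = 0" using int zero by simp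
  then have "variance (\<lambda>\<omega>. \<Sum>k\<in>J. c k * I k \<omega>) = (\<integral>\<omega>. (\<Sum>k\<in>J. c k * I k \<omega>)\<^sup>2 \<partial>P)" by simp
  also have "\<dots> = (\<integral>\<omega>. (\<Sum>k\<in>J. \<Sum>l\<in>J. c k * c l * (I k \<omega> * I l \<omega>)) \<partial>P)"
    unfolding power2_eq_square sum_product by (simp add: mult_ac)
  also have "\<dots> = (\<Sum>k\<in>J. \<integral>\<omega>. (\<Sum>l\<in>J. c k * c l * (I k \<omega> * I l \<omega>)) \<partial>P)"
    by (intro Bochner_Integration.integral_sum Bochner_Integration.integrable_sum integrable_mult_right prod_int)
  also have "\<dots> = (\<Sum>k\<in>J. \<Sum>l\<in>J. \<integral>\<omega>. c k * c l * (I k \<omega> * I l \<omega>) \<partial>P)"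
    by (intro sum.cong refl Bochner_Integration.integral_sum integrable_mult_right prod_int)
  also have "\<dots> = (\<Sum>k\<in>J. \<Sum>l\<in>J. C k l * integral {0..1} (\<lambda>s. (c k * \<psi> k s) * (c l * \<psi> l s)))"
  proof (intro sum.cong refl)
    fix k l assume kl: "k \<in> J" "l \<in> J"
    have "integral {0..1} (\<lambda>s. (c k * \<psi> k s) * (c l * \<psi> l s)) = integral {0..1} (\<lambda>s. (c k * c l) * (\<psi> k s * \<psi> l s))"
      by (simp add: mult_ac)
    also have "\<dots> = c k * c l * integral {0..1} (\<lambda>s. \<psi> k s * \<psi> l s)" by (rule integral_mult_right)
    finally show "(\<integral>\<omega>. c k * c l * (I k \<omega> * I l \<omega>) \<partial>P) = C k l * integral {0..1} (\<lambda>s. (c k * \<psi> k s) * (c l * \<psi> l s))"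
      using prod[OF kl] by simp
  qed
  finally show ?thesis .
qed

end

section \<open>Degenerate limits\<close>

text \<open>The double sum is the integral of \<open>q\<close>, a second moment for each s. Since
  \<open>q\<close> is continuous and nonnegative, a zero integral forces it to vanish at every s and
  not merely almost everywhere.\<close>

lemma (in iid_sequence) weighted_variance_eq_0_iff:
  fixes Y :: "'k \<Rightarrow> 's \<Rightarrow> real" and \<psi> :: "'k \<Rightarrow> real \<Rightarrow> real"
  assumes J: "finite J"
    and Y: "\<And>k. k \<in> J \<Longrightarrow> Y k \<in> borel_measurable S"
    and sq: "\<And>k. k \<in> J \<Longrightarrow> integrable M (\<lambda>\<omega>. (Y k (X 0 \<omega>))\<^sup>2)"
    and \<psi>: "\<And>k. k \<in> J \<Longrightarrow> continuous_on {0..1} (\<psi> k)"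
  shows "(\<Sum>k\<in>J. \<Sum>l\<in>J. (\<integral>\<omega>. Y k (X 0 \<omega>) * Y l (X 0 \<omega>) \<partial>M) * integral {0..1} (\<lambda>s. \<psi> k s * \<psi> l s)) = 0
    \<longleftrightarrow> (\<forall>s\<in>{0..1}. AE \<omega> in M. (\<Sum>k\<in>J. \<psi> k s * Y k (X 0 \<omega>)) = 0)" (is "?v = 0 \<longleftrightarrow> _")
proof -
  have YX: "(\<lambda>\<omega>. Y k (X 0 \<omega>)) \<in> borel_measurable M" if "k \<in> J" for k
    by (rule measurable_compose[OF X_measurable Y[OF that]])
  have YY: "integrable M (\<lambda>\<omega>. Y k (X 0 \<omega>) * Y l (X 0 \<omega>))" if "k \<in> J" "l \<in> J" for k l
    using that by (intro integrable_mult_squares YX sq)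
  define h where "h s \<omega> = (\<Sum>k\<in>J. \<psi> k s * Y k (X 0 \<omega>))" for s \<omega>
  have hsq: "integrable M (\<lambda>\<omega>. (h s \<omega>)\<^sup>2)" for s
    unfolding h_def using YX sq J by (intro integrable_square_sum) (auto simp: power_mult_distrib)
  define q where "q s = (\<Sum>k\<in>J. \<Sum>l\<in>J. (\<integral>\<omega>. Y k (X 0 \<omega>) * Y l (X 0 \<omega>) \<partial>M) * (\<psi> k s * \<psi> l s))" for s
  have q_eq: "(\<integral>\<omega>. (h s \<omega>)\<^sup>2 \<partial>M) = q s" for s
  proof -
    have "(\<integral>\<omega>. (h s \<omega>)\<^sup>2 \<partial>M) = (\<integral>\<omega>. (\<Sum>k\<in>J. \<Sum>l\<in>J. \<psi> k s * \<psi> l s * (Y k (X 0 \<omega>) * Y l (X 0 \<omega>))) \<partial>M)"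
      unfolding h_def power2_eq_square sum_product by (simp add: mult_ac)
    also have "\<dots> = (\<Sum>k\<in>J. \<integral>\<omega>. (\<Sum>l\<in>J. \<psi> k s * \<psi> l s * (Y k (X 0 \<omega>) * Y l (X 0 \<omega>))) \<partial>M)"
      by (intro Bochner_Integration.integral_sum Bochner_Integration.integrable_sum integrable_mult_right YY)
    also have "\<dots> = (\<Sum>k\<in>J. \<Sum>l\<in>J. \<integral>\<omega>. \<psi> k s * \<psi> l s * (Y k (X 0 \<omega>) * Y l (X 0 \<omega>)) \<partial>M)"
      by (intro sum.cong refl Bochner_Integration.integral_sum integrable_mult_right YY)
    also have "\<dots> = q s"
      unfolding q_def by (intro sum.cong refl) (simp only: integral_mult_right_zero, rule mult.commute)
    finally show ?thesis .
  qed
  have q_cont: "continuous_on {0..1} q"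
    unfolding q_def[abs_def] by (intro continuous_on_sum continuous_on_mult continuous_on_const \<psi>)
  have int_q: "integral {0..1} q = ?v"
  proof -
    have int: "(\<lambda>s. (\<integral>\<omega>. Y k (X 0 \<omega>) * Y l (X 0 \<omega>) \<partial>M) * (\<psi> k s * \<psi> l s)) integrable_on {0..1}"
      if "k \<in> J" "l \<in> J" for k l
      by (intro integrable_continuous_interval continuous_on_mult continuous_on_const \<psi> that)
    have "integral {0..1} q = (\<Sum>k\<in>J. integral {0..1} (\<lambda>s. \<Sum>l\<in>J. (\<integral>\<omega>. Y k (X 0 \<omega>) * Y l (X 0 \<omega>) \<partial>M) * (\<psi> k s * \<psi> l s)))"
      unfolding q_def[abs_def] using J by (intro Henstock_Kurzweil_Integration.integral_sum Henstock_Kurzweil_Integration.integrable_sum int)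
    also have "\<dots> = (\<Sum>k\<in>J. \<Sum>l\<in>J. integral {0..1} (\<lambda>s. (\<integral>\<omega>. Y k (X 0 \<omega>) * Y l (X 0 \<omega>) \<partial>M) * (\<psi> k s * \<psi> l s)))"
      using J by (intro sum.cong refl Henstock_Kurzweil_Integration.integral_sum int)
    finally show ?thesis by simp
  qed
  have "?v = 0 \<longleftrightarrow> (\<forall>s\<in>{0..1}. q s = 0)"
    unfolding int_q[symmetric]
  proof (rule integral_eq_0_iff)
    show "q s \<ge> 0" for s unfolding q_eq[symmetric] by simp
  qed (use q_cont in auto)
  also have "\<dots> \<longleftrightarrow> (\<forall>s\<in>{0..1}. AE \<omega> in M. h s \<omega> = 0)"
    unfolding q_eq[symmetric] using hsq by (simp add: integral_nonneg_eq_0_iff_AE)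
  finally show ?thesis by (simp only: h_def)
qed

text \<open>The exceptional set depends on s. A sequence of distinct points in (0, 1) has one common
  null set, off which linear independence applies to the values at each x.\<close>

lemma bernstein_AE_eq_0_iff:
  fixes g :: "nat \<Rightarrow> 'a \<Rightarrow> real"
  shows "(\<forall>s\<in>{0..1}. AE x in M. (\<Sum>i=1..m. g i x * psi i m s 1) = 0) \<longleftrightarrow> (\<forall>i\<in>{1..m}. AE x in M. g i x = 0)"
proof
  assume zero: "\<forall>s\<in>{0..1}. AE x in M. (\<Sum>i=1..m. g i x * psi i m s 1) = 0"
  define a where "a n = 1 / real (n + 2)" for n :: nat
  have a01: "range a \<subseteq> {0<..<1}" by (auto simp: a_def)
  have "inj a" by (auto simp: a_def inj_def)
  then have inf: "infinite (range a)" by (rule range_inj_infinite)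
  have "AE x in M. \<forall>n. (\<Sum>i=1..m. g i x * psi i m (a n) 1) = 0"
    unfolding AE_all_countable using zero a01 by (auto simp: image_subset_iff less_imp_le)
  then have "AE x in M. \<forall>i\<in>{1..m}. g i x = 0"
  proof eventually_elim
    case (elim x)
    show ?case
    proof
      fix i assume "i \<in> {1..m}"
      then show "g i x = 0"
        by (rule psi_linear_independent[OF inf a01, where c="\<lambda>i. g i x", rotated]) (use elim in auto)
    qed
  qed
  then show "\<forall>i\<in>{1..m}. AE x in M. g i x = 0" by (auto elim!: eventually_mono)
next
  assume "\<forall>i\<in>{1..m}. AE x in M. g i x = 0"
  then have "AE x in M. \<forall>i\<in>{1..m}. g i x = 0" by (simp add: AE_finite_all)
  then show "\<forall>s\<in>{0..1}. AE x in M. (\<Sum>i=1..m. g i x * psi i m s 1) = 0"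
    by (intro ballI) (auto elim!: eventually_mono)
qed

text \<open>The matrix of degree elevation from Bernstein degree \<open>d - 1\<close> to
  \<open>e - 1\<close>, whose entries are the coefficients in the degeneracy criteria.\<close>

definition elevation :: "nat \<Rightarrow> nat \<Rightarrow> nat \<Rightarrow> nat \<Rightarrow> real" where
  "elevation d e i j = binom (d - 1) (int j - 1) * binom (e - d) (int i - int j) / binom (e - 1) (int i - 1)"

lemma sum_psi_elevation:
  assumes "d \<le> e"
  shows "(\<Sum>j=1..d. c j * psi j d s 1) =
    (\<Sum>i=1..e. fact (e - 1) / fact (d - 1) * (\<Sum>j=1..d. elevation d e i j * c j) * psi i e s 1)"
proof -
  have el: "psi j d s 1 = (\<Sum>i=1..e. elevation d e i j * (fact (e - 1) * psi i e s 1)) / fact (d - 1)"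
    if "j \<in> {1..d}" for j
    using psi_elevation[OF that assms, of s] by (simp add: elevation_def field_simps)
  have "(\<Sum>j=1..d. c j * psi j d s 1) =
      (\<Sum>j=1..d. \<Sum>i=1..e. fact (e - 1) / fact (d - 1) * (elevation d e i j * c j) * psi i e s 1)"
    by (intro sum.cong refl) (simp add: el sum_distrib_left sum_divide_distrib mult_ac)
  also have "\<dots> = (\<Sum>i=1..e. \<Sum>j=1..d. fact (e - 1) / fact (d - 1) * (elevation d e i j * c j) * psi i e s 1)"
    by (rule sum.swap)
  also have "\<dots> = (\<Sum>i=1..e. fact (e - 1) / fact (d - 1) * (\<Sum>j=1..d. elevation d e i j * c j) * psi i e s 1)"
    by (intro sum.cong refl) (simp add: sum_distrib_left sum_distrib_right)
  finally show ?thesis .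
qed

text \<open>\<open>binom 0 (int i - int j)\<close> vanishes on both sides of the diagonal, thanks to
  the integer argument.\<close>

lemma elevation_same:
  assumes "i \<in> {1..d}"
  shows "(\<Sum>j=1..d. elevation d d i j * c j) = c i"
proof -
  have "elevation d d i j * c j = (if j = i then c j else 0)" if "j \<in> {1..d}" for j
  proof (cases "j = i")
    case True
    have "real (d - 1 choose (i - 1)) \<noteq> 0" using assms by (simp add: binomial_eq_0_iff) auto
    then show ?thesis using True assms by (simp add: elevation_def binom_def nat_diff_distrib)
  next
    case False
    then have "binom 0 (int i - int j) = 0" by (auto simp: binom_def)
    then show ?thesis using False by (simp add: elevation_def)
  qed
  then have "(\<Sum>j=1..d. elevation d d i j * c j) = (\<Sum>j=1..d. if j = i then c j else 0)" by (rule sum.cong[OF refl])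
  also have "\<dots> = c i" using assms by simp
  finally show ?thesis .
qed

text \<open>The constant 1 has all its Bernstein coordinates equal to 1.\<close>

lemma elevation_from_1:
  assumes "i \<in> {1..e}"
  shows "elevation 1 e i 1 = 1"
proof -
  have "real (e - 1 choose (i - 1)) \<noteq> 0" using assms by (simp add: binomial_eq_0_iff) auto
  then show ?thesis using assms by (simp add: elevation_def binom_def nat_diff_distrib)
qed

section \<open>The limit variance of two kernels and its zeros\<close>

locale two_kernels = K: L2_kernel M S X d f + K': L2_kernel M S X e g
  for M :: "'w measure" and S :: "'s measure" and X :: "nat \<Rightarrow> 'w \<Rightarrow> 's"
    and d :: nat and f :: "(nat \<Rightarrow> 's) \<Rightarrow> real" and e :: nat and g :: "(nat \<Rightarrow> 's) \<Rightarrow> real" +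
  assumes mean_pos: "kernel_mean M d f X > 0"
begin

abbreviation "\<mu> \<equiv> kernel_mean M d f X"
abbreviation "\<mu>' \<equiv> kernel_mean M e g X"
abbreviation "\<phi> \<equiv> kernel_proj M d f X"
abbreviation "\<phi>' \<equiv> kernel_proj M e g X"

text \<open>Equal to (\<mu>'/e!) / (\<mu>/d!) times e/d: the ratio of the leading coefficients times
  the derivative at 1 of the map from N^d to N^e. A relative fluctuation of the passage index
  reaches the second statistic with this slope.\<close>

definition \<kappa> :: real where "\<kappa> = fact (d - 1) * \<mu>' / (fact (e - 1) * \<mu>)"

abbreviation "J \<equiv> {1..d} <+> {1..e}"

text \<open>One disjoint sum indexes both families of projections, so that all cross-covariances are
  handled by a single limit theorem and a single process.\<close>

definition Y :: "nat + nat \<Rightarrow> 's \<Rightarrow> real" where "Y = case_sum \<phi> \<phi>'"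
definition \<psi> :: "nat + nat \<Rightarrow> real \<Rightarrow> real" where
  "\<psi> = case_sum (\<lambda>j s. psi j d s 1) (\<lambda>j s. psi j e s 1)"
text \<open>The coefficients of c (Z' - \<kappa> Z); later \<open>c\<close> is the power of d!/\<mu>
  that multiplies the limit variable.\<close>

definition coef :: "real \<Rightarrow> nat + nat \<Rightarrow> real" where "coef c = case_sum (\<lambda>_. c * (- \<kappa>)) (\<lambda>_. c)"

text \<open>The meeting point of the two sides: \<open>difference_char\<close> reaches this sum from
  the U-statistics, \<open>limit_variance_eq\<close> from the Wiener integrals.\<close>

definition limit_variance :: "real \<Rightarrow> real" where
  "limit_variance c = (\<Sum>k\<in>J. \<Sum>l\<in>J. (\<integral>\<omega>. Y k (X 0 \<omega>) * Y l (X 0 \<omega>) \<partial>M) *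
    integral {0..1} (\<lambda>s. (coef c k * \<psi> k s) * (coef c l * \<psi> l s)))"

lemma finite_J: "finite J" by simp

lemma Y_measurable: "k \<in> J \<Longrightarrow> Y k \<in> borel_measurable S"
  by (auto simp: Y_def K.proj_measurable K'.proj_measurable)

lemma Y_square_integrable: "k \<in> J \<Longrightarrow> integrable M (\<lambda>\<omega>. (Y k (X 0 \<omega>))\<^sup>2)"
  by (auto simp: Y_def K.proj_square_integrable K'.proj_square_integrable)

lemma Y_expectation: "k \<in> J \<Longrightarrow> (\<integral>\<omega>. Y k (X 0 \<omega>) \<partial>M) = 0"
  by (auto simp: Y_def K.proj_expectation K'.proj_expectation)

lemma \<psi>_continuous: "continuous_on {0..1} (\<psi> k)"
  by (cases k) (auto simp: \<psi>_def psi_def intro!: continuous_intros)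

lemma weighted_continuous: "continuous_on {0..1} (\<lambda>s. coef c k * \<psi> k s)"
  by (intro continuous_on_mult continuous_on_const \<psi>_continuous)

lemma sum_J: "(\<Sum>k\<in>J. F k) = (\<Sum>j=1..d. F (Inl j)) + (\<Sum>j=1..e. F (Inr j))" for F :: "nat + nat \<Rightarrow> real"
  by (simp add: sum.Plus comp_def)

lemma weighted_sum_eq: "(\<Sum>k\<in>J. coef c k * \<psi> k s * Y k x) =
    c * ((\<Sum>j=1..e. \<phi>' j x * psi j e s 1) - \<kappa> * (\<Sum>j=1..d. \<phi> j x * psi j d s 1))"
  unfolding sum_J by (simp add: coef_def \<psi>_def Y_def sum_distrib_left algebra_simps sum_negf)

lemma limit_variance_eq_0_iff:
  assumes "c > 0"
  shows "limit_variance c = 0 \<longleftrightarrow> (\<forall>s\<in>{0..1}. AE \<omega> in M.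
    (\<Sum>j=1..e. \<phi>' j (X 0 \<omega>) * psi j e s 1) - \<kappa> * (\<Sum>j=1..d. \<phi> j (X 0 \<omega>) * psi j d s 1) = 0)"
  unfolding limit_variance_def
  using K.weighted_variance_eq_0_iff[where J=J and Y=Y and \<psi>="\<lambda>k s. coef c k * \<psi> k s",
      OF finite_J Y_measurable Y_square_integrable weighted_continuous] assms
  by (simp add: weighted_sum_eq)

text \<open>Elevating the projections of \<open>f\<close> brings both sums into the Bernstein basis
  of degree \<open>e - 1\<close>, and \<kappa> times the ratio of factorials becomes
  \<mu>'/\<mu>.\<close>

lemma degenerate_ge:
  assumes "c > 0" "d \<le> e"
  shows "limit_variance c = 0 \<longleftrightarrow> (\<forall>i\<in>{1..e}. AE \<omega> in M.
    \<phi>' i (X 0 \<omega>) = \<mu>' / \<mu> * (\<Sum>j=1..d. elevation d e i j * \<phi> j (X 0 \<omega>)))"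
proof -
  have \<kappa>: "\<kappa> * (fact (e - 1) / fact (d - 1)) = \<mu>' / \<mu>" by (simp add: \<kappa>_def)
  have "(\<Sum>j=1..e. \<phi>' j x * psi j e s 1) - \<kappa> * (\<Sum>j=1..d. \<phi> j x * psi j d s 1) =
      (\<Sum>i=1..e. (\<phi>' i x - \<mu>' / \<mu> * (\<Sum>j=1..d. elevation d e i j * \<phi> j x)) * psi i e s 1)" for x s
  proof -
    let ?F = "fact (e - 1) / fact (d - 1) :: real" and ?E = "\<lambda>i. \<Sum>j=1..d. elevation d e i j * \<phi> j x"
    have "(\<Sum>j=1..e. \<phi>' j x * psi j e s 1) - \<kappa> * (\<Sum>j=1..d. \<phi> j x * psi j d s 1) =
        (\<Sum>i=1..e. \<phi>' i x * psi i e s 1 - \<kappa> * (?F * ?E i * psi i e s 1))"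
      unfolding sum_psi_elevation[OF assms(2)] sum_subtractf sum_distrib_left[of \<kappa>] ..
    also have "\<dots> = (\<Sum>i=1..e. (\<phi>' i x - \<kappa> * ?F * ?E i) * psi i e s 1)"
      by (intro sum.cong refl) (simp only: left_diff_distrib mult.assoc)
    finally show ?thesis unfolding \<kappa> .
  qed
  then show ?thesis
    unfolding limit_variance_eq_0_iff[OF assms(1)] by (simp only: bernstein_AE_eq_0_iff right_minus_eq)
qed

text \<open>Now the projections of \<open>g\<close> have the lower degree and are elevated. The
  factor -\<kappa> is taken out of every coordinate, which is where \<mu>' must not vanish.\<close>

lemma degenerate_less:
  assumes "c > 0" "e < d" "\<mu>' \<noteq> 0"
  shows "limit_variance c = 0 \<longleftrightarrow> (\<forall>i\<in>{1..d}. AE \<omega> in M.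
    \<phi> i (X 0 \<omega>) = \<mu> / \<mu>' * (\<Sum>j=1..e. elevation e d i j * \<phi>' j (X 0 \<omega>)))"
proof -
  have ed: "e \<le> d" using assms by simp
  have \<kappa>: "\<kappa> * (\<mu> / \<mu>') = fact (d - 1) / fact (e - 1)" "\<kappa> \<noteq> 0"
    using assms mean_pos by (simp_all add: \<kappa>_def)
  have "(\<Sum>j=1..e. \<phi>' j x * psi j e s 1) - \<kappa> * (\<Sum>j=1..d. \<phi> j x * psi j d s 1) =
      (\<Sum>i=1..d. (- \<kappa> * (\<phi> i x - \<mu> / \<mu>' * (\<Sum>j=1..e. elevation e d i j * \<phi>' j x))) * psi i d s 1)" for x s
  proof -
    let ?E = "\<lambda>i. \<Sum>j=1..e. elevation e d i j * \<phi>' j x"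
    have "(\<Sum>j=1..e. \<phi>' j x * psi j e s 1) - \<kappa> * (\<Sum>j=1..d. \<phi> j x * psi j d s 1) =
        (\<Sum>i=1..d. \<kappa> * (\<mu> / \<mu>') * ?E i * psi i d s 1 - \<kappa> * (\<phi> i x * psi i d s 1))"
      unfolding sum_psi_elevation[OF ed] \<kappa>(1)[symmetric] sum_subtractf sum_distrib_left[of \<kappa>] ..
    also have "\<dots> = (\<Sum>i=1..d. (- \<kappa> * (\<phi> i x - \<mu> / \<mu>' * ?E i)) * psi i d s 1)"
      by (intro sum.cong refl) (simp only: left_diff_distrib right_diff_distrib mult_minus_left mult.assoc minus_diff_eq)
    finally show ?thesis .
  qed
  then show ?thesis
    unfolding limit_variance_eq_0_iff[OF assms(1)] using \<kappa>(2)
    by (simp only: bernstein_AE_eq_0_iff mult_eq_0_iff neg_equal_0_iff_equal right_minus_eq simp_thms)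
qed

text \<open>Here \<kappa> is 0, and the projections of \<open>g\<close> alone remain, already in one
  basis.\<close>

lemma degenerate_zero:
  assumes "c > 0" "\<mu>' = 0"
  shows "limit_variance c = 0 \<longleftrightarrow> (\<forall>j\<in>{1..e}. AE \<omega> in M. \<phi>' j (X 0 \<omega>) = 0)"
  unfolding limit_variance_eq_0_iff[OF assms(1)] using assms(2)
  by (simp add: \<kappa>_def bernstein_AE_eq_0_iff)

lemma degenerate_eq:
  assumes "c > 0" "e = d"
  shows "limit_variance c = 0 \<longleftrightarrow> (\<forall>i\<in>{1..d}. AE \<omega> in M. \<mu> * \<phi>' i (X 0 \<omega>) = \<mu>' * \<phi> i (X 0 \<omega>))"
proof -
  have "\<phi>' i x = \<mu>' / \<mu> * (\<Sum>j=1..d. elevation d e i j * \<phi> j x) \<longleftrightarrow> \<mu> * \<phi>' i x = \<mu>' * \<phi> i x"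
    if "i \<in> {1..d}" for i x
    using elevation_same[OF that, of "\<lambda>j. \<phi> j x"] mean_pos assms(2) by (simp add: field_simps)
  then show ?thesis using degenerate_ge[OF assms(1)] assms(2) by simp
qed

lemma degenerate_1:
  assumes "c > 0" "d = 1"
  shows "limit_variance c = 0 \<longleftrightarrow> (\<forall>i\<in>{1..e}. AE \<omega> in M. \<mu> * \<phi>' i (X 0 \<omega>) = \<mu>' * \<phi> 1 (X 0 \<omega>))"
proof -
  have "\<phi>' i x = \<mu>' / \<mu> * (\<Sum>j=1..d. elevation d e i j * \<phi> j x) \<longleftrightarrow> \<mu> * \<phi>' i x = \<mu>' * \<phi> 1 x"
    if "i \<in> {1..e}" for i x
    using elevation_from_1[OF that] mean_pos assms(2) by (simp add: field_simps)
  then show ?thesis using degenerate_ge[OF assms(1)] assms(2) K'.d_pos by simp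
qed

lemma cov_Y:
  assumes "k \<in> J" "l \<in> J"
  shows "cov M (\<lambda>\<omega>. Y k (X 0 \<omega>)) (\<lambda>\<omega>. Y l (X 0 \<omega>)) = (\<integral>\<omega>. Y k (X 0 \<omega>) * Y l (X 0 \<omega>) \<partial>M)"
  using assms by (simp add: cov_def Y_expectation)

text \<open>Merging the two families over the disjoint sum makes
  \<open>variance_wiener_integrals\<close> applicable; as the projections are centred, their
  covariances are plain product moments.\<close>

lemma limit_variance_eq:
  fixes P :: "'v measure" and W W' :: "nat \<Rightarrow> real \<Rightarrow> 'v \<Rightarrow> real" and I I' :: "nat \<Rightarrow> 'v \<Rightarrow> real"
  assumes process: "gaussian_process_with_cov P J
      (\<lambda>k l. cov M (\<lambda>\<omega>. case_sum \<phi> \<phi>' k (X 0 \<omega>)) (\<lambda>\<omega>. case_sum \<phi> \<phi>' l (X 0 \<omega>))) (case_sum W W')"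
    and I: "\<forall>j\<in>{1..d}. is_wiener_integral P (W j) 0 1 (\<lambda>s. psi j d s 1) (I j)"
    and I': "\<forall>j\<in>{1..e}. is_wiener_integral P (W' j) 0 1 (\<lambda>s. psi j e s 1) (I' j)"
  shows "limit_variance c = c\<^sup>2 * prob_space.variance P (\<lambda>\<omega>. (\<Sum>j=1..e. I' j \<omega>) - \<kappa> * (\<Sum>j=1..d. I j \<omega>))"
proof -
  interpret P: prob_space P using process unfolding gaussian_process_with_cov_def by blast
  interpret P: gaussian_process_cov P J "\<lambda>k l. cov M (\<lambda>\<omega>. case_sum \<phi> \<phi>' k (X 0 \<omega>)) (\<lambda>\<omega>. case_sum \<phi> \<phi>' l (X 0 \<omega>))" "case_sum W W'"
    using process by unfold_locales
  define II where "II = case_sum I I'"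
  have "is_wiener_integral P (case_sum W W' k) 0 1 (\<psi> k) (II k)" if "k \<in> J" for k
    using that I I' by (auto simp: II_def \<psi>_def)
  from P.variance_wiener_integrals[OF finite_J this \<psi>_continuous, of "coef c"]
  have "P.variance (\<lambda>\<omega>. \<Sum>k\<in>J. coef c k * II k \<omega>) = limit_variance c"
    unfolding limit_variance_def by (simp only: cov_Y[unfolded Y_def] Y_def cong: sum.cong)
  moreover have "(\<Sum>k\<in>J. coef c k * II k \<omega>) = c * ((\<Sum>j=1..e. I' j \<omega>) - \<kappa> * (\<Sum>j=1..d. I j \<omega>))" for \<omega>
    unfolding sum_J by (simp add: coef_def II_def sum_distrib_left algebra_simps sum_negf)
  moreover have "P.variance (\<lambda>\<omega>. c * Z \<omega>) = c\<^sup>2 * P.variance Z" for Z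
    by (simp add: right_diff_distrib[symmetric] power_mult_distrib)
  ultimately show ?thesis by simp
qed

end

section \<open>The central limit theorem at first passage\<close>

text \<open>On \<open>nat\<close>, \<open>Sup\<close> is \<open>Max\<close> with value 0 at the
  empty set and \<open>Inf\<close> is \<open>LEAST\<close>. In this form measurability holds on all
  paths, including those with an infinite or empty index set.\<close>

lemma (in iid_sequence) first_passage_measurable:
  assumes f: "f \<in> borel_measurable (Pi\<^sub>M {1..d} (\<lambda>_. S))" and N: "N \<in> {N_minus d f X, N_plus d f X}"
  shows "N x \<in> M \<rightarrow>\<^sub>M count_space UNIV"
proof -
  note [measurable] = ustat_measurable[OF f]
  have "(\<lambda>\<omega>. if \<forall>n. \<not> ustat d f X n \<omega> \<le> x then 0 else Max {n. ustat d f X n \<omega> \<le> x}) \<in> M \<rightarrow>\<^sub>M count_space UNIV"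
    by measurable
  moreover have "N_minus d f X x = (\<lambda>\<omega>. if \<forall>n. \<not> ustat d f X n \<omega> \<le> x then 0 else Max {n. ustat d f X n \<omega> \<le> x})"
    by (rule ext) (simp add: N_minus_def Sup_nat_def)
  moreover have "(\<lambda>\<omega>. LEAST n. ustat d f X n \<omega> > x) \<in> M \<rightarrow>\<^sub>M count_space UNIV" by measurable
  moreover have "N_plus d f X x = (\<lambda>\<omega>. LEAST n. ustat d f X n \<omega> > x)"
    by (rule ext) (simp add: N_plus_def Inf_nat_def)
  ultimately show ?thesis using N by auto
qed

text \<open>p^d - q^d contains the factor p - q, bounded by 1, so it is of order n^(d-1)
  only.\<close>

lemma adjacent_powers_null:
  fixes p q n :: "nat \<Rightarrow> real"
  assumes n: "filterlim n at_top sequentially"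
    and p: "(\<lambda>k. p k / n k) \<longlonglongrightarrow> 1" and q: "(\<lambda>k. q k / n k) \<longlonglongrightarrow> 1"
    and pq: "\<And>k. \<bar>p k - q k\<bar> \<le> 1"
  shows "(\<lambda>k. (p k ^ d - q k ^ d) / (n k ^ d / sqrt (n k))) \<longlonglongrightarrow> 0"
proof (rule Lim_null_comparison)
  define T where "T k = (\<Sum>i<d. (q k / n k) ^ (d - Suc i) * (p k / n k) ^ i)" for k
  have "T \<longlonglongrightarrow> (\<Sum>i<d. 1 ^ (d - Suc i) * 1 ^ i)"
    unfolding T_def by (intro tendsto_sum tendsto_mult tendsto_power p q)
  moreover have "(\<lambda>k. 1 / sqrt (n k)) \<longlonglongrightarrow> 0"
    using n by (intro real_tendsto_divide_at_top[OF tendsto_const] filterlim_compose[OF sqrt_at_top])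
  ultimately have "(\<lambda>k. 1 / sqrt (n k) * \<bar>T k\<bar>) \<longlonglongrightarrow> 0 * \<bar>\<Sum>i<d. 1 ^ (d - Suc i) * 1 ^ i\<bar>"
    by (intro tendsto_mult tendsto_rabs)
  then show "(\<lambda>k. 1 / sqrt (n k) * \<bar>T k\<bar>) \<longlonglongrightarrow> 0" by simp
  have "\<forall>\<^sub>F k in sequentially. n k > 0" using n unfolding filterlim_at_top_dense by blast
  then show "\<forall>\<^sub>F k in sequentially. norm ((p k ^ d - q k ^ d) / (n k ^ d / sqrt (n k))) \<le> 1 / sqrt (n k) * \<bar>T k\<bar>"
  proof eventually_elim
    case (elim k)
    have "(p k ^ d - q k ^ d) / (n k ^ d / sqrt (n k)) = ((p k / n k) ^ d - (q k / n k) ^ d) * sqrt (n k)"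
      using elim by (simp add: power_divide diff_divide_distrib left_diff_distrib)
    also have "\<dots> = (p k / n k - q k / n k) * T k * sqrt (n k)"
      unfolding T_def by (subst power_diff_sumr2) simp
    also have "norm \<dots> = \<bar>p k - q k\<bar> / n k * sqrt (n k) * \<bar>T k\<bar>"
      using elim by (simp add: abs_mult diff_divide_distrib[symmetric] abs_divide)
    also have "\<dots> \<le> 1 / n k * sqrt (n k) * \<bar>T k\<bar>"
      using elim pq by (intro mult_right_mono divide_right_mono) auto
    also have "1 / n k * sqrt (n k) = 1 / sqrt (n k)"
      using elim by (simp add: real_div_sqrt field_simps)
    finally show ?case .
  qed
qed

text \<open>The weights are at most 1 on [0, 1], so the normalized sums have second moments bounded
  uniformly in \<open>n\<close>.\<close>

lemma (in L2_kernel) linear_part_bounded: "bounded_in_prob linear_part"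
proof -
  define Z where "Z p n \<omega> = (\<Sum>m\<in>{1..n}. psi p d (real m / real n) 1 * \<phi> p (X m \<omega>)) / sqrt (real n)" for p n \<omega>
  have psi_le: "(psi p d (real m / real n) 1)\<^sup>2 \<le> 1" if "m \<in> {1..n}" for p m n
  proof -
    let ?u = "real m / real n"
    have u: "0 \<le> ?u" "?u \<le> 1" using that by auto
    have f: "1 / (fact (p - 1) * fact (d - p)) \<le> (1 :: real)" "0 \<le> 1 / (fact (p - 1) * fact (d - p) :: real)"
      using mult_mono[of 1 "fact (p - 1) :: real" 1 "fact (d - p)"] by (auto simp: divide_le_eq)
    have "psi p d ?u 1 \<le> 1 * 1 * 1"
      unfolding psi_def using u f by (intro mult_mono power_le_one mult_nonneg_nonneg) auto
    moreover have "0 \<le> psi p d ?u 1" unfolding psi_def using u f(2) by (intro mult_nonneg_nonneg zero_le_power) auto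
    ultimately show ?thesis by (simp add: power_le_one)
  qed
  have Zm: "Z p n \<in> borel_measurable M" if "p \<in> {1..d}" for p n
    unfolding Z_def[abs_def] using proj_X_measurable[OF that] by measurable
  have Zsq: "integrable M (\<lambda>\<omega>. (Z p n \<omega>)\<^sup>2)" if "p \<in> {1..d}" for p n
    unfolding Z_def power_divide by (intro integrable_divide expectation_square_weighted that)
  have Zb: "(\<integral>\<omega>. (Z p n \<omega>)\<^sup>2 \<partial>M) \<le> (\<integral>\<omega>. (\<phi> p (X 0 \<omega>))\<^sup>2 \<partial>M)" if p: "p \<in> {1..d}" for p n
  proof (cases "n = 0")
    case True
    then show ?thesis by (simp add: Z_def)
  next
    case False
    have "(\<integral>\<omega>. (Z p n \<omega>)\<^sup>2 \<partial>M) = (\<Sum>m\<in>{1..n}. (psi p d (real m / real n) 1)\<^sup>2) * (\<integral>\<omega>. (\<phi> p (X 0 \<omega>))\<^sup>2 \<partial>M) / real n"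
      unfolding Z_def power_divide by (simp add: expectation_square_weighted[OF p])
    also have "\<dots> \<le> (\<Sum>m\<in>{1..n}. 1) * (\<integral>\<omega>. (\<phi> p (X 0 \<omega>))\<^sup>2 \<partial>M) / real n"
      by (intro divide_right_mono mult_right_mono sum_mono psi_le) auto
    finally show ?thesis using False by simp
  qed
  have lin: "linear_part n \<omega> = (\<Sum>p\<in>{1..d}. Z p n \<omega>)" for n \<omega>
    unfolding linear_part_def Z_def sum_divide_distrib[symmetric] by (subst sum.swap) simp
  define C where "C = (\<Sum>p\<in>{1..d}. \<integral>\<omega>. (\<phi> p (X 0 \<omega>))\<^sup>2 \<partial>M) * real d"
  show ?thesis
  proof (rule bounded_in_prob_L2)
    show sq: "integrable M (\<lambda>\<omega>. (linear_part n \<omega>)\<^sup>2)" for n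
      unfolding lin by (intro integrable_square_sum Zm Zsq) auto
    show "(\<integral>\<omega>. (linear_part n \<omega>)\<^sup>2 \<partial>M) \<le> C" for n
    proof -
      have "(\<integral>\<omega>. (linear_part n \<omega>)\<^sup>2 \<partial>M) \<le> (\<integral>\<omega>. (\<Sum>p\<in>{1..d}. (Z p n \<omega>)\<^sup>2) * real d \<partial>M)"
      proof (rule integral_mono[OF sq])
        show "integrable M (\<lambda>\<omega>. (\<Sum>p\<in>{1..d}. (Z p n \<omega>)\<^sup>2) * real d)"
          by (intro integrable_mult_left Bochner_Integration.integrable_sum Zsq)
        show "(linear_part n \<omega>)\<^sup>2 \<le> (\<Sum>p\<in>{1..d}. (Z p n \<omega>)\<^sup>2) * real d" for \<omega>
          using sum_squared_le_sum_of_squares[of "\<lambda>p. Z p n \<omega>" "{1..d}"] by (simp add: lin)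
      qed
      also have "\<dots> = (\<Sum>p\<in>{1..d}. \<integral>\<omega>. (Z p n \<omega>)\<^sup>2 \<partial>M) * real d" using Zsq by simp
      also have "\<dots> \<le> C" unfolding C_def by (intro mult_right_mono sum_mono Zb) auto
      finally show ?thesis .
    qed
  qed measurable
qed

context two_kernels
begin

text \<open>Both linear parts are built from the same variables X_1, ..., X_n, so their combination
  is one weighted sum over \<open>J\<close>.\<close>

lemma difference_char:
  "(\<lambda>n. char (distr M borel (\<lambda>\<omega>. c * (K'.linear_part n \<omega> - \<kappa> * K.linear_part n \<omega>))) t)
    \<longlonglongrightarrow> complex_of_real (exp (- (t\<^sup>2) * limit_variance c / 2))"
proof -
  have "c * (K'.linear_part n \<omega> - \<kappa> * K.linear_part n \<omega>) =
      (\<Sum>m\<in>{1..n}. \<Sum>k\<in>J. coef c k * \<psi> k (real m / real n) * Y k (X m \<omega>)) / sqrt (real n)" for n \<omega>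
  proof -
    have "(\<Sum>m\<in>{1..n}. \<Sum>k\<in>J. coef c k * \<psi> k (real m / real n) * Y k (X m \<omega>)) =
        c * ((\<Sum>m\<in>{1..n}. \<Sum>p\<in>{1..e}. psi p e (real m / real n) 1 * \<phi>' p (X m \<omega>))
          - \<kappa> * (\<Sum>m\<in>{1..n}. \<Sum>p\<in>{1..d}. psi p d (real m / real n) 1 * \<phi> p (X m \<omega>)))"
      unfolding weighted_sum_eq
      by (simp only: sum_distrib_left[symmetric] sum_subtractf mult.commute)
    moreover have "c * (a / s - k * (b / s)) = c * (a - k * b) / s" for a b s k :: real
      by (simp add: diff_divide_distrib right_diff_distrib)
    ultimately show ?thesis unfolding K.linear_part_def K'.linear_part_def by simp
  qed
  then show ?thesis
    unfolding limit_variance_def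
    using K.weighted_clt_char[where J=J and Y=Y and \<psi>="\<lambda>k s. coef c k * \<psi> k s",
        OF finite_J Y_measurable Y_square_integrable Y_expectation weighted_continuous, of t]
    by simp
qed

abbreviation "\<theta> \<equiv> \<mu> / fact d"
abbreviation "\<theta>' \<equiv> \<mu>' / fact e"

lemma \<theta>_pos: "\<theta> > 0" using mean_pos by simp

text \<open>
  Put \<open>n\<^sub>0 = (x / \<theta>)\<^bsup>1/d\<^esup>\<close>. Since \<open>U\<^sub>N\<close> differs from \<open>x = \<theta> n\<^sub>0\<^bsup>d\<^esup>\<close> only by the size of a jump,
  the deviation of \<open>U\<^sub>N\<close> from \<open>\<theta> N\<^bsup>d\<^esup>\<close> determines \<open>N\<^bsup>d\<^esup> - n\<^sub>0\<^bsup>d\<^esup>\<close>, hence \<open>N\<^bsup>e\<^esup> - n\<^sub>0\<^bsup>e\<^esup>\<close>; the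
  quotient of the two differences is \<open>n\<^sub>0\<^bsup>e-d\<^esup>\<close> times a continuous function of \<open>N / n\<^sub>0\<close>.
\<close>

lemma first_passage_linearization:
  fixes xs :: "nat \<Rightarrow> real" and N :: "real \<Rightarrow> 'w \<Rightarrow> nat"
  assumes xs: "filterlim xs at_top sequentially" and N: "N \<in> {N_minus d f X, N_plus d f X}"
  defines "n0 \<equiv> \<lambda>k. (xs k / \<theta>) powr (1 / real d)"
  defines "n \<equiv> \<lambda>k. nat \<lfloor>n0 k\<rfloor>"
  shows "filterlim n sequentially sequentially"
    and "K.null_in_prob (\<lambda>k \<omega>. (ustat e g X (N (xs k) \<omega>) \<omega> - \<theta>' * n0 k ^ e) / (n0 k ^ e / sqrt (n0 k))
      - (K'.linear_part (n k) \<omega> - \<kappa> * K.linear_part (n k) \<omega>))"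
proof -
  define Nk where "Nk k \<omega> = N (xs k) \<omega>" for k \<omega>
  note d_pos = K.d_pos
  have n0_top: "filterlim n0 at_top sequentially"
  proof -
    have "filterlim (\<lambda>x. (x / a) powr p) at_top at_top" if "a > 0" "p > 0" for a p :: real
      using that by real_asymp
    from filterlim_compose[OF this[OF \<theta>_pos, of "1 / real d"] xs] show ?thesis using d_pos by (simp add: n0_def)
  qed
  have n_top: "filterlim n at_top sequentially"
  proof -
    have "filterlim (\<lambda>x :: real. nat \<lfloor>x\<rfloor>) at_top at_top" by real_asymp
    from filterlim_compose[OF this n0_top] show ?thesis by (simp add: n_def)
  qed
  then show "filterlim n sequentially sequentially" .
  have ratio_n: "(\<lambda>k. real (n k) / n0 k) \<longlonglongrightarrow> 1"
  proof -
    have "((\<lambda>x :: real. real (nat \<lfloor>x\<rfloor>) / x) \<longlongrightarrow> 1) at_top" by real_asymp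
    from filterlim_compose[OF this n0_top] show ?thesis by (simp add: n_def)
  qed
  have nreal_top: "filterlim (\<lambda>k. real (n k)) at_top sequentially"
    by (rule filterlim_compose[OF filterlim_real_sequentially n_top])
  have pos: "\<forall>\<^sub>F k in sequentially. xs k > 0 \<and> n0 k > 0 \<and> real (n k) > 0"
    using xs n0_top nreal_top unfolding filterlim_at_top_dense by (intro eventually_conj) blast+
  \<comment> \<open>\<open>n0 k\<close> is the exact real solution; only its integer part
    \<open>n k\<close> can serve as an index of the linear parts.\<close>
  have x_eq: "xs k = \<theta> * n0 k ^ d" if "xs k > 0" for k
  proof -
    have x: "xs k / \<theta> > 0" using that \<theta>_pos by (rule divide_pos_pos)
    then have "n0 k > 0" unfolding n0_def by (simp only: powr_gt_zero)
    then have "n0 k ^ d = n0 k powr real d" by (simp add: powr_realpow)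
    also have "\<dots> = (xs k / \<theta>) powr (1 / real d * real d)" unfolding n0_def by (rule powr_powr)
    also have "1 / real d * real d = 1" using d_pos by simp
    also have "(xs k / \<theta>) powr 1 = xs k / \<theta>" using less_imp_le[OF x] by (rule powr_one)
    finally have "n0 k ^ d = xs k / \<theta>" .
    moreover have "y = x / t \<Longrightarrow> t > 0 \<Longrightarrow> x = t * y" for x y t :: real by simp
    ultimately show ?thesis using \<theta>_pos by blast
  qed
  have Nk_m [measurable]: "Nk k \<in> M \<rightarrow>\<^sub>M count_space UNIV" for k
    unfolding Nk_def[abs_def] by (rule K.first_passage_measurable[OF K.f_measurable N])
  have NSup: "N x \<omega> = Sup {n. ustat d f X n \<omega> \<le> x} \<or> N x \<omega> = Inf {n. ustat d f X n \<omega> > x}" for x \<omega>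
    using N by (auto simp: N_minus_def N_plus_def)
  have ae: "AE \<omega> in M. (\<lambda>k. real (Nk k \<omega>) / n0 k) \<longlonglongrightarrow> 1 \<and> filterlim (\<lambda>n. ustat d f X n \<omega>) at_top sequentially"
    using K.strong_law_ustat[OF d_pos K.f_measurable K.f_L1]
  proof eventually_elim
    case (elim \<omega>)
    note asym = first_passage_asymptotics[OF d_pos \<theta>_pos ustat_0[OF d_pos] elim NSup]
    show ?case using filterlim_compose[OF asym(3) xs] asym(1) by (simp add: Nk_def n0_def)
  qed
  have ratio_Nn: "AE \<omega> in M. (\<lambda>k. real (Nk k \<omega>) / real (n k)) \<longlonglongrightarrow> 1"
    using ae
  proof eventually_elim
    case (elim \<omega>)
    then have "(\<lambda>k. (real (Nk k \<omega>) / n0 k) / (real (n k) / n0 k)) \<longlonglongrightarrow> 1 / 1"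
      by (intro tendsto_divide ratio_n) auto
    then have "(\<lambda>k. (real (Nk k \<omega>) / n0 k) / (real (n k) / n0 k)) \<longlonglongrightarrow> 1" by simp
    then show ?case
      by (rule Lim_transform_eventually) (use pos in eventually_elim, simp)
  qed
  \<comment> \<open>Stated for any index within distance 1 of the passage time, since it is used
    there and at the two neighbours.\<close>
  have ratio_shift: "AE \<omega> in M. (\<lambda>k. real (m k \<omega>) / real (n k)) \<longlonglongrightarrow> 1"
    if m: "\<And>k \<omega>. \<bar>real (m k \<omega>) - real (Nk k \<omega>)\<bar> \<le> 1" for m :: "nat \<Rightarrow> 'w \<Rightarrow> nat"
    using ratio_Nn
  proof eventually_elim
    case (elim \<omega>)
    have "(\<lambda>k. real (m k \<omega>) / real (n k) - real (Nk k \<omega>) / real (n k)) \<longlonglongrightarrow> 0"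
    proof (rule Lim_null_comparison)
      show "(\<lambda>k. 1 / real (n k)) \<longlonglongrightarrow> 0" by (rule real_tendsto_divide_at_top[OF tendsto_const nreal_top])
      show "\<forall>\<^sub>F k in sequentially. norm (real (m k \<omega>) / real (n k) - real (Nk k \<omega>) / real (n k)) \<le> 1 / real (n k)"
        using m by (intro always_eventually allI) (simp add: diff_divide_distrib[symmetric] abs_divide divide_right_mono)
    qed
    from tendsto_add[OF this elim] show ?case by simp
  qed
  have null_ratio: "K.null_in_prob (\<lambda>k \<omega>. real (m k \<omega>) / real (n k) - 1)"
    if m: "\<And>k \<omega>. \<bar>real (m k \<omega>) - real (Nk k \<omega>)\<bar> \<le> 1" and [measurable]: "\<And>k. m k \<in> M \<rightarrow>\<^sub>M count_space UNIV"
    for m :: "nat \<Rightarrow> 'w \<Rightarrow> nat"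
  proof (rule K.null_in_prob_AE)
    show "AE \<omega> in M. (\<lambda>k. real (m k \<omega>) / real (n k) - 1) \<longlonglongrightarrow> 0"
      using ratio_shift[OF m] by eventually_elim (simp add: LIM_zero)
  qed measurable
  let ?c = "\<lambda>k. real (n k) ^ d / sqrt (real (n k))"
  let ?c' = "\<lambda>k. real (n k) ^ e / sqrt (real (n k))"
  have dev: "K.null_in_prob (\<lambda>k \<omega>. (K.deviation (m k \<omega>) \<omega> - K.deviation (n k) \<omega>) / ?c k)"
    and dev': "K.null_in_prob (\<lambda>k \<omega>. (K'.deviation (m k \<omega>) \<omega> - K'.deviation (n k) \<omega>) / ?c' k)"
    if m: "\<And>k \<omega>. \<bar>real (m k \<omega>) - real (Nk k \<omega>)\<bar> \<le> 1" and mm: "\<And>k. m k \<in> M \<rightarrow>\<^sub>M count_space UNIV"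
    for m :: "nat \<Rightarrow> 'w \<Rightarrow> nat"
    by (rule K.deviation_random_index[OF n_top mm null_ratio[OF m mm]])
      (rule K'.deviation_random_index[OF n_top mm null_ratio[OF m mm]])
  have U_dev: "ustat d f X m \<omega> = K.deviation m \<omega> + \<theta> * real m ^ d" for m \<omega>
    by (simp add: K.deviation_def)
  have U_dev': "ustat e g X m \<omega> = K'.deviation m \<omega> + \<theta>' * real m ^ e" for m \<omega>
    by (simp add: K'.deviation_def)
  \<comment> \<open>Deviations at the neighbour and at the passage time are both close to the
    deviation at \<open>n k\<close>, and the two powers are close as well. Hence a jump is
    negligible, and no term at a random index has to be bounded directly.\<close>
  have jump: "K.null_in_prob (\<lambda>k \<omega>. (ustat d f X (m k \<omega>) \<omega> - ustat d f X (Nk k \<omega>) \<omega>) / ?c k)"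
    if m: "\<And>k \<omega>. \<bar>real (m k \<omega>) - real (Nk k \<omega>)\<bar> \<le> 1" and mm: "\<And>k. m k \<in> M \<rightarrow>\<^sub>M count_space UNIV"
    for m :: "nat \<Rightarrow> 'w \<Rightarrow> nat"
  proof -
    note [measurable] = mm
    have pw: "K.null_in_prob (\<lambda>k \<omega>. (real (m k \<omega>) ^ d - real (Nk k \<omega>) ^ d) / ?c k)"
    proof (rule K.null_in_prob_AE)
      show "AE \<omega> in M. (\<lambda>k. (real (m k \<omega>) ^ d - real (Nk k \<omega>) ^ d) / ?c k) \<longlonglongrightarrow> 0"
        using ratio_shift[OF m] ratio_Nn
        by eventually_elim (rule adjacent_powers_null[OF nreal_top _ _ m])
    qed measurable
    have "K.null_in_prob (\<lambda>k \<omega>. (K.deviation (m k \<omega>) \<omega> - K.deviation (n k) \<omega>) / ?c k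
        - (K.deviation (Nk k \<omega>) \<omega> - K.deviation (n k) \<omega>) / ?c k + \<theta> * ((real (m k \<omega>) ^ d - real (Nk k \<omega>) ^ d) / ?c k))"
      by (intro K.null_in_prob_add K.null_in_prob_diff K.null_in_prob_cmult pw dev m mm Nk_m) simp
    moreover have "(K.deviation (m k \<omega>) \<omega> - K.deviation (n k) \<omega>) / ?c k
        - (K.deviation (Nk k \<omega>) \<omega> - K.deviation (n k) \<omega>) / ?c k + \<theta> * ((real (m k \<omega>) ^ d - real (Nk k \<omega>) ^ d) / ?c k)
        = (ustat d f X (m k \<omega>) \<omega> - ustat d f X (Nk k \<omega>) \<omega>) / ?c k" for k \<omega>
    proof -
      have "(a - b) / c - (a' - b) / c + h * ((p - q) / c) = (a + h * p - (a' + h * q)) / c" for a b c a' h p q :: real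
        by (simp add: diff_divide_distrib add_divide_distrib algebra_simps)
      then show ?thesis unfolding U_dev .
    qed
    ultimately show ?thesis by simp
  qed
  have abs_null: "K.null_in_prob (\<lambda>k \<omega>. \<bar>Z k \<omega>\<bar>)" if "K.null_in_prob Z" for Z
    by (rule K.null_in_prob_dominated[OF that]) (auto intro!: borel_measurable_abs K.null_in_prob_measurable[OF that])
  \<comment> \<open>The passage time is an end of an upcrossing, so its distance to the level is at
    most the jump to one of its neighbours; the sum of both jumps covers either case.\<close>
  have overshoot: "K.null_in_prob (\<lambda>k \<omega>. (ustat d f X (Nk k \<omega>) \<omega> - xs k) / ?c k)"
  proof (rule K.null_in_prob_dominated)
    have Suc_m: "(\<lambda>\<omega>. Suc (Nk k \<omega>)) \<in> M \<rightarrow>\<^sub>M count_space UNIV" "(\<lambda>\<omega>. Nk k \<omega> - 1) \<in> M \<rightarrow>\<^sub>M count_space UNIV" for k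
      by measurable
    have "K.null_in_prob (\<lambda>k \<omega>. \<bar>(ustat d f X (Suc (Nk k \<omega>)) \<omega> - ustat d f X (Nk k \<omega>) \<omega>) / ?c k\<bar>)"
      by (intro abs_null jump Suc_m) simp
    moreover have "K.null_in_prob (\<lambda>k \<omega>. \<bar>(ustat d f X (Nk k \<omega> - 1) \<omega> - ustat d f X (Nk k \<omega>) \<omega>) / ?c k\<bar>)"
      by (intro abs_null jump Suc_m) (simp add: of_nat_diff)
    ultimately show "K.null_in_prob (\<lambda>k \<omega>. \<bar>(ustat d f X (Suc (Nk k \<omega>)) \<omega> - ustat d f X (Nk k \<omega>) \<omega>) / ?c k\<bar>
        + \<bar>(ustat d f X (Nk k \<omega> - 1) \<omega> - ustat d f X (Nk k \<omega>) \<omega>) / ?c k\<bar>)"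
      by (rule K.null_in_prob_add)
    have "(\<lambda>\<omega>. ustat d f X (Nk k \<omega>) \<omega>) \<in> borel_measurable M" for k
      by (rule measurable_compose_countable[OF K.ustat_measurable[OF K.f_measurable] Nk_m])
    then show "(\<lambda>\<omega>. (ustat d f X (Nk k \<omega>) \<omega> - xs k) / ?c k) \<in> borel_measurable M" for k by measurable
    show "\<forall>\<^sub>F k in sequentially. AE \<omega> in M. \<bar>(ustat d f X (Nk k \<omega>) \<omega> - xs k) / ?c k\<bar> \<le>
        \<bar>\<bar>(ustat d f X (Suc (Nk k \<omega>)) \<omega> - ustat d f X (Nk k \<omega>) \<omega>) / ?c k\<bar>
        + \<bar>(ustat d f X (Nk k \<omega> - 1) \<omega> - ustat d f X (Nk k \<omega>) \<omega>) / ?c k\<bar>\<bar>"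
      using pos
    proof eventually_elim
      case (elim k)
      from ae show ?case
      proof eventually_elim
        case (elim \<omega>)
        have "ustat d f X 0 \<omega> \<le> xs k" using \<open>xs k > 0 \<and> n0 k > 0 \<and> real (n k) > 0\<close> by (simp add: ustat_0[OF d_pos])
        from first_passage[OF _ this NSup[of "xs k" \<omega>]] elim
        obtain a where a: "ustat d f X a \<omega> \<le> xs k" "xs k < ustat d f X (Suc a) \<omega>" "Nk k \<omega> = a \<or> Nk k \<omega> = Suc a"
          by (auto simp: Nk_def)
        have "\<bar>ustat d f X (Nk k \<omega>) \<omega> - xs k\<bar> \<le> \<bar>ustat d f X (Suc (Nk k \<omega>)) \<omega> - ustat d f X (Nk k \<omega>) \<omega>\<bar>
            + \<bar>ustat d f X (Nk k \<omega> - 1) \<omega> - ustat d f X (Nk k \<omega>) \<omega>\<bar>"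
          using a(3)
        proof
          assume "Nk k \<omega> = a"
          then show ?thesis using a(1,2) by simp
        next
          assume "Nk k \<omega> = Suc a"
          then show ?thesis using a(1,2) by simp
        qed
        moreover have "\<bar>a / c\<bar> \<le> \<bar>\<bar>b / c\<bar> + \<bar>b' / c\<bar>\<bar>" if "\<bar>a\<bar> \<le> \<bar>b\<bar> + \<bar>b'\<bar>" for a b b' c :: real
          using that by (simp add: abs_divide add_divide_distrib[symmetric] divide_right_mono)
        ultimately show ?case by blast
      qed
    qed
  qed
  have lin: "K.null_in_prob (\<lambda>k \<omega>. K.deviation (n k) \<omega> / ?c k - K.linear_part (n k) \<omega>)"
    by (rule K.null_in_prob_compose[OF K.deviation_linear_part n_top])
  have lin': "K.null_in_prob (\<lambda>k \<omega>. K'.deviation (n k) \<omega> / ?c' k - K'.linear_part (n k) \<omega>)"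
    by (rule K.null_in_prob_compose[OF K'.deviation_linear_part n_top])
  have bd: "K.bounded_in_prob (\<lambda>k. K.linear_part (n k))"
    by (rule K.bounded_in_prob_compose[OF K.linear_part_bounded n_top])
  have bd': "K.bounded_in_prob (\<lambda>k. K'.linear_part (n k))"
    by (rule K.bounded_in_prob_compose[OF K'.linear_part_bounded n_top])
  \<comment> \<open>For positive \<open>xs k\<close> the numerator equals \<theta> (N^d - n0^d), the
    shift of the passage index measured in the d-th power.\<close>
  define T where "T k \<omega> = ((ustat d f X (Nk k \<omega>) \<omega> - xs k) - K.deviation (Nk k \<omega>) \<omega>) / ?c k" for k \<omega>
  define T' where "T' k \<omega> = K'.deviation (Nk k \<omega>) \<omega> / ?c' k" for k \<omega>
  \<comment> \<open>With a negligible overshoot the shift is minus the deviation, that is, minus the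
    linear part of the first statistic.\<close>
  have T: "K.null_in_prob (\<lambda>k \<omega>. T k \<omega> + K.linear_part (n k) \<omega>)"
  proof -
    have "K.null_in_prob (\<lambda>k \<omega>. (ustat d f X (Nk k \<omega>) \<omega> - xs k) / ?c k
        - (K.deviation (Nk k \<omega>) \<omega> - K.deviation (n k) \<omega>) / ?c k - (K.deviation (n k) \<omega> / ?c k - K.linear_part (n k) \<omega>))"
      by (intro K.null_in_prob_diff overshoot dev Nk_m lin) simp
    moreover have "(ustat d f X (Nk k \<omega>) \<omega> - xs k) / ?c k
        - (K.deviation (Nk k \<omega>) \<omega> - K.deviation (n k) \<omega>) / ?c k - (K.deviation (n k) \<omega> / ?c k - K.linear_part (n k) \<omega>) =
        T k \<omega> + K.linear_part (n k) \<omega>" for k \<omega>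
    proof -
      have "u / c - (a - b) / c - (b / c - l) = (u - a) / c + l" for u a b c l :: real
        by (simp add: diff_divide_distrib)
      then show ?thesis unfolding T_def .
    qed
    ultimately show ?thesis by (simp only:)
  qed
  have T': "K.null_in_prob (\<lambda>k \<omega>. T' k \<omega> - K'.linear_part (n k) \<omega>)"
  proof -
    have "K.null_in_prob (\<lambda>k \<omega>. (K'.deviation (Nk k \<omega>) \<omega> - K'.deviation (n k) \<omega>) / ?c' k
        + (K'.deviation (n k) \<omega> / ?c' k - K'.linear_part (n k) \<omega>))"
      by (intro K.null_in_prob_add dev' Nk_m lin') simp
    moreover have "(a - b) / c + (b / c - l) = a / c - l" for a b c l :: real
      by (simp add: diff_divide_distrib)
    ultimately show ?thesis unfolding T'_def by (simp only:)
  qed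
  have bT': "K.bounded_in_prob T'"
    using K.bounded_in_prob_add_null[OF bd' T'] by simp
  have bT: "K.bounded_in_prob T"
  proof -
    have "K.bounded_in_prob (\<lambda>k \<omega>. K.linear_part (n k) \<omega> + (- 1) * (T k \<omega> + K.linear_part (n k) \<omega>))"
      by (intro K.bounded_in_prob_add_null[OF bd] K.null_in_prob_cmult T)
    then have "K.bounded_in_prob (\<lambda>k \<omega>. - T k \<omega>)" by simp
    then show ?thesis unfolding K.bounded_in_prob_def by simp
  qed
  \<comment> \<open>Corrects the normalization from the integer part \<open>n k\<close> to
    \<open>n0 k\<close>.\<close>
  define \<rho> where "\<rho> k = real (n k) ^ d / sqrt (real (n k)) / (n0 k ^ d / sqrt (n0 k))" for k
  define \<rho>' where "\<rho>' k = real (n k) ^ e / sqrt (real (n k)) / (n0 k ^ e / sqrt (n0 k))" for k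
  have \<rho>_lim: "(\<lambda>k. real (n k) ^ m / sqrt (real (n k)) / (n0 k ^ m / sqrt (n0 k))) \<longlonglongrightarrow> 1" for m
  proof -
    have "(\<lambda>k. (real (n k) / n0 k) ^ m / sqrt (real (n k) / n0 k)) \<longlonglongrightarrow> 1 ^ m / sqrt 1"
      by (intro tendsto_divide tendsto_power tendsto_real_sqrt ratio_n) simp
    moreover have "(a / b) ^ m / sqrt (a / b) = a ^ m / sqrt a / (b ^ m / sqrt b)" for a b :: real
      by (simp add: power_divide real_sqrt_divide)
    ultimately show ?thesis by (simp only: power_one real_sqrt_one div_by_1)
  qed
  have \<rho>: "\<rho> \<longlonglongrightarrow> 1" and \<rho>': "\<rho>' \<longlonglongrightarrow> 1" unfolding \<rho>_def \<rho>'_def by (rule \<rho>_lim)+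
  \<comment> \<open>(r^e - 1) / (r^d - 1) with the factor r - 1 cancelled; it is continuous at r =
    1, with value e/d.\<close>
  define q where "q r = (\<Sum>i<e. r ^ i) / (\<Sum>i<d. r ^ i)" for r :: real
  define r where "r k \<omega> = real (Nk k \<omega>) / n0 k" for k \<omega>
  have \<kappa>_eq: "\<theta>' / \<theta> * (real e / real d) = \<kappa>"
    using d_pos K'.d_pos fact_reduce[of d, where 'a=real] fact_reduce[of e, where 'a=real] mean_pos
    by (simp add: \<kappa>_def)
  have q_null: "K.null_in_prob (\<lambda>k \<omega>. \<theta>' / \<theta> * q (r k \<omega>) * \<rho> k - \<kappa>)"
  proof (rule K.null_in_prob_AE)
    show "(\<lambda>\<omega>. \<theta>' / \<theta> * q (r k \<omega>) * \<rho> k - \<kappa>) \<in> borel_measurable M" for k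
      unfolding q_def r_def by measurable
    show "AE \<omega> in M. (\<lambda>k. \<theta>' / \<theta> * q (r k \<omega>) * \<rho> k - \<kappa>) \<longlonglongrightarrow> 0"
      using ae
    proof eventually_elim
      case (elim \<omega>)
      then have r1: "(\<lambda>k. r k \<omega>) \<longlonglongrightarrow> 1" by (simp add: r_def)
      have "(\<lambda>k. q (r k \<omega>)) \<longlonglongrightarrow> (\<Sum>i<e. 1 ^ i) / (\<Sum>i<d. 1 ^ i)"
        unfolding q_def using d_pos by (intro tendsto_divide tendsto_sum tendsto_power r1) simp
      then have "(\<lambda>k. q (r k \<omega>)) \<longlonglongrightarrow> real e / real d" by simp
      then have "(\<lambda>k. \<theta>' / \<theta> * q (r k \<omega>) * \<rho> k - \<kappa>) \<longlonglongrightarrow> \<theta>' / \<theta> * (real e / real d) * 1 - \<kappa>"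
        by (intro tendsto_diff tendsto_mult tendsto_const \<rho>)
      then show ?case unfolding \<kappa>_eq by simp
    qed
  qed
  have \<rho>'_null: "K.null_in_prob (\<lambda>k \<omega>. \<rho>' k - 1)"
    by (rule K.null_in_prob_const) (use \<rho>' in \<open>simp add: LIM_zero\<close>)
  \<comment> \<open>The exact expansion has the coefficients \<rho>' of T' and (\<theta>'/\<theta>)
    q \<rho> of T, tending to 1 and \<kappa>. Tightness of T and T' makes the coefficient errors
    negligible.\<close>
  have main: "K.null_in_prob (\<lambda>k \<omega>. ((\<rho>' k - 1) * T' k \<omega> + (T' k \<omega> - K'.linear_part (n k) \<omega>))
      + ((\<theta>' / \<theta> * q (r k \<omega>) * \<rho> k - \<kappa>) * T k \<omega> + \<kappa> * (T k \<omega> + K.linear_part (n k) \<omega>)))"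
    by (intro K.null_in_prob_add K.null_in_prob_mult_bounded K.null_in_prob_cmult T T' bT bT' q_null \<rho>'_null)
  show "K.null_in_prob (\<lambda>k \<omega>. (ustat e g X (N (xs k) \<omega>) \<omega> - \<theta>' * n0 k ^ e) / (n0 k ^ e / sqrt (n0 k))
      - (K'.linear_part (n k) \<omega> - \<kappa> * K.linear_part (n k) \<omega>))"
  proof (rule K.null_in_prob_cong[OF main])
    have "(\<lambda>\<omega>. ustat e g X (Nk k \<omega>) \<omega>) \<in> borel_measurable M" for k
      by (rule measurable_compose_countable[OF K.ustat_measurable[OF K'.f_measurable] Nk_m])
    then show "(\<lambda>\<omega>. (ustat e g X (N (xs k) \<omega>) \<omega> - \<theta>' * n0 k ^ e) / (n0 k ^ e / sqrt (n0 k))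
      - (K'.linear_part (n k) \<omega> - \<kappa> * K.linear_part (n k) \<omega>)) \<in> borel_measurable M" for k
      unfolding Nk_def by measurable
    show "\<forall>\<^sub>F k in sequentially. AE \<omega> in M. (ustat e g X (N (xs k) \<omega>) \<omega> - \<theta>' * n0 k ^ e) / (n0 k ^ e / sqrt (n0 k))
      - (K'.linear_part (n k) \<omega> - \<kappa> * K.linear_part (n k) \<omega>) =
      ((\<rho>' k - 1) * T' k \<omega> + (T' k \<omega> - K'.linear_part (n k) \<omega>))
      + ((\<theta>' / \<theta> * q (r k \<omega>) * \<rho> k - \<kappa>) * T k \<omega> + \<kappa> * (T k \<omega> + K.linear_part (n k) \<omega>))"
      using pos
    proof eventually_elim
      case (elim k)
      then have p: "xs k > 0" "n0 k > 0" "real (n k) > 0" by auto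
      have c0: "?c k \<noteq> 0" "?c' k \<noteq> 0" using p by auto
      show ?case
      proof (rule AE_I2)
        fix \<omega>
        have pw: "h * (N ^ m - y ^ m) / (y ^ m / s) = h * (((N / y) ^ m - 1) * s)" if "y \<noteq> 0" for h N y s :: real and m :: nat
          using that by (simp add: power_divide field_simps)
        have r0: "r k \<omega> \<ge> 0" using p by (simp add: r_def)
        have denom: "(\<Sum>i<d. r k \<omega> ^ i) > 0"
        proof -
          have "(\<Sum>i\<in>{0}. r k \<omega> ^ i) \<le> (\<Sum>i<d. r k \<omega> ^ i)"
            using r0 d_pos by (intro sum_mono2) auto
          then show ?thesis by simp
        qed
        have ratio: "r k \<omega> ^ e - 1 = q (r k \<omega>) * (r k \<omega> ^ d - 1)"
        proof -
          have "r k \<omega> ^ m - 1 = (r k \<omega> - 1) * (\<Sum>i<m. r k \<omega> ^ i)" for m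
            by (rule power_diff_1_eq)
          then show ?thesis using denom by (simp add: q_def)
        qed
        have cancel: "D / B = A / B * (D / A)" if "A \<noteq> 0" for A B D :: real using that by simp
        have T'_eq: "K'.deviation (Nk k \<omega>) \<omega> / (n0 k ^ e / sqrt (n0 k)) = \<rho>' k * T' k \<omega>"
          unfolding \<rho>'_def T'_def by (rule cancel[OF c0(2)])
        have T_eq: "(r k \<omega> ^ d - 1) * sqrt (n0 k) = \<rho> k * T k \<omega> / \<theta>"
        proof -
          have "\<rho> k * T k \<omega> = ((ustat d f X (Nk k \<omega>) \<omega> - xs k) - K.deviation (Nk k \<omega>) \<omega>) / (n0 k ^ d / sqrt (n0 k))"
            unfolding \<rho>_def T_def by (rule cancel[OF c0(1), symmetric])
          also have "\<dots> = \<theta> * (real (Nk k \<omega>) ^ d - n0 k ^ d) / (n0 k ^ d / sqrt (n0 k))"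
            unfolding U_dev x_eq[OF p(1)] by (simp only: right_diff_distrib) simp
          also have "\<dots> = \<theta> * ((r k \<omega> ^ d - 1) * sqrt (n0 k))"
            unfolding r_def by (rule pw) (use p in simp)
          finally have "\<rho> k * T k \<omega> = \<theta> * ((r k \<omega> ^ d - 1) * sqrt (n0 k))" .
          moreover have "x = h * y \<Longrightarrow> h > 0 \<Longrightarrow> y = x / h" for x y h :: real by simp
          ultimately show ?thesis using \<theta>_pos by blast
        qed
        have "(ustat e g X (Nk k \<omega>) \<omega> - \<theta>' * n0 k ^ e) / (n0 k ^ e / sqrt (n0 k)) =
            K'.deviation (Nk k \<omega>) \<omega> / (n0 k ^ e / sqrt (n0 k)) + \<theta>' * ((r k \<omega> ^ e - 1) * sqrt (n0 k))"
        proof -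
          have "?thesis \<longleftrightarrow> \<theta>' * (real (Nk k \<omega>) ^ e - n0 k ^ e) / (n0 k ^ e / sqrt (n0 k)) = \<theta>' * ((r k \<omega> ^ e - 1) * sqrt (n0 k))"
          proof -
            have "(u + t * a - t * b) / c = u / c + w \<longleftrightarrow> t * (a - b) / c = w" for u t a b c w :: real
              by (simp add: right_diff_distrib add_divide_distrib diff_divide_distrib)
            then show ?thesis unfolding U_dev' .
          qed
          moreover have "\<theta>' * (real (Nk k \<omega>) ^ e - n0 k ^ e) / (n0 k ^ e / sqrt (n0 k)) = \<theta>' * ((r k \<omega> ^ e - 1) * sqrt (n0 k))"
            unfolding r_def by (rule pw) (use p in simp)
          ultimately show ?thesis by blast
        qed
        also have "\<dots> = \<rho>' k * T' k \<omega> + \<theta>' * (q (r k \<omega>) * (\<rho> k * T k \<omega> / \<theta>))"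
          unfolding T'_eq ratio T_eq[symmetric] by (simp only: mult.assoc)
        also have "\<theta>' * (q (r k \<omega>) * (\<rho> k * T k \<omega> / \<theta>)) = \<theta>' / \<theta> * q (r k \<omega>) * \<rho> k * T k \<omega>"
        proof -
          have "a * (b * (p * y / h)) = a / h * b * p * y" for a b p y h :: real by simp
          then show ?thesis .
        qed
        finally have *: "(ustat e g X (N (xs k) \<omega>) \<omega> - \<theta>' * n0 k ^ e) / (n0 k ^ e / sqrt (n0 k)) =
            \<rho>' k * T' k \<omega> + \<theta>' / \<theta> * q (r k \<omega>) * \<rho> k * T k \<omega>" unfolding Nk_def .
        have alg: "a * x + b * y - (l' - c * l) = ((a - 1) * x + (x - l')) + ((b - c) * y + c * (y + l))" for a x b y l' l c :: real
          by (simp add: algebra_simps)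
        show "(ustat e g X (N (xs k) \<omega>) \<omega> - \<theta>' * n0 k ^ e) / (n0 k ^ e / sqrt (n0 k))
          - (K'.linear_part (n k) \<omega> - \<kappa> * K.linear_part (n k) \<omega>) =
          ((\<rho>' k - 1) * T' k \<omega> + (T' k \<omega> - K'.linear_part (n k) \<omega>))
          + ((\<theta>' / \<theta> * q (r k \<omega>) * \<rho> k - \<kappa>) * T k \<omega> + \<kappa> * (T k \<omega> + K.linear_part (n k) \<omega>))"
          unfolding * by (rule alg)
      qed
    qed
  qed
qed

text \<open>In terms of y = x / \<theta> the centring is \<theta>' y^(e/d) and the scale is y to the
  power e/d - 1/(2d). Writing y as x d!/\<mu> splits off the constant power.\<close>

lemma first_passage_scaling:
  fixes x u :: real
  assumes "x > 0"
  defines "n0 \<equiv> (x / \<theta>) powr (1 / real d)"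
  shows "(u - (fact d / \<mu>) powr (real e / real d) * (\<mu>' / fact e) * x powr (real e / real d))
      / x powr (real e / real d - 1 / (2 * real d)) =
    (fact d / \<mu>) powr (real e / real d - 1 / (2 * real d)) * ((u - \<theta>' * n0 ^ e) / (n0 ^ e / sqrt n0))"
proof -
  define a y where "a = fact d / \<mu>" and "y = x / \<theta>"
  have a: "a > 0" and y: "y > 0" and y_eq: "y = a * x"
    using mean_pos assms by (auto simp: a_def y_def)
  have n0: "n0 > 0" using y unfolding n0_def y_def[symmetric] by simp
  have n0_eq: "n0 = y powr (1 / real d)" by (simp only: n0_def y_def)
  have pow: "n0 ^ e = y powr (real e / real d)"
  proof -
    have "n0 ^ e = n0 powr real e" using n0 by (simp add: powr_realpow)
    then show ?thesis unfolding n0_eq by (simp add: powr_powr)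
  qed
  have sqrt: "sqrt n0 = y powr (1 / (2 * real d))"
  proof -
    have "sqrt n0 = n0 powr (1 / 2)" using n0 by (simp add: powr_half_sqrt)
    then show ?thesis unfolding n0_eq by (simp add: powr_powr mult.commute)
  qed
  have "(u - a powr p * t * x powr p) / x powr b = a powr b * ((u - t * y powr p) / y powr b)" for p t b
    using a assms(1) by (simp add: y_eq powr_mult mult_ac)
  then show ?thesis unfolding pow sqrt powr_diff[symmetric] a_def .
qed

text \<open>Convergence as x grows is tested along sequences \<open>xs\<close>. There the
  linearization leads to linear parts at a deterministic index, and Levy's continuity theorem turns
  characteristic functions into weak convergence.\<close>

theorem first_passage_clt:
  assumes N: "N \<in> {N_minus d f X, N_plus d f X}"
  defines "v \<equiv> limit_variance ((fact d / \<mu>) powr (real e / real d - 1 / (2 * real d)))"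
  assumes v: "v \<ge> 0"
  shows "weak_conv_filter
    (\<lambda>x. distr M borel (\<lambda>\<omega>. (ustat e g X (N x \<omega>) \<omega>
      - (fact d / \<mu>) powr (real e / real d) * (\<mu>' / fact e) * x powr (real e / real d))
      / x powr (real e / real d - 1 / (2 * real d))))
    (normal_law 0 v) at_top"
  unfolding weak_conv_filter_def
proof (intro allI impI tendsto_at_topI_sequentially)
  fix y :: real and xs :: "nat \<Rightarrow> real"
  assume y: "isCont (cdf (normal_law 0 v)) y" and xs: "filterlim xs at_top sequentially"
  define V where "V x \<omega> = (ustat e g X (N x \<omega>) \<omega>
      - (fact d / \<mu>) powr (real e / real d) * (\<mu>' / fact e) * x powr (real e / real d))
      / x powr (real e / real d - 1 / (2 * real d))" for x \<omega>
  define c where "c = (fact d / \<mu>) powr (real e / real d - 1 / (2 * real d))"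
  define n where "n k = nat \<lfloor>(xs k / \<theta>) powr (1 / real d)\<rfloor>" for k
  define L where "L n \<omega> = c * (K'.linear_part n \<omega> - \<kappa> * K.linear_part n \<omega>)" for n \<omega>
  have Lm: "L n \<in> borel_measurable M" for n
    unfolding L_def[abs_def]
    by (intro borel_measurable_times borel_measurable_diff borel_measurable_const
        K.linear_part_measurable K'.linear_part_measurable)
  have Vm: "V x \<in> borel_measurable M" for x
  proof -
    have "(\<lambda>\<omega>. ustat e g X (N x \<omega>) \<omega>) \<in> borel_measurable M"
      by (rule measurable_compose_countable[OF K.ustat_measurable[OF K'.f_measurable]
            K.first_passage_measurable[OF K.f_measurable N]])
    then show ?thesis unfolding V_def[abs_def] by measurable
  qed
  note lin = first_passage_linearization[OF xs N]
  have "K.null_in_prob (\<lambda>k \<omega>. V (xs k) \<omega> - L (n k) \<omega>)"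
  proof (rule K.null_in_prob_cong[OF K.null_in_prob_cmult[OF lin(2), of c]])
    show "(\<lambda>\<omega>. V (xs k) \<omega> - L (n k) \<omega>) \<in> borel_measurable M" for k
      by (intro borel_measurable_diff Vm Lm)
    have "\<forall>\<^sub>F k in sequentially. xs k > 0" using xs unfolding filterlim_at_top_dense by blast
    then show "\<forall>\<^sub>F k in sequentially. AE \<omega> in M. V (xs k) \<omega> - L (n k) \<omega> =
      c * ((ustat e g X (N (xs k) \<omega>) \<omega> - \<theta>' * ((xs k / \<theta>) powr (1 / real d)) ^ e)
          / (((xs k / \<theta>) powr (1 / real d)) ^ e / sqrt ((xs k / \<theta>) powr (1 / real d)))
        - (K'.linear_part (nat \<lfloor>(xs k / \<theta>) powr (1 / real d)\<rfloor>) \<omega>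
          - \<kappa> * K.linear_part (nat \<lfloor>(xs k / \<theta>) powr (1 / real d)\<rfloor>) \<omega>))"
    proof eventually_elim
      case (elim k)
      show ?case
        unfolding V_def L_def n_def first_passage_scaling[OF elim] c_def[symmetric]
        by (rule AE_I2) (simp only: right_diff_distrib)
    qed
  qed
  moreover have "(\<lambda>k. char (distr M borel (L (n k))) t) \<longlonglongrightarrow> char (normal_law 0 v) t" for t
  proof -
    have "filterlim n sequentially sequentially" using lin(1) by (simp only: n_def[abs_def])
    from filterlim_compose[OF difference_char[of c t] this] show ?thesis
      unfolding char_normal_law[OF v] unfolding L_def[abs_def] v_def c_def .
  qed
  ultimately have "(\<lambda>k. char (distr M borel (V (xs k))) t) \<longlonglongrightarrow> char (normal_law 0 v) t" for t
    by (intro K.char_tendsto_cong[of "\<lambda>k. V (xs k)" "\<lambda>k. L (n k)"] Vm Lm)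
  then have "weak_conv_m (\<lambda>k. distr M borel (V (xs k))) (normal_law 0 v)"
    by (intro levy_continuity K.real_distribution_distr Vm real_distribution_normal_law v)
  then show "(\<lambda>k. cdf (distr M borel (\<lambda>\<omega>. (ustat e g X (N (xs k) \<omega>) \<omega>
      - (fact d / \<mu>) powr (real e / real d) * (\<mu>' / fact e) * xs k powr (real e / real d))
      / xs k powr (real e / real d - 1 / (2 * real d)))) y) \<longlonglongrightarrow> cdf (normal_law 0 v) y"
    using y unfolding weak_conv_m_def weak_conv_def V_def[abs_def] by blast
qed

end

theorem theorem3p9:
  fixes M :: "'w measure" and S :: "'s measure" and X :: "nat \<Rightarrow> 'w \<Rightarrow> 's"
    and d d' :: nat and f f' :: "(nat \<Rightarrow> 's) \<Rightarrow> real"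
    and \<mu> \<mu>' :: real and \<phi> \<phi>' :: "nat \<Rightarrow> 's \<Rightarrow> real"
    and P :: "'v measure" and W W' :: "nat \<Rightarrow> real \<Rightarrow> 'v \<Rightarrow> real"
    and I I' :: "nat \<Rightarrow> 'v \<Rightarrow> real" and Z Z' :: "'v \<Rightarrow> real" and \<gamma>2 :: real
  assumes "prob_space M"
    \<comment> \<open>\<open>X 0\<close> is the generic copy \<open>X\<close>\<close>
    and "prob_space.indep_vars M (\<lambda>_. S) X UNIV"
    and "\<And>n. distr M S (X n) = distr M S (X 0)"
    and "d \<ge> 1" and "d' \<ge> 1"
    and "f \<in> borel_measurable (Pi\<^sub>M {1..d} (\<lambda>_. S))"
    and "f' \<in> borel_measurable (Pi\<^sub>M {1..d'} (\<lambda>_. S))"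
    and mu: "\<mu> = kernel_mean M d f X" "\<mu>' = kernel_mean M d' f' X"
    and phi: "\<phi> = kernel_proj M d f X" "\<phi>' = kernel_proj M d' f' X"
    and Z: "Z = (\<lambda>\<omega>. \<Sum>j=1..d. I j \<omega>)" "Z' = (\<lambda>\<omega>. \<Sum>j=1..d'. I' j \<omega>)"
    and gamma2: "\<gamma>2 = (fact d / \<mu>) powr ((2 * real d' - 1) / real d) *
      prob_space.variance P
        (\<lambda>\<omega>. Z' \<omega> - fact (d - 1) * \<mu>' / (fact (d' - 1) * \<mu>) * Z \<omega>)"
  shows
    "(kernel_L1 M d f X \<and> kernel_L1 M d' f' X \<and> \<mu> > 0 \<longrightarrow>
       (\<forall>N \<in> {N_minus d f X, N_plus d f X}.
         AE \<omega> in M.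
           ((\<lambda>x. ustat d' f' X (N x \<omega>) \<omega> / x powr (real d' / real d)) \<longlongrightarrow>
             \<mu>' / fact d' * (fact d / \<mu>) powr (real d' / real d)) at_top))
     \<and>
     (kernel_L2 M d f X \<and> kernel_L2 M d' f' X \<and> \<mu> > 0 \<and>
      gaussian_process_with_cov P ({1..d} <+> {1..d'})
        (\<lambda>k l. cov M (\<lambda>\<omega>. case_sum \<phi> \<phi>' k (X 0 \<omega>)) (\<lambda>\<omega>. case_sum \<phi> \<phi>' l (X 0 \<omega>)))
        (case_sum W W') \<and>
      (\<forall>j\<in>{1..d}. is_wiener_integral P (W j) 0 1 (\<lambda>s. psi j d s 1) (I j)) \<and>
      (\<forall>j\<in>{1..d'}. is_wiener_integral P (W' j) 0 1 (\<lambda>s. psi j d' s 1) (I' j)) \<longrightarrow>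
       (\<forall>N \<in> {N_minus d f X, N_plus d f X}.
         weak_conv_filter
           (\<lambda>x. distr M borel (\<lambda>\<omega>.
             (ustat d' f' X (N x \<omega>) \<omega>
               - (fact d / \<mu>) powr (real d' / real d) * (\<mu>' / fact d') * x powr (real d' / real d))
             / x powr (real d' / real d - 1 / (2 * real d))))
           (normal_law 0 \<gamma>2) at_top)
       \<and>
       (d' \<ge> d \<longrightarrow>
         (\<gamma>2 = 0 \<longleftrightarrow>
           (\<forall>i\<in>{1..d'}. AE \<omega> in M. \<phi>' i (X 0 \<omega>) =
             \<mu>' / \<mu> * (\<Sum>j=1..d. binom (d - 1) (int j - 1) * binom (d' - d) (int i - int j)
               / binom (d' - 1) (int i - 1) * \<phi> j (X 0 \<omega>))))) \<and>
       (d' < d \<and> \<mu>' \<noteq> 0 \<longrightarrow>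
         (\<gamma>2 = 0 \<longleftrightarrow>
           (\<forall>i\<in>{1..d}. AE \<omega> in M. \<phi> i (X 0 \<omega>) =
             \<mu> / \<mu>' * (\<Sum>j=1..d'. binom (d' - 1) (int j - 1) * binom (d - d') (int i - int j)
               / binom (d - 1) (int i - 1) * \<phi>' j (X 0 \<omega>))))) \<and>
       (d' < d \<and> \<mu>' = 0 \<longrightarrow>
         (\<gamma>2 = 0 \<longleftrightarrow> (\<forall>j\<in>{1..d'}. AE \<omega> in M. \<phi>' j (X 0 \<omega>) = 0))) \<and>
       (d' = d \<longrightarrow>
         (\<gamma>2 = 0 \<longleftrightarrow>
           (\<forall>i\<in>{1..d}. AE \<omega> in M. \<mu> * \<phi>' i (X 0 \<omega>) = \<mu>' * \<phi> i (X 0 \<omega>)))) \<and>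
       (d = 1 \<longrightarrow>
         (\<gamma>2 = 0 \<longleftrightarrow>
           (\<forall>i\<in>{1..d'}. AE \<omega> in M. \<mu> * \<phi>' i (X 0 \<omega>) = \<mu>' * \<phi> 1 (X 0 \<omega>)))))"
proof (intro conjI[OF impI impI], goal_cases)
  interpret iid_sequence M S X
    using assms(1-3) by (simp add: iid_sequence_def iid_sequence_axioms_def)
  {
    case 1
    then show ?case unfolding mu
      using ustat_first_passage_strong_law[OF assms(4-7)] by blast
  next
    case 2
    then have pos: "kernel_mean M d f X > 0" by (simp add: mu)
    interpret T: two_kernels M S X d f d' f'
      using 2 assms(4-7) pos iid_sequence_axioms
      by (simp add: two_kernels_def two_kernels_axioms_def L2_kernel_def L2_kernel_axioms_def)
    \<comment> \<open>Half of the exponent in \<open>\<gamma>2\<close>, since \<open>c\<close>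
      multiplies the variable and enters the variance squared.\<close>
    define c where "c = (fact d / kernel_mean M d f X) powr (real d' / real d - 1 / (2 * real d))"
    have c: "c > 0" using pos by (simp add: c_def)
    have c2: "c\<^sup>2 = (fact d / kernel_mean M d f X) powr ((2 * real d' - 1) / real d)"
    proof -
      have "real d' / real d - 1 / (2 * real d) + (real d' / real d - 1 / (2 * real d)) = (2 * real d' - 1) / real d"
        using assms(4) by (simp add: field_simps)
      then show ?thesis unfolding c_def power2_eq_square powr_add[symmetric] by (simp only:)
    qed
    have \<gamma>2: "\<gamma>2 = T.limit_variance c"
      using 2 unfolding gamma2 Z mu phi T.\<kappa>_def[symmetric] c2[symmetric]
      by (intro T.limit_variance_eq[symmetric]) auto
    \<comment> \<open>Nonnegativity comes from the Wiener side, where the quantity is a variance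
      with a positive factor.\<close>
    have nonneg: "T.limit_variance c \<ge> 0"
      unfolding \<gamma>2[symmetric] gamma2 by (intro mult_nonneg_nonneg Bochner_Integration.integral_nonneg) auto
    show ?case unfolding \<gamma>2 mu phi
    proof (intro conjI impI ballI, goal_cases)
      case (1 N)
      then show ?case using T.first_passage_clt nonneg unfolding c_def by blast
    next
      case 2
      then show ?case using T.degenerate_ge[OF c] unfolding elevation_def by blast
    next
      case 3
      then show ?case using T.degenerate_less[OF c] unfolding elevation_def by blast
    next
      case 4
      then show ?case using T.degenerate_zero[OF c] by blast
    next
      case 5
      then show ?case using T.degenerate_eq[OF c] by blast
    next
      case 6
      then show ?case using T.degenerate_1[OF c] by blast
    qed
  }
qed

end
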